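(* Let $N\ge 2$ and $K\ge 0$ be integers, and let $1\le\alpha,\beta\le N$ be integers with $\alpha\neq\beta$, all fixed. Then, as $n\to\infty$, $$d_{\alpha,\beta;N}^{[K]}(n)=\frac{e^{\pi\sqrt{n/3}}}{2^{K+3}\cdot 3^{1/4}N^{N-1}n^{3/4}}\sum_{\substack{\boldsymbol\ell\in(\mathbb Z/N\mathbb Z)^N\\ N H(\boldsymbol\ell)\equiv n\ (\mathrm{mod}\ N)}}\left(1+\frac{N^2-2N[\ell_\alpha-\ell_\beta]_N+\beta-\alpha+N(e_\beta-e_\alpha)}{2\cdot 3^{1/4}\sqrt N\,n^{1/4}}+O\!\left(\frac1{\sqrt n}\right)\right).$$
   Context: $d_{\alpha,\beta;N}^{[K]}(n)$ denotes the number of partitions of $n$ into distinct parts, all of whose parts are greater than $K$, having strictly more parts congruent to $\alpha$ modulo $N$ than parts congruent to $\beta$ modulo $N$. Let $\boldsymbol e=(e_1,\dots,e_N)^T:=\lfloor K/N\rfloor(1,\dots,1)^T+(1,\dots,1,0,\dots,0)^T$, where the second vector starts with exactly $K-N\lfloor K/N\rfloor$ ones (so $\sum_j e_j=K$). Put $b_j:=\frac jN-\frac12+e_j$ and $H(\boldsymbol n):=\frac12\sum_{j=1}^N n_j^2+\sum_{j=1}^N b_jn_j$ for $\boldsymbol n\in\mathbb Z^N$. Elements $\boldsymbol\ell=(\ell_1,\dots,\ell_N)\in(\mathbb Z/N\mathbb Z)^N$ are represented by integers $0\le\ell_j<N$; for $\boldsymbol n\in\mathbb Z^N$ the number $NH(\boldsymbol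 n)$ is an integer whose class mod $N$ depends only on $\boldsymbol n$ mod $N$. For $\ell\in\mathbb Z$, $[\ell]_N$ denotes the smallest positive integer congruent to $\ell$ modulo $N$ (so $1\le[\ell]_N\le N$). Implied constants may depend on $N,K,\alpha,\beta$. *)

theory Defs
  imports
    Complex_Main
    "HOL-Library.FuncSet"
    "HOL-Library.Real_Mod"
    "HOL-Library.Landau_Symbols"
    "HOL-Number_Theory.Cong"
begin

text \<open>
  A partition of \<open>n\<close> into distinct parts is encoded as the finite set of its parts.
  The parts are positive because they exceed \<open>K \<ge> 0\<close>.
\<close>

definition distinct_partitions_gt :: "nat \<Rightarrow> nat \<Rightarrow> nat set set" where
  "distinct_partitions_gt K n = {S. finite S \<and> (\<forall>m\<in>S. K < m) \<and> \<Sum>S = n}"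

definition parts_cong :: "nat \<Rightarrow> nat \<Rightarrow> nat set \<Rightarrow> nat" where
  "parts_cong N r S = card {m \<in> S. [m = r] (mod N)}"

definition d_count :: "nat \<Rightarrow> nat \<Rightarrow> nat \<Rightarrow> nat \<Rightarrow> nat \<Rightarrow> nat" where
  "d_count \<alpha> \<beta> N K n =
     card {S \<in> distinct_partitions_gt K n. parts_cong N \<alpha> S > parts_cong N \<beta> S}"

text \<open>
  Vectors of length \<open>N\<close> are functions on the indices \<open>1, \<dots>, N\<close>.
  Note that \<open>K mod N = K - N * \<lfloor>K / N\<rfloor>\<close>.
\<close>

definition e_vec :: "nat \<Rightarrow> nat \<Rightarrow> nat \<Rightarrow> nat" where
  "e_vec N K j = K div N + (if j \<le> K mod N then 1 else 0)"

definition b_vec :: "nat \<Rightarrow> nat \<Rightarrow> nat \<Rightarrow> real" where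
  "b_vec N K j = real j / real N - 1 / 2 + real (e_vec N K j)"

definition H_fun :: "nat \<Rightarrow> nat \<Rightarrow> (nat \<Rightarrow> int) \<Rightarrow> real" where
  "H_fun N K v = 1 / 2 * (\<Sum>j=1..N. (of_int (v j))\<^sup>2) + (\<Sum>j=1..N. b_vec N K j * of_int (v j))"

text \<open>
  The elements of \<open>(\<int>/N\<int>)\<^sup>N\<close>, each represented by its unique vector with entries in
  \<open>{0..<N}\<close> (extensional outside the index set, so that distinct functions are distinct elements).
\<close>

definition residue_vectors :: "nat \<Rightarrow> (nat \<Rightarrow> int) set" where
  "residue_vectors N = {1..N} \<rightarrow>\<^sub>E {0..<int N}"

definition least_pos_residue :: "nat \<Rightarrow> int \<Rightarrow> nat" where
  "least_pos_residue N l = (LEAST m. 0 < m \<and> [int m = l] (mod int N))"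

end

theory Submission
  imports
    "HOL-Probability.Characteristic_Functions"
    "HOL-Probability.Distributions"
    "HOL-Real_Asymp.Real_Asymp"
    Defs
begin

text \<open>
  A two-variable saddle point argument. Let \<open>D(A)\<close> be the number of parts of \<open>A\<close> that are
  congruent to \<open>\<alpha>\<close> minus the number of those congruent to \<open>\<beta>\<close>. The generating function
  \<open>\<Prod>\<^sub>m (1 + q\<^sup>m z\<^bsup>\<chi>(m)\<^esup>)\<close> on the circle of radius \<open>e\<^bsup>-t\<^esup>\<close>, \<open>t = \<pi> / (2 \<surd>(3n))\<close>, is, after
  normalisation, the characteristic function \<open>\<Phi>(\<theta>, \<omega>)\<close> of a sum of independent Bernoulli
  variables. It is Gaussian, on the scales \<open>\<theta> \<approx> t\<^bsup>3/2\<^esup>\<close> and \<open>\<omega> \<approx> t\<^bsup>1/2\<^esup>\<close>, near those points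
  \<open>(2\<pi>a/N, 2\<pi>b/N)\<close> for which \<open>N\<close> divides \<open>j a + \<chi>(j) b\<close> for all \<open>j\<close>, and negligible elsewhere.

  Twice the indicator of \<open>D > 0\<close> is \<open>1 + sgn D - [D = 0]\<close>. The sign is averaged over
  \<open>D + i - j\<close> with \<open>0 \<le> i, j < N\<close>: the Fourier kernel of the averaged sign carries the Fejer factor
  \<open>|1 + z + \<dots> + z\<^bsup>N-1\<^esup>|\<^sup>2\<close>, which vanishes at the non-trivial \<open>N\<close>-th roots of unity, so only the
  singularity of the kernel at \<open>\<omega> = 0\<close> remains, and it is cancelled by \<open>\<Phi>(\<theta>, \<omega>) - \<Phi>(\<theta>, -\<omega>)\<close>. The
  averaged sign differs from the sign at finitely many values \<open>D = k\<close> only; each of the events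
  \<open>D = k\<close> contributes to the second order term, weighted by the number of residue vectors
  \<open>\<ell>\<close> with \<open>N H(\<ell>) \<equiv> n\<close> and \<open>\<ell>\<^sub>\<alpha> - \<ell>\<^sub>\<beta> \<equiv> k\<close>.
\<close>

section \<open>Elementary inequalities\<close>

text \<open>The required precision shapes the proof. Put s = \<surd>t. The number of all partitions
  comes from a one-dimensional integral of size s^3; the events D = k and the averaged sign come
  from two-dimensional integrals of size s^4; the admissible error is s^5. So a relative error s
  suffices in two dimensions, but the total needs s^2. The gain comes from real parts: on the
  Gaussian scale the centred \<Phi> is exp (-\<open>gauss_exponent\<close> + R + iY) with R = O(s^2)
  and Y = O(s), and Y enters the real part only quadratically. The other obstacle is uniformity as
  \<omega> tends to 0: dividing \<Phi>(\<theta>, \<omega>) - \<Phi>(\<theta>, -\<omega>) by sin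
  (\<omega>/2) spoils every bound that ignores the cancellation. Pairing the k-th part of the class
  of \<alpha> with the k-th part of the class of \<beta> writes this difference as \<Phi>(\<theta>,
  -\<omega>) times (a product minus 1), whose first order term is proportional to sin \<omega> times
  a sum close to the mean of D. That mean tends to \<open>shift\<close> / (2N), the origin of the
  term \<beta> - \<alpha> + N (\<open>e_\<beta>\<close> - \<open>e_\<alpha>\<close>).\<close>

lemma cos_taylor: "\<bar>cos x - 1 + x\<^sup>2 / 2\<bar> \<le> x ^ 4 / 24" for x :: real
proof -
  have "\<bar>Re (iexp x - (\<Sum>k\<le>3. (\<i> * complex_of_real x) ^ k / fact k))\<bar> \<le> \<bar>x\<bar> ^ Suc 3 / fact (Suc 3)"
    using iexp_approx1[of x 3] abs_Re_le_cmod order_trans by blast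
  moreover have "Re (iexp x - (\<Sum>k\<le>3. (\<i> * complex_of_real x) ^ k / fact k)) = cos x - 1 + x\<^sup>2 / 2"
    by (simp add: eval_nat_numeral Re_exp fact_reduce)
  moreover have "\<bar>x\<bar> ^ 4 = x ^ 4" by simp
  ultimately show ?thesis by (simp add: fact_reduce)
qed

lemma sin_taylor: "\<bar>sin x - x\<bar> \<le> \<bar>x\<bar> ^ 3 / 6" for x :: real
proof -
  have "\<bar>Im (iexp x - (\<Sum>k\<le>2. (\<i> * complex_of_real x) ^ k / fact k))\<bar> \<le> \<bar>x\<bar> ^ Suc 2 / fact (Suc 2)"
    using iexp_approx1[of x 2] abs_Im_le_cmod order_trans by blast
  moreover have "Im (iexp x - (\<Sum>k\<le>2. (\<i> * complex_of_real x) ^ k / fact k)) = sin x - x"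
    by (simp add: eval_nat_numeral Im_exp fact_reduce)
  ultimately show ?thesis by (simp add: eval_nat_numeral fact_reduce)
qed

lemma one_minus_cos_le: "1 - cos x \<le> x\<^sup>2 / 2" for x :: real
proof -
  have "1 - cos x = 2 * (sin (x/2))\<^sup>2" using cos_double_sin[of "x/2"] by simp
  also have "\<bar>sin (x/2)\<bar> \<le> \<bar>x/2\<bar>" by (rule abs_sin_x_le_abs_x)
  then have "(sin (x/2))\<^sup>2 \<le> (x/2)\<^sup>2" by (simp only: abs_le_square_iff)
  finally show ?thesis by (simp add: power2_eq_square)
qed

lemma arctan_approx: "\<bar>arctan x - x\<bar> \<le> \<bar>x\<bar> ^ 3" for x :: real
proof (cases "x = 0")
  case False
  have *: "\<bar>arctan x - x\<bar> \<le> x ^ 3" if "x > 0" for x :: real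
  proof -
    have "\<exists>z>0. z < x \<and> (arctan x - x) - (arctan 0 - 0) = (x - 0) * (inverse (1 + z\<^sup>2) - 1)"
      by (rule MVT2[OF that]) (auto intro!: derivative_eq_intros)
    then obtain z where z: "0 < z" "z < x" "arctan x - x = x * (inverse (1 + z\<^sup>2) - 1)" by auto
    have "\<bar>inverse (1 + z\<^sup>2) - 1\<bar> = z\<^sup>2 / (1 + z\<^sup>2)"
      using z by (simp add: abs_if divide_simps) (smt (verit) zero_less_power)
    also have "\<dots> \<le> z\<^sup>2 / 1" by (intro divide_left_mono) (auto intro: add_pos_nonneg)
    also have "\<dots> = z\<^sup>2" by simp
    also have "\<dots> \<le> x\<^sup>2" using z by (simp add: power_mono)
    finally show ?thesis unfolding z(3) abs_mult using that
      by (simp add: power3_eq_cube power2_eq_square mult_left_mono)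
  qed
  show ?thesis
  proof (cases "x > 0")
    case True
    then show ?thesis using *[of x] by simp
  next
    case neg: False
    then have "\<bar>arctan (-x) - (-x)\<bar> \<le> (-x) ^ 3" using False by (intro *) auto
    moreover have "\<bar>arctan (-x) - (-x)\<bar> = \<bar>arctan x - x\<bar>" by (simp add: arctan_minus abs_minus_commute)
    ultimately show ?thesis using neg by simp
  qed
qed simp

text \<open>1 + p (cis \<psi> - 1) is the characteristic function of a Bernoulli variable with
  success probability \<open>p\<close>; the factors of \<open>Phi\<close> have this form.\<close>

lemma bernoulli_factor_norm_sq:
  "(cmod (1 + of_real p * (cis \<psi> - 1)))\<^sup>2 = 1 - 2 * p * (1 - p) * (1 - cos \<psi>)"
proof -
  have "(cmod (1 + of_real p * (cis \<psi> - 1)))\<^sup>2 = (1 + p * (cos \<psi> - 1))\<^sup>2 + (p * sin \<psi>)\<^sup>2"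
    by (simp add: cmod_power2)
  also have "(p * sin \<psi>)\<^sup>2 = p\<^sup>2 * (1 - (cos \<psi>)\<^sup>2)" by (simp add: power_mult_distrib sin_squared_eq)
  finally show ?thesis by (simp add: power2_eq_square algebra_simps)
qed

text \<open>Only the variance p (1 - p) and 1 - cos \<psi> enter, with no restriction on the phase:
  the form needed away from the peaks.\<close>

lemma bernoulli_factor_norm_le:
  "cmod (1 + of_real p * (cis \<psi> - 1)) \<le> exp (- (p * (1 - p) * (1 - cos \<psi>)))"
proof (rule power2_le_imp_le)
  have "1 - 2 * p * (1 - p) * (1 - cos \<psi>) \<le> exp (- (2 * p * (1 - p) * (1 - cos \<psi>)))"
    using exp_ge_add_one_self[of "- (2 * p * (1 - p) * (1 - cos \<psi>))"] by simp
  then show "(cmod (1 + of_real p * (cis \<psi> - 1)))\<^sup>2 \<le> (exp (- (p * (1 - p) * (1 - cos \<psi>))))\<^sup>2"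
    unfolding bernoulli_factor_norm_sq by (simp add: power2_eq_square exp_add [symmetric] algebra_simps)
qed auto

text \<open>An explicit logarithm of one factor: \<open>r\<close> is half the logarithm of the
  squared modulus, \<open>y\<close> is an arctangent. The smallness condition is on p \<psi>^2
  rather than on \<psi>, because large parts have large phases but exponentially small
  \<open>p\<close>; for the same reason both errors keep a factor \<open>p\<close>, which makes them
  summable over all parts.\<close>

lemma bernoulli_factor_polar:
  fixes p \<psi> :: real
  assumes "0 \<le> p" "p \<le> 1/2" "p * \<psi>\<^sup>2 \<le> 1/4"
  obtains r y where "1 + of_real p * (cis \<psi> - 1) = exp (Complex r y)"
    "\<bar>r + p * (1 - p) * \<psi>\<^sup>2 / 2\<bar> \<le> 2 * (p * \<psi> ^ 4)" "\<bar>y - p * \<psi>\<bar> \<le> 4 * (p * \<bar>\<psi>\<bar> ^ 3)"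
proof -
  define c where "c = 1 - cos \<psi>"
  define a where "a = 1 - p * c"
  define b where "b = p * sin \<psi>"
  define x where "x = 2 * p * (1 - p) * c"
  have c: "0 \<le> c" "c \<le> \<psi>\<^sup>2 / 2" using one_minus_cos_le[of \<psi>] by (auto simp: c_def)
  have c4: "\<bar>\<psi>\<^sup>2 / 2 - c\<bar> \<le> \<psi> ^ 4 / 24" using cos_taylor[of \<psi>] unfolding c_def by (simp only: abs_le_iff) linarith
  have pc: "p * c \<le> 1/8" using assms mult_left_mono[OF c(2) assms(1)] by simp
  \<comment> \<open>The real part stays positive, so the arctangent of b / a below is the
    argument.\<close>
  have a: "a \<ge> 7/8" "a \<le> 1" using pc c assms by (auto simp: a_def)
  have x0: "0 \<le> x" using assms c by (simp add: x_def)
  have xle: "x \<le> p * \<psi>\<^sup>2"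
  proof -
    have "x = (p * c) * (2 * (1 - p))" by (simp add: x_def)
    also have "\<dots> \<le> (p * (\<psi>\<^sup>2 / 2)) * 2" using assms c by (intro mult_mono) auto
    finally show ?thesis by simp
  qed
  have ab: "a\<^sup>2 + b\<^sup>2 = 1 - x"
  proof -
    have "a\<^sup>2 + b\<^sup>2 = (cmod (Complex a b))\<^sup>2" by (simp add: cmod_power2)
    also have "Complex a b = 1 + of_real p * (cis \<psi> - 1)"
      by (simp add: complex_eq_iff a_def b_def c_def algebra_simps)
    finally show ?thesis by (simp add: bernoulli_factor_norm_sq x_def c_def)
  qed
  define r where "r = ln (1 - x) / 2"
  define y where "y = arctan (b / a)"
  have er: "exp r = sqrt (1 - x)"
  proof -
    have "1 - x > 0" using xle assms by simp
    then show ?thesis unfolding r_def by (simp add: ln_sqrt[symmetric])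
  qed
  have q: "sqrt (1 + (b/a)\<^sup>2) = sqrt (1 - x) / a"
  proof -
    have "1 + (b/a)\<^sup>2 = (1 - x) / a\<^sup>2" using a by (simp add: ab[symmetric] field_simps)
    then show ?thesis using a by (simp add: real_sqrt_divide)
  qed
  have sx: "sqrt (1 - x) > 0" using xle assms by simp
  have "exp (Complex r y) = Complex a b"
    using a sx by (simp add: complex_eq_iff Re_exp Im_exp er y_def cos_arctan sin_arctan q)
  moreover have "1 + of_real p * (cis \<psi> - 1) = Complex a b"
    by (simp add: complex_eq_iff a_def b_def c_def algebra_simps)
  ultimately have 1: "1 + of_real p * (cis \<psi> - 1) = exp (Complex r y)" by simp
  have 2: "\<bar>r + p * (1 - p) * \<psi>\<^sup>2 / 2\<bar> \<le> 2 * (p * \<psi> ^ 4)"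
  proof -
    have "\<bar>ln (1 + (- x)) - (- x)\<bar> \<le> 2 * (- x)\<^sup>2"
      by (rule abs_ln_one_plus_x_minus_x_bound) (use x0 xle assms in auto)
    then have l: "\<bar>ln (1 - x) + x\<bar> \<le> 2 * x\<^sup>2" by simp
    have "x\<^sup>2 \<le> (p * \<psi>\<^sup>2)\<^sup>2" using x0 xle by (simp add: power_mono)
    also have "\<dots> = p * (p * \<psi> ^ 4)" by (simp add: power2_eq_square eval_nat_numeral)
    also have "\<dots> \<le> (1/2) * (p * \<psi> ^ 4)" using assms by (intro mult_right_mono) auto
    finally have x2: "x\<^sup>2 \<le> p * \<psi> ^ 4 / 2" by simp
    have "r + p * (1 - p) * \<psi>\<^sup>2 / 2 = (ln (1 - x) + x) / 2 + p * (1 - p) * (\<psi>\<^sup>2 / 2 - c)"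
      unfolding r_def by (simp add: field_simps) (simp add: x_def algebra_simps)
    also have "\<bar>\<dots>\<bar> \<le> \<bar>ln (1 - x) + x\<bar> / 2 + p * (1 - p) * \<bar>\<psi>\<^sup>2 / 2 - c\<bar>"
      using assms by (intro order_trans[OF abs_triangle_ineq]) (simp add: abs_mult)
    also have "p * (1 - p) * \<bar>\<psi>\<^sup>2 / 2 - c\<bar> \<le> p * 1 * (\<psi> ^ 4 / 24)"
      using assms c4 by (intro mult_mono) auto
    finally have "\<bar>r + p * (1 - p) * \<psi>\<^sup>2 / 2\<bar> \<le> \<bar>ln (1 - x) + x\<bar> / 2 + p * \<psi> ^ 4 / 24" by simp
    moreover have "0 \<le> p * \<psi> ^ 4" using assms by simp
    moreover have "A \<le> B / 2 + C / 24 \<Longrightarrow> 0 \<le> C \<Longrightarrow> B \<le> 2 * D \<Longrightarrow> D \<le> C / 2 \<Longrightarrow> A \<le> 2 * C"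
      for A B C D :: real by linarith
    ultimately show ?thesis using l x2 by blast
  qed
  have 3: "\<bar>y - p * \<psi>\<bar> \<le> 4 * (p * \<bar>\<psi>\<bar> ^ 3)"
  proof -
    have s: "\<bar>sin \<psi>\<bar> \<le> \<bar>\<psi>\<bar>" by (rule abs_sin_x_le_abs_x)
    have "\<bar>b\<bar> \<le> p * \<bar>\<psi>\<bar>" using s assms by (simp add: b_def abs_mult mult_left_mono)
    then have ba: "\<bar>b / a\<bar> \<le> (8/7) * (p * \<bar>\<psi>\<bar>)"
    proof -
      assume *: "\<bar>b\<bar> \<le> p * \<bar>\<psi>\<bar>"
      have "\<bar>b / a\<bar> = \<bar>b\<bar> * (1 / a)" using a by (simp add: abs_divide)
      also have "\<dots> \<le> (p * \<bar>\<psi>\<bar>) * (8/7)" using * a assms by (intro mult_mono) (auto simp: divide_simps)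
      finally show ?thesis by simp
    qed
    have "\<bar>b/a\<bar> ^ 3 \<le> ((8/7) * (p * \<bar>\<psi>\<bar>)) ^ 3" using ba by (intro power_mono) auto
    also have "\<dots> = (512/343) * (p\<^sup>2 * (p * \<bar>\<psi>\<bar> ^ 3))" by (simp add: eval_nat_numeral)
    also have "p\<^sup>2 * (p * \<bar>\<psi>\<bar> ^ 3) \<le> (1/4) * (p * \<bar>\<psi>\<bar> ^ 3)"
      using assms power_mono[OF assms(2,1), of 2] by (intro mult_right_mono) (auto simp: power2_eq_square)
    finally have "\<bar>b/a\<bar> ^ 3 \<le> 512/343 * (1/4 * (p * \<bar>\<psi>\<bar> ^ 3))" by simp
    moreover have "0 \<le> p * \<bar>\<psi>\<bar> ^ 3" using assms by simp
    ultimately have t1: "\<bar>b/a\<bar> ^ 3 \<le> p * \<bar>\<psi>\<bar> ^ 3" by linarith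
    have "b / a - p * \<psi> = (p * (sin \<psi> - \<psi>) + p * \<psi> * (p * c)) / a"
      using a by (simp add: b_def field_simps a_def)
    also have "\<bar>\<dots>\<bar> = \<bar>p * (sin \<psi> - \<psi>) + p * \<psi> * (p * c)\<bar> * (1 / a)" using a by (simp add: abs_divide)
    also have "\<dots> \<le> (p * (\<bar>\<psi>\<bar> ^ 3 / 6) + p * \<bar>\<psi>\<bar> * ((1/2) * (\<bar>\<psi>\<bar>\<^sup>2 / 2))) * (8/7)"
    proof (rule mult_mono)
      show "\<bar>p * (sin \<psi> - \<psi>) + p * \<psi> * (p * c)\<bar> \<le> p * (\<bar>\<psi>\<bar> ^ 3 / 6) + p * \<bar>\<psi>\<bar> * ((1/2) * (\<bar>\<psi>\<bar>\<^sup>2 / 2))"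
      proof (intro order_trans[OF abs_triangle_ineq] add_mono)
        show "\<bar>p * (sin \<psi> - \<psi>)\<bar> \<le> p * (\<bar>\<psi>\<bar> ^ 3 / 6)"
          unfolding abs_mult using assms sin_taylor[of \<psi>] by (simp only: abs_of_nonneg) (rule mult_left_mono)
        have "p * c \<le> (1/2) * (\<bar>\<psi>\<bar>\<^sup>2 / 2)" using assms c by (intro mult_mono) auto
        then have "p * \<bar>\<psi>\<bar> * (p * c) \<le> p * \<bar>\<psi>\<bar> * ((1/2) * (\<bar>\<psi>\<bar>\<^sup>2 / 2))"
          using assms by (intro mult_left_mono) auto
        then show "\<bar>p * \<psi> * (p * c)\<bar> \<le> p * \<bar>\<psi>\<bar> * ((1/2) * (\<bar>\<psi>\<bar>\<^sup>2 / 2))"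
          using assms c by (simp add: abs_mult)
      qed
      show "1 / a \<le> 8/7" using a by (simp add: divide_simps)
    qed (use a assms in auto)
    also have "\<dots> = (10/21) * (p * \<bar>\<psi>\<bar> ^ 3)" by (simp add: power2_eq_square power3_eq_cube field_simps)
    also have "\<dots> \<le> 2 * (p * \<bar>\<psi>\<bar> ^ 3)" using assms by (intro mult_right_mono) auto
    finally have t2: "\<bar>b / a - p * \<psi>\<bar> \<le> 2 * (p * \<bar>\<psi>\<bar> ^ 3)" .
    have "0 \<le> p * \<bar>\<psi>\<bar> ^ 3" using assms by simp
    with arctan_approx[of "b/a"] t1 t2 show ?thesis unfolding y_def by linarith
  qed
  from 1 2 3 that show thesis by blast
qed

section \<open>Exponential sums at rate t\<close>

lemma power_div_fact_le_exp: "x ^ n / fact n \<le> exp x" if "0 \<le> x" for x :: real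
proof -
  have s: "(\<lambda>n. x ^ n /\<^sub>R fact n) sums exp x" by (rule exp_converges)
  have "(\<Sum>k\<in>{n}. x ^ k /\<^sub>R fact k) \<le> (\<Sum>k. x ^ k /\<^sub>R fact k)"
    by (rule sum_le_suminf) (use s that in \<open>auto simp: sums_iff\<close>)
  then show ?thesis using s by (simp add: sums_iff field_simps)
qed

lemma one_minus_exp_ge: "x / 2 \<le> 1 - exp (- x)" if "0 \<le> x" "x \<le> 1" for x :: real
proof -
  have "1 / (1 + x) \<ge> exp (-x)" using exp_ge_add_one_self[of x] that
    by (simp add: exp_minus divide_simps)
  moreover have "1 / (1 + x) \<le> 1 - x / 2" using that by (simp add: divide_simps algebra_simps) (simp add: mult_left_le power2_eq_square)
  ultimately show ?thesis by linarith
qed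

lemma sum_exp_le:
  fixes t :: real assumes "0 < t" "t \<le> 1" "finite A"
  shows "(\<Sum>m\<in>A. exp (- (t * real m))) \<le> 2 / t"
proof -
  have q: "exp (-t) < 1" "0 \<le> exp (-t)" using assms by auto
  have "(\<Sum>m\<in>A. exp (- (t * real m))) = (\<Sum>m\<in>A. exp (-t) ^ m)"
    by (simp add: exp_of_nat_mult[symmetric] mult.commute)
  also have "\<dots> \<le> (\<Sum>m. exp (-t) ^ m)"
    by (rule sum_le_suminf) (use q assms in \<open>auto intro: summable_geometric\<close>)
  also have "\<dots> = 1 / (1 - exp (-t))" using q by (simp add: suminf_geometric)
  also have "\<dots> \<le> 1 / (t / 2)" using one_minus_exp_ge[of t] assms by (intro divide_left_mono) auto
  finally show ?thesis by simp
qed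

text \<open>Half of the exponential absorbs the power: x^j / j! \<le> e^x at x = t m / 2 leaves a
  geometric sum at rate t / 2.\<close>

lemma sum_power_exp_le:
  fixes t :: real assumes "0 < t" "t \<le> 1" "finite A"
  shows "(\<Sum>m\<in>A. real m ^ j * exp (- (t * real m))) \<le> (fact j * 2 ^ j * 4) / t ^ Suc j"
proof -
  have "real m ^ j * exp (- (t * real m)) \<le> (fact j * 2 ^ j / t ^ j) * exp (- ((t/2) * real m))" for m
  proof -
    have "(t / 2 * real m) ^ j / fact j \<le> exp (t / 2 * real m)"
      by (rule power_div_fact_le_exp) (use assms in auto)
    then have "real m ^ j \<le> (fact j * 2 ^ j / t ^ j) * exp (t / 2 * real m)"
      using assms by (simp add: field_simps power_mult_distrib)
    then have "real m ^ j * exp (- (t * real m)) \<le> ((fact j * 2 ^ j / t ^ j) * exp (t / 2 * real m)) * exp (- (t * real m))"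
      by (intro mult_right_mono) auto
    also have "\<dots> = (fact j * 2 ^ j / t ^ j) * exp (- ((t/2) * real m))"
      by (simp add: mult.assoc exp_add[symmetric])
    finally show ?thesis .
  qed
  then have "(\<Sum>m\<in>A. real m ^ j * exp (- (t * real m))) \<le> (fact j * 2 ^ j / t ^ j) * (\<Sum>m\<in>A. exp (- ((t/2) * real m)))"
    by (simp add: sum_distrib_left sum_mono)
  also have "\<dots> \<le> (fact j * 2 ^ j / t ^ j) * (2 / (t / 2))"
    using assms by (intro mult_left_mono sum_exp_le) auto
  finally show ?thesis by (simp add: field_simps)
qed

section \<open>Riemann sums, the dilogarithm integral and Gaussian integrals\<close>

text \<open>With an increasing derivative the trapezoid rule overestimates, and its excess is
  controlled by the increment of \<open>h'\<close>, which telescopes over many steps.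
  \<open>D\<close> is the excess as a function of the step length; two applications of the mean
  value theorem avoid second derivatives.\<close>

lemma trapezoid_step:
  fixes h h' H :: "real \<Rightarrow> real"
  assumes "0 < d"
    and H: "\<And>x. a \<le> x \<Longrightarrow> x \<le> a + d \<Longrightarrow> (H has_real_derivative h x) (at x)"
    and h: "\<And>x. a \<le> x \<Longrightarrow> x \<le> a + d \<Longrightarrow> (h has_real_derivative h' x) (at x)"
    and mono: "\<And>x y. a \<le> x \<Longrightarrow> x \<le> y \<Longrightarrow> y \<le> a + d \<Longrightarrow> h' x \<le> h' y"
  shows "0 \<le> d * (h a + h (a + d)) / 2 - (H (a + d) - H a)"
    and "d * (h a + h (a + d)) / 2 - (H (a + d) - H a) \<le> d\<^sup>2 / 2 * (h' (a + d) - h' a)"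
proof -
  define D where "D = (\<lambda>s. s * (h a + h (a + s)) / 2 - (H (a + s) - H a))"
  have dD: "(D has_real_derivative ((h a - h (a + s) + s * h' (a + s)) / 2)) (at s)"
    if "0 \<le> s" "s \<le> d" for s
  proof -
    have 1: "((\<lambda>s. h (a + s)) has_real_derivative h' (a + s) * 1) (at s)"
      by (rule DERIV_chain2[where f = h and g = "\<lambda>s. a + s"])
         (use that in \<open>auto intro!: h derivative_eq_intros\<close>)
    have 2: "((\<lambda>s. H (a + s)) has_real_derivative h (a + s) * 1) (at s)"
      by (rule DERIV_chain2[where f = H and g = "\<lambda>s. a + s"])
         (use that in \<open>auto intro!: H derivative_eq_intros\<close>)
    show ?thesis unfolding D_def
      by (rule DERIV_cong[OF DERIV_diff[OF DERIV_cdivide[OF DERIV_mult[OF DERIV_ident DERIV_add[OF DERIV_const 1]]]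
            DERIV_diff[OF 2 DERIV_const]]]) (simp add: field_simps)
  qed
  have "\<exists>z>0. z < d \<and> D d - D 0 = (d - 0) * ((h a - h (a + z) + z * h' (a + z)) / 2)"
    by (rule MVT2[OF assms(1)]) (use dD in auto)
  then obtain z where z: "0 < z" "z < d" "D d = d * ((h a - h (a + z) + z * h' (a + z)) / 2)"
    by (auto simp: D_def)
  have "\<exists>w>a. w < a + z \<and> h (a + z) - h a = (a + z - a) * h' w"
    by (rule MVT2) (use z h in auto)
  then obtain w where w: "a < w" "w < a + z" "h (a + z) - h a = z * h' w" by auto
  have e: "D d = d * z / 2 * (h' (a + z) - h' w)" using z(3) w(3) by (simp add: algebra_simps)
  have m: "h' w \<le> h' (a + z)" "h' a \<le> h' w" "h' (a + z) \<le> h' (a + d)"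
    using mono[of w "a+z"] mono[of a w] mono[of "a+z" "a+d"] w z by auto
  show "0 \<le> d * (h a + h (a + d)) / 2 - (H (a + d) - H a)"
  proof -
    have "0 \<le> D d" unfolding e using m z by (intro mult_nonneg_nonneg) auto
    then show ?thesis by (simp add: D_def)
  qed
  have "D d \<le> d * d / 2 * (h' (a + d) - h' a)"
    unfolding e using m z by (intro mult_mono) auto
  then show "d * (h a + h (a + d)) / 2 - (H (a + d) - H a) \<le> d\<^sup>2 / 2 * (h' (a + d) - h' a)"
    by (simp add: D_def power2_eq_square)
qed

text \<open>Telescoping \<open>trapezoid_step\<close> gives an error independent of the number of
  steps. This second order rule is reserved for the two sums that are needed up to O(t): the
  logarithm of the generating function and the mean of D.\<close>

lemma trapezoid_sum:
  fixes h h' H :: "real \<Rightarrow> real"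
  assumes "0 < d"
    and H: "\<And>x. a \<le> x \<Longrightarrow> (H has_real_derivative h x) (at x)"
    and h: "\<And>x. a \<le> x \<Longrightarrow> (h has_real_derivative h' x) (at x)"
    and mono: "\<And>x y. a \<le> x \<Longrightarrow> x \<le> y \<Longrightarrow> h' x \<le> h' y"
    and neg: "\<And>x. a \<le> x \<Longrightarrow> h' x \<le> 0"
  shows "\<bar>d * (\<Sum>k<n. h (a + d * real k)) - (H (a + d * real n) - H a) - d * (h a - h (a + d * real n)) / 2\<bar>
    \<le> d\<^sup>2 / 2 * (- h' a)"
proof -
  define T where "T = (\<lambda>n. d * (\<Sum>k<n. h (a + d * real k)) - (H (a + d * real n) - H a) - d * (h a - h (a + d * real n)) / 2)"
  have step: "T (Suc n) - T n = d * (h (a + d * real n) + h (a + d * real n + d)) / 2 - (H (a + d * real n + d) - H (a + d * real n))" for n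
    by (simp add: T_def field_simps)
  have "0 \<le> T n \<and> T n \<le> d\<^sup>2 / 2 * (h' (a + d * real n) - h' a)" for n
  proof (induction n)
    case (Suc n)
    have le: "a \<le> a + d * real n" using assms by simp
    have "0 \<le> T (Suc n) - T n"
      unfolding step by (rule trapezoid_step(1)[OF assms(1), where h' = h']) (blast intro: H h mono order_trans[OF le])+
    moreover have "T (Suc n) - T n \<le> d\<^sup>2 / 2 * (h' (a + d * real n + d) - h' (a + d * real n))"
      unfolding step by (rule trapezoid_step(2)[OF assms(1), where h' = h']) (blast intro: H h mono order_trans[OF le])+
    moreover have "a + d * real n + d = a + d * real (Suc n)" by (simp add: algebra_simps)
    ultimately show ?case using Suc.IH by (simp add: algebra_simps)
  qed (simp add: T_def)
  moreover have "d\<^sup>2 / 2 * (h' (a + d * real n) - h' a) \<le> d\<^sup>2 / 2 * (- h' a)"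
    using neg[of "a + d * real n"] assms(1) by (intro mult_left_mono) auto
  ultimately have "0 \<le> T n" "T n \<le> d\<^sup>2 / 2 * (- h' a)" using order_trans by blast+
  then have "\<bar>T n\<bar> \<le> d\<^sup>2 / 2 * (- h' a)" by simp
  then show ?thesis by (simp only: T_def)
qed

text \<open>First order version: exponential decay of \<open>h'\<close> makes the local errors
  summable. It is accurate up to one power of t below the main term, which is enough for the mean of
  the part sum and for the variances.\<close>

lemma sum_integral_approx:
  fixes h h' H :: "real \<Rightarrow> real" and d a :: nat and B c :: real
  assumes "0 < d" "0 < c" "c \<le> 1" "0 \<le> B"
    and H: "\<And>x. real a \<le> x \<Longrightarrow> (H has_real_derivative h x) (at x)"
    and h: "\<And>x. real a \<le> x \<Longrightarrow> (h has_real_derivative h' x) (at x)"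
    and bound: "\<And>x. real a \<le> x \<Longrightarrow> \<bar>h' x\<bar> \<le> B * exp (- (c * x))"
  shows "\<bar>d * (\<Sum>k<n. h (a + d * real k)) - (H (a + d * real n) - H a)\<bar> \<le> 2 * (real d)\<^sup>2 * B / c"
proof -
  have step: "\<bar>d * h (a + d * real k) - (H (a + d * real (Suc k)) - H (a + d * real k))\<bar> \<le> d\<^sup>2 * B * exp (- (c * (a + d * real k)))" for k
  proof -
    define x where "x = a + d * real k"
    have x: "real a \<le> x" "0 \<le> x" by (auto simp: x_def)
    have xs: "a + d * real (Suc k) = x + d" by (simp add: x_def algebra_simps)
    have "\<exists>z>x. z < x + d \<and> H (x + d) - H x = (x + d - x) * h z"
      by (rule MVT2) (use x H assms in auto)
    then obtain z where z: "x < z" "z < x + d" "H (x + d) - H x = d * h z" by auto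
    have "\<exists>w>x. w < z \<and> h z - h x = (z - x) * h' w"
      by (rule MVT2) (use x h z in auto)
    then obtain w where w: "x < w" "w < z" "h z - h x = (z - x) * h' w" by auto
    have "\<bar>h' w\<bar> \<le> B * exp (- (c * x))"
      using bound[of w] w x assms by (smt (verit) exp_le_cancel_iff mult_left_mono)
    then have "\<bar>(z - x) * h' w\<bar> \<le> d * (B * exp (- (c * x)))"
      unfolding abs_mult using z by (intro mult_mono) auto
    then have "d * \<bar>h x - h z\<bar> \<le> d * (d * (B * exp (- (c * x))))"
      using w(3) by (intro mult_left_mono) auto
    moreover have "\<bar>d * h x - d * h z\<bar> = d * \<bar>h x - h z\<bar>" by (simp add: abs_mult flip: right_diff_distrib)
    ultimately show ?thesis unfolding xs x_def[symmetric] z(3) by (simp add: power2_eq_square algebra_simps)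
  qed
  have "(\<Sum>k<n. d * h (a + d * real k) - (H (a + d * real (Suc k)) - H (a + d * real k)))
      = d * (\<Sum>k<n. h (a + d * real k)) - (H (a + d * real n) - H a)"
    by (induction n) (auto simp: algebra_simps)
  then have "\<bar>d * (\<Sum>k<n. h (a + d * real k)) - (H (a + d * real n) - H a)\<bar>
     = \<bar>\<Sum>k<n. d * h (a + d * real k) - (H (a + d * real (Suc k)) - H (a + d * real k))\<bar>" by simp
  also have "\<dots> \<le> (\<Sum>k<n. d\<^sup>2 * B * exp (- (c * (a + d * real k))))"
    by (rule order_trans[OF sum_abs sum_mono[OF step]])
  also have "\<dots> \<le> (\<Sum>k<n. real (d\<^sup>2) * B * exp (- (c * real k)))"
  proof (intro sum_mono mult_left_mono)
    fix k
    have "real k \<le> real (a + d * k)" using assms(1) by (intro of_nat_mono) (cases d; simp)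
    then show "exp (- (c * (real a + real d * real k))) \<le> exp (- (c * real k))" using assms by simp
  qed (use assms in auto)
  also have "\<dots> \<le> d\<^sup>2 * B * (2 / c)"
    unfolding sum_distrib_left[symmetric] using assms by (intro mult_left_mono sum_exp_le) auto
  finally show ?thesis by (simp add: mult_ac)
qed

text \<open>This is -Li_2(-e^(-x)), with Li_2 the dilogarithm, that is, the integral of ln (1 +
  e^(-u)) over u > x. It provides the antiderivatives when such logarithms have to be
  integrated.\<close>

definition Lam :: "real \<Rightarrow> real" where
  "Lam x = (\<Sum>n. (-1) ^ n * exp (- (real (Suc n) * x)) / (real (Suc n))\<^sup>2)"

lemma Lam_term_le:
  assumes "0 \<le> x"
  shows "\<bar>(-1) ^ n * exp (- (real (Suc n) * x)) / (real (Suc n))\<^sup>2\<bar> \<le> 1 / (real n + 1)\<^sup>2"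
  using assms by (simp add: abs_mult divide_simps add.commute)

lemma summable_inverse_squares_Suc: "summable (\<lambda>n. 1 / (real n + 1)\<^sup>2)"
  using inverse_squares_sums by (auto simp: sums_iff add.commute)

lemma summable_Lam:
  assumes "0 \<le> x"
  shows "summable (\<lambda>n. (-1) ^ n * exp (- (real (Suc n) * x)) / (real (Suc n))\<^sup>2)"
  by (rule summable_comparison_test'[OF summable_inverse_squares_Suc, of 0])
     (use Lam_term_le[OF assms] in auto)

lemma Lam_bound: "\<bar>Lam x\<bar> \<le> 2 * exp (- x)" if "0 \<le> x"
proof -
  have le: "\<bar>(-1) ^ n * exp (- (real (Suc n) * x)) / (real (Suc n))\<^sup>2\<bar> \<le> exp (- x) * (1 / (real n + 1)\<^sup>2)" for n
  proof -
    have "exp (- (real (Suc n) * x)) \<le> exp (- x)" using that by (simp add: algebra_simps)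
    then show ?thesis by (simp add: abs_mult divide_simps add.commute)
  qed
  have s: "summable (\<lambda>n. exp (- x) * (1 / (real n + 1)\<^sup>2))"
    by (intro summable_mult summable_inverse_squares_Suc)
  have "\<bar>Lam x\<bar> \<le> (\<Sum>n. exp (- x) * (1 / (real n + 1)\<^sup>2))"
    unfolding Lam_def real_norm_def[symmetric]
  proof (rule order_trans[OF summable_norm suminf_le])
    show "summable (\<lambda>n. norm ((-1) ^ n * exp (- (real (Suc n) * x)) / (real (Suc n))\<^sup>2))"
      by (rule summable_comparison_test'[OF s, of 0]) (use le in \<open>simp only: real_norm_def abs_abs\<close>)
    then show "summable (\<lambda>n. norm ((-1) ^ n * exp (- (real (Suc n) * x)) / (real (Suc n))\<^sup>2))" .
  qed (use le s in \<open>simp_all only: real_norm_def\<close>)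
  also have "\<dots> = exp (- x) * (pi\<^sup>2 / 6)"
    using sums_mult[OF inverse_squares_sums, of "exp (-x)"] by (simp add: sums_iff add.commute)
  also have "\<dots> \<le> exp (- x) * 2"
  proof -
    have "pi\<^sup>2 \<le> 3.2\<^sup>2" using pi_approx by (intro power_mono) auto
    then show ?thesis by (intro mult_left_mono) (auto simp: power2_eq_square)
  qed
  finally show ?thesis by simp
qed

text \<open>The derivative formula below is for x > 0; continuity up to 0 lets the mean value
  theorem start at 0.\<close>

lemma continuous_on_Lam: "continuous_on {0..} Lam"
proof -
  have "uniform_limit {0..} (\<lambda>n x. \<Sum>i<n. (-1) ^ i * exp (- (real (Suc i) * x)) / (real (Suc i))\<^sup>2) Lam sequentially"
    unfolding Lam_def
    by (rule Weierstrass_m_test[OF _ summable_inverse_squares_Suc]) (use Lam_term_le in auto)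
  then show ?thesis
    by (rule uniform_limit_theorem[rotated]) (auto intro!: always_eventually continuous_intros)
qed

text \<open>The alternating sum of inverse squares is half the full one: after grouping both series
  in pairs, their difference has the terms 2 f(2n + 1) = f(n) / 2.\<close>

lemma Lam_0: "Lam 0 = pi\<^sup>2 / 12"
proof -
  define f where "f = (\<lambda>n. 1 / (real n + 1)\<^sup>2)"
  have f: "f sums (pi\<^sup>2 / 6)" using inverse_squares_sums by (simp add: f_def add.commute)
  have "(\<lambda>n. (-1) ^ n * f n) sums Lam 0"
    using summable_sums[OF summable_Lam[of 0]] by (simp add: Lam_def f_def add.commute)
  then have "(\<lambda>n. \<Sum>i\<in>{n * 2..<n * 2 + 2}. (-1) ^ i * f i) sums Lam 0"
    by (rule sums_group) simp
  moreover have "(\<Sum>i\<in>{n * 2..<n * 2 + 2}. (-1) ^ i * f i) = f (2 * n) - f (2 * n + 1)" for n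
  proof -
    have "{n * 2..<n * 2 + 2} = {2 * n, 2 * n + 1}" by auto
    then show ?thesis by simp
  qed
  ultimately have a: "(\<lambda>n. f (2 * n) - f (2 * n + 1)) sums Lam 0" by simp
  have "(\<lambda>n. \<Sum>i\<in>{n * 2..<n * 2 + 2}. f i) sums (pi\<^sup>2 / 6)"
    by (rule sums_group[OF f]) simp
  then have b: "(\<lambda>n. f (2 * n) + f (2 * n + 1)) sums (pi\<^sup>2 / 6)"
    by (simp add: numeral_2_eq_2 mult.commute)
  have "(\<lambda>n. (f (2 * n) + f (2 * n + 1)) - (f (2 * n) - f (2 * n + 1))) sums (pi\<^sup>2 / 6 - Lam 0)"
    by (rule sums_diff[OF b a])
  moreover have "(\<lambda>n. (f (2 * n) + f (2 * n + 1)) - (f (2 * n) - f (2 * n + 1))) = (\<lambda>n. (1/2) * f n)"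
    by (rule ext, simp add: f_def divide_simps) (simp add: power2_eq_square algebra_simps)
  ultimately have "(\<lambda>n. (1/2) * f n) sums (pi\<^sup>2 / 6 - Lam 0)" by (simp only:)
  moreover have "(\<lambda>n. (1/2) * f n) sums ((1/2) * (pi\<^sup>2 / 6))" by (rule sums_mult[OF f])
  ultimately have "pi\<^sup>2 / 6 - Lam 0 = (1/2) * (pi\<^sup>2 / 6)" by (rule sums_unique2)
  then show ?thesis by simp
qed

text \<open>\<open>Lam\<close> is a power series in y = e^(-x). Its termwise derivative times
  \<open>y\<close> is the series of ln (1 + y), and the chain rule contributes the factor
  -y.\<close>

lemma Lam_deriv: "(Lam has_real_derivative (- ln (1 + exp (- x)))) (at x)" if "0 < x"
proof -
  define a where "a = (\<lambda>n. if n = 0 then 0 else (-1) ^ (n - 1) / (real n)\<^sup>2)"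
  define g where "g = (\<lambda>y::real. \<Sum>n. a n * y ^ n)"
  have abs_a: "\<bar>a n\<bar> \<le> 1" for n by (auto simp: a_def abs_divide divide_simps)
  have sa: "summable (\<lambda>n. a n * y ^ n)" if "\<bar>y\<bar> < 1" for y
  proof (rule summable_comparison_test'[of "\<lambda>n. \<bar>y\<bar> ^ n" 0])
    show "norm (a n * y ^ n) \<le> \<bar>y\<bar> ^ n" for n
      using abs_a[of n] by (simp add: abs_mult power_abs mult_left_le_one_le)
  qed (use that in auto)
  define y where "y = exp (- x)"
  have y: "0 < y" "y < 1" using \<open>0 < x\<close> by (auto simp: y_def)
  obtain K where K: "y < K" "K < 1" using dense y by blast
  have dg: "(g has_real_derivative (\<Sum>n. diffs a n * y ^ n)) (at y)"
    unfolding g_def by (rule termdiffs_strong[OF sa[of K]]) (use y K in auto)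
  have Lg: "Lam z = g (exp (- z))" if "0 < z" for z
  proof -
    have "g (exp (-z)) = (\<Sum>n. a (Suc n) * exp (-z) ^ Suc n) + a 0 * exp (-z) ^ 0"
      unfolding g_def using suminf_split_head[OF sa[of "exp (-z)"]] that by simp
    also have "a 0 * exp (-z) ^ 0 = 0" by (simp add: a_def)
    also have "(\<lambda>n. a (Suc n) * exp (-z) ^ Suc n) = (\<lambda>n. (-1) ^ n * exp (- (real (Suc n) * z)) / (real (Suc n))\<^sup>2)"
      by (rule ext) (simp only: exp_of_nat_mult[symmetric], simp add: a_def)
    finally show ?thesis by (simp add: Lam_def)
  qed
  have "ln (1 + y) = (\<Sum>n. (-1) ^ n * (1 / real (n + 1)) * ((1 + y) - 1) ^ Suc n)"
    by (rule ln_series) (use y in auto)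
  also have "\<dots> = (\<Sum>n. y * (diffs a n * y ^ n))"
    by (intro suminf_cong) (simp add: diffs_def a_def power2_eq_square)
  also have "\<dots> = y * (\<Sum>n. diffs a n * y ^ n)"
  proof (rule suminf_mult)
    show "summable (\<lambda>n. diffs a n * y ^ n)"
      by (rule termdiff_converges[of _ 1]) (use sa y in auto)
  qed
  finally have l: "ln (1 + y) = y * (\<Sum>n. diffs a n * y ^ n)" .
  have "((\<lambda>z. g (exp (- z))) has_real_derivative ((\<Sum>n. diffs a n * y ^ n) * (- y))) (at x)"
    unfolding y_def by (rule DERIV_chain2[where f = g and g = "\<lambda>z. exp (- z)", OF dg[unfolded y_def]]) (auto intro!: derivative_eq_intros)
  then have "((\<lambda>z. g (exp (- z))) has_real_derivative (- ln (1 + y))) (at x)" using l by (simp add: mult.commute)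
  then show ?thesis unfolding y_def
    by (rule has_field_derivative_transform_within_open[of _ _ _ "{0<..}"]) (use that Lg in auto)
qed

text \<open>The value \<pi>^2 / 12 ends up in the exponential growth rate of the theorem, the slope
  ln 2 in its power of two.\<close>

lemma Lam_near_0: "\<bar>Lam x - (pi\<^sup>2 / 12 - x * ln 2)\<bar> \<le> x\<^sup>2" if "0 < x"
proof -
  have "\<exists>z>0. z < x \<and> Lam x - Lam 0 = (x - 0) * (- ln (1 + exp (- z)))"
  proof (rule MVT[OF that, of Lam, THEN exE])
    show "continuous_on {0..x} Lam" using continuous_on_Lam by (rule continuous_on_subset) auto
    show "Lam differentiable (at z)" if "0 < z" for z
      using Lam_deriv[OF that] real_differentiable_def by blast
    fix l assume "\<exists>z>0. z < x \<and> DERIV Lam z :> l \<and> Lam x - Lam 0 = (x - 0) * l"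
    then show ?thesis using Lam_deriv DERIV_unique by blast
  qed
  then obtain z where z: "0 < z" "z < x" "Lam x - Lam 0 = - x * ln (1 + exp (- z))" by auto
  have "ln (1 + exp (-z)) \<le> ln 2" using z by (subst ln_le_cancel_iff) (auto simp: add_pos_pos)
  moreover have "ln 2 - z \<le> ln (1 + exp (- z))"
  proof -
    have "ln 2 - z = ln (2 * exp (- z))" by (simp add: ln_mult)
    also have "\<dots> \<le> ln (1 + exp (- z))" using z by (subst ln_le_cancel_iff) (auto simp: add_pos_pos)
    finally show ?thesis .
  qed
  ultimately have "\<bar>ln 2 - ln (1 + exp (- z))\<bar> \<le> x" using z by auto
  then have "x * \<bar>ln 2 - ln (1 + exp (- z))\<bar> \<le> x * x" using that by (intro mult_left_mono) auto
  moreover have "Lam x - (pi\<^sup>2 / 12 - x * ln 2) = x * (ln 2 - ln (1 + exp (- z)))"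
    using z(3) Lam_0 by (simp add: algebra_simps)
  ultimately show ?thesis using that by (simp add: abs_mult power2_eq_square)
qed

text \<open>A rescaling of the normal density with variance 1 / (2a).\<close>

lemma gaussian_integral:
  fixes a :: real assumes "0 < a"
  shows "integrable lborel (\<lambda>x. exp (- (a * x\<^sup>2)))" "(\<integral>x. exp (- (a * x\<^sup>2)) \<partial>lborel) = sqrt (pi / a)"
proof -
  define s where "s = 1 / sqrt (2 * a)"
  have s: "0 < s" "s\<^sup>2 = 1 / (2 * a)" using assms by (auto simp: s_def power_divide)
  have e: "normal_density 0 s x = sqrt (a / pi) * exp (- (a * x\<^sup>2))" for x
    using assms by (simp add: normal_density_def s field_simps real_sqrt_divide)
  have nz: "sqrt (a / pi) > 0" using assms by simp
  have "integrable lborel (\<lambda>x. sqrt (a / pi) * exp (- (a * x\<^sup>2)))"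
    using integrable_normal_density[OF s(1), of 0] by (simp add: e[abs_def] cong: integrable_cong)
  then show "integrable lborel (\<lambda>x. exp (- (a * x\<^sup>2)))" using nz assms by simp
  have "(\<integral>x. sqrt (a / pi) * exp (- (a * x\<^sup>2)) \<partial>lborel) = 1"
    using integral_normal_density[OF s(1), of 0] by (simp add: e)
  then have "sqrt (a / pi) * (\<integral>x. exp (- (a * x\<^sup>2)) \<partial>lborel) = 1" by simp
  then show "(\<integral>x. exp (- (a * x\<^sup>2)) \<partial>lborel) = sqrt (pi / a)"
    using assms by (simp add: real_sqrt_divide field_simps)
qed

section \<open>Lower bounds for 1 - cos along arithmetic progressions\<close>

lemma one_minus_cos_ge: "x\<^sup>2 / 24 \<le> 1 - cos x" if "\<bar>x\<bar> \<le> pi" for x :: real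
proof -
  have small: "x\<^sup>2 * (11/24) \<le> 1 - cos x" if x: "\<bar>x\<bar> \<le> 1" for x :: real
  proof -
    have "x\<^sup>2 * x\<^sup>2 \<le> x\<^sup>2 * 1" using x by (intro mult_left_mono) (auto simp: abs_square_le_1)
    moreover have "x ^ 4 = x\<^sup>2 * x\<^sup>2" by (simp add: eval_nat_numeral)
    ultimately show ?thesis using cos_taylor[of x] by (simp only: abs_le_iff) linarith
  qed
  show ?thesis
  proof (cases "\<bar>x\<bar> \<le> 1")
    case True
    show ?thesis by (rule order_trans[OF _ small[OF True]]) simp
  next
    case False
    have "cos \<bar>x\<bar> \<le> cos 1" using False that by (subst cos_mono_le_eq) auto
    then have "11/24 \<le> 1 - cos x" using small[of 1] by simp
    moreover have "x\<^sup>2 \<le> 3.2\<^sup>2" using that pi_approx by (subst abs_le_square_iff[symmetric]) auto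
    ultimately show ?thesis by (simp add: power2_eq_square)
  qed
qed

text \<open>Comparing the terms \<open>k\<close> and \<open>k + g\<close> removes the unknown offset
  \<open>b\<close>, since 1 - cos (g \<eta>) is at most twice the sum of the two terms. The gap
  \<open>g\<close> \<le> J / 2 is chosen so that g \<eta> is not close to a multiple of 2\<pi>: half
  the range if that does not overshoot \<pi>, otherwise about \<pi> / |\<eta>|.\<close>

lemma sum_one_minus_cos_ge:
  fixes b \<eta> :: real
  assumes J: "4 \<le> J" and \<eta>: "\<bar>\<eta>\<bar> \<le> pi" and \<epsilon>: "0 \<le> \<epsilon>" "\<epsilon> \<le> 1" "\<epsilon> \<le> real J * \<bar>\<eta>\<bar>"
  shows "real J * \<epsilon>\<^sup>2 / 3200 \<le> (\<Sum>k<J. 1 - cos (b + real k * \<eta>))"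
proof -
  have tri: "(1 - cos (x - y)) \<le> 2 * (1 - cos x) + 2 * (1 - cos y)" for x y :: real
  proof -
    have "1 - cos (x - y) = 2 * (sin (x/2 - y/2))\<^sup>2"
      using cos_double_sin[of "x/2 - y/2"] by (simp add: algebra_simps)
    also have "\<bar>sin (x/2 - y/2)\<bar> \<le> \<bar>sin (x/2)\<bar> + \<bar>sin (y/2)\<bar>"
      unfolding sin_diff
      by (rule order_trans[OF abs_triangle_ineq4])
         (auto simp: abs_mult intro!: add_mono mult_left_le mult_right_le_one_le mult_left_le_one_le)
    then have "(sin (x/2 - y/2))\<^sup>2 \<le> (\<bar>sin (x/2)\<bar> + \<bar>sin (y/2)\<bar>)\<^sup>2"
      by (metis abs_ge_zero power2_abs power_mono)
    also have "\<dots> \<le> 2 * (sin (x/2))\<^sup>2 + 2 * (sin (y/2))\<^sup>2"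
      using sum_squares_bound[of "\<bar>sin (x/2)\<bar>" "\<bar>sin (y/2)\<bar>"] by (simp add: power2_sum)
    finally show ?thesis
      using cos_double_sin[of "x/2"] cos_double_sin[of "y/2"] by simp
  qed
  obtain g :: nat where g: "2 * g \<le> J" "\<epsilon>\<^sup>2 / 400 \<le> 1 - cos (real g * \<eta>)"
  proof (cases "real (J div 2) * \<bar>\<eta>\<bar> \<le> pi")
    case True
    have "real J \<le> 3 * real (J div 2)"
    proof -
      have "J \<le> 3 * (J div 2)" using J by presburger
      then show ?thesis by linarith
    qed
    then have "\<epsilon> / 3 \<le> real (J div 2) * \<bar>\<eta>\<bar>"
      using \<epsilon>(3) mult_right_mono[of "real J" "3 * real (J div 2)" "\<bar>\<eta>\<bar>"] by simp
    then have "(\<epsilon> / 3)\<^sup>2 \<le> (real (J div 2) * \<bar>\<eta>\<bar>)\<^sup>2" using \<epsilon> by (intro power_mono) auto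
    moreover have "(real (J div 2) * \<bar>\<eta>\<bar>)\<^sup>2 / 24 \<le> 1 - cos (real (J div 2) * \<eta>)"
      using one_minus_cos_ge[of "real (J div 2) * \<eta>"] True by (simp add: abs_mult power_mult_distrib)
    ultimately have "\<epsilon>\<^sup>2 / 400 \<le> 1 - cos (real (J div 2) * \<eta>)" by (simp add: power_divide) (smt (verit) zero_le_power2)
    then show ?thesis using that[of "J div 2"] by simp
  next
    case False
    then have e0: "\<eta> \<noteq> 0" by auto
    \<comment> \<open>The largest multiple of |\<eta>| not exceeding \<pi>; it is at least \<pi> /
      2, so its cosine is not positive.\<close>
    define g where "g = nat \<lfloor>pi / \<bar>\<eta>\<bar>\<rfloor>"
    have q: "1 \<le> pi / \<bar>\<eta>\<bar>" using \<eta> e0 by (simp add: field_simps)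
    then have g1: "real g \<le> pi / \<bar>\<eta>\<bar>" "pi / \<bar>\<eta>\<bar> < real g + 1" "1 \<le> g"
      unfolding g_def by linarith+
    have u: "real g * \<bar>\<eta>\<bar> \<le> pi" using g1(1) e0 by (simp add: field_simps)
    have "pi < (real g + 1) * \<bar>\<eta>\<bar>" using g1(2) e0 by (simp add: field_simps)
    also have "\<dots> \<le> (2 * real g) * \<bar>\<eta>\<bar>" using g1(3) by (intro mult_right_mono) auto
    finally have l: "pi / 2 \<le> real g * \<bar>\<eta>\<bar>" by simp
    have "cos (real g * \<bar>\<eta>\<bar>) \<le> cos (pi / 2)" using u l by (intro cos_monotone_0_pi_le) auto
    moreover have "cos (real g * \<bar>\<eta>\<bar>) = cos (real g * \<eta>)" by (metis abs_mult abs_of_nat cos_abs_real)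
    moreover have "\<epsilon>\<^sup>2 \<le> 1" using \<epsilon> by (simp add: power_le_one)
    ultimately have "\<epsilon>\<^sup>2 / 400 \<le> 1 - cos (real g * \<eta>)" by simp
    moreover have "real g < real (J div 2)"
    proof -
      have "real g * \<bar>\<eta>\<bar> < real (J div 2) * \<bar>\<eta>\<bar>" using u False by linarith
      then show ?thesis using e0 by (simp add: mult_less_cancel_right)
    qed
    ultimately show ?thesis using that[of g] by simp
  qed
  let ?f = "\<lambda>k. 1 - cos (b + real k * \<eta>)"
  have nn: "0 \<le> ?f k" for k by simp
  have "(\<Sum>k<J - g. 1 - cos (real g * \<eta>)) \<le> (\<Sum>k<J - g. 2 * ?f (k + g) + 2 * ?f k)"
  proof (rule sum_mono)
    fix k
    show "1 - cos (real g * \<eta>) \<le> 2 * ?f (k + g) + 2 * ?f k"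
      using tri[of "b + real (k + g) * \<eta>" "b + real k * \<eta>"] by (simp add: algebra_simps)
  qed
  also have "\<dots> = 2 * (\<Sum>k<J - g. ?f (k + g)) + 2 * (\<Sum>k<J - g. ?f k)"
    by (simp only: sum.distrib sum_distrib_left)
  also have "(\<Sum>k<J - g. ?f (k + g)) = sum ?f ((\<lambda>k. k + g) ` {..<J - g})"
    by (subst sum.reindex) (auto simp: inj_on_def)
  also have "\<dots> \<le> (\<Sum>k<J. ?f k)" by (rule sum_mono2) (auto simp: nn)
  also have "(\<Sum>k<J - g. ?f k) \<le> (\<Sum>k<J. ?f k)" by (rule sum_mono2) (auto simp: nn)
  finally have "real (J - g) * (1 - cos (real g * \<eta>)) \<le> 4 * (\<Sum>k<J. ?f k)" by simp
  moreover have "(real J / 2) * (\<epsilon>\<^sup>2 / 400) \<le> real (J - g) * (1 - cos (real g * \<eta>))"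
    using g by (intro mult_mono) auto
  ultimately show ?thesis by simp
qed

section \<open>Sums over arithmetic progressions of Fermi--Dirac weights\<close>

text \<open>The probability e^(-tx) / (1 + e^(-tx)) that a part of size \<open>x\<close> occurs when
  a set of parts is drawn with weight e^(-t \<cdot> sum).\<close>

definition fermi :: "real \<Rightarrow> real \<Rightarrow> real" where
  "fermi t x = 1 / (1 + exp (t * x))"

lemma fermi_pos: "0 < fermi t x" and fermi_less_1: "fermi t x < 1"
  by (auto simp: fermi_def add_pos_pos divide_simps)

lemma fermi_le_half: "fermi t x \<le> 1 / 2" if "0 \<le> t" "0 \<le> x"
  using that by (simp add: fermi_def divide_simps add_pos_pos)

lemma fermi_le_exp: "fermi t x \<le> exp (- (t * x))"
  by (simp add: fermi_def exp_minus divide_simps add_pos_pos)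

lemma fermi_var_le_exp: "fermi t x * (1 - fermi t x) \<le> exp (- (t * x))"
  using fermi_le_exp[of t x] fermi_pos[of t x] by (smt (verit) mult_left_le)

lemma fermi_var_nonneg: "0 \<le> fermi t x * (1 - fermi t x)"
  using fermi_pos[of t x] fermi_less_1[of t x] by simp

lemma fermi_eq: "fermi t x = exp (- (t * x)) / (1 + exp (- (t * x)))"
  by (simp add: fermi_def exp_minus field_simps)

lemma DERIV_fermi: "(fermi t has_real_derivative (- t * (fermi t x * (1 - fermi t x)))) (at x)"
proof -
  have "1 + exp (t * x) \<noteq> 0" by (smt (verit) exp_gt_zero)
  then show ?thesis unfolding fermi_def[abs_def]
    by (auto intro!: derivative_eq_intros simp: divide_simps power2_eq_square)
qed

lemma DERIV_ln_one_plus_exp: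
  "((\<lambda>x. ln (1 + exp (- (t * x)))) has_real_derivative (- t * fermi t x)) (at x)"
proof -
  have "1 + exp (- (t * x)) > 0" by (smt (verit) exp_gt_zero)
  then show ?thesis unfolding fermi_eq
    by (auto intro!: derivative_eq_intros simp: divide_simps)
qed

lemma DERIV_Lam_scaled:
  assumes "0 < t" "0 < x"
  shows "((\<lambda>x. Lam (t * x)) has_real_derivative (- t * ln (1 + exp (- (t * x))))) (at x)"
proof -
  have "((\<lambda>x. Lam (t * x)) has_real_derivative (- ln (1 + exp (- (t * x))) * t)) (at x)"
    by (rule DERIV_chain2[where f = Lam and g = "\<lambda>x. t * x", OF Lam_deriv])
       (use assms in \<open>auto intro!: derivative_eq_intros\<close>)
  then show ?thesis by (simp add: mult.commute)
qed

lemma fermi_near_half: "\<bar>fermi t x - 1 / 2\<bar> \<le> t * x" if "0 \<le> t * x"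
proof -
  have "1 / 2 - fermi t x = (1 - exp (- (t * x))) / (2 * (1 + exp (- (t * x))))"
    by (simp add: fermi_eq divide_simps add_pos_pos) (smt (verit) exp_gt_zero)
  also have "\<dots> \<le> (t * x) / 1"
    using exp_ge_add_one_self[of "- (t * x)"] that by (intro frac_le) (auto simp: add_nonneg_nonneg)
  finally have "1 / 2 - fermi t x \<le> t * x" by simp
  moreover have "fermi t x \<le> 1 / 2" using that by (simp add: fermi_def divide_simps add_pos_pos)
  ultimately show ?thesis by simp
qed

lemma ln_one_plus_exp_near: "\<bar>ln (1 + exp (- x)) - (ln 2 - x / 2)\<bar> \<le> x\<^sup>2" if "0 < x" for x :: real
proof -
  have "\<exists>z>0. z < x \<and> ln (1 + exp (- (1 * x))) - ln (1 + exp (- (1 * 0))) = (x - 0) * (- 1 * fermi 1 z)"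
    by (rule MVT2[OF that]) (rule DERIV_ln_one_plus_exp)
  then obtain z where z: "0 < z" "z < x" "ln (1 + exp (- x)) - ln 2 = - x * fermi 1 z" by auto
  have "\<bar>fermi 1 z - 1 / 2\<bar> \<le> x" using fermi_near_half[of 1 z] z by simp
  then have "x * \<bar>fermi 1 z - 1 / 2\<bar> \<le> x * x" using that by (intro mult_left_mono) auto
  moreover have "ln (1 + exp (- x)) - (ln 2 - x / 2) = - (x * (fermi 1 z - 1 / 2))"
    using z(3) by (simp add: algebra_simps)
  ultimately show ?thesis using that by (simp add: abs_mult power2_eq_square)
qed

lemma ln_one_plus_exp_bounds: "0 \<le> ln (1 + exp (- x))" "ln (1 + exp (- x)) \<le> exp (- x)" for x :: real
  using ln_add_one_self_le_self[of "exp (- x)"] by auto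

lemma exp_le_inverse: "exp (- y) \<le> 1 / y" if "0 < y" for y :: real
proof -
  have "y \<le> exp y" using exp_ge_add_one_self[of y] by linarith
  then show ?thesis using that by (simp add: exp_minus divide_simps)
qed

text \<open>The second hypothesis says L \<ge> t^(-2): the cut-off lies so far beyond the natural
  scale 1/t that e^(-tL) \<le> e^(-1/t) is at most t.\<close>

lemma exp_tail:
  fixes t L :: real
  assumes "0 < t" "1 / t \<le> t * L"
  shows "exp (- (t * L)) \<le> t" "exp (- (t * L / 2)) \<le> 2 * t"
proof -
  have "exp (- (t * L)) \<le> exp (- (1 / t))" using assms by simp
  also have "\<dots> \<le> t" using exp_le_inverse[of "1/t"] assms by simp
  finally show "exp (- (t * L)) \<le> t" .
  have "exp (- (t * L / 2)) \<le> exp (- (1 / (2 * t)))" using assms by simp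
  also have "\<dots> \<le> 2 * t" using exp_le_inverse[of "1/(2*t)"] assms by simp
  finally show "exp (- (t * L / 2)) \<le> 2 * t" .
qed

lemma power_exp_half_le:
  fixes t x :: real
  assumes "0 < t" "0 \<le> x"
  shows "x * exp (- (t * x / 2)) \<le> 2 / t" "x\<^sup>2 * exp (- (t * x / 2)) \<le> 8 / t\<^sup>2"
proof -
  have "t * x / 2 \<le> exp (t * x / 2)" "(t * x / 2)\<^sup>2 / 2 \<le> exp (t * x / 2)"
    using power_div_fact_le_exp[of "t * x / 2" 1] power_div_fact_le_exp[of "t * x / 2" 2] assms by (auto simp: fact_2)
  then show "x * exp (- (t * x / 2)) \<le> 2 / t" "x\<^sup>2 * exp (- (t * x / 2)) \<le> 8 / t\<^sup>2"
    using assms by (auto simp: exp_minus field_simps)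
qed

lemma exp_half_split: "exp (- (t * x)) = exp (- (t * x / 2)) * exp (- (t * x / 2))" for t x :: real
  by (simp add: exp_add[symmetric])

lemma sum_shift_diff:
  fixes h h' :: "real \<Rightarrow> real" and a b d :: nat
  assumes "0 < d" "0 < c" "c \<le> 1" "0 \<le> B"
    and h: "\<And>x. 0 \<le> x \<Longrightarrow> (h has_real_derivative h' x) (at x)"
    and bound: "\<And>x. 0 \<le> x \<Longrightarrow> \<bar>h' x\<bar> \<le> B * exp (- (c * x))"
  shows "\<bar>(\<Sum>k<n. h (real (a + d * k))) - (\<Sum>k<n. h (real (b + d * k)))\<bar> \<le> 2 * (real a + real b) * B / c"
proof -
  have key: "\<bar>h x - h y\<bar> \<le> (y - x) * (B * exp (- (c * x)))" if xy: "0 \<le> x" "x \<le> y" for x y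
  proof (cases "x = y")
    case False
    have "\<exists>z>x. z < y \<and> h y - h x = (y - x) * h' z"
      by (rule MVT2) (use h xy False in auto)
    then obtain z where z: "x < z" "z < y" "h y - h x = (y - x) * h' z" by auto
    have "\<bar>h' z\<bar> \<le> B * exp (- (c * z))" using bound z xy by simp
    also have "\<dots> \<le> B * exp (- (c * x))" using assms z by (intro mult_left_mono) auto
    finally have "(y - x) * \<bar>h' z\<bar> \<le> (y - x) * (B * exp (- (c * x)))" using xy by (intro mult_left_mono) auto
    moreover have "\<bar>h x - h y\<bar> = (y - x) * \<bar>h' z\<bar>"
      using z(3) xy by (simp add: abs_minus_commute[of "h x"] abs_mult)
    ultimately show ?thesis by simp
  qed simp
  have step: "\<bar>h (real (a + d * k)) - h (real (b + d * k))\<bar> \<le> (real a + real b) * B * exp (- (c * real k))" for k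
  proof -
    define x where "x = min (real (a + d * k)) (real (b + d * k))"
    define y where "y = max (real (a + d * k)) (real (b + d * k))"
    have kx: "real k \<le> x"
      unfolding x_def using assms(1) by (cases d) (auto simp flip: of_nat_mult of_nat_add of_nat_Suc)
    have "\<bar>h (real (a + d * k)) - h (real (b + d * k))\<bar> = \<bar>h x - h y\<bar>"
      by (simp add: x_def y_def min_def max_def abs_minus_commute)
    also have "\<dots> \<le> (y - x) * (B * exp (- (c * x)))" by (rule key) (auto simp: x_def y_def)
    also have "\<dots> \<le> (real a + real b) * (B * exp (- (c * real k)))"
      using kx assms by (intro mult_mono) (auto simp: x_def y_def)
    finally show ?thesis by (simp add: mult_ac)
  qed
  have "\<bar>(\<Sum>k<n. h (real (a + d * k))) - (\<Sum>k<n. h (real (b + d * k)))\<bar>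
    \<le> (\<Sum>k<n. (real a + real b) * B * exp (- (c * real k)))"
    unfolding sum_subtractf[symmetric] by (rule order_trans[OF sum_abs sum_mono[OF step]])
  also have "\<dots> \<le> (real a + real b) * B * (2 / c)"
    unfolding sum_distrib_left[symmetric] using assms by (intro mult_left_mono sum_exp_le) auto
  finally show ?thesis by (simp add: mult_ac)
qed

lemma DERIV_fermi_var:
  "((\<lambda>x. fermi t x * (1 - fermi t x)) has_real_derivative
    (- t * (fermi t x * (1 - fermi t x)) * (1 - 2 * fermi t x))) (at x)"
  by (rule DERIV_cong[OF DERIV_mult[OF DERIV_fermi DERIV_diff[OF DERIV_const DERIV_fermi]]]) (simp add: algebra_simps)

lemma fermi_var_deriv_bound:
  assumes "0 < t" "0 \<le> x"
  shows "\<bar>- t * (fermi t x * (1 - fermi t x)) * (1 - 2 * fermi t x)\<bar> \<le> t * exp (- (t * x))"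
proof -
  have "\<bar>1 - 2 * fermi t x\<bar> \<le> 1" using fermi_pos[of t x] fermi_less_1[of t x] by simp
  then have "(fermi t x * (1 - fermi t x)) * \<bar>1 - 2 * fermi t x\<bar> \<le> exp (- (t * x)) * 1"
    using fermi_var_le_exp fermi_var_nonneg by (intro mult_mono) auto
  then have "t * ((fermi t x * (1 - fermi t x)) * \<bar>1 - 2 * fermi t x\<bar>) \<le> t * exp (- (t * x))"
    using assms by (intro mult_left_mono) auto
  moreover have "\<bar>- t * (fermi t x * (1 - fermi t x)) * (1 - 2 * fermi t x)\<bar> = t * ((fermi t x * (1 - fermi t x)) * \<bar>1 - 2 * fermi t x\<bar>)"
    using assms fermi_var_nonneg[of t x] unfolding abs_mult[of _ "1 - 2 * fermi t x"] by simp
  ultimately show ?thesis by simp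
qed

section \<open>Moments along a progression a, a + d, ..., cut off at L \<ge> t^(-2)\<close>

context
  fixes t :: real and a d n :: nat
  assumes t: "0 < t" "t \<le> 1" and d: "0 < d" and a: "1 \<le> a" and tail: "1 / t \<le> t * real (a + d * n)"
begin

private abbreviation "L \<equiv> real (a + d * n)"

text \<open>fermi (1 - fermi) is exactly -1/t times the derivative of \<open>fermi\<close>, so the
  integral is fermi(a) / t up to the tail, and this is close to 1 / (2t).\<close>

lemma sum_fermi_var:
  "\<bar>real d * (\<Sum>k<n. fermi t (real (a + d * k)) * (1 - fermi t (real (a + d * k)))) - 1 / (2 * t)\<bar>
    \<le> 2 * (real d)\<^sup>2 + real a + 1"
proof -
  have "\<bar>d * (\<Sum>k<n. fermi t (a + d * real k) * (1 - fermi t (a + d * real k))) - (- fermi t (a + d * real n) / t - - fermi t a / t)\<bar>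
     \<le> 2 * (real d)\<^sup>2 * t / t"
  proof (rule sum_integral_approx[where H = "\<lambda>x. - fermi t x / t" and c = t and B = t])
    fix x :: real assume "real a \<le> x"
    then show "\<bar>- t * (fermi t x * (1 - fermi t x)) * (1 - 2 * fermi t x)\<bar> \<le> t * exp (- (t * x))"
      using t by (intro fermi_var_deriv_bound) auto
    show "((\<lambda>x. - fermi t x / t) has_real_derivative fermi t x * (1 - fermi t x)) (at x)"
      by (rule DERIV_cong[OF DERIV_cdivide[OF DERIV_minus[OF DERIV_fermi]]]) (use t in simp)
  qed (use t d DERIV_fermi_var in auto)
  moreover have "fermi t L / t \<le> 1"
    using fermi_le_exp[of t L] exp_tail(1)[OF t(1) tail] t by (simp add: divide_simps)
  moreover have "0 \<le> fermi t L / t" using fermi_pos[of t L] t by simp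
  moreover have "\<bar>fermi t a / t - 1 / (2 * t)\<bar> \<le> real a"
  proof -
    have "fermi t a / t - 1 / (2 * t) = (fermi t a - 1 / 2) / t" by (simp add: diff_divide_distrib)
    then have "\<bar>fermi t a / t - 1 / (2 * t)\<bar> = \<bar>fermi t a - 1 / 2\<bar> / t" using t by (simp only: abs_divide abs_of_pos)
    also have "\<dots> \<le> real a" using fermi_near_half[of t a] t by (simp add: divide_simps mult_ac)
    finally show ?thesis .
  qed
  moreover have "2 * (real d)\<^sup>2 * t / t = 2 * (real d)\<^sup>2" using t by simp
  ultimately show ?thesis unfolding of_nat_add of_nat_mult minus_divide_left[symmetric] by linarith
qed

text \<open>\<open>H\<close> comes from integration by parts: \<open>fermi\<close> integrates to a
  logarithm and the logarithm to \<open>Lam\<close>. At the lower end the two terms a ln 2 cancel to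
  this order, so the first element \<open>a\<close> does not affect the main term.\<close>

lemma sum_id_fermi:
  "\<bar>real d * (\<Sum>k<n. real (a + d * k) * fermi t (real (a + d * k))) - pi\<^sup>2 / (12 * t\<^sup>2)\<bar>
    \<le> (8 * (real d)\<^sup>2 + 4 * (real a)\<^sup>2 + 6) / t"
proof -
  define H where "H = (\<lambda>x. (- x * ln (1 + exp (- (t * x))) - Lam (t * x) / t) / t)"
  have b: "\<bar>fermi t x - t * x * (fermi t x * (1 - fermi t x))\<bar> \<le> 2 * exp (- (t / 2 * x))" if "0 \<le> x" for x
  proof -
    have "\<bar>fermi t x - t * x * (fermi t x * (1 - fermi t x))\<bar> \<le> fermi t x + t * x * (fermi t x * (1 - fermi t x))"
      using that t fermi_pos[of t x] fermi_var_nonneg[of t x] by (simp add: abs_le_iff)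
    also have "\<dots> \<le> exp (- (t * x)) + t * x * exp (- (t * x))"
      using that t fermi_le_exp fermi_var_le_exp by (intro add_mono mult_left_mono) auto
    also have "\<dots> = (1 + t * x) * exp (- (t * x))" by (simp add: algebra_simps)
    also have "\<dots> \<le> (2 * exp (t / 2 * x)) * exp (- (t * x))"
    proof (intro mult_right_mono)
      show "1 + t * x \<le> 2 * exp (t / 2 * x)" using exp_ge_add_one_self[of "t / 2 * x"] by (simp add: field_simps)
    qed auto
    also have "\<dots> = 2 * exp (- (t / 2 * x))" by (simp add: mult.assoc exp_add[symmetric])
    finally show ?thesis .
  qed
  have "\<bar>d * (\<Sum>k<n. (a + d * real k) * fermi t (a + d * real k)) - (H (a + d * real n) - H a)\<bar>
     \<le> 2 * (real d)\<^sup>2 * 2 / (t / 2)"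
  proof (rule sum_integral_approx[where H = H and c = "t/2" and B = 2])
    fix x :: real assume x: "real a \<le> x"
    then have x0: "0 < x" using a by linarith
    show "(H has_real_derivative x * fermi t x) (at x)" unfolding H_def
      by (rule DERIV_cong[OF DERIV_cdivide[OF DERIV_diff[OF DERIV_mult[OF DERIV_minus[OF DERIV_ident] DERIV_ln_one_plus_exp] DERIV_cdivide[OF DERIV_Lam_scaled[OF t(1) x0]]]]])
         (use t in \<open>simp add: field_simps\<close>)
    show "((\<lambda>x. x * fermi t x) has_real_derivative fermi t x - t * x * (fermi t x * (1 - fermi t x))) (at x)"
      by (rule DERIV_cong[OF DERIV_mult[OF DERIV_ident DERIV_fermi]]) (simp add: algebra_simps)
    show "\<bar>fermi t x - t * x * (fermi t x * (1 - fermi t x))\<bar> \<le> 2 * exp (- (t / 2 * x))" using b x0 by simp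
  qed (use t d in auto)
  then have 1: "\<bar>d * (\<Sum>k<n. (a + d * real k) * fermi t (a + d * real k)) - (H L - H a)\<bar> \<le> 8 * (real d)\<^sup>2 / t" by simp
  have HL: "\<bar>H L\<bar> \<le> 6 / t"
  proof -
    have e: "exp (- (t * L)) \<le> t" by (rule exp_tail(1)[OF t(1) tail])
    have "\<bar>L * ln (1 + exp (- (t * L)))\<bar> \<le> L * exp (- (t * L))"
      using ln_one_plus_exp_bounds[of "t * L"] by (simp add: abs_mult mult_left_mono)
    also have "\<dots> = (L * exp (- (t * L / 2))) * exp (- (t * L / 2))" by (subst exp_half_split) simp
    also have "\<dots> \<le> (2 / t) * (2 * t)"
      using power_exp_half_le(1)[of t L] exp_tail(2)[OF t(1) tail] t by (intro mult_mono) auto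
    finally have 1: "\<bar>L * ln (1 + exp (- (t * L)))\<bar> \<le> 4" using t by simp
    have "\<bar>Lam (t * L)\<bar> \<le> 2 * t" using Lam_bound[of "t * L"] e t by simp
    then have 2: "\<bar>Lam (t * L) / t\<bar> \<le> 2" using t by (simp add: divide_simps)
    have "\<bar>H L\<bar> = \<bar>- (L * ln (1 + exp (- (t * L)))) - Lam (t * L) / t\<bar> / t"
      using t by (simp add: H_def abs_divide)
    also have "\<dots> \<le> 6 / t"
    proof (rule divide_right_mono)
      show "\<bar>- (L * ln (1 + exp (- (t * L)))) - Lam (t * L) / t\<bar> \<le> 6" using 1 2 by linarith
    qed (use t in auto)
    finally show ?thesis .
  qed
  have Ha: "\<bar>- H a - pi\<^sup>2 / (12 * t\<^sup>2)\<bar> \<le> (4 * (real a)\<^sup>2) / t"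
  proof -
    have "- H a - pi\<^sup>2 / (12 * t\<^sup>2) = (a * ln (1 + exp (- (t * a))) + (Lam (t * a) - (pi\<^sup>2 / 12 - t * a * ln 2)) / t - a * ln 2) / t"
      using t by (simp add: H_def field_simps power2_eq_square)
    also have "\<bar>\<dots>\<bar> \<le> (4 * (real a)\<^sup>2) / t"
    proof -
      have "\<bar>(Lam (t * a) - (pi\<^sup>2 / 12 - t * a * ln 2)) / t\<bar> \<le> (t * a)\<^sup>2 / t"
        using Lam_near_0[of "t * a"] t a by (simp add: abs_divide divide_right_mono)
      also have "\<dots> = t * (real a)\<^sup>2" using t by (simp add: power2_eq_square)
      also have "\<dots> \<le> (real a)\<^sup>2" using t by (simp add: mult_left_le_one_le)
      finally have 1: "\<bar>(Lam (t * a) - (pi\<^sup>2 / 12 - t * a * ln 2)) / t\<bar> \<le> (real a)\<^sup>2" .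
      have e1: "exp (- (t * a)) \<le> 1" using t by simp
      have 2: "0 \<le> a * ln (1 + exp (- (t * a)))" "a * ln (1 + exp (- (t * a))) \<le> real a * 1"
        using ln_one_plus_exp_bounds[of "t * a"] e1 by (auto intro!: mult_left_mono simp del: mult_1_right intro: order_trans)
      have 3: "0 \<le> a * ln 2" "real a * ln 2 \<le> real a * 1" using ln2_le_25_over_36 by (auto intro!: mult_left_mono simp del: mult_1_right)
      have 4: "real a \<le> (real a)\<^sup>2" using a by (simp add: self_le_power)
      have "\<bar>a * ln (1 + exp (- (t * a))) + (Lam (t * a) - (pi\<^sup>2 / 12 - t * a * ln 2)) / t - a * ln 2\<bar> \<le> 4 * (real a)\<^sup>2"
      proof -
        have "\<bar>A\<bar> \<le> q \<Longrightarrow> 0 \<le> B \<Longrightarrow> B \<le> r \<Longrightarrow> 0 \<le> C \<Longrightarrow> C \<le> r \<Longrightarrow> r \<le> q \<Longrightarrow> \<bar>B + A - C\<bar> \<le> 4 * q"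
          for A B C q r :: real by linarith
        then show ?thesis using 1 2 3 4 unfolding mult_1_right by blast
      qed
      then show ?thesis unfolding abs_divide using t by (simp add: divide_right_mono)
    qed
    finally show ?thesis .
  qed
  have "\<bar>d * (\<Sum>k<n. (a + d * real k) * fermi t (a + d * real k)) - pi\<^sup>2 / (12 * t\<^sup>2)\<bar> \<le> 8 * (real d)\<^sup>2 / t + 6 / t + (4 * (real a)\<^sup>2) / t"
    using 1 HL Ha by linarith
  then show ?thesis by (simp add: add_divide_distrib)
qed

text \<open>As for \<open>sum_id_fermi\<close>, with one more integration by parts; the factor 2 in
  front of \<open>Lam\<close> doubles \<pi>^2 / 12 to \<pi>^2 / 6.\<close>

lemma sum_square_fermi_var:
  "\<bar>real d * (\<Sum>k<n. (real (a + d * k))\<^sup>2 * (fermi t (real (a + d * k)) * (1 - fermi t (real (a + d * k))))) - pi\<^sup>2 / (6 * t ^ 3)\<bar>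
    \<le> (48 * (real d)\<^sup>2 + 7 * (real a)\<^sup>2 + 28) / t\<^sup>2"
proof -
  define H where "H = (\<lambda>x. (- x\<^sup>2 * fermi t x - 2 * x * ln (1 + exp (- (t * x))) / t - 2 * Lam (t * x) / t\<^sup>2) / t)"
  define h' where "h' = (\<lambda>x. 2 * x * (fermi t x * (1 - fermi t x)) + x\<^sup>2 * (- t * (fermi t x * (1 - fermi t x)) * (1 - 2 * fermi t x)))"
  have b: "\<bar>h' x\<bar> \<le> (12 / t) * exp (- (t / 2 * x))" if "0 \<le> x" for x
  proof -
    have "\<bar>h' x\<bar> \<le> 2 * x * (fermi t x * (1 - fermi t x)) + x\<^sup>2 * \<bar>- t * (fermi t x * (1 - fermi t x)) * (1 - 2 * fermi t x)\<bar>"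
      unfolding h'_def using that fermi_var_nonneg[of t x]
      by (intro order_trans[OF abs_triangle_ineq] add_mono) (simp_all add: abs_mult[of "2 * x"] abs_mult[of "x\<^sup>2"])
    also have "\<dots> \<le> 2 * x * exp (- (t * x)) + x\<^sup>2 * (t * exp (- (t * x)))"
      using that t fermi_var_le_exp[of t x] fermi_var_deriv_bound[of t x] by (intro add_mono mult_left_mono) auto
    also have "\<dots> = (2 * (x * exp (- (t * x / 2))) + t * (x\<^sup>2 * exp (- (t * x / 2)))) * exp (- (t / 2 * x))"
      unfolding exp_half_split[of t x] by (simp add: algebra_simps)
    also have "\<dots> \<le> (2 * (2 / t) + t * (8 / t\<^sup>2)) * exp (- (t / 2 * x))"
      using power_exp_half_le[of t x] that t by (intro mult_right_mono add_mono mult_left_mono) auto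
    also have "2 * (2 / t) + t * (8 / t\<^sup>2) = 12 / t" using t by (simp add: field_simps power2_eq_square)
    finally show ?thesis .
  qed
  have "\<bar>d * (\<Sum>k<n. (a + d * real k)\<^sup>2 * (fermi t (a + d * real k) * (1 - fermi t (a + d * real k)))) - (H (a + d * real n) - H a)\<bar>
     \<le> 2 * (real d)\<^sup>2 * (12 / t) / (t / 2)"
  proof (rule sum_integral_approx[where H = H and c = "t/2" and B = "12 / t"])
    fix x :: real assume x: "real a \<le> x"
    then have x0: "0 < x" using a by linarith
    have D1: "((\<lambda>x. - x\<^sup>2 * fermi t x) has_real_derivative (- 2 * x * fermi t x + t * x\<^sup>2 * (fermi t x * (1 - fermi t x)))) (at x)"
      by (rule derivative_eq_intros DERIV_fermi refl)+ (simp add: algebra_simps power2_eq_square)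
    have D2: "((\<lambda>x. 2 * x * ln (1 + exp (- (t * x))) / t) has_real_derivative ((2 * ln (1 + exp (- (t * x))) - 2 * x * t * fermi t x) / t)) (at x)"
      by (rule DERIV_cong[OF DERIV_cdivide[OF DERIV_mult[OF DERIV_cmult[OF DERIV_ident] DERIV_ln_one_plus_exp]]]) (simp add: algebra_simps)
    have D3: "((\<lambda>x. 2 * Lam (t * x) / t\<^sup>2) has_real_derivative (2 * (- t * ln (1 + exp (- (t * x)))) / t\<^sup>2)) (at x)"
      by (rule DERIV_cdivide[OF DERIV_cmult[OF DERIV_Lam_scaled[OF t(1) x0]]])
    show "(H has_real_derivative x\<^sup>2 * (fermi t x * (1 - fermi t x))) (at x)" unfolding H_def
      by (rule DERIV_cong[OF DERIV_cdivide[OF DERIV_diff[OF DERIV_diff[OF D1 D2] D3]]])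
         (use t in \<open>simp add: field_simps power2_eq_square\<close>)
    show "((\<lambda>x. x\<^sup>2 * (fermi t x * (1 - fermi t x))) has_real_derivative h' x) (at x)"
      unfolding h'_def
      by (rule DERIV_cong[OF DERIV_mult[OF DERIV_power[OF DERIV_ident] DERIV_fermi_var]]) (simp add: algebra_simps)
    show "\<bar>h' x\<bar> \<le> (12 / t) * exp (- (t / 2 * x))" using b x0 by simp
  qed (use t d in auto)
  then have 1: "\<bar>d * (\<Sum>k<n. (a + d * real k)\<^sup>2 * (fermi t (a + d * real k) * (1 - fermi t (a + d * real k)))) - (H L - H a)\<bar> \<le> 48 * (real d)\<^sup>2 / t\<^sup>2"
    by (simp add: power2_eq_square)
  have HL: "\<bar>H L\<bar> \<le> 28 / t\<^sup>2"
  proof -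
    have e: "exp (- (t * L)) \<le> t" by (rule exp_tail(1)[OF t(1) tail])
    have "L\<^sup>2 * fermi t L \<le> L\<^sup>2 * exp (- (t * L))" using fermi_le_exp by (intro mult_left_mono) auto
    also have "\<dots> = (L\<^sup>2 * exp (- (t * L / 2))) * exp (- (t * L / 2))" by (subst exp_half_split) simp
    also have "\<dots> \<le> (8 / t\<^sup>2) * (2 * t)"
      using power_exp_half_le(2)[of t L] exp_tail(2)[OF t(1) tail] t by (intro mult_mono) auto
    finally have 0: "L\<^sup>2 * fermi t L \<le> 16 / t" using t by (simp add: power2_eq_square)
    have 00: "0 \<le> L\<^sup>2 * fermi t L" using fermi_pos[of t L] by simp
    have "\<bar>L * ln (1 + exp (- (t * L)))\<bar> \<le> L * exp (- (t * L))"
      using ln_one_plus_exp_bounds[of "t * L"] by (simp add: abs_mult mult_left_mono)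
    also have "\<dots> = (L * exp (- (t * L / 2))) * exp (- (t * L / 2))" by (subst exp_half_split) simp
    also have "\<dots> \<le> (2 / t) * (2 * t)"
      using power_exp_half_le(1)[of t L] exp_tail(2)[OF t(1) tail] t by (intro mult_mono) auto
    finally have "\<bar>L * ln (1 + exp (- (t * L)))\<bar> \<le> 4" using t by simp
    then have 1: "\<bar>2 * L * ln (1 + exp (- (t * L))) / t\<bar> \<le> 8 / t" proof -
      assume *: "\<bar>L * ln (1 + exp (- (t * L)))\<bar> \<le> 4"
      have "\<bar>2 * L * ln (1 + exp (- (t * L))) / t\<bar> = 2 * \<bar>L * ln (1 + exp (- (t * L)))\<bar> / t"
        using t by (simp only: abs_divide abs_mult abs_numeral abs_of_pos mult.assoc)
      also have "\<dots> \<le> 8 / t"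
      proof (rule divide_right_mono)
        show "2 * \<bar>L * ln (1 + exp (- (t * L)))\<bar> \<le> 8" using * by linarith
      qed (use t in auto)
      finally show ?thesis .
    qed
    have "\<bar>Lam (t * L)\<bar> \<le> 2 * t" using Lam_bound[of "t * L"] e t by simp
    then have 2: "\<bar>2 * Lam (t * L) / t\<^sup>2\<bar> \<le> 4 / t" using t by (simp add: divide_simps power2_eq_square abs_mult)
    have "\<bar>H L\<bar> = \<bar>- L\<^sup>2 * fermi t L - 2 * L * ln (1 + exp (- (t * L))) / t - 2 * Lam (t * L) / t\<^sup>2\<bar> / t"
      using t by (simp add: H_def abs_divide)
    also have "\<dots> \<le> (16 / t + 8 / t + 4 / t) / t"
    proof (rule divide_right_mono)
      show "\<bar>- L\<^sup>2 * fermi t L - 2 * L * ln (1 + exp (- (t * L))) / t - 2 * Lam (t * L) / t\<^sup>2\<bar> \<le> 16 / t + 8 / t + 4 / t"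
      proof -
        have "0 \<le> A \<Longrightarrow> A \<le> x \<Longrightarrow> \<bar>B\<bar> \<le> y \<Longrightarrow> \<bar>C\<bar> \<le> z \<Longrightarrow> \<bar>- A - B - C\<bar> \<le> x + y + z"
          for A B C x y z :: real by linarith
        then show ?thesis using 0 00 1 2 unfolding mult_minus_left by blast
      qed
    qed (use t in auto)
    finally show ?thesis using t by (simp add: field_simps power2_eq_square)
  qed
  have Ha: "\<bar>- H a - pi\<^sup>2 / (6 * t ^ 3)\<bar> \<le> (7 * (real a)\<^sup>2) / t\<^sup>2"
  proof -
    have "- H a - pi\<^sup>2 / (6 * t ^ 3) = (t * a\<^sup>2 * fermi t a + 2 * a * ln (1 + exp (- (t * a))) + 2 * ((Lam (t * a) - (pi\<^sup>2 / 12 - t * a * ln 2)) / t) - 2 * (a * ln 2)) / t\<^sup>2"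
      using t by (simp add: H_def field_simps power2_eq_square eval_nat_numeral)
    also have "\<bar>\<dots>\<bar> \<le> (7 * (real a)\<^sup>2) / t\<^sup>2"
    proof -
      have "\<bar>(Lam (t * a) - (pi\<^sup>2 / 12 - t * a * ln 2)) / t\<bar> \<le> (t * a)\<^sup>2 / t"
        using Lam_near_0[of "t * a"] t a by (simp add: abs_divide divide_right_mono)
      also have "\<dots> = t * (real a)\<^sup>2" using t by (simp add: power2_eq_square)
      also have "\<dots> \<le> (real a)\<^sup>2" using t by (simp add: mult_left_le_one_le)
      finally have 1: "\<bar>(Lam (t * a) - (pi\<^sup>2 / 12 - t * a * ln 2)) / t\<bar> \<le> (real a)\<^sup>2" .
      have e1: "exp (- (t * a)) \<le> 1" using t by simp
      have 2: "0 \<le> a * ln (1 + exp (- (t * a)))" "a * ln (1 + exp (- (t * a))) \<le> real a * 1"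
        using ln_one_plus_exp_bounds[of "t * a"] e1 by (auto intro!: mult_left_mono simp del: mult_1_right intro: order_trans)
      have 3: "0 \<le> a * ln 2" "real a * ln 2 \<le> real a * 1" using ln2_le_25_over_36 by (auto intro!: mult_left_mono simp del: mult_1_right)
      have 4: "real a \<le> (real a)\<^sup>2" using a by (simp add: self_le_power)
      have "t * a\<^sup>2 * fermi t a \<le> 1 * (real a)\<^sup>2 * 1"
        using t fermi_pos[of t a] fermi_less_1[of t a] by (intro mult_mono) auto
      then have 5: "t * a\<^sup>2 * fermi t a \<le> (real a)\<^sup>2" by simp
      have 6: "0 \<le> t * a\<^sup>2 * fermi t a" using t fermi_pos[of t a] by simp
      have "\<bar>t * a\<^sup>2 * fermi t a + 2 * a * ln (1 + exp (- (t * a))) + 2 * ((Lam (t * a) - (pi\<^sup>2 / 12 - t * a * ln 2)) / t) - 2 * (a * ln 2)\<bar> \<le> 7 * (real a)\<^sup>2"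
        using 1 2 3 4 5 6 unfolding mult.assoc by linarith
      then show ?thesis unfolding abs_divide using t by (simp add: divide_right_mono)
    qed
    finally show ?thesis .
  qed
  have "\<bar>d * (\<Sum>k<n. (a + d * real k)\<^sup>2 * (fermi t (a + d * real k) * (1 - fermi t (a + d * real k)))) - pi\<^sup>2 / (6 * t ^ 3)\<bar> \<le> 48 * (real d)\<^sup>2 / t\<^sup>2 + 28 / t\<^sup>2 + (7 * (real a)\<^sup>2) / t\<^sup>2"
    using 1 HL Ha by linarith
  then show ?thesis by (simp add: add_divide_distrib)
qed

text \<open>Here accuracy O(t) is essential. The terms ln 2 / t and d / 4 do not depend on
  \<open>a\<close> and cancel between the classes of \<alpha> and \<beta>; what survives is -a /
  2.\<close>

lemma sum_fermi:
  "\<bar>real d * (\<Sum>k<n. fermi t (real (a + d * k))) - (ln 2 / t - real a / 2 + real d / 4)\<bar>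
    \<le> ((real d)\<^sup>2 + (real a)\<^sup>2 + real a * real d + real d) * t + 1 * exp (- (t * L)) / t"
proof -
  have "\<bar>d * (\<Sum>k<n. fermi t (a + d * real k)) - (- ln (1 + exp (- (t * (a + d * real n)))) / t - - ln (1 + exp (- (t * a))) / t) - d * (fermi t a - fermi t (a + d * real n)) / 2\<bar>
     \<le> (real d)\<^sup>2 / 2 * (- (- t * (fermi t a * (1 - fermi t a))))"
  proof (rule trapezoid_sum)
    fix x :: real
    show "((\<lambda>x. - ln (1 + exp (- (t * x))) / t) has_real_derivative fermi t x) (at x)"
      by (rule DERIV_cong[OF DERIV_cdivide[OF DERIV_minus[OF DERIV_ln_one_plus_exp]]]) (use t in simp)
    show "(fermi t has_real_derivative - t * (fermi t x * (1 - fermi t x))) (at x)" by (rule DERIV_fermi)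
    show "- t * (fermi t x * (1 - fermi t x)) \<le> 0" using t fermi_var_nonneg[of t x] by simp
    fix y :: real assume "real a \<le> x" "x \<le> y"
    then have "fermi t y \<le> fermi t x" "fermi t x \<le> 1/2"
      using t by (auto simp: fermi_def divide_simps add_pos_pos intro: fermi_le_half)
    then have "0 \<le> (fermi t x - fermi t y) * (1 - fermi t x - fermi t y)" by (intro mult_nonneg_nonneg) auto
    then have "fermi t y * (1 - fermi t y) \<le> fermi t x * (1 - fermi t x)" by (simp add: algebra_simps)
    then show "- t * (fermi t x * (1 - fermi t x)) \<le> - t * (fermi t y * (1 - fermi t y))" using t by simp
  qed (use d in simp)
  also have "\<dots> \<le> (real d)\<^sup>2 / 2 * t"
    using t fermi_var_le_exp[of t a] by (intro mult_left_mono) (auto intro: order_trans mult_left_le)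
  finally have 1: "\<bar>d * (\<Sum>k<n. fermi t (a + d * real k)) - (ln (1 + exp (- (t * a))) / t - ln (1 + exp (- (t * L))) / t) - d * (fermi t a - fermi t L) / 2\<bar> \<le> (real d)\<^sup>2 / 2 * t"
    by simp
  have 2: "\<bar>ln (1 + exp (- (t * a))) / t - (ln 2 / t - real a / 2)\<bar> \<le> (real a)\<^sup>2 * t"
  proof -
    have "ln (1 + exp (- (t * a))) / t - (ln 2 / t - real a / 2) = (ln (1 + exp (- (t * a))) - (ln 2 - (t * a) / 2)) / t"
      using t by (simp add: field_simps)
    also have "\<bar>\<dots>\<bar> \<le> (t * a)\<^sup>2 / t" using ln_one_plus_exp_near[of "t * a"] t a by (simp add: abs_divide divide_right_mono)
    also have "\<dots> = (real a)\<^sup>2 * t" using t by (simp add: power2_eq_square)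
    finally show ?thesis .
  qed
  have 3: "0 \<le> ln (1 + exp (- (t * L))) / t" "ln (1 + exp (- (t * L))) / t \<le> exp (- (t * L)) / t"
    using ln_one_plus_exp_bounds[of "t * L"] t by (auto intro!: divide_right_mono)
  have 4: "\<bar>real d * fermi t a / 2 - real d / 4\<bar> \<le> real a * real d * t"
  proof -
    have "real d * fermi t a / 2 - real d / 4 = real d / 2 * (fermi t a - 1 / 2)" by (simp add: algebra_simps)
    also have "\<bar>\<dots>\<bar> \<le> real d / 2 * (t * a)" unfolding abs_mult using fermi_near_half[of t a] t by (intro mult_mono) auto
    also have "\<dots> \<le> real a * real d * t" using t by simp
    finally show ?thesis .
  qed
  have 5: "0 \<le> real d * fermi t L / 2" "real d * fermi t L / 2 \<le> real d * t"
  proof -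
    have "fermi t L \<le> t" using fermi_le_exp[of t L] exp_tail(1)[OF t(1) tail] by linarith
    then have "real d * fermi t L \<le> real d * t" by (intro mult_left_mono) auto
    moreover have "0 \<le> real d * fermi t L" using fermi_pos[of t L] by simp
    ultimately show "real d * fermi t L / 2 \<le> real d * t" by linarith
  qed (use fermi_pos[of t L] in simp)
  have 6: "0 \<le> (real d)\<^sup>2 * t" using t by simp
  have "\<bar>d * (\<Sum>k<n. fermi t (a + d * real k)) - (ln 2 / t - real a / 2 + real d / 4)\<bar>
    \<le> (real d)\<^sup>2 * t + (real a)\<^sup>2 * t + real a * real d * t + real d * t + exp (- (t * L)) / t"
    using 1 2 3 4 5 6 unfolding right_diff_distrib diff_divide_distrib of_nat_add of_nat_mult by linarith
  then show ?thesis by (simp add: algebra_simps)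
qed

end

text \<open>The trapezoid rule for the logarithm of the product of the 1 + e^(-tm). Its boundary
  term contributes ln 2 / 2, so the exponent of 2 becomes -(a - 1/2).\<close>

lemma sum_ln_one_plus_exp:
  fixes t :: real and a n :: nat
  assumes t: "0 < t" "t \<le> 1" and a: "1 \<le> a" and tail: "1 / t \<le> t * real (a + n)"
  shows "\<bar>(\<Sum>k<n. ln (1 + exp (- (t * real (a + k))))) - (pi\<^sup>2 / (12 * t) - real a * ln 2 + ln 2 / 2)\<bar>
    \<le> (2 * (real a)\<^sup>2 + 2) * t + 2 * exp (- (t * real (a + n))) / t"
proof -
  let ?h = "\<lambda>x. ln (1 + exp (- (t * x)))"
  have "\<bar>1 * (\<Sum>k<n. ?h (a + 1 * real k)) - (- Lam (t * (a + 1 * real n)) / t - - Lam (t * a) / t) - 1 * (?h a - ?h (a + 1 * real n)) / 2\<bar>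
     \<le> 1\<^sup>2 / 2 * (- (- t * fermi t a))"
  proof (rule trapezoid_sum)
    fix x :: real assume x: "real a \<le> x"
    then have x0: "0 < x" using a by linarith
    show "((\<lambda>x. - Lam (t * x) / t) has_real_derivative ?h x) (at x)"
      by (rule DERIV_cong[OF DERIV_cdivide[OF DERIV_minus[OF DERIV_Lam_scaled[OF t(1) x0]]]]) (use t in simp)
    show "(?h has_real_derivative - t * fermi t x) (at x)" by (rule DERIV_ln_one_plus_exp)
    show "- t * fermi t x \<le> 0" using t fermi_pos[of t x] by simp
    fix y :: real assume "x \<le> y"
    then have "fermi t y \<le> fermi t x" using t by (auto simp: fermi_def divide_simps add_pos_pos)
    then show "- t * fermi t x \<le> - t * fermi t y" using t by simp
  qed simp
  also have "\<dots> \<le> t / 2" using t fermi_less_1[of t a] by simp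
  finally have 1: "\<bar>(\<Sum>k<n. ?h (a + real k)) - (Lam (t * a) / t - Lam (t * (a + real n)) / t) - (?h a - ?h (a + real n)) / 2\<bar> \<le> t / 2"
    by simp
  have 2: "\<bar>Lam (t * a) / t - (pi\<^sup>2 / (12 * t) - a * ln 2)\<bar> \<le> (real a)\<^sup>2 * t"
  proof -
    have "Lam (t * a) / t - (pi\<^sup>2 / (12 * t) - a * ln 2) = (Lam (t * a) - (pi\<^sup>2 / 12 - t * a * ln 2)) / t"
      using t by (simp add: field_simps)
    also have "\<bar>\<dots>\<bar> \<le> (t * a)\<^sup>2 / t" using Lam_near_0[of "t * a"] t a by (simp add: abs_divide divide_right_mono)
    also have "\<dots> = (real a)\<^sup>2 * t" using t by (simp add: power2_eq_square)
    finally show ?thesis .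
  qed
  have 3: "\<bar>Lam (t * (a + real n)) / t\<bar> \<le> 2 * exp (- (t * (a + real n))) / t"
    using Lam_bound[of "t * (a + real n)"] t by (simp add: abs_divide divide_right_mono)
  have 4: "\<bar>?h a - ln 2\<bar> \<le> 2 * (real a)\<^sup>2 * t"
  proof -
    have "\<bar>?h a - (ln 2 - (t * a) / 2)\<bar> \<le> (t * a)\<^sup>2" using ln_one_plus_exp_near[of "t * a"] t a by simp
    moreover have "(t * a)\<^sup>2 \<le> (real a)\<^sup>2 * t" using t mult_left_le[of t "t * (real a)\<^sup>2"]
      by (simp add: power2_eq_square mult_ac)
    moreover have "t * a \<le> (real a)\<^sup>2 * t" using t a self_le_power[of "real a" 2] by simp
    moreover have "0 \<le> t * a" using t by simp
    ultimately show ?thesis by (simp add: abs_le_iff)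
  qed
  have 5: "0 \<le> ?h (a + real n)" "?h (a + real n) \<le> t"
    using ln_one_plus_exp_bounds[of "t * (a + real n)"] exp_tail(1)[OF t(1) tail] by auto
  have "\<bar>(\<Sum>k<n. ?h (a + real k)) - (pi\<^sup>2 / (12 * t) - a * ln 2 + ln 2 / 2)\<bar>
    \<le> t / 2 + (real a)\<^sup>2 * t + 2 * exp (- (t * (a + real n))) / t + 2 * (real a)\<^sup>2 * t / 2 + t / 2"
    using 1 2 3 4 5 unfolding diff_divide_distrib by linarith
  then show ?thesis unfolding of_nat_add using t by (simp add: algebra_simps)
qed

section \<open>Phases, products and roots of unity\<close>

lemma cos_le_away:
  fixes y d :: real
  assumes "0 \<le> d" "d \<le> y" "y \<le> 2 * pi - d"
  shows "cos y \<le> cos d"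
proof (cases "y \<le> pi")
  case True
  then show ?thesis using assms by (intro cos_monotone_0_pi_le) auto
next
  case False
  have "cos (2 * pi - y) \<le> cos d" using assms False by (intro cos_monotone_0_pi_le) auto
  then show ?thesis by (simp add: cos_diff)
qed

lemma cos_add_2pi_int: "cos (x + 2 * pi * of_int z) = cos x"
  by (simp add: cos_add cos_int_2pin sin_int_2pin)

lemma cis_add_2pi_int: "cis (x + 2 * pi * of_int z) = cis x"
  by (simp add: complex_eq_iff cos_add sin_add cos_int_2pin sin_int_2pin)

text \<open>Half of the decay is spent on the polynomial factor.\<close>

lemma one_plus_cube_exp_bound:
  fixes a S :: real
  assumes "0 < a" "0 \<le> S"
  shows "(1 + S) ^ 3 * exp (- (a * S)) \<le> (48 / a ^ 3 * exp (a / 2)) * exp (- (a / 2 * S))"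
proof -
  have "(a / 2 * (1 + S)) ^ 3 / fact 3 \<le> exp (a / 2 * (1 + S))"
    using assms by (intro power_div_fact_le_exp) auto
  then have "(1 + S) ^ 3 \<le> (48 / a ^ 3) * exp (a / 2 * (1 + S))"
    using assms by (simp add: power_mult_distrib power_divide fact_numeral) (simp add: field_simps)
  then have "(1 + S) ^ 3 * exp (- (a * S)) \<le> ((48 / a ^ 3) * exp (a / 2 * (1 + S))) * exp (- (a * S))"
    by (intro mult_right_mono) auto
  also have "\<dots> = (48 / a ^ 3) * (exp (a / 2 * (1 + S)) * exp (- (a * S)))" by simp
  also have "exp (a / 2 * (1 + S)) * exp (- (a * S)) = exp (a / 2) * exp (- (a / 2 * S))"
    by (simp add: exp_add[symmetric]) (simp add: field_simps)
  finally show ?thesis by simp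
qed

text \<open>Perturbing a real exponent by R + iY costs |R| + |Y| in general, but only |R| + Y^2 / 2
  in the real part, because cos Y - 1 is quadratic. The second form supplies the extra order needed
  for the total count.\<close>

lemma exp_complex_perturb:
  fixes R Y A :: real
  shows "cmod (exp (Complex (A + R) Y) - of_real (exp A)) \<le> exp (A + \<bar>R\<bar>) * (\<bar>R\<bar> + \<bar>Y\<bar>)"
    and "\<bar>Re (exp (Complex (A + R) Y)) - exp A\<bar> \<le> exp (A + \<bar>R\<bar>) * (\<bar>R\<bar> + Y\<^sup>2 / 2)"
proof -
  have e: "\<bar>exp R - 1\<bar> \<le> exp \<bar>R\<bar> * \<bar>R\<bar>"
  proof (cases "R = 0")
    case False
    have *: "exp u - exp v \<le> (u - v) * exp u" if "v \<le> u" for u v :: real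
    proof -
      have "exp v = exp u * exp (v - u)" by (simp add: exp_add[symmetric])
      moreover have "exp u * (1 + (v - u)) \<le> exp u * exp (v - u)" by (intro mult_left_mono exp_ge_add_one_self) auto
      ultimately show ?thesis by (simp add: algebra_simps)
    qed
    show ?thesis
    proof (cases "R \<ge> 0")
      case True
      then show ?thesis using *[of 0 R] by (simp add: mult.commute)
    next
      case False
      have "1 - exp R \<le> - R" using *[of R 0] False by simp
      also have "\<dots> \<le> exp \<bar>R\<bar> * \<bar>R\<bar>" using False by (simp add: mult_le_cancel_right1)
      finally show ?thesis using False by simp
    qed
  qed simp
  have R: "exp R \<le> exp \<bar>R\<bar>" by simp
  have Y: "cmod (cis Y - 1) \<le> \<bar>Y\<bar>"
    using iexp_approx1[of Y 0] by (simp add: cis_conv_exp)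
  have E: "exp (Complex (A + R) Y) = of_real (exp A) * (of_real (exp R) * cis Y)"
    by (simp add: exp_eq_polar exp_add mult.assoc)
  have "exp (Complex (A + R) Y) - of_real (exp A) = of_real (exp A) * (of_real (exp R) * (cis Y - 1) + of_real (exp R - 1))"
    unfolding E by (simp add: algebra_simps)
  also have "cmod \<dots> \<le> exp A * (exp R * cmod (cis Y - 1) + \<bar>exp R - 1\<bar>)"
    unfolding norm_mult by (intro mult_mono order_trans[OF norm_triangle_ineq] add_mono) (auto simp: norm_mult simp flip: of_real_diff)
  also have "\<dots> \<le> exp A * (exp \<bar>R\<bar> * \<bar>Y\<bar> + exp \<bar>R\<bar> * \<bar>R\<bar>)"
    using e Y R by (intro mult_left_mono add_mono mult_mono) auto
  finally show "cmod (exp (Complex (A + R) Y) - of_real (exp A)) \<le> exp (A + \<bar>R\<bar>) * (\<bar>R\<bar> + \<bar>Y\<bar>)"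
    by (simp add: exp_add algebra_simps)
  have "Re (exp (Complex (A + R) Y)) - exp A = exp A * (exp R * (cos Y - 1) + (exp R - 1))"
    by (simp add: Re_exp exp_add algebra_simps)
  also have "\<bar>\<dots>\<bar> \<le> exp A * (exp R * \<bar>cos Y - 1\<bar> + \<bar>exp R - 1\<bar>)"
    unfolding abs_mult by (intro mult_mono order_trans[OF abs_triangle_ineq] add_mono) (auto simp: abs_mult)
  also have "\<dots> \<le> exp A * (exp \<bar>R\<bar> * (Y\<^sup>2 / 2) + exp \<bar>R\<bar> * \<bar>R\<bar>)"
    using e R one_minus_cos_le[of Y] by (intro mult_left_mono add_mono mult_mono) auto
  finally show "\<bar>Re (exp (Complex (A + R) Y)) - exp A\<bar> \<le> exp (A + \<bar>R\<bar>) * (\<bar>R\<bar> + Y\<^sup>2 / 2)"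
    by (simp add: exp_add algebra_simps)
qed

lemma cube_add_le: "(a + b) ^ 3 \<le> 4 * (a ^ 3 + b ^ 3)" if "0 \<le> a" "0 \<le> b" for a b :: real
proof -
  have "4 * (a ^ 3 + b ^ 3) - (a + b) ^ 3 = 3 * (a + b) * (a - b)\<^sup>2"
    by (simp add: power2_eq_square power3_eq_cube algebra_simps)
  also have "\<dots> \<ge> 0" using that by simp
  finally show ?thesis by simp
qed

lemma quartic_add_le: "(a + b) ^ 4 \<le> 8 * (a ^ 4 + b ^ 4)" for a b :: real
proof -
  have sq: "(u + v)\<^sup>2 \<le> 2 * (u\<^sup>2 + v\<^sup>2)" for u v :: real
    using sum_squares_bound[of u v] by (simp add: power2_sum)
  have "(a + b) ^ 4 = ((a + b)\<^sup>2)\<^sup>2" by simp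
  also have "\<dots> \<le> (2 * (a\<^sup>2 + b\<^sup>2))\<^sup>2" by (rule power_mono[OF sq]) simp
  also have "\<dots> = 4 * (a\<^sup>2 + b\<^sup>2)\<^sup>2" by (simp only: power_mult_distrib) simp
  also have "\<dots> \<le> 4 * (2 * ((a\<^sup>2)\<^sup>2 + (b\<^sup>2)\<^sup>2))" by (rule mult_left_mono[OF sq]) simp
  finally show ?thesis by simp
qed

lemma integral_mult_pair:
  fixes f g :: "real \<Rightarrow> 'a :: {real_normed_field, second_countable_topology, banach}"
  assumes f: "integrable lborel f" and g: "integrable lborel g"
  shows "integrable (lborel \<Otimes>\<^sub>M lborel) (\<lambda>(x, y). f x * g y)"
    "(\<integral>z. (case z of (x, y) \<Rightarrow> f x * g y) \<partial>(lborel \<Otimes>\<^sub>M lborel)) = (\<integral>x. f x \<partial>lborel) * (\<integral>y. g y \<partial>lborel)"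
proof -
  have [measurable]: "f \<in> borel_measurable borel" "g \<in> borel_measurable borel"
    using f g by (auto dest: borel_measurable_integrable)
  show i: "integrable (lborel \<Otimes>\<^sub>M lborel) (\<lambda>(x, y). f x * g y)"
  proof (rule lborel_pair.Fubini_integrable)
    show "integrable lborel (\<lambda>x. \<integral>y. norm (case (x, y) of (x, y) \<Rightarrow> f x * g y) \<partial>lborel)"
      using f by (simp add: norm_mult integrable_norm)
    show "AE x in lborel. integrable lborel (\<lambda>y. case (x, y) of (x, y) \<Rightarrow> f x * g y)"
      using g by simp
  qed simp
  show "(\<integral>z. (case z of (x, y) \<Rightarrow> f x * g y) \<partial>(lborel \<Otimes>\<^sub>M lborel)) = (\<integral>x. f x \<partial>lborel) * (\<integral>y. g y \<partial>lborel)"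
    by (subst lborel_pair.integral_fst[OF i, symmetric]) (use f g in simp)
qed

text \<open>The sign kernel is estimated for \<omega> \<noteq> 0; this makes the line \<omega> = 0
  harmless in the integrals.\<close>

lemma AE_snd_neq: "AE z in (lborel \<Otimes>\<^sub>M lborel :: (real \<times> real) measure). snd z \<noteq> 0"
proof (rule AE_I)
  show "{z \<in> space (lborel \<Otimes>\<^sub>M lborel). \<not> snd z \<noteq> (0::real)} \<subseteq> (UNIV :: real set) \<times> {0}" by auto
  show "emeasure (lborel \<Otimes>\<^sub>M lborel) ((UNIV :: real set) \<times> {0 :: real}) = 0"
    by (subst lborel.emeasure_pair_measure_Times) auto
  show "(UNIV :: real set) \<times> {0 :: real} \<in> sets (lborel \<Otimes>\<^sub>M lborel)" by simp
qed

lemma sum_roots_of_unity: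
  fixes k :: int
  assumes "0 < N"
  shows "(\<Sum>a<N. cis (2 * pi * of_int k * real a / N)) = (if int N dvd k then of_nat N else 0)"
proof -
  define z where "z = cis (2 * pi * of_int k / N)"
  have p: "cis (2 * pi * of_int k * real a / N) = z ^ a" for a
    unfolding z_def by (subst Complex.DeMoivre) (rule arg_cong[where f = cis], simp)
  have zN: "z ^ N = 1"
    using assms cis_add_2pi_int[of 0 k] unfolding z_def by (simp add: Complex.DeMoivre)
  show ?thesis
  proof (cases "int N dvd k")
    case True
    then obtain q where "k = int N * q" by (rule dvdE)
    then have "z = cis (0 + 2 * pi * of_int q)"
      unfolding z_def using assms by (intro arg_cong[where f = cis]) simp
    then have "z = 1" by (simp only: cis_add_2pi_int cis_zero)
    then show ?thesis using True by (simp add: p)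
  next
    case False
    have "z \<noteq> 1"
    proof
      assume "z = 1"
      then have "cos (2 * pi * of_int k / N) = 1" unfolding z_def by (metis cis.sel(1) one_complex.sel(1))
      then obtain q :: int where "2 * pi * of_int k / N = of_int q * 2 * pi" using cos_one_2pi_int by blast
      then have "(of_int k :: real) = of_int q * real N" using assms by (simp add: field_simps)
      then have "k = q * int N" by (metis of_int_eq_iff of_int_mult of_int_of_nat_eq)
      then show False using False by simp
    qed
    then show ?thesis using False geometric_sum[of z N] zN by (simp add: p)
  qed
qed

lemma exp_minus_one_le: "exp Y - 1 \<le> Y * exp Y" for Y :: real
proof -
  have "exp Y * (1 + - Y) \<le> exp Y * exp (- Y)" by (intro mult_left_mono exp_ge_add_one_self) auto
  then show ?thesis by (simp add: exp_add[symmetric] algebra_simps)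
qed

text \<open>Both differences are majorised by the same expressions in the absolute values: the
  induction carries e^Y - 1 and e^Y - 1 - Y.\<close>

lemma prod_one_plus_approx:
  fixes y :: "nat \<Rightarrow> complex" and n :: nat
  defines "Y \<equiv> \<Sum>k<n. cmod (y k)"
  shows "cmod ((\<Prod>k<n. 1 + y k) - 1) \<le> Y * exp Y"
    "cmod ((\<Prod>k<n. 1 + y k) - 1 - (\<Sum>k<n. y k)) \<le> Y\<^sup>2 * exp Y"
proof -
  have *: "cmod ((\<Prod>k<n. 1 + y k) - 1) \<le> exp (\<Sum>k<n. cmod (y k)) - 1 \<and>
    cmod ((\<Prod>k<n. 1 + y k) - 1 - (\<Sum>k<n. y k)) \<le> exp (\<Sum>k<n. cmod (y k)) - 1 - (\<Sum>k<n. cmod (y k))"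
  proof (induction n)
    case (Suc n)
    let ?P = "\<Prod>k<n. 1 + y k" let ?S = "\<Sum>k<n. y k" let ?Y = "\<Sum>k<n. cmod (y k)"
    have Y0: "0 \<le> ?Y" by (intro sum_nonneg) auto
    have e: "exp ?Y * (1 + cmod (y n)) \<le> exp (?Y + cmod (y n))"
      unfolding exp_add by (intro mult_left_mono exp_ge_add_one_self) auto
    have "?P * (1 + y n) - 1 = (?P - 1) + y n * (?P - 1) + y n" by (simp add: algebra_simps)
    also have "cmod \<dots> \<le> cmod (?P - 1) + cmod (y n) * cmod (?P - 1) + cmod (y n)"
      by (intro norm_triangle_le add_mono) (auto simp: norm_mult)
    also have "\<dots> \<le> (exp ?Y - 1) + cmod (y n) * (exp ?Y - 1) + cmod (y n)"
      using Suc.IH by (intro add_mono mult_left_mono) auto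
    also have "\<dots> = exp ?Y * (1 + cmod (y n)) - 1" by (simp add: algebra_simps)
    finally have 1: "cmod (?P * (1 + y n) - 1) \<le> exp (?Y + cmod (y n)) - 1" using e by linarith
    have "?P * (1 + y n) - 1 - (?S + y n) = (?P - 1 - ?S) + y n * (?P - 1)" by (simp add: algebra_simps)
    also have "cmod \<dots> \<le> cmod (?P - 1 - ?S) + cmod (y n) * cmod (?P - 1)"
      by (intro norm_triangle_le add_mono) (auto simp: norm_mult)
    also have "\<dots> \<le> (exp ?Y - 1 - ?Y) + cmod (y n) * (exp ?Y - 1)"
      using Suc.IH by (intro add_mono mult_left_mono) auto
    also have "\<dots> = exp ?Y * (1 + cmod (y n)) - 1 - (?Y + cmod (y n))" by (simp add: algebra_simps)
    finally have 2: "cmod (?P * (1 + y n) - 1 - (?S + y n)) \<le> exp (?Y + cmod (y n)) - 1 - (?Y + cmod (y n))" using e by linarith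
    show ?case using 1 2 by (simp only: prod.lessThan_Suc sum.lessThan_Suc)
  qed simp
  have Y0: "0 \<le> Y" unfolding Y_def by (intro sum_nonneg) auto
  show "cmod ((\<Prod>k<n. 1 + y k) - 1) \<le> Y * exp Y"
    using * exp_minus_one_le[of Y] unfolding Y_def by linarith
  have "exp Y - 1 - Y \<le> Y * (exp Y - 1)" using exp_minus_one_le[of Y] by (simp add: algebra_simps)
  also have "\<dots> \<le> Y * (Y * exp Y)" using exp_minus_one_le[of Y] Y0 by (intro mult_left_mono) auto
  finally show "cmod ((\<Prod>k<n. 1 + y k) - 1 - (\<Sum>k<n. y k)) \<le> Y\<^sup>2 * exp Y"
    using * unfolding Y_def power2_eq_square by (simp only: mult.assoc) linarith
qed

lemma cmod_cis_diff_le: "cmod (cis x - cis y) \<le> \<bar>x - y\<bar>"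
proof -
  have "cis x - cis y = cis y * (cis (x - y) - 1)" by (simp add: right_diff_distrib cis_mult)
  then have "cmod (cis x - cis y) = cmod (cis (x - y) - 1)" by (simp add: norm_mult)
  also have "\<dots> \<le> \<bar>x - y\<bar>" using iexp_approx1[of "x - y" 0] by (simp add: cis_conv_exp)
  finally show ?thesis .
qed

lemma abs_exp_diff_le:
  fixes t :: real
  assumes "0 \<le> t" "k \<le> a" "k \<le> b"
  shows "\<bar>exp (- (t * a)) - exp (- (t * b))\<bar> \<le> t * \<bar>a - b\<bar> * exp (- (t * k))"
proof -
  have *: "exp (- (t * a)) - exp (- (t * b)) \<le> t * (b - a) * exp (- (t * k))" if "k \<le> a" "a \<le> b" for a b
  proof -
    have "exp (- (t * b)) = exp (- (t * a)) * exp (- (t * (b - a)))" by (simp add: exp_add[symmetric] algebra_simps)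
    moreover have "1 - t * (b - a) \<le> exp (- (t * (b - a)))" using exp_ge_add_one_self[of "- (t * (b - a))"] by simp
    then have "exp (- (t * a)) * (1 - t * (b - a)) \<le> exp (- (t * a)) * exp (- (t * (b - a)))" by (intro mult_left_mono) auto
    ultimately have "exp (- (t * a)) - exp (- (t * b)) \<le> t * (b - a) * exp (- (t * a))" by (simp add: algebra_simps)
    also have "\<dots> \<le> t * (b - a) * exp (- (t * k))" using that assms by (intro mult_left_mono) (auto intro: mult_left_mono)
    finally show ?thesis .
  qed
  have mono: "exp (- (t * y)) \<le> exp (- (t * x))" if "x \<le> y" for x y using that assms by (simp add: mult_left_mono)
  show ?thesis
  proof (cases "a \<le> b")
    case True
    then show ?thesis using *[of a b] mono[of a b] assms by simp
  next
    case False
    then show ?thesis using *[of b a] mono[of b a] assms by simp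
  qed
qed

text \<open>Bounds the denominators 1 + e^(-tm) cis (m\<theta> \<plusminus> \<omega>) for |\<theta>|
  \<le> t/4 and |\<omega>| \<le> 1/4, uniformly in m. For y \<le> 1 the phase is at most 1/2 and the
  real part at least 1; for y > 1 the exponential is at most 1/2.\<close>

lemma cmod_one_plus_exp_cis_ge:
  fixes y \<psi> :: real
  assumes "0 \<le> y" "\<bar>\<psi>\<bar> \<le> (1 + y) / 4"
  shows "1 / 2 \<le> cmod (1 + of_real (exp (- y)) * cis \<psi>)"
proof (cases "y \<le> 1")
  case True
  have "(1 + y) / 4 \<le> 1 / 2" using True by simp
  then have "\<bar>\<psi>\<bar> \<le> 1 / 2" using assms(2) by (rule order_trans[rotated])
  moreover have "1 / 2 \<le> pi / 2" using pi_gt3 by simp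
  ultimately have "0 \<le> cos \<psi>" by (intro cos_ge_zero) linarith+
  then have "1 \<le> Re (1 + of_real (exp (- y)) * cis \<psi>)" by simp
  also have "\<dots> \<le> cmod (1 + of_real (exp (- y)) * cis \<psi>)" by (rule complex_Re_le_cmod)
  finally show ?thesis by simp
next
  case False
  have "2 \<le> exp y" using exp_ge_add_one_self[of y] False by linarith
  then have "exp (- y) \<le> 1 / 2" by (simp add: exp_minus divide_simps)
  moreover have "1 - exp (- y) \<le> cmod (1 + of_real (exp (- y)) * cis \<psi>)"
    using norm_triangle_ineq2[of 1 "- (of_real (exp (- y)) * cis \<psi>)"] by (simp add: norm_mult)
  ultimately show ?thesis by linarith
qed

lemma abs_cos_minus_one_le: "\<bar>cos x - 1\<bar> \<le> \<bar>x\<bar>" for x :: real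
  using abs_Re_le_cmod[of "cis x - cis 0"] cmod_cis_diff_le[of x 0] by simp

lemma abs_cos_diff_le: "\<bar>cos x - cos y\<bar> \<le> \<bar>x - y\<bar>" for x y :: real
  using abs_Re_le_cmod[of "cis x - cis y"] cmod_cis_diff_le[of x y] by simp

lemma abs_sin_half_ge: "\<bar>\<omega>\<bar> / 7 \<le> \<bar>sin (\<omega> / 2)\<bar>" if "\<bar>\<omega>\<bar> \<le> pi" for \<omega> :: real
proof -
  have "\<omega>\<^sup>2 / 24 \<le> 2 * (sin (\<omega> / 2))\<^sup>2" using one_minus_cos_ge[OF that] cos_double_sin[of "\<omega> / 2"] by simp
  then have "\<omega>\<^sup>2 / 49 \<le> (sin (\<omega> / 2))\<^sup>2" using zero_le_power2[of "sin (\<omega> / 2)"] by linarith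
  then have "(\<bar>\<omega>\<bar> / 7)\<^sup>2 \<le> \<bar>sin (\<omega> / 2)\<bar>\<^sup>2" by (simp add: power_divide)
  then show ?thesis by (rule power2_le_imp_le) simp
qed

section \<open>Moments of the part sizes at the saddle point\<close>

locale residue_pair =
  fixes N K \<alpha> \<beta> :: nat
  assumes N_ge_2: "N \<ge> 2" and alpha: "\<alpha> \<in> {1..N}" and beta: "\<beta> \<in> {1..N}" and alpha_neq_beta: "\<alpha> \<noteq> \<beta>"
begin

text \<open>\<open>e_vec N K j\<close> is the number of positive integers up to \<open>K\<close>
  congruent to \<open>j\<close>, so for \<open>j\<close> in 1..N this is the least part above
  \<open>K\<close> in that class.\<close>

definition first_part :: "nat \<Rightarrow> nat" where
  "first_part j = j + N * e_vec N K j"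

text \<open>
  The product over all parts greater than \<open>K\<close> is truncated at \<open>K + N n\<close>: this loses no partition
  of \<open>n\<close>, keeps all products finite, and gives each residue class exactly \<open>n\<close> parts.
\<close>

definition parts :: "nat \<Rightarrow> nat set" where
  "parts n = {K + 1..K + N * n}"

definition chi :: "nat \<Rightarrow> int" where
  "chi m = (if [m = \<alpha>] (mod N) then 1 else if [m = \<beta>] (mod N) then -1 else 0)"

lemma finite_parts [simp]: "finite (parts n)"
  by (simp add: parts_def)

lemma first_part_bounds:
  assumes "j \<in> {1..N}"
  shows "K < first_part j" "first_part j \<le> K + N"
proof -
  define q r where "q = N * (K div N)" and "r = K mod N"
  have "q + r = K" by (simp add: q_def r_def)
  moreover have "r < N" using N_ge_2 by (simp add: r_def)
  moreover have "first_part j = j + q + (if j \<le> r then N else 0)"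
    by (simp add: first_part_def e_vec_def q_def r_def algebra_simps)
  ultimately show "K < first_part j" "first_part j \<le> K + N"
    using assms by (auto split: if_splits)
qed

lemma cong_first_part: "[first_part j + N * k = j] (mod N)"
  by (simp add: first_part_def cong_def)

lemma cong_index_eq:
  assumes "i \<in> {1..N}" "j \<in> {1..N}" "[i = j] (mod N)"
  shows "i = j"
proof -
  have "i mod N = j mod N" using assms by (simp add: cong_def)
  then show ?thesis using assms(1,2) by (cases "i = N"; cases "j = N") auto
qed

lemma chi_first_part:
  "chi (first_part \<alpha> + N * k) = 1" "chi (first_part \<beta> + N * k) = -1"
  "j \<in> {1..N} \<Longrightarrow> j \<noteq> \<alpha> \<Longrightarrow> j \<noteq> \<beta> \<Longrightarrow> chi (first_part j + N * k) = 0"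
proof -
  have *: "[first_part j + N * k = i] (mod N) \<longleftrightarrow> j = i" if "i \<in> {1..N}" "j \<in> {1..N}" for i j
    using cong_index_eq[OF that(2,1)] cong_first_part[of j k] cong_trans[of j "first_part j + N * k" N i] cong_sym[of _ j N] by blast
  show "chi (first_part \<alpha> + N * k) = 1" "chi (first_part \<beta> + N * k) = -1"
    "j \<in> {1..N} \<Longrightarrow> j \<noteq> \<alpha> \<Longrightarrow> j \<noteq> \<beta> \<Longrightarrow> chi (first_part j + N * k) = 0"
    using alpha beta alpha_neq_beta by (auto simp: chi_def *)
qed

lemma parts_class:
  assumes "j \<in> {1..N}"
  shows "{m \<in> parts n. [m = j] (mod N)} = (\<lambda>k. first_part j + N * k) ` {..<n}"
proof (intro equalityI subsetI)
  fix m assume "m \<in> {m \<in> parts n. [m = j] (mod N)}"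
  then have m: "K < m" "m \<le> K + N * n" "[m = j] (mod N)" by (auto simp: parts_def)
  note f = first_part_bounds[OF assms]
  have c: "[m = first_part j] (mod N)"
    using m(3) cong_first_part[of j 0] cong_trans cong_sym by (metis add.right_neutral mult_0_right)
  have "first_part j \<le> m"
  proof (rule ccontr)
    assume *: "\<not> first_part j \<le> m"
    have "N dvd first_part j - m" using c * by (metis cong_altdef_nat cong_sym nat_le_linear)
    then have "N \<le> first_part j - m" using * by (intro dvd_imp_le) auto
    then show False using m f by linarith
  qed
  then obtain k where k: "m = first_part j + N * k"
    using c by (metis cong_altdef_nat dvdE le_add_diff_inverse)
  have "N * k < N * n" using k m f by linarith
  then show "m \<in> (\<lambda>k. first_part j + N * k) ` {..<n}" using k by auto
next
  fix m assume "m \<in> (\<lambda>k. first_part j + N * k) ` {..<n}"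
  then obtain k where k: "k < n" "m = first_part j + N * k" by auto
  have "N * (k + 1) \<le> N * n" using k by (intro mult_le_mono) auto
  then show "m \<in> {m \<in> parts n. [m = j] (mod N)}"
    using k first_part_bounds[OF assms] cong_first_part[of j k] by (auto simp: parts_def)
qed

lemma inj_class: "inj_on (\<lambda>k. first_part j + N * k) A"
  using N_ge_2 by (auto simp: inj_on_def)

lemma sum_class:
  assumes "j \<in> {1..N}"
  shows "(\<Sum>m\<in>{m \<in> parts n. [m = j] (mod N)}. g m) = (\<Sum>k<n. g (first_part j + N * k))"
  unfolding parts_class[OF assms] by (subst sum.reindex[OF inj_class]) simp

lemma parts_split:
  "parts n = {m \<in> parts n. [m = \<alpha>] (mod N)} \<union> {m \<in> parts n. [m = \<beta>] (mod N)} \<union> {m \<in> parts n. chi m = 0}"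
  by (auto simp: chi_def)

lemma not_cong_alpha_beta: "\<not> ([m = \<alpha>] (mod N) \<and> [m = \<beta>] (mod N))"
  using cong_index_eq[OF alpha beta] alpha_neq_beta cong_trans[of \<alpha> m N \<beta>] cong_sym[of m \<alpha> N] by blast

text \<open>The summand takes the value of \<open>chi\<close> as an argument, so that it can be
  specialised to 1, -1 and 0 on the three groups.\<close>

lemma sum_parts_split:
  "(\<Sum>m\<in>parts n. g m (chi m)) = (\<Sum>k<n. g (first_part \<alpha> + N * k) 1) + (\<Sum>k<n. g (first_part \<beta> + N * k) (-1))
    + (\<Sum>m | m \<in> parts n \<and> chi m = 0. g m 0)"
  for g :: "nat \<Rightarrow> int \<Rightarrow> 'a :: comm_monoid_add"
proof -
  have "(\<Sum>m\<in>parts n. g m (chi m)) = (\<Sum>m | m \<in> parts n \<and> [m = \<alpha>] (mod N). g m (chi m))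
     + (\<Sum>m | m \<in> parts n \<and> [m = \<beta>] (mod N). g m (chi m)) + (\<Sum>m | m \<in> parts n \<and> chi m = 0. g m (chi m))"
    using not_cong_alpha_beta
    by (subst parts_split, subst sum.union_disjoint, simp, simp, force simp: chi_def,
        subst sum.union_disjoint) auto
  then show ?thesis using alpha beta by (simp add: sum_class chi_first_part)
qed

lemma prod_parts_split:
  "(\<Prod>m\<in>parts n. g m (chi m)) = (\<Prod>k<n. g (first_part \<alpha> + N * k) 1) * (\<Prod>k<n. g (first_part \<beta> + N * k) (-1))
    * (\<Prod>m | m \<in> parts n \<and> chi m = 0. g m 0)"
  for g :: "nat \<Rightarrow> int \<Rightarrow> 'a :: comm_monoid_mult"
proof -
  have "(\<Prod>m\<in>parts n. g m (chi m)) = (\<Prod>m | m \<in> parts n \<and> [m = \<alpha>] (mod N). g m (chi m))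
     * (\<Prod>m | m \<in> parts n \<and> [m = \<beta>] (mod N). g m (chi m)) * (\<Prod>m | m \<in> parts n \<and> chi m = 0. g m (chi m))"
    using not_cong_alpha_beta
    by (subst parts_split, subst prod.union_disjoint, simp, simp, force simp: chi_def,
        subst prod.union_disjoint) auto
  moreover have "(\<Prod>m | m \<in> parts n \<and> [m = j] (mod N). g m (chi m)) = (\<Prod>k<n. g (first_part j + N * k) (chi (first_part j + N * k)))"
    if "j \<in> {1..N}" for j
    unfolding parts_class[OF that] by (subst prod.reindex[OF inj_class]) simp
  ultimately show ?thesis using alpha beta by (simp add: chi_first_part)
qed

lemma sum_parts_all: "(\<Sum>m\<in>parts n. g m) = (\<Sum>k<N * n. g (K + 1 + 1 * k))"
proof -
  have "parts n = (\<lambda>k. K + 1 + 1 * k) ` {..<N * n}"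
  proof (intro equalityI subsetI)
    fix m assume "m \<in> parts n"
    then have "m = K + 1 + 1 * (m - (K + 1))" "m - (K + 1) < N * n" by (auto simp: parts_def)
    then show "m \<in> (\<lambda>k. K + 1 + 1 * k) ` {..<N * n}" by blast
  qed (auto simp: parts_def)
  then show ?thesis by (simp add: sum.reindex inj_on_def)
qed

text \<open>Solves \<pi>^2 / (12 t^2) = n, the leading form of the saddle point equation (mean of
  the part sum) = n. The remaining discrepancy O(1/t) adds only O(s) to the phase on the scale
  \<theta> = x s^3, where s = \<surd>t.\<close>

definition saddle :: "nat \<Rightarrow> real" where
  "saddle n = pi / (2 * sqrt (3 * real n))"

lemma saddle_sq: "n \<ge> 1 \<Longrightarrow> (saddle n)\<^sup>2 * real n = pi\<^sup>2 / 12"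
  by (simp add: saddle_def power_divide power_mult_distrib)

lemma saddle_pos: "n \<ge> 1 \<Longrightarrow> 0 < saddle n"
  by (simp add: saddle_def)

lemma saddle_le_1: "n \<ge> 1 \<Longrightarrow> saddle n \<le> 1"
proof -
  assume n: "n \<ge> 1"
  have "pi\<^sup>2 \<le> 3.2\<^sup>2" using pi_approx by (intro power_mono) auto
  then have "pi\<^sup>2 / 12 \<le> 1" by (simp add: power2_eq_square)
  moreover have "(saddle n)\<^sup>2 * 1 \<le> (saddle n)\<^sup>2 * real n" using n by (intro mult_left_mono) auto
  ultimately have "(saddle n)\<^sup>2 \<le> 1\<^sup>2" using saddle_sq[OF n] by simp
  then show ?thesis by (rule power2_le_imp_le) simp
qed

text \<open>The cut-off is at least N n \<ge> 2n, and 1 / t^2 = 12 n / \<pi>^2 is smaller.\<close>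

lemma saddle_tail:
  assumes "n \<ge> 1"
  shows "1 / saddle n \<le> saddle n * real (a + N * n)"
proof -
  have "9 \<le> pi\<^sup>2" using power_mono[of 3 pi 2] pi_gt3 by simp
  then have "1 \<le> 2 * (pi\<^sup>2 / 12)" by simp
  also have "\<dots> \<le> real N * ((saddle n)\<^sup>2 * real n)" unfolding saddle_sq[OF assms] using N_ge_2 by (intro mult_right_mono) auto
  also have "\<dots> \<le> (saddle n)\<^sup>2 * real (a + N * n)" by (simp add: algebra_simps)
  finally show ?thesis using saddle_pos[OF assms] by (simp add: divide_simps power2_eq_square mult_ac)
qed

text \<open>One order sharper than \<open>exp_tail\<close>, from the quadratic term of the
  exponential series: after division by t the tail is still O(t).\<close>

lemma saddle_exp_tail:
  assumes "n \<ge> 1"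
  shows "exp (- (saddle n * real (a + N * n))) / saddle n \<le> 2 * saddle n"
proof -
  let ?t = "saddle n"
  have t: "0 < ?t" by (rule saddle_pos[OF assms])
  have "exp (- (?t * real (a + N * n))) \<le> exp (- (1 / ?t))" using saddle_tail[OF assms] by simp
  also have "(1 / ?t)\<^sup>2 / fact 2 \<le> exp (1 / ?t)" using t by (intro power_div_fact_le_exp) auto
  then have "exp (- (1 / ?t)) \<le> 2 * ?t\<^sup>2" using t by (simp add: exp_minus field_simps fact_2)
  finally show ?thesis using t by (simp add: divide_simps power2_eq_square)
qed

text \<open>When the parts are chosen independently with probabilities \<open>fermi\<close>, these
  five quantities are the means, variances and covariance of the sum of the chosen parts and of
  D.\<close>

definition mean_sum :: "nat \<Rightarrow> real" where
  "mean_sum n = (\<Sum>m\<in>parts n. real m * fermi (saddle n) m)"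

definition mean_diff :: "nat \<Rightarrow> real" where
  "mean_diff n = (\<Sum>m\<in>parts n. of_int (chi m) * fermi (saddle n) m)"

definition var_sum :: "nat \<Rightarrow> real" where
  "var_sum n = (\<Sum>m\<in>parts n. (real m)\<^sup>2 * (fermi (saddle n) m * (1 - fermi (saddle n) m)))"

definition var_diff :: "nat \<Rightarrow> real" where
  "var_diff n = (\<Sum>m\<in>parts n. (of_int (chi m))\<^sup>2 * (fermi (saddle n) m * (1 - fermi (saddle n) m)))"

definition covar :: "nat \<Rightarrow> real" where
  "covar n = (\<Sum>m\<in>parts n. real m * of_int (chi m) * (fermi (saddle n) m * (1 - fermi (saddle n) m)))"

definition shift :: real where
  "shift = real (first_part \<beta>) - real (first_part \<alpha>)"

lemma shift_eq: "shift = real \<beta> - real \<alpha> + real N * (real (e_vec N K \<beta>) - real (e_vec N K \<alpha>))"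
  by (simp add: shift_def first_part_def algebra_simps)

lemma mean_sum_bound: "\<exists>C. \<forall>n\<ge>1. \<bar>mean_sum n - real n\<bar> \<le> C / saddle n"
proof (intro exI allI impI)
  fix n :: nat assume n: "n \<ge> 1"
  have e: "pi\<^sup>2 / (12 * (saddle n)\<^sup>2) = real n"
    using saddle_sq[OF n] saddle_pos[OF n] by (simp add: field_simps)
  have "\<bar>real 1 * (\<Sum>k<N * n. real (K + 1 + 1 * k) * fermi (saddle n) (real (K + 1 + 1 * k))) - pi\<^sup>2 / (12 * (saddle n)\<^sup>2)\<bar>
    \<le> (8 * (real 1)\<^sup>2 + 4 * (real (K + 1))\<^sup>2 + 6) / saddle n"
    using saddle_tail[OF n, of "K + 1"]
    by (intro sum_id_fermi saddle_pos[OF n] saddle_le_1[OF n]) auto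
  then show "\<bar>mean_sum n - real n\<bar> \<le> (8 * (real 1)\<^sup>2 + 4 * (real (K + 1))\<^sup>2 + 6) / saddle n"
    unfolding e mean_sum_def sum_parts_all by simp
qed

lemma var_sum_bound: "\<exists>C. \<forall>n\<ge>1. \<bar>var_sum n - pi\<^sup>2 / (6 * (saddle n) ^ 3)\<bar> \<le> C / (saddle n)\<^sup>2"
proof (intro exI allI impI)
  fix n :: nat assume n: "n \<ge> 1"
  have "\<bar>real 1 * (\<Sum>k<N * n. (real (K + 1 + 1 * k))\<^sup>2 * (fermi (saddle n) (real (K + 1 + 1 * k)) * (1 - fermi (saddle n) (real (K + 1 + 1 * k))))) - pi\<^sup>2 / (6 * (saddle n) ^ 3)\<bar>
    \<le> (48 * (real 1)\<^sup>2 + 7 * (real (K + 1))\<^sup>2 + 28) / (saddle n)\<^sup>2"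
    using saddle_tail[OF n, of "K + 1"]
    by (intro sum_square_fermi_var saddle_pos[OF n] saddle_le_1[OF n]) auto
  then show "\<bar>var_sum n - pi\<^sup>2 / (6 * (saddle n) ^ 3)\<bar> \<le> (48 * (real 1)\<^sup>2 + 7 * (real (K + 1))\<^sup>2 + 28) / (saddle n)\<^sup>2"
    unfolding var_sum_def sum_parts_all by simp
qed

lemma first_part_ge_1: "j \<in> {1..N} \<Longrightarrow> 1 \<le> first_part j"
  using first_part_bounds[of j] by simp

text \<open>The square of \<open>chi\<close> does not see the sign, so both classes contribute 1 /
  (2Nt).\<close>

lemma var_diff_bound: "\<exists>C. \<forall>n\<ge>1. \<bar>var_diff n - 1 / (real N * saddle n)\<bar> \<le> C"
proof (intro exI allI impI)
  fix n :: nat assume n: "n \<ge> 1"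
  let ?v = "\<lambda>m. fermi (saddle n) (real m) * (1 - fermi (saddle n) (real m))"
  have b: "\<bar>real N * (\<Sum>k<n. ?v (first_part j + N * k)) - 1 / (2 * saddle n)\<bar> \<le> 2 * (real N)\<^sup>2 + real (first_part j) + 1"
    if "j \<in> {1..N}" for j
    using saddle_tail[OF n] N_ge_2 first_part_ge_1[OF that]
    by (intro sum_fermi_var saddle_pos[OF n] saddle_le_1[OF n]) auto
  have "var_diff n = (\<Sum>k<n. ?v (first_part \<alpha> + N * k)) + (\<Sum>k<n. ?v (first_part \<beta> + N * k))"
    unfolding var_diff_def sum_parts_split[where g = "\<lambda>m c. (of_int c)\<^sup>2 * ?v m"] by simp
  then have "real N * var_diff n - 1 / saddle n = (real N * (\<Sum>k<n. ?v (first_part \<alpha> + N * k)) - 1 / (2 * saddle n)) + (real N * (\<Sum>k<n. ?v (first_part \<beta> + N * k)) - 1 / (2 * saddle n))"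
    by (simp add: algebra_simps)
  then have "\<bar>real N * var_diff n - 1 / saddle n\<bar> \<le> 4 * (real N)\<^sup>2 + real (first_part \<alpha>) + real (first_part \<beta>) + 2"
    using b[OF alpha] b[OF beta] by linarith
  moreover have "\<bar>var_diff n - 1 / (real N * saddle n)\<bar> \<le> \<bar>real N * var_diff n - 1 / saddle n\<bar>"
  proof -
    have "real N * var_diff n - 1 / saddle n = real N * (var_diff n - 1 / (real N * saddle n))"
      using N_ge_2 by (simp add: field_simps)
    moreover have "1 * \<bar>var_diff n - 1 / (real N * saddle n)\<bar> \<le> real N * \<bar>var_diff n - 1 / (real N * saddle n)\<bar>"
      using N_ge_2 by (intro mult_right_mono) auto
    ultimately show ?thesis by (simp add: abs_mult)
  qed
  ultimately show "\<bar>var_diff n - 1 / (real N * saddle n)\<bar> \<le> 4 * (real N)\<^sup>2 + real (first_part \<alpha>) + real (first_part \<beta>) + 2"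
    by linarith
qed

text \<open>Each class alone would contribute order t^(-2), with opposite signs. After the
  cancellation the mixed term of the quadratic form is only O(t) on the Gaussian scale.\<close>

lemma covar_bound: "\<exists>C. \<forall>n\<ge>1. \<bar>covar n\<bar> \<le> C / saddle n"
proof (intro exI allI impI)
  fix n :: nat assume n: "n \<ge> 1"
  let ?t = "saddle n"
  let ?v = "\<lambda>x. fermi ?t x * (1 - fermi ?t x)"
  note t = saddle_pos[OF n] saddle_le_1[OF n]
  have "\<bar>(\<Sum>k<n. real (first_part \<alpha> + N * k) * ?v (real (first_part \<alpha> + N * k))) - (\<Sum>k<n. real (first_part \<beta> + N * k) * ?v (real (first_part \<beta> + N * k)))\<bar>
    \<le> 2 * (real (first_part \<alpha>) + real (first_part \<beta>)) * 2 / (?t / 2)"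
  proof (rule sum_shift_diff[where h = "\<lambda>x. x * ?v x"])
    fix x :: real assume x: "0 \<le> x"
    show "((\<lambda>x. x * ?v x) has_real_derivative ?v x + x * (- ?t * ?v x * (1 - 2 * fermi ?t x))) (at x)"
      by (rule DERIV_cong[OF DERIV_mult[OF DERIV_ident DERIV_fermi_var]]) simp
    have "\<bar>?v x + x * (- ?t * ?v x * (1 - 2 * fermi ?t x))\<bar> \<le> ?v x + x * \<bar>- ?t * ?v x * (1 - 2 * fermi ?t x)\<bar>"
      using x fermi_var_nonneg[of ?t x] by (intro order_trans[OF abs_triangle_ineq] add_mono) (simp_all add: abs_mult[of x])
    also have "\<dots> \<le> exp (- (?t * x)) + x * (?t * exp (- (?t * x)))"
      using x t fermi_var_le_exp fermi_var_deriv_bound by (intro add_mono mult_left_mono) auto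
    also have "\<dots> = (1 + ?t * x) * exp (- (?t * x))" by (simp add: algebra_simps)
    also have "\<dots> \<le> (2 * exp (?t / 2 * x)) * exp (- (?t * x))"
    proof (intro mult_right_mono)
      show "1 + ?t * x \<le> 2 * exp (?t / 2 * x)" using exp_ge_add_one_self[of "?t / 2 * x"] by (simp add: field_simps)
    qed auto
    also have "\<dots> = 2 * exp (- (?t / 2 * x))" by (simp add: mult.assoc exp_add[symmetric])
    finally show "\<bar>?v x + x * (- ?t * ?v x * (1 - 2 * fermi ?t x))\<bar> \<le> 2 * exp (- (?t / 2 * x))" .
  qed (use t N_ge_2 in auto)
  moreover have "covar n = (\<Sum>k<n. real (first_part \<alpha> + N * k) * ?v (real (first_part \<alpha> + N * k))) - (\<Sum>k<n. real (first_part \<beta> + N * k) * ?v (real (first_part \<beta> + N * k)))"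
    unfolding covar_def sum_parts_split[where g = "\<lambda>m c. real m * of_int c * ?v (real m)"]
    by (simp only: of_int_1 of_int_minus mult_1_right mult_minus_right mult_minus_left sum_negf) simp
  ultimately show "\<bar>covar n\<bar> \<le> (8 * (real (first_part \<alpha>) + real (first_part \<beta>))) / ?t" by simp
qed

text \<open>The leading terms of the two classes agree. Their different first parts leave
  (first_part \<beta> - first_part \<alpha>) / (2N): the weights near 0 are close to 1/2 and the
  spacing is N.\<close>

lemma mean_diff_bound: "\<exists>C. \<forall>n\<ge>1. \<bar>mean_diff n - shift / (2 * real N)\<bar> \<le> C * saddle n"
proof -
  define c where "c = (\<lambda>j. (real N)\<^sup>2 + (real (first_part j))\<^sup>2 + real (first_part j) * real N + real N)"
  have "\<bar>mean_diff n - shift / (2 * real N)\<bar> \<le> (c \<alpha> + c \<beta> + 4) * saddle n" if n: "n \<ge> 1" for n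
  proof -
    let ?t = "saddle n"
    let ?p = "\<lambda>m. fermi ?t (real m)"
    have b: "\<bar>real N * (\<Sum>k<n. ?p (first_part j + N * k)) - (ln 2 / ?t - real (first_part j) / 2 + real N / 4)\<bar> \<le> c j * ?t + 2 * ?t"
      if "j \<in> {1..N}" for j
    proof -
      have "\<bar>real N * (\<Sum>k<n. ?p (first_part j + N * k)) - (ln 2 / ?t - real (first_part j) / 2 + real N / 4)\<bar>
        \<le> c j * ?t + 1 * exp (- (?t * real (first_part j + N * n))) / ?t"
        unfolding c_def using saddle_tail[OF n] N_ge_2 first_part_ge_1[OF that]
        by (intro sum_fermi saddle_pos[OF n] saddle_le_1[OF n]) auto
      then show ?thesis using saddle_exp_tail[OF n, of "first_part j"] by simp
    qed
    have "mean_diff n = (\<Sum>k<n. ?p (first_part \<alpha> + N * k)) - (\<Sum>k<n. ?p (first_part \<beta> + N * k))"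
      unfolding mean_diff_def sum_parts_split[where g = "\<lambda>m c. of_int c * ?p m"] by (simp add: sum_negf)
    then have "real N * mean_diff n = real N * (\<Sum>k<n. ?p (first_part \<alpha> + N * k)) - real N * (\<Sum>k<n. ?p (first_part \<beta> + N * k))"
      by (simp add: right_diff_distrib)
    then have "\<bar>real N * mean_diff n - shift / 2\<bar> \<le> c \<alpha> * ?t + c \<beta> * ?t + 4 * ?t"
    proof -
      have "X = A - B \<Longrightarrow> \<bar>A - (l - a / 2 + q)\<bar> \<le> x + 2 * z \<Longrightarrow> \<bar>B - (l - b / 2 + q)\<bar> \<le> y + 2 * z
        \<Longrightarrow> \<bar>X - (b - a) / 2\<bar> \<le> x + y + 4 * z" for X A B l a b q x y z :: real
        by (simp only: diff_divide_distrib)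
      then show ?thesis
        using \<open>real N * mean_diff n = _\<close> b[OF alpha] b[OF beta] unfolding shift_def by blast
    qed
    then have 1: "\<bar>real N * mean_diff n - shift / 2\<bar> \<le> (c \<alpha> + c \<beta> + 4) * ?t" by (simp add: algebra_simps)
    have "real N * mean_diff n - shift / 2 = real N * (mean_diff n - shift / (2 * real N))"
      using N_ge_2 by (simp add: field_simps)
    moreover have "1 * \<bar>mean_diff n - shift / (2 * real N)\<bar> \<le> real N * \<bar>mean_diff n - shift / (2 * real N)\<bar>"
      using N_ge_2 by (intro mult_right_mono) auto
    ultimately show ?thesis using 1 by (simp add: abs_mult)
  qed
  then show ?thesis by blast
qed

definition gf :: "nat \<Rightarrow> real" where
  "gf n = (\<Prod>m\<in>parts n. 1 + exp (- (saddle n * real m)))"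

text \<open>The product starts at a = K + 1, whence the power 2^(-(K + 1/2)).\<close>

lemma gf_bound:
  "\<exists>C. \<forall>n\<ge>1. \<bar>ln (gf n) - (pi\<^sup>2 / (12 * saddle n) - (real K + 1 / 2) * ln 2)\<bar> \<le> C * saddle n"
proof (intro exI allI impI)
  fix n :: nat assume n: "n \<ge> 1"
  have "ln (gf n) = (\<Sum>m\<in>parts n. ln (1 + exp (- (saddle n * real m))))"
    unfolding gf_def by (rule ln_prod) (auto simp: add_pos_pos less_imp_neq[THEN not_sym])
  also have "\<dots> = (\<Sum>k<N * n. ln (1 + exp (- (saddle n * real (K + 1 + k)))))"
    unfolding sum_parts_all by simp
  finally have l: "ln (gf n) = (\<Sum>k<N * n. ln (1 + exp (- (saddle n * real (K + 1 + k)))))" .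
  have "\<bar>ln (gf n) - (pi\<^sup>2 / (12 * saddle n) - real (K + 1) * ln 2 + ln 2 / 2)\<bar>
    \<le> (2 * (real (K + 1))\<^sup>2 + 2) * saddle n + 2 * exp (- (saddle n * real (K + 1 + N * n))) / saddle n"
    unfolding l by (intro sum_ln_one_plus_exp saddle_pos[OF n] saddle_le_1[OF n] saddle_tail[OF n]) auto
  moreover have "2 * exp (- (saddle n * real (K + 1 + N * n))) / saddle n \<le> 4 * saddle n"
    using saddle_exp_tail[OF n, of "K + 1"] by simp
  moreover have "pi\<^sup>2 / (12 * saddle n) - real (K + 1) * ln 2 + ln 2 / 2 = pi\<^sup>2 / (12 * saddle n) - (real K + 1 / 2) * ln 2"
    by (simp add: algebra_simps)
  ultimately show "\<bar>ln (gf n) - (pi\<^sup>2 / (12 * saddle n) - (real K + 1 / 2) * ln 2)\<bar> \<le> (2 * (real (K + 1))\<^sup>2 + 6) * saddle n"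
    by (simp add: algebra_simps)
qed

section \<open>Minor arcs\<close>

definition Phi :: "nat \<Rightarrow> real \<Rightarrow> real \<Rightarrow> complex" where
  "Phi n \<theta> \<omega> = (\<Prod>m\<in>parts n. 1 + of_real (fermi (saddle n) m) * (cis (real m * \<theta> + of_int (chi m) * \<omega>) - 1))"

text \<open>Since \<open>chi\<close> is periodic, this says that the shift by (2\<pi>a/N, 2\<pi>b/N)
  changes every phase by a multiple of 2\<pi>. Non-trivial solutions occur, for instance a = 1, b =
  2 when N = 3, \<alpha> = 1, \<beta> = 2.\<close>

definition resonant :: "int \<Rightarrow> int \<Rightarrow> bool" where
  "resonant a b \<longleftrightarrow> (\<forall>j\<in>{1..N}. int N dvd int j * a + chi j * b)"

lemma abs_chi_le: "\<bar>chi m\<bar> \<le> 1"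
  by (simp add: chi_def)

lemma chi_cong: "[m = m'] (mod N) \<Longrightarrow> chi m = chi m'"
  by (simp add: chi_def cong_def)

lemma resonant_dvd:
  assumes "resonant a b"
  shows "int N dvd int m * a + chi m * b"
proof -
  obtain j where j: "j \<in> {1..N}" "[j = m] (mod N)"
  proof (cases "m mod N = 0")
    case True
    then show ?thesis using that[of N] N_ge_2 by (simp add: cong_def)
  next
    case False
    then show ?thesis using that[of "m mod N"] N_ge_2 by (simp add: cong_def Suc_le_eq less_imp_le)
  qed
  have "int N dvd int m - int j" using j(2) by (metis cong_int_iff cong_iff_dvd_diff cong_sym)
  then have "int N dvd (int m - int j) * a" by simp
  moreover have "int N dvd int j * a + chi j * b" using assms j by (simp add: resonant_def)
  ultimately have "int N dvd (int m - int j) * a + (int j * a + chi j * b)" by (rule dvd_add)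
  then show ?thesis using chi_cong[OF j(2)] by (simp add: algebra_simps)
qed

lemma shifted_phase:
  "real m * (\<theta> + 2 * pi * of_int a / N) + of_int (chi m) * (\<omega> + 2 * pi * of_int b / N)
    = (real m * \<theta> + of_int (chi m) * \<omega>) + 2 * pi * of_int (int m * a + chi m * b) / N"
proof -
  have "real_of_int (int m * a + chi m * b) = real m * of_int a + of_int (chi m) * of_int b" by simp
  moreover have "x * (\<theta> + c * A / N) + y * (\<omega> + c * B / N) = (x * \<theta> + y * \<omega>) + c * (x * A + y * B) / N" for x y c A B :: real
    by (simp add: distrib_left add_divide_distrib mult_ac)
  ultimately show ?thesis by (simp only:)
qed

lemma Phi_resonant:
  assumes "resonant a b"
  shows "Phi n (\<theta> + 2 * pi * of_int a / N) (\<omega> + 2 * pi * of_int b / N) = Phi n \<theta> \<omega>"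
  unfolding Phi_def
proof (rule prod.cong[OF refl])
  fix m assume "m \<in> parts n"
  obtain z where z: "int m * a + chi m * b = int N * z"
    using resonant_dvd[OF assms, of m] by (rule dvdE)
  have "real_of_int (int m * a + chi m * b) = real N * of_int z" by (simp only: z of_int_mult of_int_of_nat_eq)
  then have e: "2 * pi * of_int (int m * a + chi m * b) / N = 2 * pi * of_int z" using N_ge_2 by (simp only:) simp
  show "1 + of_real (fermi (saddle n) m) * (cis (real m * (\<theta> + 2 * pi * of_int a / N) + of_int (chi m) * (\<omega> + 2 * pi * of_int b / N)) - 1)
    = 1 + of_real (fermi (saddle n) m) * (cis (real m * \<theta> + of_int (chi m) * \<omega>) - 1)"
    by (simp only: shifted_phase e cis_add_2pi_int)
qed

text \<open>For small t, about 1 / (2Nt) parts of each class satisfy t m \<le> 1, and for them the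
  variance p (1 - p) is at least 1/8. The minor arc bounds rest on these parts.\<close>

definition num_small :: "nat \<Rightarrow> nat" where
  "num_small n = nat \<lfloor>1 / (2 * real N * saddle n)\<rfloor>"

lemma saddle_tendsto_0: "saddle \<longlonglongrightarrow> 0"
  unfolding saddle_def by real_asymp

lemma eventually_saddle_less: "0 < e \<Longrightarrow> \<forall>\<^sub>F n in sequentially. saddle n < e"
  using order_tendstoD(2)[OF saddle_tendsto_0] by blast

lemma num_small_bounds:
  assumes "n \<ge> 1" "saddle n \<le> 1 / (16 * real N)"
  shows "4 \<le> num_small n" "1 / (4 * real N * saddle n) \<le> real (num_small n)"
    "real (num_small n) \<le> 1 / (2 * real N * saddle n)" "num_small n \<le> n"
proof -
  let ?t = "saddle n"
  have t: "0 < ?t" "?t \<le> 1" using saddle_pos saddle_le_1 assms by auto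
  have N: "real N \<ge> 2" using N_ge_2 by simp
  have x: "8 \<le> 1 / (2 * real N * ?t)" using assms N t by (simp add: field_simps)
  have r: "real (num_small n) > 1 / (2 * real N * ?t) - 1" "real (num_small n) \<le> 1 / (2 * real N * ?t)"
    unfolding num_small_def using x by linarith+
  then show "real (num_small n) \<le> 1 / (2 * real N * ?t)" by simp
  have "1 / (4 * real N * ?t) = (1 / (2 * real N * ?t)) / 2" by simp
  then show "1 / (4 * real N * ?t) \<le> real (num_small n)" using r x by linarith
  show "4 \<le> num_small n" using r x by linarith
  have "1 / (2 * real N * ?t) \<le> 1 / (2 * 2 * ?t)" using N t by (intro divide_left_mono mult_right_mono) auto
  also have "\<dots> \<le> real n"
  proof -
    have "9 \<le> pi\<^sup>2" using power_mono[of 3 pi 2] pi_gt3 by simp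
    then have "1 / 4 \<le> ?t\<^sup>2 * real n" using saddle_sq[OF assms(1)] by simp
    also have "\<dots> \<le> ?t * real n" using t by (intro mult_right_mono) (auto simp: power2_eq_square mult_left_le)
    finally show ?thesis using t by (simp add: field_simps)
  qed
  finally show "num_small n \<le> n" using r by linarith
qed

text \<open>Every factor has modulus at most 1, so all but the small parts of one class
  \<open>j\<close> may be dropped. The class stays free, since different classes detect different
  obstructions.\<close>

lemma cmod_Phi_le:
  assumes n: "n \<ge> 1" "saddle n \<le> 1 / (16 * real N)" "saddle n \<le> 1 / (2 * real (K + N))" and j: "j \<in> {1..N}"
  shows "cmod (Phi n \<theta> \<omega>) \<le> exp (- ((\<Sum>k<num_small n. 1 - cos (real (first_part j + N * k) * \<theta> + of_int (chi j) * \<omega>)) / 8))"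
proof -
  let ?t = "saddle n"
  let ?p = "\<lambda>m. fermi ?t (real m)"
  let ?\<psi> = "\<lambda>m. real m * \<theta> + of_int (chi m) * \<omega>"
  let ?A = "(\<lambda>k. first_part j + N * k) ` {..<num_small n}"
  have t: "0 < ?t" "?t \<le> 1" using saddle_pos saddle_le_1 n by auto
  have A: "?A \<subseteq> parts n"
  proof -
    have "?A \<subseteq> (\<lambda>k. first_part j + N * k) ` {..<n}" using num_small_bounds(4)[OF n(1,2)] by (intro image_mono) auto
    then show ?thesis using parts_class[OF j, of n] by blast
  qed
  have small: "1 / 8 \<le> ?p m * (1 - ?p m)" if mA: "m \<in> ?A" for m
  proof -
    obtain k where k: "k < num_small n" "m = first_part j + N * k" using mA by blast
    have "real k \<le> 1 / (2 * real N * ?t)" using k(1) num_small_bounds(3)[OF n(1,2)] by linarith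
    then have "?t * (real N * real k) \<le> 1 / 2" using t N_ge_2 by (simp add: field_simps)
    moreover have "?t * real (first_part j) \<le> 1 / 2"
    proof -
      have "?t * real (first_part j) \<le> ?t * real (K + N)" using first_part_bounds[OF j] t by (intro mult_left_mono) auto
      also have "\<dots> \<le> 1 / 2" using n(3) N_ge_2 by (simp add: field_simps)
      finally show ?thesis .
    qed
    ultimately have "?t * real m \<le> 1" unfolding k(2) by (simp add: algebra_simps)
    then have "exp (?t * real m) \<le> exp 1" by simp
    also have "exp 1 \<le> (3::real)" by (rule exp_le)
    finally have "1 / 4 \<le> ?p m" by (simp add: fermi_def divide_simps add_pos_pos)
    moreover have "1 / 2 \<le> 1 - ?p m" using fermi_le_half[of ?t m] t by simp
    ultimately have "1 / 4 * (1 / 2) \<le> ?p m * (1 - ?p m)" by (intro mult_mono) auto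
    then show ?thesis by simp
  qed
  have "cmod (Phi n \<theta> \<omega>) = (\<Prod>m\<in>parts n. cmod (1 + of_real (?p m) * (cis (?\<psi> m) - 1)))"
    by (simp add: Phi_def prod_norm)
  also have "\<dots> \<le> (\<Prod>m\<in>parts n. exp (- (?p m * (1 - ?p m) * (1 - cos (?\<psi> m)))))"
    by (intro prod_mono conjI norm_ge_zero bernoulli_factor_norm_le)
  also have "\<dots> = exp (- (\<Sum>m\<in>parts n. ?p m * (1 - ?p m) * (1 - cos (?\<psi> m))))"
    by (simp add: exp_sum sum_negf[symmetric])
  also have "\<dots> \<le> exp (- (\<Sum>m\<in>?A. (1 - cos (?\<psi> m)) / 8))"
  proof -
    have "(\<Sum>m\<in>?A. (1 - cos (?\<psi> m)) / 8) \<le> (\<Sum>m\<in>?A. ?p m * (1 - ?p m) * (1 - cos (?\<psi> m)))"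
    proof (rule sum_mono)
      fix m assume "m \<in> ?A"
      then have "1 / 8 * (1 - cos (?\<psi> m)) \<le> ?p m * (1 - ?p m) * (1 - cos (?\<psi> m))"
        using small by (intro mult_right_mono) auto
      then show "(1 - cos (?\<psi> m)) / 8 \<le> ?p m * (1 - ?p m) * (1 - cos (?\<psi> m))" by simp
    qed
    also have "\<dots> \<le> (\<Sum>m\<in>parts n. ?p m * (1 - ?p m) * (1 - cos (?\<psi> m)))"
      using A fermi_var_nonneg by (intro sum_mono2) (auto intro!: mult_nonneg_nonneg simp: less_imp_le[OF fermi_pos] less_imp_le[OF fermi_less_1])
    finally show ?thesis by simp
  qed
  also have "(\<Sum>m\<in>?A. (1 - cos (?\<psi> m)) / 8) = (\<Sum>k<num_small n. (1 - cos (?\<psi> (first_part j + N * k))) / 8)"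
    by (subst sum.reindex[OF inj_class]) simp
  also have "\<dots> = (\<Sum>k<num_small n. 1 - cos (real (first_part j + N * k) * \<theta> + of_int (chi j) * \<omega>)) / 8"
    unfolding sum_divide_distrib using chi_cong[OF cong_first_part] by simp
  finally show ?thesis .
qed

text \<open>Either \<theta> is at least of order t, and then the phases rotate along any class; or
  it is smaller, and the phases of the small parts are nearly constant. In the latter case they stay
  near \<omega>, which exceeds \<delta> in modulus, if (a, b) is resonant; otherwise some class has
  phases at distance at least \<pi>/(2N) from the multiples of 2\<pi>.\<close>

lemma minor_arc:
  assumes "0 < \<delta>"
  shows "\<exists>c>0. \<forall>\<^sub>F n in sequentially. \<forall>a b \<theta> \<omega>. \<bar>\<theta>\<bar> \<le> pi / N \<longrightarrow> \<bar>\<omega>\<bar> \<le> pi / N \<longrightarrow>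
    \<not> (resonant a b \<and> \<bar>\<theta>\<bar> \<le> \<delta> * saddle n \<and> \<bar>\<omega>\<bar> \<le> \<delta>) \<longrightarrow>
    cmod (Phi n (\<theta> + 2 * pi * of_int a / N) (\<omega> + 2 * pi * of_int b / N)) \<le> exp (- (c / saddle n))"
proof -
  \<comment> \<open>Half of \<delta> keeps |m\<theta> + \<omega>| \<ge> \<delta>' when |\<omega>| >
    \<delta>. The bound \<pi>/(2N) ensures that the deviations \<pi>/(2N) from m\<theta> and \<pi>/N
    from \<omega> leave \<pi>/(2N) of the gap 2\<pi>/N.\<close>
  define \<delta>' where "\<delta>' = min (\<delta> / 2) (pi / (2 * N))"
  have N: "real N \<ge> 2" using N_ge_2 by simp
  have d': "0 < \<delta>'" "\<delta>' \<le> \<delta> / 2" "\<delta>' \<le> pi / (2 * N)" using assms N by (auto simp: \<delta>'_def)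
  define \<epsilon> where "\<epsilon> = min 1 (\<delta>' / 4)"
  define \<kappa> where "\<kappa> = min (\<epsilon>\<^sup>2 / 3200) (min ((pi / (2 * N))\<^sup>2 / 24) (\<delta>'\<^sup>2 / 24))"
  have eps: "0 < \<epsilon>" "\<epsilon> \<le> 1" "\<epsilon> \<le> \<delta>' / 4" using d' by (auto simp: \<epsilon>_def)
  have kap: "0 < \<kappa>" "\<kappa> \<le> \<epsilon>\<^sup>2 / 3200" "\<kappa> \<le> (pi / (2 * N))\<^sup>2 / 24" "\<kappa> \<le> \<delta>'\<^sup>2 / 24"
    unfolding \<kappa>_def
    by (use eps N d' in simp) (rule min.cobounded1 order_trans[OF min.cobounded2 min.cobounded1] order_trans[OF min.cobounded2 min.cobounded2])+
  \<comment> \<open>There are at least 1 / (4Nt) small parts, and the exponent in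
    \<open>cmod_Phi_le\<close> carries a factor 1/8.\<close>
  define c where "c = \<kappa> / (32 * N)"
  have ev1: "\<forall>\<^sub>F n in sequentially. saddle n < 1 / (16 * real N)"
    and ev2: "\<forall>\<^sub>F n in sequentially. saddle n < 1 / (2 * real (K + N))"
    using N by (auto intro!: eventually_saddle_less divide_pos_pos)
  have "0 < c" using kap N by (simp add: c_def)
  moreover have "\<forall>\<^sub>F n in sequentially. \<forall>a b \<theta> \<omega>. \<bar>\<theta>\<bar> \<le> pi / N \<longrightarrow> \<bar>\<omega>\<bar> \<le> pi / N \<longrightarrow>
    \<not> (resonant a b \<and> \<bar>\<theta>\<bar> \<le> \<delta> * saddle n \<and> \<bar>\<omega>\<bar> \<le> \<delta>) \<longrightarrow>
    cmod (Phi n (\<theta> + 2 * pi * of_int a / N) (\<omega> + 2 * pi * of_int b / N)) \<le> exp (- (c / saddle n))"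
    using ev1 ev2 eventually_ge_at_top[of 1]
  proof eventually_elim
    case (elim n)
    have s: "n \<ge> 1" "saddle n \<le> 1 / (16 * real N)" "saddle n \<le> 1 / (2 * real (K + N))"
      using elim N by auto
    let ?t = "saddle n" let ?J = "num_small n"
    have t: "0 < ?t" "?t \<le> 1" using saddle_pos saddle_le_1 s by auto
    note J = num_small_bounds[OF s(1,2)]
    show ?case
    proof (intro allI impI)
      fix a b :: int and \<theta> \<omega> :: real
      assume th: "\<bar>\<theta>\<bar> \<le> pi / N" and om: "\<bar>\<omega>\<bar> \<le> pi / N"
        and nr: "\<not> (resonant a b \<and> \<bar>\<theta>\<bar> \<le> \<delta> * ?t \<and> \<bar>\<omega>\<bar> \<le> \<delta>)"
      define \<theta>' where "\<theta>' = \<theta> + 2 * pi * of_int a / N"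
      define \<omega>' where "\<omega>' = \<omega> + 2 * pi * of_int b / N"
      let ?\<psi> = "\<lambda>j k. real (first_part j + N * k) * \<theta>' + of_int (chi j) * \<omega>'"
      have suff: "cmod (Phi n \<theta>' \<omega>') \<le> exp (- (c / ?t))"
        if j: "j \<in> {1..N}" and le: "real ?J * \<kappa> \<le> (\<Sum>k<?J. 1 - cos (?\<psi> j k))" for j
      proof -
        have "c / ?t = (1 / (4 * real N * ?t)) * \<kappa> / 8" by (simp add: c_def)
        also have "\<dots> \<le> real ?J * \<kappa> / 8" using J(2) kap by (intro divide_right_mono mult_right_mono) auto
        also have "\<dots> \<le> (\<Sum>k<?J. 1 - cos (?\<psi> j k)) / 8" using le by simp
        finally show ?thesis using cmod_Phi_le[OF s j, of \<theta>' \<omega>'] by (smt (verit) exp_le_cancel_iff)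
      qed
      have phase: "?\<psi> j k = (real (first_part j + N * k) * \<theta> + of_int (chi j) * \<omega>) + 2 * pi * of_int (int (first_part j + N * k) * a + chi j * b) / N" for j k
        using shifted_phase[of "first_part j + N * k" \<theta> a \<omega> b] chi_cong[OF cong_first_part[of j k]]
        by (simp only: \<theta>'_def \<omega>'_def)
      show "cmod (Phi n (\<theta> + 2 * pi * of_int a / N) (\<omega> + 2 * pi * of_int b / N)) \<le> exp (- (c / ?t))"
      proof (cases "\<delta>' * ?t \<le> \<bar>\<theta>\<bar>")
        case True
        \<comment> \<open>Successive parts of a class differ by N, and N times 2\<pi>a/N is a
          multiple of 2\<pi>: the phases form a progression with step N\<theta>, whatever
          \<open>a\<close> is.\<close>
        have "real ?J * \<epsilon>\<^sup>2 / 3200 \<le> (\<Sum>k<?J. 1 - cos ((real (first_part \<alpha>) * \<theta>' + of_int (chi \<alpha>) * \<omega>') + real k * (real N * \<theta>)))"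
        proof (rule sum_one_minus_cos_ge)
          show "\<bar>real N * \<theta>\<bar> \<le> pi" using th N by (simp add: abs_mult field_simps)
          have "\<epsilon> \<le> (1 / (4 * real N * ?t)) * (real N * (\<delta>' * ?t))" using eps N t by simp
          also have "\<dots> \<le> real ?J * (real N * \<bar>\<theta>\<bar>)" using J True d' t by (intro mult_mono) auto
          finally show "\<epsilon> \<le> real ?J * \<bar>real N * \<theta>\<bar>" by (simp add: abs_mult)
        qed (use J eps in auto)
        also have "(\<Sum>k<?J. 1 - cos ((real (first_part \<alpha>) * \<theta>' + of_int (chi \<alpha>) * \<omega>') + real k * (real N * \<theta>))) = (\<Sum>k<?J. 1 - cos (?\<psi> \<alpha> k))"
        proof (intro sum.cong refl)
          fix k
          have "?\<psi> \<alpha> k = (real (first_part \<alpha>) * \<theta>' + of_int (chi \<alpha>) * \<omega>' + real k * (real N * \<theta>)) + 2 * pi * of_int (int k * a)"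
            using N by (simp add: \<theta>'_def field_simps)
          then show "1 - cos (real (first_part \<alpha>) * \<theta>' + of_int (chi \<alpha>) * \<omega>' + real k * (real N * \<theta>)) = 1 - cos (?\<psi> \<alpha> k)"
            by (simp only: cos_add_2pi_int)
        qed
        finally have "real ?J * (\<epsilon>\<^sup>2 / 3200) \<le> (\<Sum>k<?J. 1 - cos (?\<psi> \<alpha> k))" by simp
        moreover have "real ?J * \<kappa> \<le> real ?J * (\<epsilon>\<^sup>2 / 3200)" using kap by (intro mult_left_mono) auto
        ultimately show ?thesis using suff[OF alpha] unfolding \<theta>'_def \<omega>'_def by linarith
      next
        case False
        have small: "\<bar>real (first_part j + N * k) * \<theta>\<bar> \<le> \<delta>'" if "j \<in> {1..N}" "k < ?J" for j k
        proof -
          have "real k \<le> 1 / (2 * real N * ?t)" using that J(3) by linarith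
          then have "?t * (real N * real k) \<le> 1 / 2" using t N by (simp add: field_simps)
          moreover have "?t * real (first_part j) \<le> 1 / 2"
          proof -
            have "?t * real (first_part j) \<le> ?t * real (K + N)" using first_part_bounds[OF that(1)] t by (intro mult_left_mono) auto
            also have "\<dots> \<le> 1 / 2" using s(3) N by (simp add: field_simps)
            finally show ?thesis .
          qed
          ultimately have 1: "?t * real (first_part j + N * k) \<le> 1" by (simp add: algebra_simps)
          have "\<bar>real (first_part j + N * k) * \<theta>\<bar> = real (first_part j + N * k) * \<bar>\<theta>\<bar>" by (simp only: abs_mult abs_of_nat)
          also have "\<dots> \<le> real (first_part j + N * k) * (\<delta>' * ?t)" using False by (intro mult_left_mono) auto
          also have "\<dots> = \<delta>' * (?t * real (first_part j + N * k))" by simp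
          also have "\<dots> \<le> \<delta>' * 1" using 1 d' by (intro mult_left_mono) auto
          finally show ?thesis by simp
        qed
        have chi1: "\<bar>of_int (chi j) * \<omega>\<bar> \<le> pi / N" for j
        proof -
          have "\<bar>of_int (chi j) :: real\<bar> \<le> 1" using abs_chi_le[of j] by linarith
          then have "\<bar>of_int (chi j)\<bar> * \<bar>\<omega>\<bar> \<le> 1 * (pi / N)" using om by (intro mult_mono) auto
          then show ?thesis by (simp add: abs_mult)
        qed
        have half: "pi / N = pi / (2 * N) + pi / (2 * N)" by (simp add: field_simps)
        show ?thesis
        proof (cases "resonant a b")
          case True
          have "\<delta>' * ?t \<le> \<delta> * ?t" using d' t assms by (intro mult_right_mono) auto
          then have om2: "\<delta> < \<bar>\<omega>\<bar>" using nr False True by auto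
          have "\<kappa> \<le> 1 - cos (?\<psi> \<alpha> k)" if "k < ?J" for k
          proof -
            have c1: "chi \<alpha> = 1" by (simp add: chi_def)
            obtain z where z: "int (first_part \<alpha> + N * k) * a + chi (first_part \<alpha> + N * k) * b = int N * z"
              using resonant_dvd[OF True, of "first_part \<alpha> + N * k"] by (rule dvdE)
            have "real_of_int (int (first_part \<alpha> + N * k) * a + chi \<alpha> * b) = real N * of_int z"
              using z unfolding c1 chi_first_part(1) by (simp only: of_int_mult of_int_of_nat_eq)
            then have "2 * pi * of_int (int (first_part \<alpha> + N * k) * a + chi \<alpha> * b) / N = 2 * pi * of_int z"
              using N by (simp only:) simp
            then have e: "cos (?\<psi> \<alpha> k) = cos (real (first_part \<alpha> + N * k) * \<theta> + \<omega>)"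
              unfolding phase using c1 by (simp only: cos_add_2pi_int of_int_1 mult_1)
            let ?x = "real (first_part \<alpha> + N * k) * \<theta> + \<omega>"
            have lo: "\<delta>' \<le> \<bar>?x\<bar>" using small[OF alpha that] om2 d' by linarith
            have "\<bar>?x\<bar> \<le> pi" 
            proof -
              have "\<bar>?x\<bar> \<le> pi / (2 * N) + pi / N" using small[OF alpha that] om d' by linarith
              also have "\<dots> = (3/2) * (pi / N)" by simp
              also have "pi / N \<le> pi / 2" using N by (intro divide_left_mono) auto
              finally show ?thesis using pi_gt_zero by linarith
            qed
            then have "?x\<^sup>2 / 24 \<le> 1 - cos ?x" by (rule one_minus_cos_ge)
            moreover have "\<delta>'\<^sup>2 \<le> ?x\<^sup>2" using lo d' by (metis abs_le_square_iff abs_of_pos)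
            ultimately show ?thesis unfolding e using kap by linarith
          qed
          then have "(\<Sum>k<?J. \<kappa>) \<le> (\<Sum>k<?J. 1 - cos (?\<psi> \<alpha> k))" by (intro sum_mono) auto
          then show ?thesis using suff[OF alpha] unfolding \<theta>'_def \<omega>'_def by simp
        next
          case F2: False
          then obtain j where j: "j \<in> {1..N}" "\<not> int N dvd int j * a + chi j * b" by (auto simp: resonant_def)
          have "\<kappa> \<le> 1 - cos (?\<psi> j k)" if "k < ?J" for k
          proof -
            define w where "w = int (first_part j + N * k) * a + chi j * b"
            define g where "g = w mod int N"
            have w: "w = int N * (w div int N) + g" by (simp add: g_def)
            have "g \<noteq> 0"
            proof
              assume "g = 0"
              then have "int N dvd w" by (simp add: g_def dvd_eq_mod_eq_0)
              moreover have "w = (int j * a + chi j * b) + int N * (int (e_vec N K j + k) * a)"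
                by (simp add: w_def first_part_def algebra_simps)
              ultimately show False using j(2) by (metis dvd_add_times_triv_right_iff mult.commute)
            qed
            moreover have "0 \<le> g" "g < int N" using N_ge_2 by (auto simp: g_def)
            ultimately have g: "1 \<le> g" "g \<le> int N - 1" by auto
            have e: "cos (?\<psi> j k) = cos (real (first_part j + N * k) * \<theta> + of_int (chi j) * \<omega> + 2 * pi * of_int g / N)"
            proof -
              have "?\<psi> j k = (real (first_part j + N * k) * \<theta> + of_int (chi j) * \<omega> + 2 * pi * of_int g / N) + 2 * pi * of_int (w div int N)"
                unfolding phase w_def[symmetric] by (subst w) (use N in \<open>simp add: field_simps\<close>)
              then show ?thesis by (simp only: cos_add_2pi_int)
            qed
            let ?x = "real (first_part j + N * k) * \<theta> + of_int (chi j) * \<omega>"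
            have x: "\<bar>?x\<bar> \<le> pi / (2 * N) + pi / N" using small[OF j(1) that] chi1[of j] d' by linarith
            have g1: "2 * (pi / N) \<le> 2 * pi * of_int g / N"
            proof -
              have "2 * (pi / N) * 1 \<le> 2 * (pi / N) * of_int g" using g by (intro mult_left_mono) auto
              then show ?thesis by simp
            qed
            have g2: "2 * pi * of_int g / N \<le> 2 * pi - 2 * (pi / N)"
            proof -
              have "of_int g \<le> real N - 1" using g by linarith
              then have "2 * (pi / N) * of_int g \<le> 2 * (pi / N) * (real N - 1)" by (intro mult_left_mono) auto
              also have "\<dots> = 2 * pi - 2 * (pi / N)" using N by (simp add: field_simps)
              finally show ?thesis by simp
            qed
            have "cos (?x + 2 * pi * of_int g / N) \<le> cos (pi / (2 * N))"
            proof (rule cos_le_away)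
              show "0 \<le> pi / (2 * N)" by simp
              show "pi / (2 * N) \<le> ?x + 2 * pi * of_int g / N" using x g1 half by linarith
              show "?x + 2 * pi * of_int g / N \<le> 2 * pi - pi / (2 * N)" using x g2 half by linarith
            qed
            moreover have "(pi / (2 * N))\<^sup>2 / 24 \<le> 1 - cos (pi / (2 * N))"
              using N by (intro one_minus_cos_ge) (simp add: field_simps)
            ultimately show ?thesis unfolding e using kap by linarith
          qed
          then have "(\<Sum>k<?J. \<kappa>) \<le> (\<Sum>k<?J. 1 - cos (?\<psi> j k))" by (intro sum_mono) auto
          then show ?thesis using suff[OF j(1)] unfolding \<theta>'_def \<omega>'_def by simp
        qed
      qed
    qed
  qed
  ultimately show ?thesis by blast
qed

section \<open>Major arcs\<close>

text \<open>Half the covariance form after the substitution \<theta> = x s^3, \<omega> = y s with s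
  = \<surd>t: the variances \<pi>^2 / (6 t^3) and 1 / (N t) become constants, and the covariance
  vanishes in the limit.\<close>

definition gauss_exponent :: "real \<Rightarrow> real \<Rightarrow> real" where
  "gauss_exponent x y = pi\<^sup>2 / 12 * x\<^sup>2 + y\<^sup>2 / (2 * N)"

text \<open>As the weights decay like e^(-tm), a power m^j costs t^(-j-1). The third moments bound
  the errors of the arguments of the factors, the fourth moments those of the logarithms of the
  moduli.\<close>

lemma weighted_power_sums:
  fixes \<theta> \<omega> :: real
  assumes n: "n \<ge> 1"
  defines "\<psi> \<equiv> \<lambda>m. real m * \<theta> + of_int (chi m) * \<omega>"
  shows "(\<Sum>m\<in>parts n. fermi (saddle n) m * \<bar>\<psi> m\<bar> ^ 3) \<le> 768 * (\<bar>\<theta>\<bar> ^ 3 / saddle n ^ 4 + \<bar>\<omega>\<bar> ^ 3 / saddle n)"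
    and "(\<Sum>m\<in>parts n. fermi (saddle n) m * \<psi> m ^ 4) \<le> 12288 * (\<theta> ^ 4 / saddle n ^ 5 + \<omega> ^ 4 / saddle n)"
proof -
  let ?t = "saddle n"
  have t: "0 < ?t" "?t \<le> 1" using saddle_pos saddle_le_1 n by auto
  have psi: "\<bar>\<psi> m\<bar> \<le> real m * \<bar>\<theta>\<bar> + \<bar>\<omega>\<bar>" for m
  proof -
    have "\<bar>of_int (chi m) :: real\<bar> \<le> 1" using abs_chi_le[of m] by linarith
    then have "\<bar>of_int (chi m)\<bar> * \<bar>\<omega>\<bar> \<le> 1 * \<bar>\<omega>\<bar>" by (intro mult_right_mono) auto
    then show ?thesis unfolding \<psi>_def by (intro order_trans[OF abs_triangle_ineq]) (simp add: abs_mult)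
  qed
  have S: "(\<Sum>m\<in>parts n. real m ^ j * exp (- (?t * real m))) \<le> (fact j * 2 ^ j * 4) / ?t ^ Suc j" for j
    by (rule sum_power_exp_le[OF t]) simp
  have "fermi ?t m * \<bar>\<psi> m\<bar> ^ 3 \<le> 4 * \<bar>\<theta>\<bar> ^ 3 * (real m ^ 3 * exp (- (?t * real m))) + 4 * \<bar>\<omega>\<bar> ^ 3 * (real m ^ 0 * exp (- (?t * real m)))" for m
  proof -
    have "\<bar>\<psi> m\<bar> ^ 3 \<le> (real m * \<bar>\<theta>\<bar> + \<bar>\<omega>\<bar>) ^ 3" using psi by (intro power_mono) auto
    also have "\<dots> \<le> 4 * ((real m * \<bar>\<theta>\<bar>) ^ 3 + \<bar>\<omega>\<bar> ^ 3)" by (rule cube_add_le) auto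
    finally have "fermi ?t m * \<bar>\<psi> m\<bar> ^ 3 \<le> exp (- (?t * real m)) * (4 * ((real m * \<bar>\<theta>\<bar>) ^ 3 + \<bar>\<omega>\<bar> ^ 3))"
      using fermi_le_exp by (intro mult_mono) auto
    then show ?thesis by (simp add: power_mult_distrib algebra_simps)
  qed
  then have "(\<Sum>m\<in>parts n. fermi ?t m * \<bar>\<psi> m\<bar> ^ 3) \<le> (\<Sum>m\<in>parts n. 4 * \<bar>\<theta>\<bar> ^ 3 * (real m ^ 3 * exp (- (?t * real m))) + 4 * \<bar>\<omega>\<bar> ^ 3 * (real m ^ 0 * exp (- (?t * real m))))"
    by (rule sum_mono)
  also have "\<dots> = 4 * \<bar>\<theta>\<bar> ^ 3 * (\<Sum>m\<in>parts n. real m ^ 3 * exp (- (?t * real m))) + 4 * \<bar>\<omega>\<bar> ^ 3 * (\<Sum>m\<in>parts n. real m ^ 0 * exp (- (?t * real m)))"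
    by (simp only: sum.distrib sum_distrib_left)
  also have "\<dots> \<le> 4 * \<bar>\<theta>\<bar> ^ 3 * ((fact 3 * 2 ^ 3 * 4) / ?t ^ Suc 3) + 4 * \<bar>\<omega>\<bar> ^ 3 * ((fact 0 * 2 ^ 0 * 4) / ?t ^ Suc 0)"
    by (intro add_mono mult_left_mono S) auto
  also have "\<dots> = 768 * (\<bar>\<theta>\<bar> ^ 3 / ?t ^ 4) + 16 * (\<bar>\<omega>\<bar> ^ 3 / ?t)" by (simp add: fact_numeral)
  also have "\<dots> \<le> 768 * (\<bar>\<theta>\<bar> ^ 3 / ?t ^ 4) + 768 * (\<bar>\<omega>\<bar> ^ 3 / ?t)"
    using t by (intro add_left_mono mult_right_mono) auto
  also have "\<dots> = 768 * (\<bar>\<theta>\<bar> ^ 3 / ?t ^ 4 + \<bar>\<omega>\<bar> ^ 3 / ?t)" by (rule distrib_left[symmetric])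
  finally show "(\<Sum>m\<in>parts n. fermi ?t m * \<bar>\<psi> m\<bar> ^ 3) \<le> 768 * (\<bar>\<theta>\<bar> ^ 3 / ?t ^ 4 + \<bar>\<omega>\<bar> ^ 3 / ?t)" .
  have "fermi ?t m * \<psi> m ^ 4 \<le> 8 * \<theta> ^ 4 * (real m ^ 4 * exp (- (?t * real m))) + 8 * \<omega> ^ 4 * (real m ^ 0 * exp (- (?t * real m)))" for m
  proof -
    have "\<bar>\<psi> m\<bar> ^ 4 \<le> (real m * \<bar>\<theta>\<bar> + \<bar>\<omega>\<bar>) ^ 4" using psi by (intro power_mono) auto
    also have "\<dots> \<le> 8 * ((real m * \<bar>\<theta>\<bar>) ^ 4 + \<bar>\<omega>\<bar> ^ 4)" by (rule quartic_add_le)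
    finally have "fermi ?t m * \<bar>\<psi> m\<bar> ^ 4 \<le> exp (- (?t * real m)) * (8 * ((real m * \<bar>\<theta>\<bar>) ^ 4 + \<bar>\<omega>\<bar> ^ 4))"
      using fermi_le_exp by (intro mult_mono) auto
    then show ?thesis by (simp add: power_mult_distrib algebra_simps)
  qed
  then have "(\<Sum>m\<in>parts n. fermi ?t m * \<psi> m ^ 4) \<le> (\<Sum>m\<in>parts n. 8 * \<theta> ^ 4 * (real m ^ 4 * exp (- (?t * real m))) + 8 * \<omega> ^ 4 * (real m ^ 0 * exp (- (?t * real m))))"
    by (rule sum_mono)
  also have "\<dots> = 8 * \<theta> ^ 4 * (\<Sum>m\<in>parts n. real m ^ 4 * exp (- (?t * real m))) + 8 * \<omega> ^ 4 * (\<Sum>m\<in>parts n. real m ^ 0 * exp (- (?t * real m)))"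
    by (simp only: sum.distrib sum_distrib_left)
  also have "\<dots> \<le> 8 * \<theta> ^ 4 * ((fact 4 * 2 ^ 4 * 4) / ?t ^ Suc 4) + 8 * \<omega> ^ 4 * ((fact 0 * 2 ^ 0 * 4) / ?t ^ Suc 0)"
    by (intro add_mono mult_left_mono S) auto
  also have "\<dots> = 12288 * (\<theta> ^ 4 / ?t ^ 5) + 32 * (\<omega> ^ 4 / ?t)" by (simp add: fact_numeral)
  also have "\<dots> \<le> 12288 * (\<theta> ^ 4 / ?t ^ 5) + 12288 * (\<omega> ^ 4 / ?t)"
    using t by (intro add_left_mono mult_right_mono) auto
  also have "\<dots> = 12288 * (\<theta> ^ 4 / ?t ^ 5 + \<omega> ^ 4 / ?t)" by (rule distrib_left[symmetric])
  finally show "(\<Sum>m\<in>parts n. fermi ?t m * \<psi> m ^ 4) \<le> 12288 * (\<theta> ^ 4 / ?t ^ 5 + \<omega> ^ 4 / ?t)" .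
qed

text \<open>On this box the phase of the part m is at most (1 + tm) / 4, which may be large, but
  fermi times its square is at most 1/4 for every m. So each factor has the logarithm of
  \<open>bernoulli_factor_polar\<close>, and these add up without any choice of branch.\<close>

lemma Phi_polar:
  assumes n: "n \<ge> 1" and small: "\<bar>\<theta>\<bar> \<le> saddle n / 4" "\<bar>\<omega>\<bar> \<le> 1 / 4"
  obtains R Y where "Phi n \<theta> \<omega> = exp (Complex R Y)"
    "\<bar>R + (var_sum n * \<theta>\<^sup>2 + 2 * covar n * \<theta> * \<omega> + var_diff n * \<omega>\<^sup>2) / 2\<bar> \<le> 24576 * (\<theta> ^ 4 / saddle n ^ 5 + \<omega> ^ 4 / saddle n)"
    "\<bar>Y - (mean_sum n * \<theta> + mean_diff n * \<omega>)\<bar> \<le> 3072 * (\<bar>\<theta>\<bar> ^ 3 / saddle n ^ 4 + \<bar>\<omega>\<bar> ^ 3 / saddle n)"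
proof -
  let ?t = "saddle n"
  let ?p = "\<lambda>m. fermi ?t (real m)"
  define \<psi> where "\<psi> = (\<lambda>m. real m * \<theta> + of_int (chi m) * \<omega>)"
  have t: "0 < ?t" "?t \<le> 1" using saddle_pos saddle_le_1 n by auto
  have psi: "\<bar>\<psi> m\<bar> \<le> (1 + ?t * real m) / 4" for m
  proof -
    have "\<bar>of_int (chi m) :: real\<bar> \<le> 1" using abs_chi_le[of m] by linarith
    then have "\<bar>of_int (chi m)\<bar> * \<bar>\<omega>\<bar> \<le> 1 * (1 / 4)" using small by (intro mult_mono) auto
    moreover have "real m * \<bar>\<theta>\<bar> \<le> real m * (?t / 4)" using small by (intro mult_left_mono) auto
    ultimately show ?thesis unfolding \<psi>_def by (intro order_trans[OF abs_triangle_ineq]) (simp add: abs_mult field_simps)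
  qed
  have "?p m * (\<psi> m)\<^sup>2 \<le> 1 / 4" for m
  proof -
    have u: "1 + ?t * real m \<le> 2 * exp (?t * real m / 2)"
      using exp_ge_add_one_self[of "?t * real m / 2"] by (simp add: field_simps)
    have "(\<psi> m)\<^sup>2 \<le> ((1 + ?t * real m) / 4)\<^sup>2" using psi[of m] by (metis abs_ge_zero power2_abs power_mono)
    also have "\<dots> \<le> (exp (?t * real m / 2) / 2)\<^sup>2" using u t by (intro power_mono) auto
    also have "\<dots> = exp (?t * real m) / 4" by (simp add: power_divide power2_eq_square exp_add[symmetric])
    finally have "?p m * (\<psi> m)\<^sup>2 \<le> exp (- (?t * real m)) * (exp (?t * real m) / 4)"
      using fermi_le_exp by (intro mult_mono) auto
    then show ?thesis by (simp add: exp_minus)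
  qed
  then have "\<exists>r y. 1 + of_real (?p m) * (cis (\<psi> m) - 1) = exp (Complex r y) \<and>
    \<bar>r + ?p m * (1 - ?p m) * (\<psi> m)\<^sup>2 / 2\<bar> \<le> 2 * (?p m * \<psi> m ^ 4) \<and> \<bar>y - ?p m * \<psi> m\<bar> \<le> 4 * (?p m * \<bar>\<psi> m\<bar> ^ 3)" for m
    using bernoulli_factor_polar[of "?p m" "\<psi> m"] fermi_le_half[of ?t m] t less_imp_le[OF fermi_pos[of ?t m]]
    by (metis less_imp_le of_nat_0_le_iff)
  then obtain r y where ry: "\<And>m. 1 + of_real (?p m) * (cis (\<psi> m) - 1) = exp (Complex (r m) (y m))"
    "\<And>m. \<bar>r m + ?p m * (1 - ?p m) * (\<psi> m)\<^sup>2 / 2\<bar> \<le> 2 * (?p m * \<psi> m ^ 4)"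
    "\<And>m. \<bar>y m - ?p m * \<psi> m\<bar> \<le> 4 * (?p m * \<bar>\<psi> m\<bar> ^ 3)" by metis
  define R where "R = (\<Sum>m\<in>parts n. r m)"
  define Y where "Y = (\<Sum>m\<in>parts n. y m)"
  have c: "(\<Sum>m\<in>parts n. Complex (r m) (y m)) = Complex R Y"
    by (simp add: complex_eq_iff R_def Y_def)
  have "Phi n \<theta> \<omega> = (\<Prod>m\<in>parts n. exp (Complex (r m) (y m)))"
    unfolding Phi_def ry(1)[symmetric] \<psi>_def ..
  also have "\<dots> = exp (Complex R Y)" by (simp add: exp_sum[symmetric] c)
  finally have 1: "Phi n \<theta> \<omega> = exp (Complex R Y)" .
  have Q: "var_sum n * \<theta>\<^sup>2 + 2 * covar n * \<theta> * \<omega> + var_diff n * \<omega>\<^sup>2 = (\<Sum>m\<in>parts n. ?p m * (1 - ?p m) * (\<psi> m)\<^sup>2)"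
  proof -
    have "?p m * (1 - ?p m) * (\<psi> m)\<^sup>2 = \<theta>\<^sup>2 * ((real m)\<^sup>2 * (?p m * (1 - ?p m))) + (2 * \<theta> * \<omega>) * (real m * of_int (chi m) * (?p m * (1 - ?p m))) + \<omega>\<^sup>2 * ((of_int (chi m))\<^sup>2 * (?p m * (1 - ?p m)))" for m
      unfolding \<psi>_def by (simp add: power2_eq_square algebra_simps)
    then have "(\<Sum>m\<in>parts n. ?p m * (1 - ?p m) * (\<psi> m)\<^sup>2) = \<theta>\<^sup>2 * var_sum n + (2 * \<theta> * \<omega>) * covar n + \<omega>\<^sup>2 * var_diff n"
      by (simp only: sum.distrib sum_distrib_left[symmetric] var_sum_def covar_def var_diff_def)
    then show ?thesis by (simp add: mult_ac)
  qed
  have "R + (var_sum n * \<theta>\<^sup>2 + 2 * covar n * \<theta> * \<omega> + var_diff n * \<omega>\<^sup>2) / 2 = (\<Sum>m\<in>parts n. r m + ?p m * (1 - ?p m) * (\<psi> m)\<^sup>2 / 2)"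
    unfolding Q R_def by (simp add: sum.distrib sum_divide_distrib)
  also have "\<bar>\<dots>\<bar> \<le> (\<Sum>m\<in>parts n. 2 * (?p m * \<psi> m ^ 4))" by (rule order_trans[OF sum_abs sum_mono[OF ry(2)]])
  also have "\<dots> = 2 * (\<Sum>m\<in>parts n. ?p m * \<psi> m ^ 4)" by (simp only: sum_distrib_left)
  also have "\<dots> \<le> 2 * (12288 * (\<theta> ^ 4 / ?t ^ 5 + \<omega> ^ 4 / ?t))"
    unfolding \<psi>_def by (intro mult_left_mono weighted_power_sums[OF n]) simp
  finally have 2: "\<bar>R + (var_sum n * \<theta>\<^sup>2 + 2 * covar n * \<theta> * \<omega> + var_diff n * \<omega>\<^sup>2) / 2\<bar> \<le> 24576 * (\<theta> ^ 4 / ?t ^ 5 + \<omega> ^ 4 / ?t)"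
    by simp
  have L: "mean_sum n * \<theta> + mean_diff n * \<omega> = (\<Sum>m\<in>parts n. ?p m * \<psi> m)"
    unfolding mean_sum_def mean_diff_def \<psi>_def sum_distrib_right sum.distrib[symmetric]
    by (intro sum.cong refl) (simp add: algebra_simps)
  have "Y - (mean_sum n * \<theta> + mean_diff n * \<omega>) = (\<Sum>m\<in>parts n. y m - ?p m * \<psi> m)"
    unfolding L Y_def by (simp add: sum_subtractf)
  also have "\<bar>\<dots>\<bar> \<le> (\<Sum>m\<in>parts n. 4 * (?p m * \<bar>\<psi> m\<bar> ^ 3))" by (rule order_trans[OF sum_abs sum_mono[OF ry(3)]])
  also have "\<dots> = 4 * (\<Sum>m\<in>parts n. ?p m * \<bar>\<psi> m\<bar> ^ 3)" by (simp only: sum_distrib_left)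
  also have "\<dots> \<le> 4 * (768 * (\<bar>\<theta>\<bar> ^ 3 / ?t ^ 4 + \<bar>\<omega>\<bar> ^ 3 / ?t))"
    unfolding \<psi>_def by (intro mult_left_mono weighted_power_sums[OF n]) simp
  finally have 3: "\<bar>Y - (mean_sum n * \<theta> + mean_diff n * \<omega>)\<bar> \<le> 3072 * (\<bar>\<theta>\<bar> ^ 3 / ?t ^ 4 + \<bar>\<omega>\<bar> ^ 3 / ?t)"
    by simp
  show thesis using that 1 2 3 by blast
qed

definition scale :: "nat \<Rightarrow> real" where
  "scale n = sqrt (saddle n)"

lemma scale_sq: "n \<ge> 1 \<Longrightarrow> (scale n)\<^sup>2 = saddle n"
  using saddle_pos[of n] by (simp add: scale_def)

lemma scale_pos: "n \<ge> 1 \<Longrightarrow> 0 < scale n"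
  using saddle_pos[of n] by (simp add: scale_def)

lemma scale_le_1: "n \<ge> 1 \<Longrightarrow> scale n \<le> 1"
  using saddle_le_1[of n] by (simp add: scale_def)

text \<open>Multiplication by cis (-n\<theta>) centres the part sum. What remains in the phase (the
  mean defects and the cubic terms) is O(s), while the errors of the modulus (variance defects,
  covariance and quartic terms) are O(s^2).\<close>

lemma Phi_scaled_polar:
  "\<exists>C>0. \<forall>n\<ge>1. \<forall>x y. \<bar>x\<bar> * scale n \<le> 1 / 4 \<longrightarrow> \<bar>y\<bar> * scale n \<le> 1 / 4 \<longrightarrow>
    (\<exists>R Y. Phi n (x * scale n ^ 3) (y * scale n) * cis (- (real n * (x * scale n ^ 3))) = exp (Complex (- gauss_exponent x y + R) Y) \<and>
      \<bar>R\<bar> \<le> C * (scale n)\<^sup>2 * ((x\<^sup>2 + y\<^sup>2) + (x\<^sup>2 + y\<^sup>2)\<^sup>2) \<and> \<bar>Y\<bar> \<le> C * scale n * (\<bar>x\<bar> + \<bar>y\<bar> + \<bar>x\<bar> ^ 3 + \<bar>y\<bar> ^ 3))"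
proof -
  obtain C1 where C1: "\<And>n. n \<ge> 1 \<Longrightarrow> \<bar>mean_sum n - real n\<bar> \<le> C1 / saddle n" using mean_sum_bound by auto
  obtain C2 where C2: "\<And>n. n \<ge> 1 \<Longrightarrow> \<bar>var_sum n - pi\<^sup>2 / (6 * saddle n ^ 3)\<bar> \<le> C2 / (saddle n)\<^sup>2" using var_sum_bound by auto
  obtain C3 where C3: "\<And>n. n \<ge> 1 \<Longrightarrow> \<bar>var_diff n - 1 / (real N * saddle n)\<bar> \<le> C3" using var_diff_bound by auto
  obtain C4 where C4: "\<And>n. n \<ge> 1 \<Longrightarrow> \<bar>covar n\<bar> \<le> C4 / saddle n" using covar_bound by auto
  obtain C5 where C5: "\<And>n. n \<ge> 1 \<Longrightarrow> \<bar>mean_diff n - shift / (2 * real N)\<bar> \<le> C5 * saddle n" using mean_diff_bound by auto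
  define D where "D = \<bar>C1\<bar> + \<bar>C2\<bar> + \<bar>C3\<bar> + \<bar>C4\<bar> + \<bar>C5\<bar> + \<bar>shift / (2 * real N)\<bar>"
  define C where "C = D + 24576"
  have D0: "0 \<le> D" by (simp add: D_def)
  have CD: "C1 \<le> D" "C2 \<le> D" "C3 \<le> D" "C4 \<le> D" "\<bar>C5\<bar> + \<bar>shift / (2 * real N)\<bar> \<le> D"
    unfolding D_def by linarith+
  have "\<exists>R Y. Phi n (x * scale n ^ 3) (y * scale n) * cis (- (real n * (x * scale n ^ 3))) = exp (Complex (- gauss_exponent x y + R) Y) \<and>
      \<bar>R\<bar> \<le> C * (scale n)\<^sup>2 * ((x\<^sup>2 + y\<^sup>2) + (x\<^sup>2 + y\<^sup>2)\<^sup>2) \<and> \<bar>Y\<bar> \<le> C * scale n * (\<bar>x\<bar> + \<bar>y\<bar> + \<bar>x\<bar> ^ 3 + \<bar>y\<bar> ^ 3)"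
    if n: "n \<ge> 1" and xy: "\<bar>x\<bar> * scale n \<le> 1 / 4" "\<bar>y\<bar> * scale n \<le> 1 / 4" for n x y
  proof -
    let ?s = "scale n"
    let ?\<theta> = "x * ?s ^ 3" let ?\<omega> = "y * ?s"
    have s: "0 < ?s" "?s \<le> 1" using scale_pos scale_le_1 n by auto
    have t: "saddle n = ?s\<^sup>2" using scale_sq[OF n] by simp
    have "\<bar>?\<theta>\<bar> = (\<bar>x\<bar> * ?s) * ?s\<^sup>2" using s by (simp add: abs_mult power3_eq_cube power2_eq_square)
    also have "\<dots> \<le> (1 / 4) * ?s\<^sup>2" using xy by (intro mult_right_mono) auto
    finally have sm1: "\<bar>?\<theta>\<bar> \<le> saddle n / 4" by (simp add: t)
    have sm2: "\<bar>?\<omega>\<bar> \<le> 1 / 4" using xy s by (simp add: abs_mult)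
    obtain R0 Y0 where RY: "Phi n ?\<theta> ?\<omega> = exp (Complex R0 Y0)"
      "\<bar>R0 + (var_sum n * ?\<theta>\<^sup>2 + 2 * covar n * ?\<theta> * ?\<omega> + var_diff n * ?\<omega>\<^sup>2) / 2\<bar> \<le> 24576 * (?\<theta> ^ 4 / saddle n ^ 5 + ?\<omega> ^ 4 / saddle n)"
      "\<bar>Y0 - (mean_sum n * ?\<theta> + mean_diff n * ?\<omega>)\<bar> \<le> 3072 * (\<bar>?\<theta>\<bar> ^ 3 / saddle n ^ 4 + \<bar>?\<omega>\<bar> ^ 3 / saddle n)"
      using Phi_polar[OF n sm1 sm2] by blast
    have p4: "?\<theta> ^ 4 / saddle n ^ 5 + ?\<omega> ^ 4 / saddle n = ?s\<^sup>2 * (x ^ 4 + y ^ 4)"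
      using s by (simp add: t power_mult_distrib field_simps flip: power_mult power_add)
    have p3: "\<bar>?\<theta>\<bar> ^ 3 / saddle n ^ 4 + \<bar>?\<omega>\<bar> ^ 3 / saddle n = ?s * (\<bar>x\<bar> ^ 3 + \<bar>y\<bar> ^ 3)"
      using s by (simp add: t abs_mult power_mult_distrib field_simps eval_nat_numeral)
    define R where "R = R0 + gauss_exponent x y"
    define Y where "Y = Y0 - real n * ?\<theta>"
    have 1: "Phi n ?\<theta> ?\<omega> * cis (- (real n * ?\<theta>)) = exp (Complex (- gauss_exponent x y + R) Y)"
      unfolding RY(1) R_def Y_def by (simp add: exp_eq_polar cis_mult)
    define a where "a = (var_sum n - pi\<^sup>2 / (6 * saddle n ^ 3)) * ?s ^ 6"
    define b where "b = (var_diff n - 1 / (real N * saddle n)) * ?s\<^sup>2"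
    define c where "c = covar n * ?s ^ 4"
    have a: "\<bar>a\<bar> \<le> D * ?s\<^sup>2"
    proof -
      have "\<bar>a\<bar> \<le> (C2 / (saddle n)\<^sup>2) * ?s ^ 6" unfolding a_def abs_mult using C2[OF n] s by (intro mult_mono) auto
      also have "\<dots> = C2 * ?s\<^sup>2" using s by (simp add: t field_simps eval_nat_numeral)
      also have "\<dots> \<le> D * ?s\<^sup>2" by (intro mult_right_mono CD) auto
      finally show ?thesis .
    qed
    have b: "\<bar>b\<bar> \<le> D * ?s\<^sup>2"
    proof -
      have "\<bar>b\<bar> \<le> C3 * ?s\<^sup>2" unfolding b_def abs_mult using C3[OF n] s by (intro mult_mono) auto
      also have "\<dots> \<le> D * ?s\<^sup>2" by (intro mult_right_mono CD) auto
      finally show ?thesis .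
    qed
    have c: "\<bar>c\<bar> \<le> D * ?s\<^sup>2"
    proof -
      have "\<bar>c\<bar> \<le> (C4 / saddle n) * ?s ^ 4" unfolding c_def abs_mult using C4[OF n] s by (intro mult_mono) auto
      also have "\<dots> = C4 * ?s\<^sup>2" using s by (simp add: t field_simps eval_nat_numeral)
      also have "\<dots> \<le> D * ?s\<^sup>2" by (intro mult_right_mono CD) auto
      finally show ?thesis .
    qed
    have V: "var_sum n * ?s ^ 6 = pi\<^sup>2 / 6 + a" using s by (simp add: a_def t left_diff_distrib flip: power_mult)
    have W: "var_diff n * ?s\<^sup>2 = 1 / N + b" using s by (simp add: b_def t left_diff_distrib)
    have "(var_sum n * ?\<theta>\<^sup>2 + 2 * covar n * ?\<theta> * ?\<omega> + var_diff n * ?\<omega>\<^sup>2) / 2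
      = ((var_sum n * ?s ^ 6) * x\<^sup>2 + 2 * c * (x * y) + (var_diff n * ?s\<^sup>2) * y\<^sup>2) / 2"
      by (simp add: c_def power_mult_distrib eval_nat_numeral mult_ac)
    also have "\<dots> = gauss_exponent x y + (a * x\<^sup>2 + 2 * c * (x * y) + b * y\<^sup>2) / 2"
      unfolding V W gauss_exponent_def by (simp add: field_simps)
    finally have Qe: "(var_sum n * ?\<theta>\<^sup>2 + 2 * covar n * ?\<theta> * ?\<omega> + var_diff n * ?\<omega>\<^sup>2) / 2 = gauss_exponent x y + (a * x\<^sup>2 + 2 * c * (x * y) + b * y\<^sup>2) / 2" .
    have "\<bar>(a * x\<^sup>2 + 2 * c * (x * y) + b * y\<^sup>2) / 2\<bar> \<le> (\<bar>a\<bar> * x\<^sup>2 + \<bar>c\<bar> * (2 * \<bar>x * y\<bar>) + \<bar>b\<bar> * y\<^sup>2) / 2"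
      by (simp add: abs_mult divide_right_mono)
         (intro order_trans[OF abs_triangle_ineq] add_mono; simp add: abs_mult)
    also have "\<dots> \<le> (D * ?s\<^sup>2 * x\<^sup>2 + D * ?s\<^sup>2 * (x\<^sup>2 + y\<^sup>2) + D * ?s\<^sup>2 * y\<^sup>2) / 2"
    proof (intro divide_right_mono add_mono mult_mono)
      show "2 * \<bar>x * y\<bar> \<le> x\<^sup>2 + y\<^sup>2" using sum_squares_bound[of "\<bar>x\<bar>" "\<bar>y\<bar>"] by (simp add: abs_mult)
    qed (use a b c D0 in auto)
    also have "\<dots> = D * ?s\<^sup>2 * (x\<^sup>2 + y\<^sup>2)" by (simp add: algebra_simps)
    finally have E: "\<bar>(a * x\<^sup>2 + 2 * c * (x * y) + b * y\<^sup>2) / 2\<bar> \<le> D * ?s\<^sup>2 * (x\<^sup>2 + y\<^sup>2)" .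
    have q4: "x ^ 4 + y ^ 4 \<le> (x\<^sup>2 + y\<^sup>2)\<^sup>2" by (simp add: power2_sum)
    have "\<bar>R\<bar> \<le> 24576 * (?s\<^sup>2 * (x ^ 4 + y ^ 4)) + D * ?s\<^sup>2 * (x\<^sup>2 + y\<^sup>2)"
      using RY(2) E unfolding p4 Qe R_def by linarith
    also have "\<dots> \<le> C * ?s\<^sup>2 * (x\<^sup>2 + y\<^sup>2)\<^sup>2 + C * ?s\<^sup>2 * (x\<^sup>2 + y\<^sup>2)"
    proof (intro add_mono)
      have "24576 * ?s\<^sup>2 * (x ^ 4 + y ^ 4) \<le> C * ?s\<^sup>2 * (x\<^sup>2 + y\<^sup>2)\<^sup>2"
        using q4 D0 by (intro mult_mono) (auto simp: C_def)
      then show "24576 * (?s\<^sup>2 * (x ^ 4 + y ^ 4)) \<le> C * ?s\<^sup>2 * (x\<^sup>2 + y\<^sup>2)\<^sup>2" by simp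
      show "D * ?s\<^sup>2 * (x\<^sup>2 + y\<^sup>2) \<le> C * ?s\<^sup>2 * (x\<^sup>2 + y\<^sup>2)" by (intro mult_right_mono) (auto simp: C_def)
    qed
    finally have 2: "\<bar>R\<bar> \<le> C * ?s\<^sup>2 * ((x\<^sup>2 + y\<^sup>2) + (x\<^sup>2 + y\<^sup>2)\<^sup>2)" by (simp add: algebra_simps)
    have m1: "\<bar>(mean_sum n - real n) * ?\<theta>\<bar> \<le> D * ?s * \<bar>x\<bar>"
    proof -
      have "\<bar>(mean_sum n - real n) * ?\<theta>\<bar> \<le> (C1 / saddle n) * \<bar>?\<theta>\<bar>" unfolding abs_mult using C1[OF n] by (intro mult_right_mono) auto
      also have "\<dots> = C1 * (?s * \<bar>x\<bar>)" using s by (simp add: t abs_mult field_simps eval_nat_numeral)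
      also have "\<dots> \<le> D * (?s * \<bar>x\<bar>)" using s by (intro mult_right_mono CD) auto
      finally show ?thesis by simp
    qed
    have m2: "\<bar>mean_diff n * ?\<omega>\<bar> \<le> D * ?s * \<bar>y\<bar>"
    proof -
      have "C5 * saddle n \<le> \<bar>C5\<bar> * 1" using saddle_le_1[OF n] saddle_pos[OF n] by (intro mult_mono) auto
      then have "\<bar>mean_diff n\<bar> \<le> \<bar>C5\<bar> + \<bar>shift / (2 * real N)\<bar>" using C5[OF n] by linarith
      also have "\<dots> \<le> D" by (rule CD)
      finally have "\<bar>mean_diff n\<bar> * (\<bar>y\<bar> * ?s) \<le> D * (\<bar>y\<bar> * ?s)" using s by (intro mult_right_mono) auto
      then show ?thesis using s by (simp add: abs_mult mult_ac)
    qed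
    have "\<bar>Y\<bar> \<le> 3072 * (?s * (\<bar>x\<bar> ^ 3 + \<bar>y\<bar> ^ 3)) + D * ?s * \<bar>x\<bar> + D * ?s * \<bar>y\<bar>"
      using RY(3) m1 m2 unfolding p3 Y_def left_diff_distrib by linarith
    also have "\<dots> \<le> C * (?s * (\<bar>x\<bar> ^ 3 + \<bar>y\<bar> ^ 3)) + C * ?s * \<bar>x\<bar> + C * ?s * \<bar>y\<bar>"
      using s D0 by (intro add_mono mult_right_mono) (auto simp: C_def)
    also have "\<dots> = C * ?s * (\<bar>x\<bar> + \<bar>y\<bar> + \<bar>x\<bar> ^ 3 + \<bar>y\<bar> ^ 3)" by (simp add: algebra_simps)
    finally have 3: "\<bar>Y\<bar> \<le> C * ?s * (\<bar>x\<bar> + \<bar>y\<bar> + \<bar>x\<bar> ^ 3 + \<bar>y\<bar> ^ 3)" .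
    show ?thesis using 1 2 3 by blast
  qed
  moreover have "0 < C" using D0 by (simp add: C_def)
  ultimately show ?thesis by blast
qed

text \<open>\<open>Phi_scaled_polar\<close> combined with \<open>exp_complex_perturb\<close>: the
  complex error is O(s), that of the real part O(s^2), and a weaker Gaussian survives as a factor of
  both. The bound on \<open>c\<close> is recorded so that the true Gaussian is later dominated by
  the square of the error Gaussian.\<close>

lemma major_arc:
  "\<exists>C>0. \<exists>c>0. \<exists>\<delta>>0. c \<le> 1 / (8 * N) \<and> (\<forall>\<^sub>F n in sequentially. \<forall>x y. \<bar>x\<bar> * scale n \<le> \<delta> \<longrightarrow> \<bar>y\<bar> * scale n \<le> \<delta> \<longrightarrow>
    cmod (Phi n (x * scale n ^ 3) (y * scale n) * cis (- (real n * (x * scale n ^ 3))) - of_real (exp (- gauss_exponent x y)))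
      \<le> C * scale n * exp (- (c * (x\<^sup>2 + y\<^sup>2))) \<and>
    \<bar>Re (Phi n (x * scale n ^ 3) (y * scale n) * cis (- (real n * (x * scale n ^ 3)))) - exp (- gauss_exponent x y)\<bar>
      \<le> C * (scale n)\<^sup>2 * exp (- (c * (x\<^sup>2 + y\<^sup>2))))"
proof -
  obtain C where C: "0 < C" "\<And>n x y. n \<ge> 1 \<Longrightarrow> \<bar>x\<bar> * scale n \<le> 1 / 4 \<Longrightarrow> \<bar>y\<bar> * scale n \<le> 1 / 4 \<Longrightarrow>
    (\<exists>R Y. Phi n (x * scale n ^ 3) (y * scale n) * cis (- (real n * (x * scale n ^ 3))) = exp (Complex (- gauss_exponent x y + R) Y) \<and>
      \<bar>R\<bar> \<le> C * (scale n)\<^sup>2 * ((x\<^sup>2 + y\<^sup>2) + (x\<^sup>2 + y\<^sup>2)\<^sup>2) \<and> \<bar>Y\<bar> \<le> C * scale n * (\<bar>x\<bar> + \<bar>y\<bar> + \<bar>x\<bar> ^ 3 + \<bar>y\<bar> ^ 3))"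
    using Phi_scaled_polar by blast
  have N: "real N \<ge> 2" using N_ge_2 by simp
  \<comment> \<open>Small enough, together with the bound on \<open>saddle n\<close> below, for |R|
    to use up at most half of (x^2 + y^2) / (2N), a lower bound of
    \<open>gauss_exponent\<close>.\<close>
  define \<delta> where "\<delta> = min (1 / 4) (1 / (16 * N * C))"
  have d: "0 < \<delta>" "\<delta> \<le> 1 / 4" "\<delta> \<le> 1 / (16 * N * C)" using N C by (auto simp: \<delta>_def)
  define a where "a = 1 / (4 * real N)"
  have a0: "0 < a" using N by (simp add: a_def)
  define M where "M = 48 / a ^ 3 * exp (a / 2)"
  have M0: "0 < M" using a0 by (simp add: M_def)
  define B where "B = (9 * C + 9 * C\<^sup>2) * M"
  have B0: "0 < B" using C M0 by (simp add: B_def add_pos_pos)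
  have ev: "\<forall>\<^sub>F n in sequentially. saddle n < 1 / (8 * N * C)"
    using N C by (intro eventually_saddle_less) auto
  have "\<forall>\<^sub>F n in sequentially. \<forall>x y. \<bar>x\<bar> * scale n \<le> \<delta> \<longrightarrow> \<bar>y\<bar> * scale n \<le> \<delta> \<longrightarrow>
    cmod (Phi n (x * scale n ^ 3) (y * scale n) * cis (- (real n * (x * scale n ^ 3))) - of_real (exp (- gauss_exponent x y)))
      \<le> B * scale n * exp (- (a / 2 * (x\<^sup>2 + y\<^sup>2))) \<and>
    \<bar>Re (Phi n (x * scale n ^ 3) (y * scale n) * cis (- (real n * (x * scale n ^ 3)))) - exp (- gauss_exponent x y)\<bar>
      \<le> B * (scale n)\<^sup>2 * exp (- (a / 2 * (x\<^sup>2 + y\<^sup>2)))"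
    using ev eventually_ge_at_top[of 1]
  proof eventually_elim
    case (elim n)
    then have n: "n \<ge> 1" by simp
    let ?s = "scale n"
    have s: "0 < ?s" "?s \<le> 1" using scale_pos scale_le_1 n by auto
    have s2: "?s\<^sup>2 \<le> 1 / (8 * N * C)" using elim scale_sq[OF n] by simp
    show ?case
    proof (intro allI impI)
      fix x y :: real
      assume x: "\<bar>x\<bar> * ?s \<le> \<delta>" and y: "\<bar>y\<bar> * ?s \<le> \<delta>"
      define S where "S = x\<^sup>2 + y\<^sup>2"
      have S0: "0 \<le> S" by (simp add: S_def)
      obtain R Y where RY: "Phi n (x * ?s ^ 3) (y * ?s) * cis (- (real n * (x * ?s ^ 3))) = exp (Complex (- gauss_exponent x y + R) Y)"
        "\<bar>R\<bar> \<le> C * ?s\<^sup>2 * (S + S\<^sup>2)" "\<bar>Y\<bar> \<le> C * ?s * (\<bar>x\<bar> + \<bar>y\<bar> + \<bar>x\<bar> ^ 3 + \<bar>y\<bar> ^ 3)"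
        using C(2)[OF n, of x y] x y d unfolding S_def by force
      have g: "S / (2 * N) \<le> gauss_exponent x y"
      proof -
        have "9 \<le> pi\<^sup>2" using power_mono[of 3 pi 2] pi_gt3 by simp
        moreover have "1 / (2 * N) \<le> 1 / 4" using N by (simp add: field_simps)
        ultimately have "1 / (2 * N) * x\<^sup>2 \<le> pi\<^sup>2 / 12 * x\<^sup>2" by (intro mult_right_mono) auto
        then show ?thesis by (simp add: S_def gauss_exponent_def add_divide_distrib)
      qed
      have R4: "\<bar>R\<bar> \<le> a * S"
      proof -
        have "?s\<^sup>2 * S \<le> 2 * \<delta>\<^sup>2"
        proof -
          have "(\<bar>x\<bar> * ?s)\<^sup>2 \<le> \<delta>\<^sup>2" "(\<bar>y\<bar> * ?s)\<^sup>2 \<le> \<delta>\<^sup>2" using x y s by (auto intro!: power_mono)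
          then show ?thesis by (simp add: S_def power_mult_distrib algebra_simps)
        qed
        also have "\<dots> \<le> 2 * (\<delta> * 1)" unfolding power2_eq_square using d by (intro mult_left_mono) auto
        also have "\<dots> \<le> 1 / (8 * N * C)" using d(3) by simp
        finally have "?s\<^sup>2 + ?s\<^sup>2 * S \<le> 1 / (8 * N * C) + 1 / (8 * N * C)" using s2 by (intro add_mono)
        then have "?s\<^sup>2 + ?s\<^sup>2 * S \<le> 2 / (8 * N * C)" by (simp only: add_divide_distrib[symmetric] one_add_one)
        then have "C * (?s\<^sup>2 + ?s\<^sup>2 * S) * S \<le> C * (2 / (8 * N * C)) * S" using C S0 by (intro mult_right_mono mult_left_mono) auto
        also have "C * (2 / (8 * N * C)) = a" using C N by (simp add: a_def field_simps)
        finally show ?thesis using RY(2) by (simp add: power2_eq_square algebra_simps)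
      qed
      have ex: "exp (- gauss_exponent x y + \<bar>R\<bar>) \<le> exp (- (a * S))"
      proof -
        have "S / (2 * N) = a * S + a * S" using N by (simp add: a_def field_simps)
        then show ?thesis using R4 g unfolding exp_le_cancel_iff by linarith
      qed
      have xle: "\<bar>x\<bar> \<le> 1 + S" "\<bar>y\<bar> \<le> 1 + S"
      proof -
        have "\<bar>z\<bar> \<le> 1 + z\<^sup>2" for z :: real using sum_squares_bound[of "\<bar>z\<bar>" 1] by (simp add: power2_eq_square)
        from this[of x] this[of y] show "\<bar>x\<bar> \<le> 1 + S" "\<bar>y\<bar> \<le> 1 + S"
          unfolding S_def using zero_le_power2[of x] zero_le_power2[of y] by linarith+
      qed
      have x3: "\<bar>z\<bar> ^ 3 \<le> (1 + S)\<^sup>2" if "\<bar>z\<bar> \<le> 1 + S" "z\<^sup>2 \<le> S" for z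
      proof -
        have "\<bar>z\<bar> ^ 3 = z\<^sup>2 * \<bar>z\<bar>" by (simp add: power3_eq_cube power2_eq_square)
        also have "\<dots> \<le> (1 + S) * (1 + S)" using that S0 by (intro mult_mono) auto
        finally show ?thesis by (simp add: power2_eq_square)
      qed
      have x3s: "\<bar>x\<bar> ^ 3 \<le> (1 + S)\<^sup>2" "\<bar>y\<bar> ^ 3 \<le> (1 + S)\<^sup>2" using x3 xle by (auto simp: S_def)
      have S1: "1 + S \<le> (1 + S)\<^sup>2" "(1 + S)\<^sup>2 \<le> (1 + S) ^ 3"
        using S0 by (auto intro: self_le_power power_increasing)
      have Yb: "\<bar>Y\<bar> \<le> C * ?s * (4 * (1 + S)\<^sup>2)"
      proof -
        have "\<bar>x\<bar> + \<bar>y\<bar> + \<bar>x\<bar> ^ 3 + \<bar>y\<bar> ^ 3 \<le> 4 * (1 + S)\<^sup>2" using xle x3s S1 by linarith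
        then show ?thesis using RY(3) C s by (meson mult_left_mono mult_nonneg_nonneg less_imp_le order_trans)
      qed
      have Rb: "\<bar>R\<bar> \<le> C * ?s\<^sup>2 * (1 + S) ^ 3"
      proof -
        have "S + S\<^sup>2 \<le> (1 + S)\<^sup>2" using S0 by (simp add: power2_sum)
        then have "S + S\<^sup>2 \<le> (1 + S) ^ 3" using S1 by linarith
        then show ?thesis using RY(2) C by (meson mult_left_mono mult_nonneg_nonneg less_imp_le zero_le_power2 order_trans)
      qed
      have Y2: "Y\<^sup>2 / 2 \<le> 8 * C\<^sup>2 * ?s\<^sup>2 * (1 + S) ^ 3"
      proof -
        have "\<bar>Y\<bar>\<^sup>2 \<le> (C * ?s * (\<bar>x\<bar> + \<bar>y\<bar> + \<bar>x\<bar> ^ 3 + \<bar>y\<bar> ^ 3))\<^sup>2" using RY(3) by (intro power_mono) auto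
        also have "\<dots> = C\<^sup>2 * ?s\<^sup>2 * (\<bar>x\<bar> + \<bar>y\<bar> + \<bar>x\<bar> ^ 3 + \<bar>y\<bar> ^ 3)\<^sup>2" by (simp add: power_mult_distrib)
        also have "(\<bar>x\<bar> + \<bar>y\<bar> + \<bar>x\<bar> ^ 3 + \<bar>y\<bar> ^ 3)\<^sup>2 \<le> 16 * (1 + S) ^ 3"
        proof -
          have sixth: "(\<bar>z\<bar> ^ 3)\<^sup>2 = (z\<^sup>2) ^ 3" for z :: real
            by (metis mult.commute power2_abs power_mult)
          have "(u + v + w + z)\<^sup>2 \<le> 4 * (u\<^sup>2 + v\<^sup>2 + w\<^sup>2 + z\<^sup>2)" for u v w z :: real
          proof -
            have "4 * (u\<^sup>2 + v\<^sup>2 + w\<^sup>2 + z\<^sup>2) - (u + v + w + z)\<^sup>2 = (u - v)\<^sup>2 + (u - w)\<^sup>2 + (u - z)\<^sup>2 + (v - w)\<^sup>2 + (v - z)\<^sup>2 + (w - z)\<^sup>2"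
              by (simp add: power2_eq_square algebra_simps)
            also have "\<dots> \<ge> 0" by simp
            finally show ?thesis by simp
          qed
          then have "(\<bar>x\<bar> + \<bar>y\<bar> + \<bar>x\<bar> ^ 3 + \<bar>y\<bar> ^ 3)\<^sup>2 \<le> 4 * (\<bar>x\<bar>\<^sup>2 + \<bar>y\<bar>\<^sup>2 + (\<bar>x\<bar> ^ 3)\<^sup>2 + (\<bar>y\<bar> ^ 3)\<^sup>2)" .
          also have "(\<bar>x\<bar> ^ 3)\<^sup>2 = (x\<^sup>2) ^ 3" by (rule sixth)
          also have "(\<bar>y\<bar> ^ 3)\<^sup>2 = (y\<^sup>2) ^ 3" by (rule sixth)
          also have "4 * (\<bar>x\<bar>\<^sup>2 + \<bar>y\<bar>\<^sup>2 + (x\<^sup>2) ^ 3 + (y\<^sup>2) ^ 3) \<le> 4 * ((1 + S) ^ 3 + (1 + S) ^ 3 + (1 + S) ^ 3 + (1 + S) ^ 3)"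
          proof -
            have z: "x\<^sup>2 \<le> 1 + S" "y\<^sup>2 \<le> 1 + S" by (auto simp: S_def)
            have "(x\<^sup>2) ^ 3 \<le> (1 + S) ^ 3" "(y\<^sup>2) ^ 3 \<le> (1 + S) ^ 3"
              by (rule power_mono[OF z(1) zero_le_power2], rule power_mono[OF z(2) zero_le_power2])
            then show ?thesis unfolding power2_abs
              using order_trans[OF z(1) order_trans[OF S1]] order_trans[OF z(2) order_trans[OF S1]]
              by (intro mult_left_mono add_mono) auto
          qed
          finally show ?thesis by simp
        qed
        finally have "\<bar>Y\<bar>\<^sup>2 \<le> C\<^sup>2 * ?s\<^sup>2 * (16 * (1 + S) ^ 3)" by (simp add: mult_left_mono)
        then show ?thesis by (simp add: mult_ac)
      qed
      have T: "(1 + S) ^ 3 * exp (- (a * S)) \<le> M * exp (- (a / 2 * S))"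
        unfolding M_def by (rule one_plus_cube_exp_bound[OF a0 S0])
      have "exp (- gauss_exponent x y + \<bar>R\<bar>) * (\<bar>R\<bar> + \<bar>Y\<bar>) \<le> exp (- (a * S)) * ((5 * C * ?s) * (1 + S) ^ 3)"
      proof (intro mult_mono ex)
        have "\<bar>R\<bar> \<le> C * ?s * (1 + S) ^ 3"
        proof -
          have "C * ?s\<^sup>2 * (1 + S) ^ 3 \<le> C * ?s * (1 + S) ^ 3"
            using s C S0 by (intro mult_right_mono mult_left_mono) (auto simp: power2_eq_square mult_left_le)
          then show ?thesis using Rb by linarith
        qed
        moreover have "\<bar>Y\<bar> \<le> C * ?s * (4 * (1 + S) ^ 3)"
        proof -
          have "C * ?s * (4 * (1 + S)\<^sup>2) \<le> C * ?s * (4 * (1 + S) ^ 3)" using s C S1 by (intro mult_left_mono) auto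
          then show ?thesis using Yb by linarith
        qed
        ultimately show "\<bar>R\<bar> + \<bar>Y\<bar> \<le> (5 * C * ?s) * (1 + S) ^ 3" by (simp add: algebra_simps)
      qed auto
      also have "\<dots> = (5 * C * ?s) * ((1 + S) ^ 3 * exp (- (a * S)))" by simp
      also have "\<dots> \<le> (5 * C * ?s) * (M * exp (- (a / 2 * S)))" using C s T by (intro mult_left_mono) auto
      also have "\<dots> = (5 * C * M) * ?s * exp (- (a / 2 * S))" by simp
      also have "\<dots> \<le> B * ?s * exp (- (a / 2 * S))"
      proof -
        have "0 \<le> C * M" "0 \<le> C\<^sup>2 * M" using C M0 by auto
        then have "5 * C * M \<le> B" by (simp add: B_def distrib_right mult.assoc)
        then show ?thesis using s by (intro mult_right_mono) auto
      qed
      finally have e1: "exp (- gauss_exponent x y + \<bar>R\<bar>) * (\<bar>R\<bar> + \<bar>Y\<bar>) \<le> B * ?s * exp (- (a / 2 * S))" .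
      have "exp (- gauss_exponent x y + \<bar>R\<bar>) * (\<bar>R\<bar> + Y\<^sup>2 / 2) \<le> exp (- (a * S)) * (((C + 8 * C\<^sup>2) * ?s\<^sup>2) * (1 + S) ^ 3)"
        using Rb Y2 by (intro mult_mono ex) (auto simp: algebra_simps)
      also have "\<dots> = ((C + 8 * C\<^sup>2) * ?s\<^sup>2) * ((1 + S) ^ 3 * exp (- (a * S)))" by simp
      also have "\<dots> \<le> ((C + 8 * C\<^sup>2) * ?s\<^sup>2) * (M * exp (- (a / 2 * S)))" using C T by (intro mult_left_mono) auto
      also have "\<dots> = ((C + 8 * C\<^sup>2) * M) * ?s\<^sup>2 * exp (- (a / 2 * S))" by simp
      also have "\<dots> \<le> B * ?s\<^sup>2 * exp (- (a / 2 * S))"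
        unfolding B_def using C M0 by (intro mult_right_mono) auto
      finally have e2: "exp (- gauss_exponent x y + \<bar>R\<bar>) * (\<bar>R\<bar> + Y\<^sup>2 / 2) \<le> B * ?s\<^sup>2 * exp (- (a / 2 * S))" .
      show "cmod (Phi n (x * ?s ^ 3) (y * ?s) * cis (- (real n * (x * ?s ^ 3))) - of_real (exp (- gauss_exponent x y)))
          \<le> B * ?s * exp (- (a / 2 * (x\<^sup>2 + y\<^sup>2))) \<and>
        \<bar>Re (Phi n (x * ?s ^ 3) (y * ?s) * cis (- (real n * (x * ?s ^ 3)))) - exp (- gauss_exponent x y)\<bar>
          \<le> B * ?s\<^sup>2 * exp (- (a / 2 * (x\<^sup>2 + y\<^sup>2)))"
        unfolding RY(1) S_def[symmetric] using exp_complex_perturb[of "- gauss_exponent x y" R Y] e1 e2 by linarith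
    qed
  qed
  moreover have "a / 2 \<le> 1 / (8 * N)" by (simp add: a_def)
  moreover have "0 < a / 2" using a0 by simp
  ultimately show ?thesis using B0 d(1) by blast
qed

section \<open>Integrals over the arcs\<close>

text \<open>One N-th of the circle. The N^2 translates of the square \<open>arc\<close> \<times>
  \<open>arc\<close> tile the torus, and a peak of \<Phi> can only sit at the centre of a
  translate.\<close>

definition arc :: "real set" where
  "arc = {- (pi / N)..pi / N}"

lemma arc_iff: "x \<in> arc \<longleftrightarrow> \<bar>x\<bar> \<le> pi / N"
  by (auto simp: arc_def)

lemma arc_measurable [measurable]: "arc \<in> sets borel"
  by (simp add: arc_def)

lemma arc_minus: "x \<in> arc \<Longrightarrow> - x \<in> arc"
  by (simp add: arc_iff)

lemma integrable_arc: "integrable lborel (indicator arc :: real \<Rightarrow> real)" "(\<integral>x. indicator arc x \<partial>lborel) = 2 * pi / N"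
  by (simp_all add: arc_def integrable_indicator_iff)

definition box_integral :: "(real \<Rightarrow> real \<Rightarrow> complex) \<Rightarrow> complex" where
  "box_integral f = (\<integral>z. indicator (arc \<times> arc) z *\<^sub>R f (fst z) (snd z) \<partial>(lborel \<Otimes>\<^sub>M lborel))"

definition arc_integral :: "(real \<Rightarrow> 'a) \<Rightarrow> 'a :: {banach, second_countable_topology}" where
  "arc_integral f = (\<integral>x. indicator arc x *\<^sub>R f x \<partial>lborel)"

definition gauss :: "real \<Rightarrow> real \<Rightarrow> real \<Rightarrow> real" where
  "gauss s \<theta> \<omega> = exp (- gauss_exponent (\<theta> / s ^ 3) (\<omega> / s))"

definition gauss_err :: "real \<Rightarrow> real \<Rightarrow> real \<Rightarrow> real \<Rightarrow> real" where
  "gauss_err c s \<theta> \<omega> = exp (- (c * ((\<theta> / s ^ 3)\<^sup>2 + (\<omega> / s)\<^sup>2)))"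

lemma gauss_err_pos: "0 < gauss_err c s \<theta> \<omega>"
  by (simp add: gauss_err_def)

lemma gauss_err_antimono: "c \<le> c' \<Longrightarrow> gauss_err c' s \<theta> \<omega> \<le> gauss_err c s \<theta> \<omega>"
  by (auto simp: gauss_err_def intro!: mult_right_mono add_nonneg_nonneg)

lemma gauss_exponent_ge: "(x\<^sup>2 + y\<^sup>2) / (2 * N) \<le> gauss_exponent x y"
proof -
  have N: "real N \<ge> 2" using N_ge_2 by simp
  have "9 \<le> pi\<^sup>2" using power_mono[of 3 pi 2] pi_gt3 by simp
  moreover have "1 / (2 * N) \<le> 1 / 4" using N by (simp add: field_simps)
  ultimately have "1 / (2 * N) * x\<^sup>2 \<le> pi\<^sup>2 / 12 * x\<^sup>2" by (intro mult_right_mono) auto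
  then show ?thesis by (simp add: gauss_exponent_def add_divide_distrib)
qed

lemma gauss_le_err:
  assumes "c \<le> 1 / (2 * N)"
  shows "gauss s \<theta> \<omega> \<le> gauss_err c s \<theta> \<omega>"
proof -
  have "c * ((\<theta> / s ^ 3)\<^sup>2 + (\<omega> / s)\<^sup>2) \<le> 1 / (2 * N) * ((\<theta> / s ^ 3)\<^sup>2 + (\<omega> / s)\<^sup>2)"
    using assms by (intro mult_right_mono) auto
  then show ?thesis using gauss_exponent_ge[of "\<theta> / s ^ 3" "\<omega> / s"] by (simp add: gauss_def gauss_err_def)
qed

lemma gauss_err_square: "gauss_err (2 * c) s \<theta> \<omega> = gauss_err c s \<theta> \<omega> * gauss_err c s \<theta> \<omega>"
  by (simp add: gauss_err_def exp_add[symmetric])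

lemma gauss_err_outside:
  assumes c: "0 < c" and s: "0 < s" "s \<le> 1" and r: "0 < r"
    and out: "\<bar>\<theta>\<bar> > r * s\<^sup>2 \<or> \<bar>\<omega>\<bar> > r"
  shows "gauss_err c s \<theta> \<omega> \<le> 1 / (c * r\<^sup>2) * s\<^sup>2"
proof -
  have "r\<^sup>2 / s\<^sup>2 \<le> (\<theta> / s ^ 3)\<^sup>2 + (\<omega> / s)\<^sup>2"
    using out
  proof
    assume "\<bar>\<theta>\<bar> > r * s\<^sup>2"
    then have "r / s \<le> \<bar>\<theta> / s ^ 3\<bar>" using s by (simp add: divide_simps eval_nat_numeral mult_ac)
    then have "(r / s)\<^sup>2 \<le> \<bar>\<theta> / s ^ 3\<bar>\<^sup>2" using r s by (intro power_mono) auto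
    then have "(r / s)\<^sup>2 \<le> (\<theta> / s ^ 3)\<^sup>2" by (simp only: power2_abs)
    then show ?thesis by (simp add: power_divide add_increasing2)
  next
    assume "\<bar>\<omega>\<bar> > r"
    then have "r / s \<le> \<bar>\<omega> / s\<bar>" using s by (simp add: divide_simps)
    then have "(r / s)\<^sup>2 \<le> \<bar>\<omega> / s\<bar>\<^sup>2" using r s by (intro power_mono) auto
    then have "(r / s)\<^sup>2 \<le> (\<omega> / s)\<^sup>2" by (simp only: power2_abs)
    then show ?thesis by (simp add: power_divide add_increasing)
  qed
  then have "c * (r\<^sup>2 / s\<^sup>2) \<le> c * ((\<theta> / s ^ 3)\<^sup>2 + (\<omega> / s)\<^sup>2)" using c by (intro mult_left_mono) auto
  then have "gauss_err c s \<theta> \<omega> \<le> exp (- (c * (r\<^sup>2 / s\<^sup>2)))"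
    unfolding gauss_err_def exp_le_cancel_iff by (rule le_imp_neg_le)
  also have "\<dots> \<le> 1 / (c * (r\<^sup>2 / s\<^sup>2))" using c r s by (intro exp_le_inverse) auto
  finally show ?thesis using s by simp
qed

lemma gauss_err_integral:
  assumes "0 < c" "0 < s"
  shows "integrable (lborel \<Otimes>\<^sub>M lborel) (\<lambda>z. gauss_err c s (fst z) (snd z))"
    "(\<integral>z. gauss_err c s (fst z) (snd z) \<partial>(lborel \<Otimes>\<^sub>M lborel)) = s ^ 4 * (pi / c)"
proof -
  have e: "gauss_err c s \<theta> \<omega> = exp (- ((c / s ^ 6) * \<theta>\<^sup>2)) * exp (- ((c / s\<^sup>2) * \<omega>\<^sup>2))" for \<theta> \<omega>
    by (simp add: gauss_err_def exp_add[symmetric] power_divide distrib_left flip: power_mult)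
  have "0 < c / s ^ 6" "0 < c / s\<^sup>2" using assms by auto
  note g = gaussian_integral[OF this(1)] gaussian_integral[OF this(2)]
  show "integrable (lborel \<Otimes>\<^sub>M lborel) (\<lambda>z. gauss_err c s (fst z) (snd z))"
    using integral_mult_pair(1)[OF g(1,3)] by (simp add: e case_prod_unfold)
  have "(\<integral>z. gauss_err c s (fst z) (snd z) \<partial>(lborel \<Otimes>\<^sub>M lborel)) = sqrt (pi / (c / s ^ 6)) * sqrt (pi / (c / s\<^sup>2))"
    using integral_mult_pair(2)[OF g(1,3)] g by (simp add: e case_prod_unfold)
  also have "\<dots> = sqrt ((s ^ 4 * (pi / c))\<^sup>2)"
    unfolding real_sqrt_mult[symmetric] by (rule arg_cong[where f = sqrt]) (simp add: power_mult_distrib power_divide power2_eq_square eval_nat_numeral)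
  finally show "(\<integral>z. gauss_err c s (fst z) (snd z) \<partial>(lborel \<Otimes>\<^sub>M lborel)) = s ^ 4 * (pi / c)"
    using assms by simp
qed

lemma gauss_integral:
  assumes "0 < s"
  shows "integrable (lborel \<Otimes>\<^sub>M lborel) (\<lambda>z. gauss s (fst z) (snd z))"
    "(\<integral>z. gauss s (fst z) (snd z) \<partial>(lborel \<Otimes>\<^sub>M lborel)) = s ^ 4 * sqrt (24 * N)"
proof -
  have N: "real N \<ge> 2" using N_ge_2 by simp
  have e: "gauss s \<theta> \<omega> = exp (- ((pi\<^sup>2 / 12 / s ^ 6) * \<theta>\<^sup>2)) * exp (- ((1 / (2 * N) / s\<^sup>2) * \<omega>\<^sup>2))" for \<theta> \<omega>
    by (simp add: gauss_def gauss_exponent_def exp_add[symmetric] power_divide distrib_left mult_ac flip: power_mult)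
  have "0 < pi\<^sup>2 / 12 / s ^ 6" "0 < 1 / (2 * N) / s\<^sup>2" using assms N by auto
  note g = gaussian_integral[OF this(1)] gaussian_integral[OF this(2)]
  show "integrable (lborel \<Otimes>\<^sub>M lborel) (\<lambda>z. gauss s (fst z) (snd z))"
    using integral_mult_pair(1)[OF g(1,3)] by (simp add: e case_prod_unfold)
  have "(\<integral>z. gauss s (fst z) (snd z) \<partial>(lborel \<Otimes>\<^sub>M lborel)) = sqrt (pi / (pi\<^sup>2 / 12 / s ^ 6)) * sqrt (pi / (1 / (2 * N) / s\<^sup>2))"
    using integral_mult_pair(2)[OF g(1,3)] g by (simp add: e case_prod_unfold)
  also have "\<dots> = sqrt ((s ^ 4)\<^sup>2 * (24 * N))"
    unfolding real_sqrt_mult[symmetric] by (rule arg_cong[where f = sqrt]) (simp add: power2_eq_square eval_nat_numeral)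
  also have "\<dots> = s ^ 4 * sqrt (24 * N)" using assms by (simp only: real_sqrt_mult real_sqrt_abs) simp
  finally show "(\<integral>z. gauss s (fst z) (snd z) \<partial>(lborel \<Otimes>\<^sub>M lborel)) = s ^ 4 * sqrt (24 * N)" .
qed

text \<open>The Gaussian is at most the square of the error Gaussian. Outside the square one of the
  two factors is O(s^2); the other stays as an integrable majorant.\<close>

lemma gauss_outside_arcs:
  assumes c: "0 < c" "c \<le> 1 / (8 * N)" and s: "0 < s" "s \<le> 1" and out: "\<not> (\<theta> \<in> arc \<and> \<omega> \<in> arc)"
  shows "gauss s \<theta> \<omega> \<le> 1 / (c * (pi / N)\<^sup>2) * s\<^sup>2 * gauss_err c s \<theta> \<omega>"
proof -
  have N: "real N \<ge> 2" using N_ge_2 by simp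
  have "2 * c \<le> 2 * (1 / (8 * N))" using c by simp
  also have "\<dots> \<le> 1 / (2 * N)" using N by (simp add: field_simps)
  finally have "gauss s \<theta> \<omega> \<le> gauss_err (2 * c) s \<theta> \<omega>" by (rule gauss_le_err)
  also have "\<dots> = gauss_err c s \<theta> \<omega> * gauss_err c s \<theta> \<omega>" by (rule gauss_err_square)
  also have "\<dots> \<le> (1 / (c * (pi / N)\<^sup>2) * s\<^sup>2) * gauss_err c s \<theta> \<omega>"
  proof (intro mult_right_mono gauss_err_outside)
    have "pi / N * s\<^sup>2 \<le> pi / N * 1" using s by (intro mult_left_mono) (auto simp: power_le_one)
    then show "\<bar>\<theta>\<bar> > (pi / N) * s\<^sup>2 \<or> \<bar>\<omega>\<bar> > pi / N" using out by (auto simp: arc_iff)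
  qed (use c s N less_imp_le[OF gauss_err_pos] in auto)
  finally show ?thesis .
qed

text \<open>Replaces an integral over the square by \<tau> times the Gaussian integral over the
  plane. The majorant s gauss_err + s^6 integrates to O(s^5). The constant is uniform in
  \<open>f\<close> and in \<tau> of modulus at most \<open>T\<close>, so one instance serves all N^2
  shifts; the pointwise bound is asked for \<omega> \<noteq> 0 only, which the sign kernel can
  provide.\<close>

lemma box_integral_approx:
  assumes c: "0 < c" "c \<le> 1 / (8 * N)" and A: "0 \<le> A" and T: "0 \<le> T"
  shows "\<exists>C>0. \<forall>s f \<tau>. 0 < s \<longrightarrow> s \<le> 1 \<longrightarrow> (\<lambda>z. f (fst z) (snd z)) \<in> borel_measurable (lborel \<Otimes>\<^sub>M lborel) \<longrightarrow> cmod \<tau> \<le> T \<longrightarrow>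
    (\<forall>\<theta>\<in>arc. \<forall>\<omega>\<in>arc. \<omega> \<noteq> 0 \<longrightarrow> cmod (f \<theta> \<omega> - \<tau> * of_real (gauss s \<theta> \<omega>)) \<le> A * (s * gauss_err c s \<theta> \<omega> + s ^ 6)) \<longrightarrow>
    integrable (lborel \<Otimes>\<^sub>M lborel) (\<lambda>z. indicator (arc \<times> arc) z *\<^sub>R f (fst z) (snd z)) \<and>
    cmod (box_integral f - \<tau> * of_real (s ^ 4 * sqrt (24 * N))) \<le> C * s ^ 5"
proof -
  have N: "real N \<ge> 2" using N_ge_2 by simp
  let ?M = "lborel \<Otimes>\<^sub>M lborel :: (real \<times> real) measure"
  define C1 where "C1 = 1 / (c * (pi / N)\<^sup>2)"
  have C1: "0 < C1" using c N by (simp add: C1_def)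
  define C where "C = (A + T * C1) * (pi / c) + A * (2 * pi / N)\<^sup>2 + 1"
  have C0: "0 < C" using A T C1 c by (simp add: C_def add_nonneg_pos)
  have "integrable ?M (\<lambda>z. indicator (arc \<times> arc) z *\<^sub>R f (fst z) (snd z)) \<and>
    cmod (box_integral f - \<tau> * of_real (s ^ 4 * sqrt (24 * N))) \<le> C * s ^ 5"
    if s: "0 < s" "s \<le> 1" and fm[measurable]: "(\<lambda>z. f (fst z) (snd z)) \<in> borel_measurable ?M" and tau: "cmod \<tau> \<le> T"
      and b: "\<And>\<theta> \<omega>. \<theta> \<in> arc \<Longrightarrow> \<omega> \<in> arc \<Longrightarrow> \<omega> \<noteq> 0 \<Longrightarrow> cmod (f \<theta> \<omega> - \<tau> * of_real (gauss s \<theta> \<omega>)) \<le> A * (s * gauss_err c s \<theta> \<omega> + s ^ 6)"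
    for s f \<tau>
  proof -
    define B where "B = (\<lambda>z::real \<times> real. indicator (arc \<times> arc) z :: real)"
    define h where "h = (\<lambda>z. (A + T * C1) * s * gauss_err c s (fst z) (snd z) + A * s ^ 6 * B z)"
    define d where "d = (\<lambda>z. B z *\<^sub>R f (fst z) (snd z) - \<tau> * of_real (gauss s (fst z) (snd z)))"
    have Be: "B = (\<lambda>(x, y). indicator arc x * indicator arc y)"
      by (auto simp: B_def indicator_def fun_eq_iff)
    have B: "integrable ?M B" "(\<integral>z. B z \<partial>?M) = (2 * pi / N)\<^sup>2"
      unfolding Be using integral_mult_pair[OF integrable_arc(1) integrable_arc(1)] integrable_arc(2)
      by (auto simp: power2_eq_square)
    have G: "integrable ?M (\<lambda>z. \<tau> * of_real (gauss s (fst z) (snd z)))"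
      using gauss_integral(1)[OF s(1)] by simp
    have Gi: "(\<integral>z. \<tau> * of_real (gauss s (fst z) (snd z)) \<partial>?M) = \<tau> * of_real (s ^ 4 * sqrt (24 * N))"
      using gauss_integral[OF s(1)] by simp
    have h: "integrable ?M h" unfolding h_def
      using gauss_err_integral(1)[OF c(1) s(1)] B(1) by (intro Bochner_Integration.integrable_add Bochner_Integration.integrable_mult_right) auto
    have hi: "(\<integral>z. h z \<partial>?M) = (A + T * C1) * s * (s ^ 4 * (pi / c)) + A * s ^ 6 * (2 * pi / N)\<^sup>2"
      unfolding h_def using gauss_err_integral[OF c(1) s(1)] B by (subst Bochner_Integration.integral_add) auto
    have bound: "cmod (d z) \<le> h z" if "snd z \<noteq> 0" for z
    proof (cases "fst z \<in> arc \<and> snd z \<in> arc")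
      case True
      then have Bz: "B z = 1" by (cases z) (simp add: B_def)
      have "cmod (d z) \<le> A * (s * gauss_err c s (fst z) (snd z) + s ^ 6)"
        unfolding d_def Bz using b True that by simp
      also have "\<dots> \<le> h z" unfolding h_def Bz using T C1 s gauss_err_pos[of c s "fst z" "snd z"]
        by (simp add: algebra_simps)
      finally show ?thesis .
    next
      case False
      then have Bz: "B z = 0" by (cases z) (auto simp: B_def)
      have "cmod (d z) = cmod \<tau> * gauss s (fst z) (snd z)" by (simp add: d_def Bz norm_mult gauss_def)
      also have "\<dots> \<le> T * (C1 * s\<^sup>2 * gauss_err c s (fst z) (snd z))"
        using tau T gauss_outside_arcs[OF c s False] unfolding C1_def by (intro mult_mono) (auto simp: gauss_def)
      also have "\<dots> \<le> T * (C1 * s * gauss_err c s (fst z) (snd z))"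
        using T C1 s gauss_err_pos[of c s "fst z" "snd z"]
        by (intro mult_left_mono mult_right_mono) (auto simp: power2_eq_square mult_left_le)
      also have "\<dots> \<le> h z" unfolding h_def Bz using A s gauss_err_pos[of c s "fst z" "snd z"]
        by (simp add: algebra_simps)
      finally show ?thesis .
    qed
    have [measurable]: "d \<in> borel_measurable ?M"
      unfolding d_def B_def using G by measurable
    have ae: "AE z in ?M. cmod (d z) \<le> h z" using AE_snd_neq by eventually_elim (rule bound)
    have d: "integrable ?M d"
      by (rule Bochner_Integration.integrable_bound[OF h]) (use ae in \<open>auto elim: eventually_mono\<close>)
    have i: "integrable ?M (\<lambda>z. B z *\<^sub>R f (fst z) (snd z))"
      using Bochner_Integration.integrable_add[OF d G] by (simp add: d_def)
    have "box_integral f - \<tau> * of_real (s ^ 4 * sqrt (24 * N)) = (\<integral>z. d z \<partial>?M)"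
      unfolding d_def box_integral_def Gi[symmetric] using Bochner_Integration.integral_diff[OF i G] by (simp add: B_def)
    also have "cmod \<dots> \<le> (\<integral>z. h z \<partial>?M)"
      by (rule order_trans[OF integral_norm_bound integral_mono_AE]) (use d h ae in auto)
    also have "\<dots> \<le> C * s ^ 5"
    proof -
      have "A * s ^ 6 * (2 * pi / N)\<^sup>2 \<le> A * s ^ 5 * (2 * pi / N)\<^sup>2"
        using A s by (intro mult_right_mono mult_left_mono power_decreasing) auto
      then have "(\<integral>z. h z \<partial>?M) \<le> (A + T * C1) * (pi / c) * s ^ 5 + A * (2 * pi / N)\<^sup>2 * s ^ 5"
        unfolding hi by (simp add: eval_nat_numeral mult_ac)
      also have "\<dots> \<le> C * s ^ 5" using s by (simp add: C_def distrib_right)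
      finally show ?thesis .
    qed
    finally show ?thesis using i by (simp add: B_def)
  qed
  then show ?thesis using C0 by blast
qed

text \<open>In one dimension the Gaussian integral has size s^3, so it takes the factor s^2 of the
  real part estimate to reach the error s^5 again.\<close>

lemma arc_integral_approx:
  assumes c: "0 < c" "c \<le> 1 / (8 * N)" and A: "0 \<le> A" and T: "0 \<le> T"
  shows "\<exists>C>0. \<forall>s f \<tau>. 0 < s \<longrightarrow> s \<le> 1 \<longrightarrow> f \<in> borel_measurable lborel \<longrightarrow> \<bar>\<tau>\<bar> \<le> T \<longrightarrow>
    (\<forall>\<theta>\<in>arc. \<bar>f \<theta> - \<tau> * gauss s \<theta> 0\<bar> \<le> A * (s\<^sup>2 * gauss_err c s \<theta> 0 + s ^ 6)) \<longrightarrow>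
    \<bar>arc_integral f - \<tau> * (s ^ 3 * sqrt (12 / pi))\<bar> \<le> C * s ^ 5"
proof -
  have N: "real N \<ge> 2" using N_ge_2 by simp
  define C1 where "C1 = 1 / (c * (pi / N)\<^sup>2)"
  have C1: "0 < C1" using c N by (simp add: C1_def)
  define C where "C = (A + T * C1) * sqrt (pi / c) + A * (2 * pi / N) + 1"
  have C0: "0 < C" using A T C1 c by (simp add: C_def add_nonneg_pos)
  have "\<bar>arc_integral f - \<tau> * (s ^ 3 * sqrt (12 / pi))\<bar> \<le> C * s ^ 5"
    if s: "0 < s" "s \<le> 1" and fm[measurable]: "f \<in> borel_measurable lborel" and tau: "\<bar>\<tau>\<bar> \<le> T"
      and b: "\<And>\<theta>. \<theta> \<in> arc \<Longrightarrow> \<bar>f \<theta> - \<tau> * gauss s \<theta> 0\<bar> \<le> A * (s\<^sup>2 * gauss_err c s \<theta> 0 + s ^ 6)"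
    for s f \<tau>
  proof -
    let ?B = "indicator arc :: real \<Rightarrow> real"
    have E0: "gauss_err c s \<theta> 0 = exp (- ((c / s ^ 6) * \<theta>\<^sup>2))" for \<theta>
      by (simp add: gauss_err_def power_divide flip: power_mult)
    have G0: "gauss s \<theta> 0 = exp (- ((pi\<^sup>2 / 12 / s ^ 6) * \<theta>\<^sup>2))" for \<theta>
      by (simp add: gauss_def gauss_exponent_def power_divide flip: power_mult)
    have "0 < c / s ^ 6" "0 < pi\<^sup>2 / 12 / s ^ 6" using c s by auto
    note g = gaussian_integral[OF this(1), folded E0] gaussian_integral[OF this(2), folded G0]
    have sE: "sqrt (pi / (c / s ^ 6)) = s ^ 3 * sqrt (pi / c)"
    proof -
      have e: "pi / (c / s ^ 6) = (s ^ 3)\<^sup>2 * (pi / c)" by (simp flip: power_mult)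
      show ?thesis unfolding e real_sqrt_mult real_sqrt_abs using s by simp
    qed
    have sG: "sqrt (pi / (pi\<^sup>2 / 12 / s ^ 6)) = s ^ 3 * sqrt (12 / pi)"
    proof -
      have e: "pi / (pi\<^sup>2 / 12 / s ^ 6) = (s ^ 3)\<^sup>2 * (12 / pi)" by (simp add: power2_eq_square flip: power_add)
      show ?thesis unfolding e real_sqrt_mult real_sqrt_abs using s by simp
    qed
    define h where "h = (\<lambda>\<theta>. (A + T * C1) * s\<^sup>2 * gauss_err c s \<theta> 0 + A * s ^ 6 * ?B \<theta>)"
    define d where "d = (\<lambda>\<theta>. ?B \<theta> *\<^sub>R f \<theta> - \<tau> * gauss s \<theta> 0)"
    have h: "integrable lborel h" unfolding h_def
      using g(1) integrable_arc(1) by (intro Bochner_Integration.integrable_add Bochner_Integration.integrable_mult_right) auto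
    have hi: "(\<integral>z. h z \<partial>lborel) = (A + T * C1) * s\<^sup>2 * (s ^ 3 * sqrt (pi / c)) + A * s ^ 6 * (2 * pi / N)"
      unfolding h_def using g integrable_arc sE by (subst Bochner_Integration.integral_add) auto
    have bound: "\<bar>d z\<bar> \<le> h z" for z
    proof (cases "z \<in> arc")
      case True
      then have "\<bar>d z\<bar> \<le> A * (s\<^sup>2 * gauss_err c s z 0 + s ^ 6)" unfolding d_def using b by simp
      also have "\<dots> \<le> h z" unfolding h_def using True T C1 s gauss_err_pos[of c s z 0]
        by (simp add: algebra_simps)
      finally show ?thesis .
    next
      case False
      then have "\<bar>d z\<bar> = \<bar>\<tau>\<bar> * gauss s z 0" by (simp add: d_def abs_mult gauss_def)
      also have "\<dots> \<le> T * (C1 * s\<^sup>2 * gauss_err c s z 0)"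
        using tau T gauss_outside_arcs[OF c s, of z 0] False unfolding C1_def by (intro mult_mono) (auto simp: gauss_def)
      also have "\<dots> \<le> h z" unfolding h_def using False A s gauss_err_pos[of c s z 0]
        by (simp add: algebra_simps)
      finally show ?thesis .
    qed
    have G: "integrable lborel (\<lambda>\<theta>. \<tau> * gauss s \<theta> 0)" using g(3) by simp
    have [measurable]: "d \<in> borel_measurable lborel"
      unfolding d_def using G by measurable
    have d: "integrable lborel d"
      by (rule Bochner_Integration.integrable_bound[OF h]) (use order_trans[OF bound abs_ge_self] in \<open>auto intro!: always_eventually\<close>)
    have i: "integrable lborel (\<lambda>z. ?B z *\<^sub>R f z)"
      using Bochner_Integration.integrable_add[OF d G] by (simp add: d_def)
    have "arc_integral f - \<tau> * (s ^ 3 * sqrt (12 / pi)) = (\<integral>z. d z \<partial>lborel)"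
      unfolding d_def arc_integral_def using Bochner_Integration.integral_diff[OF i G] g(4) sG by simp
    also have "\<bar>\<dots>\<bar> \<le> (\<integral>z. h z \<partial>lborel)"
      by (rule order_trans[OF integral_abs_bound integral_mono]) (use d h bound in auto)
    also have "\<dots> \<le> C * s ^ 5"
    proof -
      have "A * s ^ 6 * (2 * pi / N) \<le> A * s ^ 5 * (2 * pi / N)"
        using A s by (intro mult_right_mono mult_left_mono power_decreasing) auto
      then have "(\<integral>z. h z \<partial>lborel) \<le> (A + T * C1) * sqrt (pi / c) * s ^ 5 + A * (2 * pi / N) * s ^ 5"
        unfolding hi by (simp add: eval_nat_numeral mult_ac)
      also have "\<dots> \<le> C * s ^ 5" using s by (simp add: C_def distrib_right)
      finally show ?thesis .
    qed
    finally show ?thesis .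
  qed
  then show ?thesis using C0 by blast
qed

text \<open>The exponent 12 leaves s^6 after the later division by t^3 = s^6 in the bound for the
  sign kernel. The term of degree 7 of the exponential series gives t^7, and one factor t pays for
  the constant.\<close>

lemma eventually_exp_saddle_le:
  assumes "0 < c"
  shows "\<forall>\<^sub>F n in sequentially. exp (- (c / saddle n)) \<le> scale n ^ 12"
proof -
  have ev: "\<forall>\<^sub>F n in sequentially. saddle n < c ^ 7 / fact 7" using assms by (intro eventually_saddle_less) auto
  show ?thesis using ev eventually_ge_at_top[of 1]
  proof eventually_elim
    case (elim n)
    have t: "0 < saddle n" using saddle_pos elim by simp
    have "(c / saddle n) ^ 7 / fact 7 \<le> exp (c / saddle n)"
      using assms t by (intro power_div_fact_le_exp) auto
    then have "c ^ 7 / fact 7 \<le> saddle n ^ 7 * exp (c / saddle n)" using t by (simp add: power_divide field_simps)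
    then have "saddle n * 1 \<le> saddle n * (saddle n ^ 6 * exp (c / saddle n))" using elim by (simp add: eval_nat_numeral mult_ac)
    then have "1 \<le> saddle n ^ 6 * exp (c / saddle n)" using t by (subst (asm) mult_le_cancel_left_pos) auto
    then have "exp (- (c / saddle n)) \<le> saddle n ^ 6" by (simp add: exp_minus field_simps)
    also have "\<dots> = ((scale n)\<^sup>2) ^ 6" using scale_sq[of n] elim by simp
    also have "\<dots> = scale n ^ 12" by (simp only: power_mult[symmetric]) simp
    finally show ?case .
  qed
qed

text \<open>One pointwise bound on the whole square for every shift: near a resonance it is
  \<open>major_arc\<close>; elsewhere \<Phi> is tiny by \<open>minor_arc\<close>, and the Gaussian,
  if present, is O(s^2) times the error Gaussian.\<close>

lemma Phi_approx:
  "\<exists>C>0. \<exists>c>0. c \<le> 1 / (8 * N) \<and> (\<forall>\<^sub>F n in sequentially. \<forall>a b. \<forall>\<theta>\<in>arc. \<forall>\<omega>\<in>arc.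
    cmod (Phi n (\<theta> + 2 * pi * of_int a / N) (\<omega> + 2 * pi * of_int b / N) * cis (- (real n * \<theta>)) - (if resonant a b then of_real (gauss (scale n) \<theta> \<omega>) else 0))
      \<le> C * (scale n * gauss_err c (scale n) \<theta> \<omega> + scale n ^ 6) \<and>
    \<bar>Re (Phi n (\<theta> + 2 * pi * of_int a / N) (\<omega> + 2 * pi * of_int b / N) * cis (- (real n * \<theta>))) - (if resonant a b then gauss (scale n) \<theta> \<omega> else 0)\<bar>
      \<le> C * ((scale n)\<^sup>2 * gauss_err c (scale n) \<theta> \<omega> + scale n ^ 6))"
proof -
  obtain C c \<delta> where M: "0 < C" "0 < c" "0 < \<delta>" "c \<le> 1 / (8 * N)"
    and ev1: "\<forall>\<^sub>F n in sequentially. \<forall>x y. \<bar>x\<bar> * scale n \<le> \<delta> \<longrightarrow> \<bar>y\<bar> * scale n \<le> \<delta> \<longrightarrow>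
    cmod (Phi n (x * scale n ^ 3) (y * scale n) * cis (- (real n * (x * scale n ^ 3))) - of_real (exp (- gauss_exponent x y)))
      \<le> C * scale n * exp (- (c * (x\<^sup>2 + y\<^sup>2))) \<and>
    \<bar>Re (Phi n (x * scale n ^ 3) (y * scale n) * cis (- (real n * (x * scale n ^ 3)))) - exp (- gauss_exponent x y)\<bar>
      \<le> C * (scale n)\<^sup>2 * exp (- (c * (x\<^sup>2 + y\<^sup>2)))"
    using major_arc by blast
  have N: "real N \<ge> 2" using N_ge_2 by simp
  obtain c2 where c2: "0 < c2" and ev2: "\<forall>\<^sub>F n in sequentially. \<forall>a b \<theta> \<omega>. \<bar>\<theta>\<bar> \<le> pi / N \<longrightarrow> \<bar>\<omega>\<bar> \<le> pi / N \<longrightarrow>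
    \<not> (resonant a b \<and> \<bar>\<theta>\<bar> \<le> \<delta> * saddle n \<and> \<bar>\<omega>\<bar> \<le> \<delta>) \<longrightarrow>
    cmod (Phi n (\<theta> + 2 * pi * of_int a / N) (\<omega> + 2 * pi * of_int b / N)) \<le> exp (- (c2 / saddle n))"
    using minor_arc[OF M(3)] by blast
  define C1 where "C1 = 1 / (c * \<delta>\<^sup>2)"
  have C1: "0 < C1" using M by (simp add: C1_def)
  define D where "D = C + C1 + 1"
  have D0: "0 < D" using M C1 by (simp add: D_def)
  have "\<forall>\<^sub>F n in sequentially. \<forall>a b. \<forall>\<theta>\<in>arc. \<forall>\<omega>\<in>arc.
    cmod (Phi n (\<theta> + 2 * pi * of_int a / N) (\<omega> + 2 * pi * of_int b / N) * cis (- (real n * \<theta>)) - (if resonant a b then of_real (gauss (scale n) \<theta> \<omega>) else 0))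
      \<le> D * (scale n * gauss_err c (scale n) \<theta> \<omega> + scale n ^ 6) \<and>
    \<bar>Re (Phi n (\<theta> + 2 * pi * of_int a / N) (\<omega> + 2 * pi * of_int b / N) * cis (- (real n * \<theta>))) - (if resonant a b then gauss (scale n) \<theta> \<omega> else 0)\<bar>
      \<le> D * ((scale n)\<^sup>2 * gauss_err c (scale n) \<theta> \<omega> + scale n ^ 6)"
    using ev1 ev2 eventually_exp_saddle_le[OF c2] eventually_ge_at_top[of 1]
  proof eventually_elim
    case (elim n)
    let ?s = "scale n"
    have n: "n \<ge> 1" using elim by simp
    have s: "0 < ?s" "?s \<le> 1" "saddle n = ?s\<^sup>2" using scale_pos scale_le_1 scale_sq n by auto
    show ?case
    proof (intro allI ballI)
      fix a b :: int and \<theta> \<omega> :: real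
      assume arcs: "\<theta> \<in> arc" "\<omega> \<in> arc"
      let ?P = "Phi n (\<theta> + 2 * pi * of_int a / N) (\<omega> + 2 * pi * of_int b / N)"
      let ?E = "gauss_err c ?s \<theta> \<omega>"
      have E0: "0 < ?E" by (rule gauss_err_pos)
      show "cmod (?P * cis (- (real n * \<theta>)) - (if resonant a b then of_real (gauss ?s \<theta> \<omega>) else 0)) \<le> D * (?s * ?E + ?s ^ 6) \<and>
        \<bar>Re (?P * cis (- (real n * \<theta>))) - (if resonant a b then gauss ?s \<theta> \<omega> else 0)\<bar> \<le> D * (?s\<^sup>2 * ?E + ?s ^ 6)"
      proof (cases "resonant a b \<and> \<bar>\<theta>\<bar> \<le> \<delta> * saddle n \<and> \<bar>\<omega>\<bar> \<le> \<delta>")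
        case True
        have P: "?P = Phi n \<theta> \<omega>" using Phi_resonant True by blast
        let ?x = "\<theta> / ?s ^ 3" let ?y = "\<omega> / ?s"
        have x: "?x * ?s ^ 3 = \<theta>" "?y * ?s = \<omega>" using s by auto
        have "\<bar>?x\<bar> * ?s \<le> \<delta>" using True s by (simp add: abs_divide divide_simps eval_nat_numeral mult_ac)
        moreover have "\<bar>?y\<bar> * ?s \<le> \<delta>" using True s by (simp add: abs_divide)
        ultimately have "cmod (Phi n (?x * ?s ^ 3) (?y * ?s) * cis (- (real n * (?x * ?s ^ 3))) - of_real (exp (- gauss_exponent ?x ?y))) \<le> C * ?s * exp (- (c * (?x\<^sup>2 + ?y\<^sup>2))) \<and>
          \<bar>Re (Phi n (?x * ?s ^ 3) (?y * ?s) * cis (- (real n * (?x * ?s ^ 3)))) - exp (- gauss_exponent ?x ?y)\<bar> \<le> C * ?s\<^sup>2 * exp (- (c * (?x\<^sup>2 + ?y\<^sup>2)))"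
          using elim(1) by blast
        then have "cmod (?P * cis (- (real n * \<theta>)) - of_real (gauss ?s \<theta> \<omega>)) \<le> C * ?s * ?E"
          "\<bar>Re (?P * cis (- (real n * \<theta>))) - gauss ?s \<theta> \<omega>\<bar> \<le> C * ?s\<^sup>2 * ?E"
          unfolding x P gauss_def gauss_err_def by auto
        moreover have "C * u * ?E \<le> D * (u * ?E + ?s ^ 6)" if "0 \<le> u" for u
        proof -
          have "C * (u * ?E) \<le> D * (u * ?E)" using that M C1 E0 by (intro mult_right_mono) (auto simp: D_def less_imp_le)
          moreover have "0 \<le> D * ?s ^ 6" using D0 s by simp
          ultimately show ?thesis by (simp add: distrib_left mult.assoc)
        qed
        from this[of ?s] this[of "?s\<^sup>2"] have "C * ?s * ?E \<le> D * (?s * ?E + ?s ^ 6)" "C * ?s\<^sup>2 * ?E \<le> D * (?s\<^sup>2 * ?E + ?s ^ 6)"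
          using s by auto
        ultimately show ?thesis using True by (simp only: if_True) linarith
      next
        case False
        have "cmod ?P \<le> exp (- (c2 / saddle n))" using elim(2) False arcs by (auto simp: arc_iff)
        also have "\<dots> \<le> ?s ^ 12" by (rule elim(3))
        also have "\<dots> \<le> ?s ^ 6" using s by (intro power_decreasing) auto
        finally have P: "cmod (?P * cis (- (real n * \<theta>))) \<le> ?s ^ 6" by (simp add: norm_mult)
        have G: "gauss ?s \<theta> \<omega> \<le> C1 * ?s\<^sup>2 * ?E" if "resonant a b"
        proof -
          have out: "\<bar>\<theta>\<bar> > \<delta> * ?s\<^sup>2 \<or> \<bar>\<omega>\<bar> > \<delta>" using False that s by auto
          have "2 * c \<le> 2 * (1 / (8 * N))" using M by simp
          also have "\<dots> \<le> 1 / (2 * N)" using N by (simp add: field_simps)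
          finally have "gauss ?s \<theta> \<omega> \<le> ?E * ?E" unfolding gauss_err_square[symmetric] by (rule gauss_le_err)
          also have "\<dots> \<le> (C1 * ?s\<^sup>2) * ?E" unfolding C1_def
            using gauss_err_outside[OF M(2) s(1,2) M(3) out] E0 by (intro mult_right_mono) auto
          finally show ?thesis .
        qed
        have 1: "cmod (?P * cis (- (real n * \<theta>)) - (if resonant a b then of_real (gauss ?s \<theta> \<omega>) else 0)) \<le> ?s ^ 6 + C1 * ?s\<^sup>2 * ?E"
        proof (cases "resonant a b")
          case True
          have "cmod (?P * cis (- (real n * \<theta>)) - of_real (gauss ?s \<theta> \<omega>)) \<le> cmod (?P * cis (- (real n * \<theta>))) + \<bar>gauss ?s \<theta> \<omega>\<bar>"
            by (rule order_trans[OF norm_triangle_ineq4]) simp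
          then show ?thesis using P G[OF True] True by (simp add: gauss_def)
        next
          case F: False
          have "0 \<le> C1 * ?s\<^sup>2 * ?E" using C1 E0 by simp
          then show ?thesis using P F by simp
        qed
        have 2: "\<bar>Re (?P * cis (- (real n * \<theta>))) - (if resonant a b then gauss ?s \<theta> \<omega> else 0)\<bar> \<le> ?s ^ 6 + C1 * ?s\<^sup>2 * ?E"
        proof -
          have e: "Re (?P * cis (- (real n * \<theta>))) - (if resonant a b then gauss ?s \<theta> \<omega> else 0) = Re (?P * cis (- (real n * \<theta>)) - (if resonant a b then of_real (gauss ?s \<theta> \<omega>) else 0))"
            by (cases "resonant a b") (simp_all only: minus_complex.sel if_True if_False Re_complex_of_real zero_complex.sel)
          show ?thesis unfolding e by (rule order_trans[OF abs_Re_le_cmod 1])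
        qed
        have 3: "?s ^ 6 + C1 * ?s\<^sup>2 * ?E \<le> D * (?s\<^sup>2 * ?E + ?s ^ 6)"
        proof -
          have "1 * ?s ^ 6 \<le> D * ?s ^ 6" using M C1 s by (intro mult_right_mono) (auto simp: D_def)
          moreover have "C1 * (?s\<^sup>2 * ?E) \<le> D * (?s\<^sup>2 * ?E)"
            using M C1 E0 by (intro mult_right_mono) (auto simp: D_def less_imp_le)
          ultimately show ?thesis by (simp add: distrib_left mult.assoc)
        qed
        have "D * (?s\<^sup>2 * ?E + ?s ^ 6) \<le> D * (?s * ?E + ?s ^ 6)"
          using D0 s E0 by (intro mult_left_mono add_right_mono mult_right_mono) (auto simp: power2_eq_square mult_left_le)
        then show ?thesis using 1 2 3 by linarith
      qed
    qed
  qed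
  then show ?thesis using D0 M by blast
qed

section \<open>Extraction of coefficients by Fourier inversion\<close>

definition part_diff :: "nat set \<Rightarrow> int" where
  "part_diff A = (\<Sum>m\<in>A. chi m)"

lemma gf_pos: "0 < gf n"
  unfolding gf_def by (intro prod_pos) (auto intro: add_pos_pos)

text \<open>(1 + e^(-tm)) (1 + p (c - 1)) = 1 + e^(-tm) c, so multiplication by \<open>gf\<close>
  turns \<Phi> back into the generating function, which is then expanded over the subsets of
  \<open>parts\<close>.\<close>

lemma gf_Phi_expansion:
  "of_real (gf n) * Phi n \<theta> \<omega> = (\<Sum>A\<in>Pow (parts n). of_real (exp (- (saddle n * real (\<Sum>A)))) * (cis (real (\<Sum>A) * \<theta>) * cis (of_int (part_diff A) * \<omega>)))"
proof -
  let ?t = "saddle n"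
  let ?x = "\<lambda>m. of_real (exp (- (?t * real m))) * cis (real m * \<theta> + of_int (chi m) * \<omega>)"
  have f: "of_real (1 + exp (- (?t * real m))) * (1 + of_real (fermi ?t m) * (cis (real m * \<theta> + of_int (chi m) * \<omega>) - 1)) = ?x m + 1" for m
  proof -
    have "1 + exp (- (?t * real m)) \<noteq> 0" by (smt (verit) exp_gt_zero)
    then have "of_real (1 + exp (- (?t * real m))) * (of_real (fermi ?t m) :: complex) = of_real (exp (- (?t * real m)))"
      unfolding of_real_mult[symmetric] fermi_eq by (intro arg_cong[where f = of_real]) simp
    then have "of_real (1 + exp (- (?t * real m))) * (1 + of_real (fermi ?t m) * (c - 1)) = of_real (1 + exp (- (?t * real m))) + of_real (exp (- (?t * real m))) * (c - 1)" for c :: complex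
      by (simp only: distrib_left mult.assoc[symmetric] mult_1_right)
    then show ?thesis by (simp only:) (simp add: algebra_simps)
  qed
  have "of_real (gf n) * Phi n \<theta> \<omega> = (\<Prod>m\<in>parts n. ?x m + 1)"
    unfolding gf_def Phi_def of_real_prod prod.distrib[symmetric] f ..
  also have "\<dots> = (\<Sum>A\<in>Pow (parts n). prod ?x A * prod (\<lambda>_. 1) (parts n - A))"
    by (rule prod_add) simp
  also have "\<dots> = (\<Sum>A\<in>Pow (parts n). of_real (exp (- (?t * real (\<Sum>A)))) * (cis (real (\<Sum>A) * \<theta>) * cis (of_int (part_diff A) * \<omega>)))"
  proof (intro sum.cong refl)
    fix A assume "A \<in> Pow (parts n)"
    then have fin: "finite A" using finite_subset[OF _ finite_parts] by blast
    have 1: "(\<Prod>m\<in>A. of_real (exp (- (?t * real m))) :: complex) = of_real (exp (- (?t * real (\<Sum>A))))"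
      by (simp add: exp_sum[OF fin, symmetric] sum_negf sum_distrib_left[symmetric] flip: of_real_prod)
    have 2: "(\<Prod>m\<in>A. cis (f m)) = cis (\<Sum>m\<in>A. f m)" for f
      using fin by (induction rule: finite_induct) (auto simp: cis_mult)
    have "(\<Sum>m\<in>A. real m * \<theta> + of_int (chi m) * \<omega>) = real (\<Sum>A) * \<theta> + of_int (part_diff A) * \<omega>"
      by (simp add: sum.distrib sum_distrib_right part_diff_def)
    then show "prod ?x A * prod (\<lambda>_. 1) (parts n - A) = of_real (exp (- (?t * real (\<Sum>A)))) * (cis (real (\<Sum>A) * \<theta>) * cis (of_int (part_diff A) * \<omega>))"
      by (simp only: prod.distrib 1 2 cis_mult prod.neutral_const mult_1_right)
  qed
  finally show ?thesis .
qed

definition step :: "nat \<Rightarrow> real" where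
  "step a = 2 * pi * real a / N"

lemma integrable_continuous_arc:
  fixes f :: "real \<Rightarrow> complex"
  assumes "continuous_on UNIV f"
  shows "integrable lborel (\<lambda>x. indicator arc x *\<^sub>R f x)"
  unfolding arc_def
  using borel_integrable_compact[of "{- (pi / N)..pi / N}" f] continuous_on_subset[OF assms] by (simp add: compact_Icc)

text \<open>Orthogonality on the circle cut into N arcs. If N does not divide k, the roots of unity
  coming from the shifts sum to 0; if N divides k \<noteq> 0, the integral over a single arc
  vanishes because the antiderivative agrees at both ends.\<close>

lemma arc_integral_cis:
  "(\<Sum>a<N. arc_integral (\<lambda>\<theta>. cis (of_int k * (\<theta> + step a)))) = (if k = 0 then of_real (2 * pi) else 0)"
proof -
  have N: "0 < N" using N_ge_2 by simp
  have "(\<Sum>a<N. arc_integral (\<lambda>\<theta>. cis (of_int k * (\<theta> + step a)))) = (\<Sum>a<N. cis (2 * pi * of_int k * real a / N) * arc_integral (\<lambda>\<theta>. cis (of_int k * \<theta>)))"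
  proof (intro sum.cong refl)
    fix a
    have "indicator arc \<theta> *\<^sub>R cis (of_int k * (\<theta> + step a)) = cis (2 * pi * of_int k * real a / N) * (indicator arc \<theta> *\<^sub>R cis (of_int k * \<theta>))" for \<theta>
      by (simp add: cis_mult distrib_left step_def mult_ac add.commute)
    then show "arc_integral (\<lambda>\<theta>. cis (of_int k * (\<theta> + step a))) = cis (2 * pi * of_int k * real a / N) * arc_integral (\<lambda>\<theta>. cis (of_int k * \<theta>))"
      unfolding arc_integral_def by (simp only: integral_mult_right_zero)
  qed
  also have "\<dots> = (\<Sum>a<N. cis (2 * pi * of_int k * real a / N)) * arc_integral (\<lambda>\<theta>. cis (of_int k * \<theta>))"
    by (simp add: sum_distrib_right)
  also have "\<dots> = (if k = 0 then of_real (2 * pi) else 0)"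
  proof (cases "int N dvd k")
    case True
    then obtain q where q: "k = int N * q" by (rule dvdE)
    have "arc_integral (\<lambda>\<theta>. cis (of_int k * \<theta>)) = (if k = 0 then of_real (2 * pi / N) else 0)"
    proof (cases "k = 0")
      case True
      have "(\<integral>x. indicator arc x *\<^sub>R (1 :: complex) \<partial>lborel) = of_real (\<integral>x. indicator arc x \<partial>lborel)"
        by (subst integral_complex_of_real[symmetric]) (simp add: scaleR_conv_of_real)
      then show ?thesis using True integrable_arc(2) by (simp add: arc_integral_def)
    next
      case False
      define F where "F = (\<lambda>x. cis (of_int k * x) / (\<i> * of_int k))"
      have "arc_integral (\<lambda>\<theta>. cis (of_int k * \<theta>)) = F (pi / N) - F (- (pi / N))"
        unfolding arc_integral_def arc_def
      proof (rule integral_FTC_Icc)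
        fix x :: real
        have "((\<lambda>x. cis (of_int k * x)) has_vector_derivative (of_int k * (\<i> * cis (of_int k * x)))) (at x)"
        proof -
          have "((\<lambda>z. exp (\<i> * (of_int k * z))) has_field_derivative (of_int k * (\<i> * exp (\<i> * (of_int k * of_real x))))) (at (of_real x))"
            by (rule derivative_eq_intros refl)+ simp
          then have "((\<lambda>x. exp (\<i> * (of_int k * of_real x))) has_vector_derivative (of_int k * (\<i> * exp (\<i> * (of_int k * of_real x))))) (at x)"
            by (rule has_vector_derivative_real_field)
          then show ?thesis by (simp add: cis_conv_exp)
        qed
        then have "((\<lambda>x. cis (of_int k * x) / (\<i> * of_int k)) has_vector_derivative (of_int k * (\<i> * cis (of_int k * x)) / (\<i> * of_int k))) (at x)"
          by (rule has_vector_derivative_divide)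
        then show "(F has_vector_derivative cis (of_int k * x)) (at x within {- (pi / N)..pi / N})"
          unfolding F_def using False by (auto intro: has_vector_derivative_at_within)
        show "continuous_on {- (pi / N)..pi / N} (\<lambda>\<theta>. cis (of_int k * \<theta>))" by (intro continuous_intros)
      qed simp
      also have "F (pi / N) = F (- (pi / N))"
      proof -
        have "of_int k * (pi / N) = of_int k * (- (pi / N)) + 2 * pi * of_int q"
          using N by (simp add: q field_simps)
        then show ?thesis unfolding F_def by (simp only: cis_add_2pi_int)
      qed
      finally show ?thesis using False by simp
    qed
    then show ?thesis using True N sum_roots_of_unity[OF N, of k] by simp
  next
    case False
    then show ?thesis using sum_roots_of_unity[OF N, of k] by auto
  qed
  finally show ?thesis .
qed

lemma box_integral_prod:
  assumes "integrable lborel (\<lambda>x. indicator arc x *\<^sub>R f x)" "integrable lborel (\<lambda>x. indicator arc x *\<^sub>R g x)"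
  shows "integrable (lborel \<Otimes>\<^sub>M lborel) (\<lambda>z. indicator (arc \<times> arc) z *\<^sub>R (f (fst z) * g (snd z)))"
    "box_integral (\<lambda>\<theta> \<omega>. f \<theta> * g \<omega>) = arc_integral f * arc_integral g"
proof -
  have e: "(\<lambda>z. indicator (arc \<times> arc) z *\<^sub>R (f (fst z) * g (snd z))) = (\<lambda>(x, y). (indicator arc x *\<^sub>R f x) * (indicator arc y *\<^sub>R g y))"
    by (auto simp: indicator_def fun_eq_iff)
  show "integrable (lborel \<Otimes>\<^sub>M lborel) (\<lambda>z. indicator (arc \<times> arc) z *\<^sub>R (f (fst z) * g (snd z)))"
    unfolding e by (rule integral_mult_pair(1)[OF assms])
  show "box_integral (\<lambda>\<theta> \<omega>. f \<theta> * g \<omega>) = arc_integral f * arc_integral g"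
    unfolding box_integral_def e arc_integral_def by (rule integral_mult_pair(2)[OF assms])
qed

text \<open>The generating function with the character cis (d\<omega>) replaced by an arbitrary
  kernel, so that one extraction lemma covers both the events D = k and the averaged sign.\<close>

definition kernel_gf :: "(int \<Rightarrow> real \<Rightarrow> complex) \<Rightarrow> nat \<Rightarrow> real \<Rightarrow> real \<Rightarrow> complex" where
  "kernel_gf ker n \<theta> \<omega> = (\<Sum>A\<in>Pow (parts n). of_real (exp (- (saddle n * real (\<Sum>A)))) * (cis (real (\<Sum>A) * \<theta>) * ker (part_diff A) \<omega>))"

lemma kernel_gf_measurable:
  assumes "\<And>d. continuous_on UNIV (ker d)"
  shows "(\<lambda>z. kernel_gf ker n (fst z + u) (snd z + v) * cis (- (real n * (fst z + w)))) \<in> borel_measurable (lborel \<Otimes>\<^sub>M lborel)"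
proof -
  have [measurable]: "ker d \<in> borel_measurable borel" for d
    using assms by (rule borel_measurable_continuous_onI)
  have [measurable]: "cis \<in> borel_measurable borel"
    by (rule borel_measurable_continuous_onI) (intro continuous_intros)
  show ?thesis unfolding kernel_gf_def by measurable
qed

text \<open>2\<pi> w(d) is the integral of \<open>ker d\<close> over the whole circle. Integrating
  over both variables keeps the subsets with sum n and weights each of them by w(D).\<close>

lemma fourier_extraction:
  assumes cont: "\<And>d. continuous_on UNIV (ker d)"
    and w: "\<And>d. (\<Sum>b<N. arc_integral (\<lambda>\<omega>. ker d (\<omega> + step b))) = of_real (2 * pi) * w d"
  shows "(\<Sum>a<N. \<Sum>b<N. box_integral (\<lambda>\<theta> \<omega>. kernel_gf ker n (\<theta> + step a) (\<omega> + step b) * cis (- (real n * (\<theta> + step a)))))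
    = of_real (4 * pi\<^sup>2 * exp (- (saddle n * real n))) * (\<Sum>A | A \<in> Pow (parts n) \<and> \<Sum>A = n. w (part_diff A))"
proof -
  let ?c = "\<lambda>A. of_real (exp (- (saddle n * real (\<Sum>A)))) :: complex"
  let ?f = "\<lambda>A a \<theta>. cis (of_int (int (\<Sum>A) - int n) * (\<theta> + step a))"
  have fi: "integrable lborel (\<lambda>x. indicator arc x *\<^sub>R ?f A a x)" for A a
    by (rule integrable_continuous_arc) (intro continuous_intros)
  have gi: "integrable lborel (\<lambda>x. indicator arc x *\<^sub>R ker d (x + step b))" for d b
  proof (rule integrable_continuous_arc)
    show "continuous_on UNIV (\<lambda>x. ker d (x + step b))"
      by (rule continuous_on_compose2[OF cont]) (auto intro!: continuous_intros)
  qed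
  have "box_integral (\<lambda>\<theta> \<omega>. kernel_gf ker n (\<theta> + step a) (\<omega> + step b) * cis (- (real n * (\<theta> + step a))))
    = (\<Sum>A\<in>Pow (parts n). ?c A * (arc_integral (?f A a) * arc_integral (\<lambda>\<omega>. ker (part_diff A) (\<omega> + step b))))" for a b
  proof -
    have "kernel_gf ker n (\<theta> + step a) (\<omega> + step b) * cis (- (real n * (\<theta> + step a)))
      = (\<Sum>A\<in>Pow (parts n). ?c A * (?f A a \<theta> * ker (part_diff A) (\<omega> + step b)))" for \<theta> \<omega>
    proof -
      have "?f A a \<theta> = cis (real (\<Sum>A) * (\<theta> + step a)) * cis (- (real n * (\<theta> + step a)))" for A
        unfolding cis_mult by (simp add: left_diff_distrib del: of_nat_sum)
      then show ?thesis unfolding kernel_gf_def sum_distrib_right by (intro sum.cong refl) (simp only: mult_ac)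
    qed
    then have "box_integral (\<lambda>\<theta> \<omega>. kernel_gf ker n (\<theta> + step a) (\<omega> + step b) * cis (- (real n * (\<theta> + step a))))
      = (\<integral>z. (\<Sum>A\<in>Pow (parts n). ?c A * (indicator (arc \<times> arc) z *\<^sub>R (?f A a (fst z) * ker (part_diff A) (snd z + step b)))) \<partial>(lborel \<Otimes>\<^sub>M lborel))"
      unfolding box_integral_def by (simp only: scaleR_sum_right mult_scaleR_right)
    also have "\<dots> = (\<Sum>A\<in>Pow (parts n). ?c A * box_integral (\<lambda>\<theta> \<omega>. ?f A a \<theta> * ker (part_diff A) (\<omega> + step b)))"
      unfolding box_integral_def integral_mult_right_zero[symmetric]
      by (intro Bochner_Integration.integral_sum Bochner_Integration.integrable_mult_right box_integral_prod(1)[OF fi gi])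
    finally show ?thesis by (simp only: box_integral_prod(2)[OF fi gi])
  qed
  then have "(\<Sum>a<N. \<Sum>b<N. box_integral (\<lambda>\<theta> \<omega>. kernel_gf ker n (\<theta> + step a) (\<omega> + step b) * cis (- (real n * (\<theta> + step a)))))
    = (\<Sum>a<N. \<Sum>b<N. \<Sum>A\<in>Pow (parts n). ?c A * (arc_integral (?f A a) * arc_integral (\<lambda>\<omega>. ker (part_diff A) (\<omega> + step b))))" by simp
  also have "\<dots> = (\<Sum>a<N. \<Sum>A\<in>Pow (parts n). \<Sum>b<N. ?c A * (arc_integral (?f A a) * arc_integral (\<lambda>\<omega>. ker (part_diff A) (\<omega> + step b))))"
    by (intro sum.cong refl sum.swap)
  also have "\<dots> = (\<Sum>A\<in>Pow (parts n). \<Sum>a<N. \<Sum>b<N. ?c A * (arc_integral (?f A a) * arc_integral (\<lambda>\<omega>. ker (part_diff A) (\<omega> + step b))))"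
    by (rule sum.swap)
  also have "\<dots> = (\<Sum>A\<in>Pow (parts n). ?c A * ((\<Sum>a<N. arc_integral (?f A a)) * (\<Sum>b<N. arc_integral (\<lambda>\<omega>. ker (part_diff A) (\<omega> + step b)))))"
    unfolding sum_product by (simp only: sum_distrib_left)
  also have "\<dots> = (\<Sum>A\<in>Pow (parts n). if \<Sum>A = n then of_real (4 * pi\<^sup>2 * exp (- (saddle n * real n))) * w (part_diff A) else 0)"
  proof (intro sum.cong refl)
    fix A
    have *: "int (\<Sum>A) - int n = 0 \<longleftrightarrow> \<Sum>A = n" by linarith
    show "?c A * ((\<Sum>a<N. arc_integral (?f A a)) * (\<Sum>b<N. arc_integral (\<lambda>\<omega>. ker (part_diff A) (\<omega> + step b)))) = (if \<Sum>A = n then of_real (4 * pi\<^sup>2 * exp (- (saddle n * real n))) * w (part_diff A) else 0)"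
    proof (cases "\<Sum>A = n")
      case True
      have "of_real e * (of_real (2 * pi) * (of_real (2 * pi) * v)) = of_real (4 * pi\<^sup>2 * e) * v" for e :: real and v :: complex
        by (simp add: power2_eq_square mult_ac)
      then show ?thesis unfolding arc_integral_cis w * by (simp only: True if_True simp_thms)
    next
      case False
      then show ?thesis unfolding arc_integral_cis w * by (simp only: if_False mult_zero_left mult_zero_right)
    qed
  qed
  also have "\<dots> = of_real (4 * pi\<^sup>2 * exp (- (saddle n * real n))) * (\<Sum>A | A \<in> Pow (parts n) \<and> \<Sum>A = n. w (part_diff A))"
    by (simp only: sum_distrib_left sum.inter_filter[symmetric] finite_Pow_iff finite_parts)
  finally show ?thesis .
qed

text \<open>The total is extracted at \<omega> = 0 from a one-dimensional integral; its size s^3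
  makes it the leading term.\<close>

lemma fourier_extraction_total:
  "(\<Sum>a<N. arc_integral (\<lambda>\<theta>. Phi n (\<theta> + step a) 0 * cis (- (real n * (\<theta> + step a))))) * of_real (gf n)
    = of_real (2 * pi * exp (- (saddle n * real n))) * of_nat (card {A \<in> Pow (parts n). \<Sum>A = n})"
proof -
  let ?c = "\<lambda>A. of_real (exp (- (saddle n * real (\<Sum>A)))) :: complex"
  let ?f = "\<lambda>A a \<theta>. cis (of_int (int (\<Sum>A) - int n) * (\<theta> + step a))"
  have fi: "integrable lborel (\<lambda>x. indicator arc x *\<^sub>R ?f A a x)" for A a
    by (rule integrable_continuous_arc) (intro continuous_intros)
  have "arc_integral (\<lambda>\<theta>. Phi n (\<theta> + step a) 0 * cis (- (real n * (\<theta> + step a)))) * of_real (gf n)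
    = (\<Sum>A\<in>Pow (parts n). ?c A * arc_integral (?f A a))" for a
  proof -
    have e: "(Phi n (\<theta> + step a) 0 * cis (- (real n * (\<theta> + step a)))) * of_real (gf n) = (\<Sum>A\<in>Pow (parts n). ?c A * ?f A a \<theta>)" for \<theta>
    proof -
      have 1: "?f A a \<theta> = cis (real (\<Sum>A) * (\<theta> + step a)) * cis (- (real n * (\<theta> + step a)))" for A
        unfolding cis_mult by (simp add: left_diff_distrib del: of_nat_sum)
      have "(Phi n (\<theta> + step a) 0 * cis (- (real n * (\<theta> + step a)))) * of_real (gf n) = (of_real (gf n) * Phi n (\<theta> + step a) 0) * cis (- (real n * (\<theta> + step a)))"
        by (simp only: mult_ac)
      also have "\<dots> = (\<Sum>A\<in>Pow (parts n). ?c A * ?f A a \<theta>)"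
        unfolding gf_Phi_expansion sum_distrib_right 1 by (intro sum.cong refl) (simp del: of_nat_sum)
      finally show ?thesis .
    qed
    have "arc_integral (\<lambda>\<theta>. Phi n (\<theta> + step a) 0 * cis (- (real n * (\<theta> + step a)))) * of_real (gf n)
      = arc_integral (\<lambda>\<theta>. (Phi n (\<theta> + step a) 0 * cis (- (real n * (\<theta> + step a)))) * of_real (gf n))"
      unfolding arc_integral_def scaleR_conv_of_real mult.assoc[symmetric] by simp
    also have "\<dots> = (\<integral>\<theta>. (\<Sum>A\<in>Pow (parts n). ?c A * (indicator arc \<theta> *\<^sub>R ?f A a \<theta>)) \<partial>lborel)"
      unfolding arc_integral_def e by (simp only: scaleR_sum_right mult_scaleR_right)
    also have "\<dots> = (\<Sum>A\<in>Pow (parts n). ?c A * arc_integral (?f A a))"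
      unfolding arc_integral_def integral_mult_right_zero[symmetric]
      by (intro Bochner_Integration.integral_sum Bochner_Integration.integrable_mult_right fi)
    finally show ?thesis .
  qed
  then have "(\<Sum>a<N. arc_integral (\<lambda>\<theta>. Phi n (\<theta> + step a) 0 * cis (- (real n * (\<theta> + step a))))) * of_real (gf n)
    = (\<Sum>a<N. \<Sum>A\<in>Pow (parts n). ?c A * arc_integral (?f A a))" by (simp only: sum_distrib_right)
  also have "\<dots> = (\<Sum>A\<in>Pow (parts n). ?c A * (\<Sum>a<N. arc_integral (?f A a)))"
    unfolding sum_distrib_left by (rule sum.swap)
  also have "\<dots> = (\<Sum>A\<in>Pow (parts n). if \<Sum>A = n then of_real (2 * pi * exp (- (saddle n * real n))) else 0)"
  proof (intro sum.cong refl)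
    fix A
    have *: "int (\<Sum>A) - int n = 0 \<longleftrightarrow> \<Sum>A = n" by linarith
    show "?c A * (\<Sum>a<N. arc_integral (?f A a)) = (if \<Sum>A = n then of_real (2 * pi * exp (- (saddle n * real n))) else 0)"
    proof (cases "\<Sum>A = n")
      case True
      then show ?thesis unfolding arc_integral_cis * by (simp only: True if_True simp_thms of_real_mult mult_ac)
    next
      case False
      then show ?thesis unfolding arc_integral_cis * by (simp only: if_False mult_zero_right)
    qed
  qed
  also have "\<dots> = (\<Sum>A | A \<in> Pow (parts n) \<and> \<Sum>A = n. of_real (2 * pi * exp (- (saddle n * real n))))"
    by (intro sum.mono_neutral_cong_right) auto
  finally show ?thesis by (simp add: mult.commute)
qed

section \<open>Partitions as subsets of \<open>parts\<close>, and Fourier kernels of the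
  sign\<close>

lemma Pow_parts_eq: "{A \<in> Pow (parts n). \<Sum>A = n} = distinct_partitions_gt K n"
proof (intro equalityI subsetI)
  fix A assume "A \<in> distinct_partitions_gt K n"
  then have A: "finite A" "\<And>m. m \<in> A \<Longrightarrow> K < m" "\<Sum>A = n" by (auto simp: distinct_partitions_gt_def)
  have "m \<in> parts n" if m: "m \<in> A" for m
  proof -
    have "m \<le> n" using member_le_sum[OF m, of "\<lambda>m. m"] A by simp
    also have "n \<le> N * n" using N_ge_2 by simp
    finally show ?thesis using A(2)[OF m] by (simp add: parts_def)
  qed
  then show "A \<in> {A \<in> Pow (parts n). \<Sum>A = n}" using A by auto
next
  fix A assume A: "A \<in> {A \<in> Pow (parts n). \<Sum>A = n}"
  then have "finite A" using finite_subset[OF _ finite_parts] by blast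
  then show "A \<in> distinct_partitions_gt K n" using A by (auto simp: distinct_partitions_gt_def parts_def)
qed

lemma part_diff_eq: "finite A \<Longrightarrow> part_diff A = int (parts_cong N \<alpha> A) - int (parts_cong N \<beta> A)"
proof -
  assume fin: "finite A"
  have "part_diff A = (\<Sum>m\<in>A. (if [m = \<alpha>] (mod N) then 1 else 0) - (if [m = \<beta>] (mod N) then 1 else 0))"
    unfolding part_diff_def chi_def using not_cong_alpha_beta by (intro sum.cong) auto
  also have "\<dots> = int (parts_cong N \<alpha> A) - int (parts_cong N \<beta> A)"
    using fin by (simp add: sum_subtractf parts_cong_def sum.If_cases Int_def)
  finally show ?thesis .
qed

text \<open>This trigonometric polynomial equals cot (\<omega>/2) sin (d\<omega>) away from the
  poles of the cotangent. In this form it is continuous everywhere, and its only constant term, from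
  j = 0, makes its mean value sgn d.\<close>

definition cot_kernel :: "int \<Rightarrow> real \<Rightarrow> real" where
  "cot_kernel d \<omega> = of_int (sgn d) * (\<Sum>j<nat \<bar>d\<bar>. cos (real (Suc j) * \<omega>) + cos (real j * \<omega>))"

text \<open>By the sum-to-product formulas each summand times sin (\<omega>/2) is cos (\<omega>/2)
  times a difference of sines, and the sum telescopes.\<close>

lemma cot_kernel_identity: "sin (\<omega> / 2) * cot_kernel d \<omega> = cos (\<omega> / 2) * sin (of_int d * \<omega>)"
proof -
  have pos: "sin (\<omega> / 2) * (\<Sum>j<n. cos (real (Suc j) * \<omega>) + cos (real j * \<omega>)) = cos (\<omega> / 2) * sin (real n * \<omega>)" for n
  proof (induction n)
    case (Suc n)
    have "cos (real (Suc n) * \<omega>) + cos (real n * \<omega>) = 2 * cos (real n * \<omega> + \<omega> / 2) * cos (\<omega> / 2)"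
      by (subst cos_plus_cos) (simp add: algebra_simps add_divide_distrib)
    moreover have "sin (real (Suc n) * \<omega>) - sin (real n * \<omega>) = 2 * sin (\<omega> / 2) * cos (real n * \<omega> + \<omega> / 2)"
      by (subst sin_diff_sin) (simp add: algebra_simps add_divide_distrib)
    ultimately have "sin (\<omega> / 2) * (cos (real (Suc n) * \<omega>) + cos (real n * \<omega>)) = cos (\<omega> / 2) * (sin (real (Suc n) * \<omega>) - sin (real n * \<omega>))"
      by simp
    then have "sin (\<omega> / 2) * (\<Sum>j<Suc n. cos (real (Suc j) * \<omega>) + cos (real j * \<omega>))
      = cos (\<omega> / 2) * sin (real n * \<omega>) + cos (\<omega> / 2) * (sin (real (Suc n) * \<omega>) - sin (real n * \<omega>))"
      using Suc.IH by (simp only: sum.lessThan_Suc distrib_left[of _ "sum _ _"])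
    then show ?case by (simp only: right_diff_distrib add.commute diff_add_cancel)
  qed simp
  consider "d = 0" | "d > 0" | "d < 0" by linarith
  then show ?thesis
  proof cases
    case 2
    then show ?thesis using pos[of "nat \<bar>d\<bar>"] by (simp add: cot_kernel_def)
  next
    case 3
    then have "real (nat \<bar>d\<bar>) = - of_int d" by simp
    then show ?thesis using pos[of "nat \<bar>d\<bar>"] 3 by (simp add: cot_kernel_def)
  qed (simp add: cot_kernel_def)
qed

lemma continuous_on_cot_kernel: "continuous_on UNIV (cot_kernel d)"
  unfolding cot_kernel_def[abs_def] by (intro continuous_intros)

lemma arc_integral_Re:
  assumes "continuous_on UNIV f"
  shows "arc_integral (\<lambda>x. Re (f x)) = Re (arc_integral f)"
proof -
  have "Re (\<integral>x. indicator arc x *\<^sub>R f x \<partial>lborel) = (\<integral>x. Re (indicator arc x *\<^sub>R f x) \<partial>lborel)"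
    using integral_Re[OF integrable_continuous_arc[OF assms]] by simp
  then show ?thesis by (simp add: arc_integral_def)
qed

lemma arc_integral_cos: "(\<Sum>a<N. arc_integral (\<lambda>\<theta>. cos (real k * (\<theta> + step a)))) = (if k = 0 then 2 * pi else 0)"
proof -
  have "arc_integral (\<lambda>\<theta>. cos (real k * (\<theta> + step a))) = Re (arc_integral (\<lambda>\<theta>. cis (of_int (int k) * (\<theta> + step a))))" for a
    by (subst arc_integral_Re[symmetric]) (auto intro!: continuous_intros)
  then have "(\<Sum>a<N. arc_integral (\<lambda>\<theta>. cos (real k * (\<theta> + step a)))) = Re (\<Sum>a<N. arc_integral (\<lambda>\<theta>. cis (of_int (int k) * (\<theta> + step a))))"
    by (simp only: Re_sum)
  then show ?thesis unfolding arc_integral_cis by simp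
qed

lemma integrable_continuous_arc_real:
  fixes f :: "real \<Rightarrow> real"
  assumes "continuous_on UNIV f"
  shows "integrable lborel (\<lambda>x. indicator arc x *\<^sub>R f x)"
  unfolding arc_def
  using borel_integrable_compact[of "{- (pi / N)..pi / N}" f] continuous_on_subset[OF assms] by (simp add: compact_Icc)

lemma arc_integral_cot_kernel: "(\<Sum>b<N. arc_integral (\<lambda>\<omega>. cot_kernel d (\<omega> + step b))) = 2 * pi * of_int (sgn d)"
proof -
  have ci: "integrable lborel (\<lambda>x. indicator arc x *\<^sub>R cos (real k * (x + step b)))" for k b
    by (rule integrable_continuous_arc_real) (intro continuous_intros)
  have "arc_integral (\<lambda>\<omega>. cot_kernel d (\<omega> + step b)) = of_int (sgn d) * (\<Sum>j<nat \<bar>d\<bar>. arc_integral (\<lambda>\<omega>. cos (real (Suc j) * (\<omega> + step b))) + arc_integral (\<lambda>\<omega>. cos (real j * (\<omega> + step b))))" for b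
  proof -
    have "indicator arc \<omega> *\<^sub>R cot_kernel d (\<omega> + step b) = of_int (sgn d) * (\<Sum>j<nat \<bar>d\<bar>. indicator arc \<omega> *\<^sub>R cos (real (Suc j) * (\<omega> + step b)) + indicator arc \<omega> *\<^sub>R cos (real j * (\<omega> + step b)))" for \<omega>
      by (simp only: cot_kernel_def mult_scaleR_right[symmetric] scaleR_add_right[symmetric] scaleR_sum_right[symmetric])
    then have "arc_integral (\<lambda>\<omega>. cot_kernel d (\<omega> + step b)) = of_int (sgn d) * (\<integral>\<omega>. (\<Sum>j<nat \<bar>d\<bar>. indicator arc \<omega> *\<^sub>R cos (real (Suc j) * (\<omega> + step b)) + indicator arc \<omega> *\<^sub>R cos (real j * (\<omega> + step b))) \<partial>lborel)"
      unfolding arc_integral_def by (simp only: integral_mult_right_zero)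
    also have "(\<integral>\<omega>. (\<Sum>j<nat \<bar>d\<bar>. indicator arc \<omega> *\<^sub>R cos (real (Suc j) * (\<omega> + step b)) + indicator arc \<omega> *\<^sub>R cos (real j * (\<omega> + step b))) \<partial>lborel)
      = (\<Sum>j<nat \<bar>d\<bar>. \<integral>\<omega>. indicator arc \<omega> *\<^sub>R cos (real (Suc j) * (\<omega> + step b)) + indicator arc \<omega> *\<^sub>R cos (real j * (\<omega> + step b)) \<partial>lborel)"
      by (intro Bochner_Integration.integral_sum Bochner_Integration.integrable_add ci)
    also have "\<dots> = (\<Sum>j<nat \<bar>d\<bar>. arc_integral (\<lambda>\<omega>. cos (real (Suc j) * (\<omega> + step b))) + arc_integral (\<lambda>\<omega>. cos (real j * (\<omega> + step b))))"
      unfolding arc_integral_def by (intro sum.cong refl Bochner_Integration.integral_add ci)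
    finally show ?thesis .
  qed
  then have "(\<Sum>b<N. arc_integral (\<lambda>\<omega>. cot_kernel d (\<omega> + step b))) = of_int (sgn d) * (\<Sum>b<N. \<Sum>j<nat \<bar>d\<bar>. arc_integral (\<lambda>\<omega>. cos (real (Suc j) * (\<omega> + step b))) + arc_integral (\<lambda>\<omega>. cos (real j * (\<omega> + step b))))"
    by (simp only: sum_distrib_left)
  also have "\<dots> = of_int (sgn d) * (\<Sum>j<nat \<bar>d\<bar>. \<Sum>b<N. arc_integral (\<lambda>\<omega>. cos (real (Suc j) * (\<omega> + step b))) + arc_integral (\<lambda>\<omega>. cos (real j * (\<omega> + step b))))"
    by (subst sum.swap) (rule refl)
  also have "\<dots> = of_int (sgn d) * (\<Sum>j<nat \<bar>d\<bar>. if j = 0 then 2 * pi else 0)"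
    unfolding sum.distrib arc_integral_cos by simp
  also have "\<dots> = 2 * pi * of_int (sgn d)" by (cases "d = 0") (auto simp: sum.delta)
  finally show ?thesis .
qed

definition smooth_kernel :: "int \<Rightarrow> real \<Rightarrow> real" where
  "smooth_kernel d \<omega> = (\<Sum>i<N. \<Sum>j<N. cot_kernel (d + int i - int j) \<omega>) / (real N)\<^sup>2"

definition smooth_sgn :: "int \<Rightarrow> real" where
  "smooth_sgn d = (\<Sum>i<N. \<Sum>j<N. of_int (sgn (d + int i - int j))) / (real N)\<^sup>2"

text \<open>The normalised Fejer kernel |1 + z + ... + z^(N-1)|^2 / N^2 at z = cis \<omega>, in real
  form.\<close>

definition fejer :: "real \<Rightarrow> real" where
  "fejer \<omega> = (\<Sum>i<N. \<Sum>j<N. cos ((real i - real j) * \<omega>)) / (real N)\<^sup>2"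

text \<open>Averaging over the shifts i - j multiplies sin (d\<omega>) by \<open>fejer\<close>; the
  companion term with sin ((i - j)\<omega>) is antisymmetric in i and j and sums to 0.\<close>

lemma smooth_kernel_identity: "sin (\<omega> / 2) * smooth_kernel d \<omega> = cos (\<omega> / 2) * (fejer \<omega> * sin (of_int d * \<omega>))"
proof -
  have "(\<Sum>i<N. \<Sum>j<N. sin ((real i - real j) * \<omega>)) = (\<Sum>i<N. \<Sum>j<N. sin ((real j - real i) * \<omega>))" by (rule sum.swap)
  also have "\<dots> = - (\<Sum>i<N. \<Sum>j<N. sin ((real i - real j) * \<omega>))"
    unfolding sum_negf[symmetric] by (intro sum.cong refl) (simp add: left_diff_distrib flip: sin_minus)
  finally have z: "(\<Sum>i<N. \<Sum>j<N. sin ((real i - real j) * \<omega>)) = 0" by simp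
  have "(\<Sum>i<N. \<Sum>j<N. sin (of_int (d + int i - int j) * \<omega>))
    = (\<Sum>i<N. \<Sum>j<N. sin (of_int d * \<omega>) * cos ((real i - real j) * \<omega>) + cos (of_int d * \<omega>) * sin ((real i - real j) * \<omega>))"
    unfolding sin_add[symmetric] by (intro sum.cong refl arg_cong[where f = sin]) (simp add: algebra_simps)
  also have "\<dots> = sin (of_int d * \<omega>) * (\<Sum>i<N. \<Sum>j<N. cos ((real i - real j) * \<omega>))"
    by (simp only: sum.distrib sum_distrib_left[symmetric] z mult_zero_right add_0_right)
  finally have s: "(\<Sum>i<N. \<Sum>j<N. sin (of_int (d + int i - int j) * \<omega>)) = sin (of_int d * \<omega>) * (\<Sum>i<N. \<Sum>j<N. cos ((real i - real j) * \<omega>))" .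
  have "sin (\<omega> / 2) * smooth_kernel d \<omega> = (\<Sum>i<N. \<Sum>j<N. sin (\<omega> / 2) * cot_kernel (d + int i - int j) \<omega>) / (real N)\<^sup>2"
    by (simp only: smooth_kernel_def sum_distrib_left times_divide_eq_right)
  also have "\<dots> = cos (\<omega> / 2) * (\<Sum>i<N. \<Sum>j<N. sin (of_int (d + int i - int j) * \<omega>)) / (real N)\<^sup>2"
    by (simp only: cot_kernel_identity sum_distrib_left)
  finally show ?thesis unfolding s fejer_def by simp
qed

lemma continuous_on_smooth_kernel: "continuous_on UNIV (smooth_kernel d)"
  unfolding smooth_kernel_def[abs_def] using N_ge_2
  by (intro continuous_intros continuous_on_sum continuous_on_cot_kernel) auto

lemma arc_integral_smooth_kernel:
  "(\<Sum>b<N. arc_integral (\<lambda>\<omega>. of_real (smooth_kernel d (\<omega> + step b)) :: complex)) = of_real (2 * pi) * of_real (smooth_sgn d)"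
proof -
  have ci: "integrable lborel (\<lambda>x. indicator arc x *\<^sub>R cot_kernel e (x + step b))" for e b
    by (rule integrable_continuous_arc_real)
       (auto intro!: continuous_on_compose2[OF continuous_on_cot_kernel] continuous_intros)
  have r: "arc_integral (\<lambda>\<omega>. smooth_kernel d (\<omega> + step b)) = (\<Sum>i<N. \<Sum>j<N. arc_integral (\<lambda>\<omega>. cot_kernel (d + int i - int j) (\<omega> + step b))) / (real N)\<^sup>2" for b
  proof -
    have "indicator arc \<omega> *\<^sub>R smooth_kernel d (\<omega> + step b) = (\<Sum>i<N. \<Sum>j<N. indicator arc \<omega> *\<^sub>R cot_kernel (d + int i - int j) (\<omega> + step b)) / (real N)\<^sup>2" for \<omega>
      by (simp only: smooth_kernel_def scaleR_sum_right real_scaleR_def times_divide_eq_right sum_distrib_left)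
    then have "arc_integral (\<lambda>\<omega>. smooth_kernel d (\<omega> + step b)) = (\<integral>\<omega>. (\<Sum>i<N. \<Sum>j<N. indicator arc \<omega> *\<^sub>R cot_kernel (d + int i - int j) (\<omega> + step b)) \<partial>lborel) / (real N)\<^sup>2"
      unfolding arc_integral_def by (simp only: integral_divide_zero)
    also have "(\<integral>\<omega>. (\<Sum>i<N. \<Sum>j<N. indicator arc \<omega> *\<^sub>R cot_kernel (d + int i - int j) (\<omega> + step b)) \<partial>lborel)
      = (\<Sum>i<N. \<integral>\<omega>. (\<Sum>j<N. indicator arc \<omega> *\<^sub>R cot_kernel (d + int i - int j) (\<omega> + step b)) \<partial>lborel)"
      by (intro Bochner_Integration.integral_sum Bochner_Integration.integrable_sum ci)
    also have "\<dots> = (\<Sum>i<N. \<Sum>j<N. arc_integral (\<lambda>\<omega>. cot_kernel (d + int i - int j) (\<omega> + step b)))"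
      unfolding arc_integral_def by (intro sum.cong refl Bochner_Integration.integral_sum ci)
    finally show ?thesis .
  qed
  have "(\<Sum>b<N. arc_integral (\<lambda>\<omega>. smooth_kernel d (\<omega> + step b))) = (\<Sum>b<N. \<Sum>i<N. \<Sum>j<N. arc_integral (\<lambda>\<omega>. cot_kernel (d + int i - int j) (\<omega> + step b))) / (real N)\<^sup>2"
    by (simp only: r sum_divide_distrib)
  also have "(\<Sum>b<N. \<Sum>i<N. \<Sum>j<N. arc_integral (\<lambda>\<omega>. cot_kernel (d + int i - int j) (\<omega> + step b))) = (\<Sum>i<N. \<Sum>b<N. \<Sum>j<N. arc_integral (\<lambda>\<omega>. cot_kernel (d + int i - int j) (\<omega> + step b)))"
    by (rule sum.swap)
  also have "\<dots> = (\<Sum>i<N. \<Sum>j<N. \<Sum>b<N. arc_integral (\<lambda>\<omega>. cot_kernel (d + int i - int j) (\<omega> + step b)))"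
    by (intro sum.cong refl sum.swap)
  finally have "(\<Sum>b<N. arc_integral (\<lambda>\<omega>. smooth_kernel d (\<omega> + step b))) = 2 * pi * smooth_sgn d"
    by (simp only: arc_integral_cot_kernel smooth_sgn_def sum_distrib_left times_divide_eq_right)
  moreover have "arc_integral (\<lambda>\<omega>. of_real (smooth_kernel d (\<omega> + step b)) :: complex) = of_real (arc_integral (\<lambda>\<omega>. smooth_kernel d (\<omega> + step b)))" for b
    unfolding arc_integral_def by (subst integral_complex_of_real[symmetric]) (simp add: scaleR_conv_of_real)
  ultimately show ?thesis by (simp flip: of_real_sum of_real_mult)
qed

section \<open>The generating function of the smoothed sign\<close>

definition sgn_gf :: "nat \<Rightarrow> real \<Rightarrow> real \<Rightarrow> complex" where
  "sgn_gf n \<theta> \<omega> = kernel_gf (\<lambda>d \<omega>. of_real (smooth_kernel d \<omega>)) n \<theta> \<omega> / of_real (gf n)"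

text \<open>The factor sin (\<omega>/2) stays on the left, so the identity also holds at \<omega> =
  0; dividing by it with uniform bounds is the work of the lemmas below.\<close>

lemma sgn_gf_identity:
  "of_real (sin (\<omega> / 2)) * sgn_gf n \<theta> \<omega> = of_real (cos (\<omega> / 2) * fejer \<omega>) * ((Phi n \<theta> \<omega> - Phi n \<theta> (- \<omega>)) / (2 * \<i>))"
proof -
  let ?c = "\<lambda>A. of_real (exp (- (saddle n * real (\<Sum>A)))) * cis (real (\<Sum>A) * \<theta>) :: complex"
  have s: "cis x - cis (- x) = 2 * \<i> * of_real (sin x)" for x by (simp add: complex_eq_iff)
  have "of_real (gf n) * (Phi n \<theta> \<omega> - Phi n \<theta> (- \<omega>)) = (\<Sum>A\<in>Pow (parts n). ?c A * (cis (of_int (part_diff A) * \<omega>) - cis (- (of_int (part_diff A) * \<omega>))))"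
    unfolding right_diff_distrib[of "of_real (gf n)"] gf_Phi_expansion sum_subtractf[symmetric]
    by (intro sum.cong refl) (simp add: algebra_simps del: of_nat_sum)
  then have 1: "of_real (gf n) * (Phi n \<theta> \<omega> - Phi n \<theta> (- \<omega>)) = 2 * \<i> * (\<Sum>A\<in>Pow (parts n). ?c A * of_real (sin (of_int (part_diff A) * \<omega>)))"
    unfolding s sum_distrib_left by (simp only: mult_ac)
  have "of_real (sin (\<omega> / 2)) * kernel_gf (\<lambda>d \<omega>. of_real (smooth_kernel d \<omega>)) n \<theta> \<omega>
    = (\<Sum>A\<in>Pow (parts n). ?c A * of_real (sin (\<omega> / 2) * smooth_kernel (part_diff A) \<omega>))"
    unfolding kernel_gf_def sum_distrib_left by (intro sum.cong refl) (simp only: of_real_mult mult_ac)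
  also have "\<dots> = of_real (cos (\<omega> / 2) * fejer \<omega>) * (\<Sum>A\<in>Pow (parts n). ?c A * of_real (sin (of_int (part_diff A) * \<omega>)))"
    unfolding smooth_kernel_identity sum_distrib_left by (intro sum.cong refl) (simp only: of_real_mult mult_ac)
  finally have 2: "of_real (sin (\<omega> / 2)) * kernel_gf (\<lambda>d \<omega>. of_real (smooth_kernel d \<omega>)) n \<theta> \<omega> = of_real (cos (\<omega> / 2) * fejer \<omega>) * (\<Sum>A\<in>Pow (parts n). ?c A * of_real (sin (of_int (part_diff A) * \<omega>)))" .
  have g: "(of_real (gf n) :: complex) \<noteq> 0" using gf_pos[of n] by simp
  have "of_real (gf n) * (of_real (sin (\<omega> / 2)) * sgn_gf n \<theta> \<omega>) = of_real (cos (\<omega> / 2) * fejer \<omega>) * (\<Sum>A\<in>Pow (parts n). ?c A * of_real (sin (of_int (part_diff A) * \<omega>)))"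
    unfolding 2[symmetric] sgn_gf_def using g by simp
  also have "\<dots> = of_real (gf n) * (of_real (cos (\<omega> / 2) * fejer \<omega>) * ((Phi n \<theta> \<omega> - Phi n \<theta> (- \<omega>)) / (2 * \<i>)))"
  proof -
    have "(\<Sum>A\<in>Pow (parts n). ?c A * of_real (sin (of_int (part_diff A) * \<omega>))) = of_real (gf n) * ((Phi n \<theta> \<omega> - Phi n \<theta> (- \<omega>)) / (2 * \<i>))"
      using 1 by (simp add: field_simps)
    then show ?thesis by (simp only: mult_ac)
  qed
  finally show ?thesis using mult_left_cancel[OF g] by blast
qed

lemma abs_fejer_le_1: "\<bar>fejer \<omega>\<bar> \<le> 1"
proof -
  have "\<bar>\<Sum>i<N. \<Sum>j<N. cos ((real i - real j) * \<omega>)\<bar> \<le> (\<Sum>i<N. \<Sum>j<N. 1)"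
    by (intro order_trans[OF sum_abs] sum_mono order_trans[OF sum_abs]) auto
  then show ?thesis using N_ge_2 by (simp add: fejer_def abs_divide power2_eq_square)
qed

lemma fejer_diff_le: "\<bar>fejer (x + \<omega>) - fejer x\<bar> \<le> real N * \<bar>\<omega>\<bar>" for x \<omega> :: real
proof -
  have le: "\<bar>cos ((real i - real j) * (x + \<omega>)) - cos ((real i - real j) * x)\<bar> \<le> real N * \<bar>\<omega>\<bar>" if "i < N" "j < N" for i j
  proof -
    have "\<bar>cos ((real i - real j) * (x + \<omega>)) - cos ((real i - real j) * x)\<bar> \<le> \<bar>(real i - real j) * (x + \<omega>) - (real i - real j) * x\<bar>"
      by (rule abs_cos_diff_le)
    also have "\<dots> = \<bar>real i - real j\<bar> * \<bar>\<omega>\<bar>" by (simp add: abs_mult[symmetric] algebra_simps)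
    also have "\<dots> \<le> real N * \<bar>\<omega>\<bar>" using that by (intro mult_right_mono) auto
    finally show ?thesis .
  qed
  have "fejer (x + \<omega>) - fejer x = (\<Sum>i<N. \<Sum>j<N. cos ((real i - real j) * (x + \<omega>)) - cos ((real i - real j) * x)) / (real N)\<^sup>2"
    by (simp only: fejer_def sum_subtractf diff_divide_distrib)
  also have "\<bar>\<dots>\<bar> \<le> (\<Sum>i<N. \<Sum>j<N. real N * \<bar>\<omega>\<bar>) / (real N)\<^sup>2"
    unfolding abs_divide abs_power2
    by (intro divide_right_mono order_trans[OF sum_abs] sum_mono order_trans[OF sum_abs] le) auto
  also have "\<dots> = real N * \<bar>\<omega>\<bar>" using N_ge_2 by (simp add: power2_eq_square)
  finally show ?thesis .
qed

lemma fejer_0: "fejer 0 = 1"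
  using N_ge_2 by (simp add: fejer_def power2_eq_square)

text \<open>A vanishing sum of roots of unity. Together with \<open>fejer_diff_le\<close> it gives a
  factor |\<omega>| around every shift with b \<noteq> 0, which is worth one power of s.\<close>

lemma fejer_step: "fejer (step b) = 0" if "0 < b" "b < N"
proof -
  have N: "0 < N" using N_ge_2 by simp
  have nd: "\<not> int N dvd int b" using that by (auto dest: zdvd_imp_le)
  have "(\<Sum>i<N. cis (real i * step b)) = (\<Sum>a<N. cis (2 * pi * of_int (int b) * real a / N))"
    by (intro sum.cong refl arg_cong[where f = cis]) (simp add: step_def)
  also have "\<dots> = 0" using sum_roots_of_unity[OF N, of "int b"] nd by (simp del: of_int_of_nat_eq)
  finally have z: "(\<Sum>i<N. cis (real i * step b)) = 0" .
  have c: "(\<Sum>i<N. cos (real i * step b)) = 0" using arg_cong[OF z, of Re] by (simp add: Re_sum)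
  have s: "(\<Sum>i<N. sin (real i * step b)) = 0" using arg_cong[OF z, of Im] by (simp add: Im_sum)
  have "(\<Sum>i<N. \<Sum>j<N. cos ((real i - real j) * step b)) = (\<Sum>i<N. cos (real i * step b)) * (\<Sum>i<N. cos (real i * step b)) + (\<Sum>i<N. sin (real i * step b)) * (\<Sum>i<N. sin (real i * step b))"
    unfolding sum_product sum.distrib[symmetric] left_diff_distrib cos_diff ..
  then show ?thesis by (simp add: fejer_def c s)
qed

section \<open>The quotient of \<Phi> at opposite angles\<close>

definition au :: "nat \<Rightarrow> real \<Rightarrow> nat \<Rightarrow> complex" where
  "au n \<theta> m = of_real (exp (- (saddle n * real m))) * cis (real m * \<theta>)"

text \<open>Pair the k-th part, of weight u, in the class of \<alpha> with the k-th part, of weight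
  v, in the class of \<beta>. With z = cis \<omega>, the product (1 + uz)(1 + v/z) exceeds (1 +
  u/z)(1 + vz) by (z - 1/z)(u - v), where z - 1/z = 2i sin \<omega>.\<close>

definition ratio_term :: "nat \<Rightarrow> real \<Rightarrow> real \<Rightarrow> nat \<Rightarrow> complex" where
  "ratio_term n \<theta> \<omega> k = (au n \<theta> (first_part \<alpha> + N * k) - au n \<theta> (first_part \<beta> + N * k)) /
    ((1 + au n \<theta> (first_part \<alpha> + N * k) * cis (- \<omega>)) * (1 + au n \<theta> (first_part \<beta> + N * k) * cis \<omega>))"

lemma cmod_au: "cmod (au n \<theta> m) = exp (- (saddle n * real m))"
  by (simp add: au_def norm_mult)

lemma part_index_bounds:
  assumes "j \<in> {1..N}"
  shows "k \<le> first_part j + N * k" "1 \<le> first_part j + N * k" "first_part j + N * k \<le> K + N + N * k"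
proof -
  have "k \<le> N * k" using N_ge_2 by simp
  then show "k \<le> first_part j + N * k" by linarith
qed (use first_part_bounds[OF assms] in auto)

text \<open>Crude but valid for every \<theta>: the modulus is at least 1 - e^(-t).\<close>

lemma cmod_one_plus_au_ge:
  assumes n: "n \<ge> 1" and m: "m \<ge> 1"
  shows "saddle n / 2 \<le> cmod (1 + au n \<theta> m * cis \<psi>)"
proof -
  let ?t = "saddle n"
  have t: "0 < ?t" "?t \<le> 1" using saddle_pos saddle_le_1 n by auto
  have "exp (- (?t * real m)) \<le> exp (- ?t)" using m t by simp
  moreover have "?t / 2 \<le> 1 - exp (- ?t)" using t by (intro one_minus_exp_ge) auto
  moreover have "1 - exp (- (?t * real m)) \<le> cmod (1 + au n \<theta> m * cis \<psi>)"
    using norm_triangle_ineq2[of 1 "- (au n \<theta> m * cis \<psi>)"] by (simp add: norm_mult cmod_au)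
  ultimately show ?thesis by linarith
qed

lemma gf_Phi_prod: "of_real (gf n) * Phi n \<theta> \<omega> = (\<Prod>m\<in>parts n. 1 + au n \<theta> m * cis (of_int (chi m) * \<omega>))"
proof -
  let ?t = "saddle n"
  have f: "of_real (1 + exp (- (?t * real m))) * (1 + of_real (fermi ?t m) * (cis (real m * \<theta> + of_int (chi m) * \<omega>) - 1)) = 1 + au n \<theta> m * cis (of_int (chi m) * \<omega>)" for m
  proof -
    have "1 + exp (- (?t * real m)) \<noteq> 0" by (smt (verit) exp_gt_zero)
    then have "of_real (1 + exp (- (?t * real m))) * (of_real (fermi ?t m) :: complex) = of_real (exp (- (?t * real m)))"
      unfolding of_real_mult[symmetric] fermi_eq by (intro arg_cong[where f = of_real]) simp
    then have "of_real (1 + exp (- (?t * real m))) * (1 + of_real (fermi ?t m) * (c - 1)) = of_real (1 + exp (- (?t * real m))) + of_real (exp (- (?t * real m))) * (c - 1)" for c :: complex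
      by (simp only: distrib_left mult.assoc[symmetric] mult_1_right)
    then show ?thesis by (simp only: au_def mult.assoc cis_mult) (simp add: algebra_simps)
  qed
  show ?thesis unfolding gf_def Phi_def of_real_prod prod.distrib[symmetric] f ..
qed

text \<open>Parts with \<open>chi\<close> = 0 contribute equally at \<omega> and -\<omega> and
  cancel in the quotient; the others are paired as in \<open>ratio_term\<close>. Keeping
  \<Phi>(\<theta>, -\<omega>) as a factor preserves all its smallness.\<close>

lemma Phi_ratio:
  assumes n: "n \<ge> 1"
  shows "Phi n \<theta> \<omega> - Phi n \<theta> (- \<omega>) = Phi n \<theta> (- \<omega>) * ((\<Prod>k<n. 1 + 2 * \<i> * of_real (sin \<omega>) * ratio_term n \<theta> \<omega> k) - 1)"
proof -
  let ?u = "\<lambda>k. au n \<theta> (first_part \<alpha> + N * k)" let ?v = "\<lambda>k. au n \<theta> (first_part \<beta> + N * k)"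
  let ?R = "\<Prod>m | m \<in> parts n \<and> chi m = 0. 1 + au n \<theta> m"
  have t: "0 < saddle n / 2" using saddle_pos[OF n] by simp
  have P: "of_real (gf n) * Phi n \<theta> w = (\<Prod>k<n. 1 + ?u k * cis w) * (\<Prod>k<n. 1 + ?v k * cis (- w)) * ?R" for w
    unfolding gf_Phi_prod prod_parts_split[where g = "\<lambda>m c. 1 + au n \<theta> m * cis (of_int c * w)"] by simp
  have fac: "(1 + ?u k * cis \<omega>) * (1 + ?v k * cis (- \<omega>)) = ((1 + ?u k * cis (- \<omega>)) * (1 + ?v k * cis \<omega>)) * (1 + 2 * \<i> * of_real (sin \<omega>) * ratio_term n \<theta> \<omega> k)" for k
  proof -
    have nz: "1 + ?u k * cis (- \<omega>) \<noteq> 0" "1 + ?v k * cis \<omega> \<noteq> 0"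
      using cmod_one_plus_au_ge[OF n part_index_bounds(2)[OF alpha], of \<theta> k "- \<omega>"]
        cmod_one_plus_au_ge[OF n part_index_bounds(2)[OF beta], of \<theta> k \<omega>] t by (metis norm_zero not_le)+
    have c: "cis \<omega> * cis (- \<omega>) = 1" by (simp add: cis_mult)
    have "((1 + u * z') * (1 + v * z)) * (1 + s * ((u - v) / ((1 + u * z') * (1 + v * z)))) = (1 + u * z') * (1 + v * z) + s * (u - v)"
      if "1 + u * z' \<noteq> 0" "1 + v * z \<noteq> 0" for u v z z' s :: complex
    proof -
      have "A * (1 + s * (w / A)) = A + s * w" if "A \<noteq> 0" for A w :: complex
        using that by (simp add: distrib_left)
      then show ?thesis using that by simp
    qed
    moreover have "(1 + u * z') * (1 + v * z) + (z - z') * (u - v) = (1 + u * z) * (1 + v * z')" if "z * z' = 1" for u v z z' :: complex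
    proof -
      have "(1 + u * z') * (1 + v * z) + (z - z') * (u - v) - (1 + u * z) * (1 + v * z') = 0" by (simp add: algebra_simps)
      then show ?thesis by simp
    qed
    moreover have "2 * \<i> * of_real (sin \<omega>) = cis \<omega> - cis (- \<omega>)" by (simp add: complex_eq_iff)
    ultimately show ?thesis unfolding ratio_term_def using nz c by simp
  qed
  have "of_real (gf n) * Phi n \<theta> \<omega> = (\<Prod>k<n. (1 + ?u k * cis \<omega>) * (1 + ?v k * cis (- \<omega>))) * ?R"
    unfolding P prod.distrib ..
  also have "\<dots> = (\<Prod>k<n. (1 + ?u k * cis (- \<omega>)) * (1 + ?v k * cis \<omega>)) * (\<Prod>k<n. 1 + 2 * \<i> * of_real (sin \<omega>) * ratio_term n \<theta> \<omega> k) * ?R"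
    unfolding fac prod.distrib ..
  also have "\<dots> = of_real (gf n) * Phi n \<theta> (- \<omega>) * (\<Prod>k<n. 1 + 2 * \<i> * of_real (sin \<omega>) * ratio_term n \<theta> \<omega> k)"
    unfolding P prod.distrib minus_minus by (simp only: mult_ac)
  finally have "of_real (gf n) * Phi n \<theta> \<omega> = of_real (gf n) * (Phi n \<theta> (- \<omega>) * (\<Prod>k<n. 1 + 2 * \<i> * of_real (sin \<omega>) * ratio_term n \<theta> \<omega> k))"
    by (simp only: mult.assoc)
  then have "Phi n \<theta> \<omega> = Phi n \<theta> (- \<omega>) * (\<Prod>k<n. 1 + 2 * \<i> * of_real (sin \<omega>) * ratio_term n \<theta> \<omega> k)"
    using gf_pos[of n] by simp
  then show ?thesis by (simp only: right_diff_distrib mult_1_right)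
qed

text \<open>The loss t^(-3) is harmless where this is used, because \<Phi> is O(s^12) there.\<close>

lemma ratio_term_sum_le:
  assumes n: "n \<ge> 1"
  shows "(\<Sum>k<n. cmod (ratio_term n \<theta> \<omega> k)) \<le> 16 / saddle n ^ 3"
proof -
  let ?t = "saddle n"
  have t: "0 < ?t" "?t \<le> 1" using saddle_pos saddle_le_1 n by auto
  have "cmod (ratio_term n \<theta> \<omega> k) \<le> 8 / ?t\<^sup>2 * exp (- (?t * real k))" for k
  proof -
    let ?u = "au n \<theta> (first_part \<alpha> + N * k)" let ?v = "au n \<theta> (first_part \<beta> + N * k)"
    have e: "exp (- (?t * real (first_part j + N * k))) \<le> exp (- (?t * real k))" if "j \<in> {1..N}" for j
    proof -
      have "real k \<le> real (first_part j + N * k)" using part_index_bounds(1)[OF that, of k] by (simp only: of_nat_le_iff)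
      then show ?thesis using t by (simp add: mult_left_mono del: of_nat_add)
    qed
    have "cmod (?u - ?v) \<le> cmod ?u + cmod ?v" by (rule norm_triangle_ineq4)
    also have "\<dots> \<le> 2 * exp (- (?t * real k))" unfolding cmod_au using e[OF alpha] e[OF beta] by linarith
    finally have 1: "cmod (?u - ?v) \<le> 2 * exp (- (?t * real k))" .
    have 2: "(?t / 2) * (?t / 2) \<le> cmod (1 + ?u * cis (- \<omega>)) * cmod (1 + ?v * cis \<omega>)"
      using t by (intro mult_mono cmod_one_plus_au_ge[OF n] part_index_bounds(2) alpha beta) auto
    have "cmod (ratio_term n \<theta> \<omega> k) \<le> (2 * exp (- (?t * real k))) / ((?t / 2) * (?t / 2))"
      unfolding ratio_term_def norm_divide norm_mult[of "1 + _"] using 1 2 t by (intro frac_le) auto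
    then show ?thesis by (simp add: power2_eq_square)
  qed
  then have "(\<Sum>k<n. cmod (ratio_term n \<theta> \<omega> k)) \<le> (\<Sum>k<n. 8 / ?t\<^sup>2 * exp (- (?t * real k)))" by (rule sum_mono)
  also have "\<dots> \<le> 8 / ?t\<^sup>2 * (2 / ?t)"
    unfolding sum_distrib_left[symmetric] using t by (intro mult_left_mono sum_exp_le) auto
  finally show ?thesis by (simp add: power2_eq_square power3_eq_cube)
qed

text \<open>For |\<omega>| \<ge> t^3 the division by |sin (\<omega>/2)| \<ge> |\<omega>|/7 costs at
  most order t^(-3). For smaller \<omega> the product formula supplies a factor |\<omega>|, with Y
  \<le> 32 by \<open>ratio_term_sum_le\<close>.\<close>

lemma sgn_gf_minor:
  assumes n: "n \<ge> 1" and om: "\<omega> \<noteq> 0" "\<bar>\<omega>\<bar> \<le> pi" and e: "cmod (Phi n \<theta> \<omega>) \<le> e" "cmod (Phi n \<theta> (- \<omega>)) \<le> e"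
  shows "cmod (sgn_gf n \<theta> \<omega>) \<le> (7 + 112 * exp 32) * e / saddle n ^ 3"
proof -
  let ?t = "saddle n" let ?W = "sgn_gf n \<theta> \<omega>" let ?D = "Phi n \<theta> \<omega> - Phi n \<theta> (- \<omega>)"
  have t: "0 < ?t" "?t \<le> 1" using saddle_pos saddle_le_1 n by auto
  have e0: "0 \<le> e" using e(1) norm_ge_zero order_trans by blast
  have "\<bar>sin (\<omega> / 2)\<bar> * cmod ?W = cmod (of_real (sin (\<omega> / 2)) * ?W)" by (simp add: norm_mult)
  also have "\<dots> = \<bar>cos (\<omega> / 2) * fejer \<omega>\<bar> * (cmod ?D / 2)" unfolding sgn_gf_identity norm_mult norm_of_real norm_divide by simp
  also have "\<dots> \<le> (1 * 1) * (cmod ?D / 2)"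
    unfolding abs_mult using abs_fejer_le_1 by (intro mult_right_mono mult_mono) auto
  finally have a: "\<bar>sin (\<omega> / 2)\<bar> * cmod ?W \<le> cmod ?D / 2" by simp
  have "\<bar>\<omega>\<bar> / 7 * cmod ?W \<le> \<bar>sin (\<omega> / 2)\<bar> * cmod ?W" using om by (intro mult_right_mono abs_sin_half_ge) auto
  then have b: "\<bar>\<omega>\<bar> * cmod ?W \<le> 7 / 2 * cmod ?D" using a by simp
  have "\<bar>\<omega>\<bar> * cmod ?W \<le> \<bar>\<omega>\<bar> * ((7 + 112 * exp 32) * e / ?t ^ 3)"
  proof (cases "?t ^ 3 \<le> \<bar>\<omega>\<bar>")
    case True
    have "cmod ?D \<le> 2 * e" using norm_triangle_ineq4[of "Phi n \<theta> \<omega>" "Phi n \<theta> (- \<omega>)"] e by linarith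
    then have "\<bar>\<omega>\<bar> * cmod ?W \<le> 7 * e" using b by linarith
    also have "\<dots> \<le> (\<bar>\<omega>\<bar> / ?t ^ 3) * ((7 + 112 * exp 32) * e)"
    proof -
      have "1 * (7 * e) \<le> (\<bar>\<omega>\<bar> / ?t ^ 3) * ((7 + 112 * exp 32) * e)"
        using True t e0 by (intro mult_mono mult_right_mono) (auto simp: divide_simps)
      then show ?thesis by simp
    qed
    finally show ?thesis by simp
  next
    case False
    define Y where "Y = (\<Sum>k<n. cmod (2 * \<i> * of_real (sin \<omega>) * ratio_term n \<theta> \<omega> k))"
    have Ye: "Y = 2 * \<bar>sin \<omega>\<bar> * (\<Sum>k<n. cmod (ratio_term n \<theta> \<omega> k))" by (simp add: Y_def norm_mult sum_distrib_left)
    also have "\<dots> \<le> 2 * \<bar>\<omega>\<bar> * (16 / ?t ^ 3)"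
      using ratio_term_sum_le[OF n] abs_sin_x_le_abs_x by (intro mult_mono mult_left_mono) (auto intro: sum_nonneg)
    finally have Y: "Y \<le> 32 * (\<bar>\<omega>\<bar> / ?t ^ 3)" by simp
    have "\<bar>\<omega>\<bar> / ?t ^ 3 \<le> 1" using False t by (simp add: divide_simps)
    then have Y32: "Y \<le> 32" using Y by linarith
    have Y0: "0 \<le> Y" by (simp add: Y_def sum_nonneg)
    have "cmod ?D = cmod (Phi n \<theta> (- \<omega>)) * cmod ((\<Prod>k<n. 1 + 2 * \<i> * of_real (sin \<omega>) * ratio_term n \<theta> \<omega> k) - 1)"
      unfolding Phi_ratio[OF n] norm_mult ..
    also have "\<dots> \<le> e * (Y * exp Y)" unfolding Y_def using e e0 by (intro mult_mono prod_one_plus_approx) auto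
    also have "\<dots> \<le> e * ((32 * (\<bar>\<omega>\<bar> / ?t ^ 3)) * exp 32)" using e0 Y Y0 Y32 by (intro mult_left_mono mult_mono) auto
    finally have D: "cmod ?D \<le> e * ((32 * (\<bar>\<omega>\<bar> / ?t ^ 3)) * exp 32)" .
    have "\<bar>\<omega>\<bar> * cmod ?W \<le> 7 / 2 * (e * ((32 * (\<bar>\<omega>\<bar> / ?t ^ 3)) * exp 32))"
      by (rule order_trans[OF b mult_left_mono[OF D]]) simp
    also have "\<dots> = \<bar>\<omega>\<bar> * ((112 * exp 32) * e / ?t ^ 3)" by simp
    also have "\<dots> \<le> \<bar>\<omega>\<bar> * ((7 + 112 * exp 32) * e / ?t ^ 3)"
      using e0 t by (intro mult_left_mono divide_right_mono mult_right_mono) auto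
    finally show ?thesis .
  qed
  then show ?thesis using om(1) by (subst (asm) mult_le_cancel_left_pos) auto
qed

text \<open>The right-hand side is the sum of \<open>ratio_term\<close> at \<theta> = \<omega> =
  0.\<close>

lemma mean_diff_eq: "mean_diff n = (\<Sum>k<n. (exp (- (saddle n * real (first_part \<alpha> + N * k))) - exp (- (saddle n * real (first_part \<beta> + N * k)))) /
    ((1 + exp (- (saddle n * real (first_part \<alpha> + N * k)))) * (1 + exp (- (saddle n * real (first_part \<beta> + N * k))))))"
proof -
  have e: "u / (1 + u) - v / (1 + v) = (u - v) / ((1 + u) * (1 + v))" if "0 < u" "0 < v" for u v :: real
    using that by (simp add: divide_simps add_pos_pos) (simp add: algebra_simps)
  have "mean_diff n = (\<Sum>k<n. fermi (saddle n) (real (first_part \<alpha> + N * k)) - fermi (saddle n) (real (first_part \<beta> + N * k)))"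
    unfolding mean_diff_def sum_parts_split[where g = "\<lambda>m c. of_int c * fermi (saddle n) (real m)"] by (simp add: sum_subtractf sum_negf)
  then show ?thesis unfolding fermi_eq by (simp only: e exp_gt_zero)
qed

text \<open>Near the origin each numerator is O(t e^(-tk)), because paired parts differ by a bounded
  amount; hence the sum is bounded. Freezing \<theta> and \<omega> at 0 costs |\<theta>|/t +
  |\<omega>|.\<close>

lemma ratio_term_approx:
  "\<exists>C>0. \<forall>n\<ge>1. \<forall>\<theta> \<omega>. \<bar>\<theta>\<bar> \<le> saddle n / 4 \<longrightarrow> \<bar>\<omega>\<bar> \<le> 1 / 4 \<longrightarrow>
    (\<Sum>k<n. cmod (ratio_term n \<theta> \<omega> k)) \<le> C \<and>
    cmod ((\<Sum>k<n. ratio_term n \<theta> \<omega> k) - of_real (mean_diff n)) \<le> C * (\<bar>\<theta>\<bar> / saddle n + \<bar>\<omega>\<bar>)"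
proof -
  define M where "M = real (K + N)"
  have M1: "1 \<le> M" using N_ge_2 by (simp add: M_def)
  define C where "C = 20 * M * (2 * M + 8 * N) + 32 * M"
  have C0: "0 < C" using M1 by (simp add: C_def add_nonneg_pos)
  have "(\<Sum>k<n. cmod (ratio_term n \<theta> \<omega> k)) \<le> C \<and>
    cmod ((\<Sum>k<n. ratio_term n \<theta> \<omega> k) - of_real (mean_diff n)) \<le> C * (\<bar>\<theta>\<bar> / saddle n + \<bar>\<omega>\<bar>)"
    if n: "n \<ge> 1" and th: "\<bar>\<theta>\<bar> \<le> saddle n / 4" and om: "\<bar>\<omega>\<bar> \<le> 1 / 4" for n \<theta> \<omega>
  proof -
    let ?t = "saddle n"
    have t: "0 < ?t" "?t \<le> 1" using saddle_pos saddle_le_1 n by auto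
    define E where "E = (\<lambda>k::nat. exp (- (?t * real k)))"
    \<comment> \<open>A bound for the phases m\<theta> \<plusminus> \<omega> of both parts with
      index \<open>k\<close>.\<close>
    define q where "q = (\<lambda>k::nat. (M + N * real k) * \<bar>\<theta>\<bar> + \<bar>\<omega>\<bar>)"
    define x0 where "x0 = (\<lambda>k. (exp (- (?t * real (first_part \<alpha> + N * k))) - exp (- (?t * real (first_part \<beta> + N * k)))) /
      ((1 + exp (- (?t * real (first_part \<alpha> + N * k)))) * (1 + exp (- (?t * real (first_part \<beta> + N * k))))))"
    have E0: "0 < E k" for k by (simp add: E_def)
    have q0: "0 \<le> q k" for k using M1 by (simp add: q_def)
    have main: "cmod (ratio_term n \<theta> \<omega> k) \<le> 8 * ?t * M * E k \<and>
      cmod (ratio_term n \<theta> \<omega> k - of_real (x0 k)) \<le> 4 * (?t * M * E k * ((M + N * real k) * \<bar>\<theta>\<bar>) + M * \<bar>\<theta>\<bar> * E k) + 16 * (?t * M * E k) * q k" for k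
    proof -
      define a where "a = real (first_part \<alpha> + N * k)"
      define b where "b = real (first_part \<beta> + N * k)"
      have ab: "real k \<le> a" "real k \<le> b" "a \<le> M + N * real k" "b \<le> M + N * real k" "0 \<le> a" "0 \<le> b"
        using part_index_bounds(1,3)[OF alpha, of k] part_index_bounds(1,3)[OF beta, of k]
        unfolding a_def b_def M_def of_nat_mult[symmetric] of_nat_add[symmetric] of_nat_le_iff by auto
      have abM: "\<bar>a - b\<bar> \<le> M"
        using first_part_bounds[OF alpha] first_part_bounds[OF beta] by (simp add: a_def b_def M_def)
      define u0 where "u0 = exp (- (?t * a))"
      define v0 where "v0 = exp (- (?t * b))"
      define g1 where "g1 = 1 / (1 + of_real u0 * cis (a * \<theta> - \<omega>))"
      define g2 where "g2 = 1 / (1 + of_real v0 * cis (b * \<theta> + \<omega>))"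
      define h1 where "h1 = 1 / (1 + of_real u0 :: complex)"
      define h2 where "h2 = 1 / (1 + of_real v0 :: complex)"
      define d where "d = of_real u0 * cis (a * \<theta>) - of_real v0 * cis (b * \<theta>)"
      define d0 where "d0 = (of_real u0 - of_real v0 :: complex)"
      have uE: "u0 \<le> E k" "v0 \<le> E k" "0 < u0" "0 < v0" using ab t by (auto simp: u0_def v0_def E_def)
      have E1: "E k \<le> 1" using t by (simp add: E_def)
      have rt: "ratio_term n \<theta> \<omega> k = d * g1 * g2"
        unfolding ratio_term_def au_def a_def[symmetric] b_def[symmetric] u0_def[symmetric] v0_def[symmetric] d_def g1_def g2_def
        by (simp add: mult.assoc cis_mult)
      have x0e: "of_real (x0 k) = d0 * h1 * h2"
        unfolding x0_def a_def[symmetric] b_def[symmetric] u0_def[symmetric] v0_def[symmetric] d0_def h1_def h2_def by simp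
      have ph: "\<bar>c * \<theta>\<bar> \<le> ?t * c / 4" if "0 \<le> c" for c
        using mult_left_mono[OF th that] that by (simp add: abs_mult mult_ac)
      have n1: "1 / 2 \<le> cmod (1 + of_real u0 * cis (a * \<theta> - \<omega>))"
        unfolding u0_def using ph[OF ab(5)] om ab t by (intro cmod_one_plus_exp_cis_ge) (auto simp: add_divide_distrib)
      have n2: "1 / 2 \<le> cmod (1 + of_real v0 * cis (b * \<theta> + \<omega>))"
        unfolding v0_def using ph[OF ab(6)] om ab t by (intro cmod_one_plus_exp_cis_ge) (auto simp: add_divide_distrib)
      have n3: "1 \<le> cmod (1 + of_real w :: complex)" if "0 < w" for w
      proof -
        have "cmod (of_real (1 + w)) = 1 + w" unfolding norm_of_real using that by simp
        then show ?thesis using that by simp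
      qed
      have inv: "cmod (1 / z) \<le> 2" if "1 / 2 \<le> cmod z" for z :: complex
      proof -
        have "1 / cmod z \<le> 1 / (1 / 2)" using that by (intro divide_left_mono) auto
        then show ?thesis by (simp add: norm_divide)
      qed
      have G: "cmod g1 \<le> 2" "cmod g2 \<le> 2" unfolding g1_def g2_def using n1 n2 by (auto intro: inv)
      have H: "cmod h1 \<le> 2" "cmod h2 \<le> 2" unfolding h1_def h2_def using n3[OF uE(3)] n3[OF uE(4)] by (auto intro!: inv)
      have invd: "cmod (1 / z - 1 / w) \<le> 2 * cmod (z - w)" if "1 / 2 \<le> cmod z" "1 \<le> cmod w" for z w :: complex
      proof -
        have nz: "z \<noteq> 0" "w \<noteq> 0" using that by auto
        have "1 / z - 1 / w = (w - z) / (z * w)" using nz by (simp add: field_simps)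
        then have "cmod (1 / z - 1 / w) = cmod (z - w) / (cmod z * cmod w)" by (simp add: norm_divide norm_mult norm_minus_commute)
        also have "\<dots> \<le> cmod (z - w) / (1 / 2 * 1)" using that by (intro divide_left_mono mult_mono mult_pos_pos) auto
        finally show ?thesis by simp
      qed
      have cq: "cmod (of_real w * cis x - of_real w) \<le> q k" if "0 < w" "w \<le> E k" "\<bar>x\<bar> \<le> q k" for w x
      proof -
        have "of_real w * cis x - of_real w = of_real w * (cis x - cis 0)" by (simp add: right_diff_distrib)
        then have "cmod (of_real w * cis x - of_real w) = w * cmod (cis x - cis 0)" using that by (simp add: norm_mult)
        also have "\<dots> \<le> 1 * \<bar>x\<bar>" using that E1 cmod_cis_diff_le[of x 0] by (intro mult_mono) auto
        finally show ?thesis using that by simp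
      qed
      have th2: "\<bar>c * \<theta>\<bar> \<le> (M + N * real k) * \<bar>\<theta>\<bar>" if "0 \<le> c" "c \<le> M + N * real k" for c
        using that by (simp add: abs_mult mult_right_mono)
      have dg1: "cmod (g1 - h1) \<le> 2 * q k"
      proof -
        have "cmod (g1 - h1) \<le> 2 * cmod ((1 + of_real u0 * cis (a * \<theta> - \<omega>)) - (1 + of_real u0))"
          unfolding g1_def h1_def by (rule invd[OF n1 n3[OF uE(3)]])
        also have "\<dots> \<le> 2 * q k"
        proof -
          have "\<bar>a * \<theta> - \<omega>\<bar> \<le> q k" using th2[OF ab(5,3)] unfolding q_def by linarith
          then show ?thesis using cq[OF uE(3,1), of "a * \<theta> - \<omega>"] by simp
        qed
        finally show ?thesis .
      qed
      have dg2: "cmod (g2 - h2) \<le> 2 * q k"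
      proof -
        have "cmod (g2 - h2) \<le> 2 * cmod ((1 + of_real v0 * cis (b * \<theta> + \<omega>)) - (1 + of_real v0))"
          unfolding g2_def h2_def by (rule invd[OF n2 n3[OF uE(4)]])
        also have "\<dots> \<le> 2 * q k"
        proof -
          have "\<bar>b * \<theta> + \<omega>\<bar> \<le> q k" using th2[OF ab(6,4)] unfolding q_def by linarith
          then show ?thesis using cq[OF uE(4,2), of "b * \<theta> + \<omega>"] by simp
        qed
        finally show ?thesis .
      qed
      have D0: "\<bar>u0 - v0\<bar> \<le> ?t * M * E k"
      proof -
        have "\<bar>u0 - v0\<bar> \<le> ?t * \<bar>a - b\<bar> * E k" unfolding u0_def v0_def E_def using t ab by (intro abs_exp_diff_le) auto
        also have "\<dots> \<le> ?t * M * E k" using abM t E0[of k] by (intro mult_right_mono mult_left_mono) auto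
        finally show ?thesis .
      qed
      then have cd0: "cmod d0 \<le> ?t * M * E k" unfolding d0_def by (simp flip: of_real_diff)
      have cc: "cmod (of_real v0 * (cis (a * \<theta>) - cis (b * \<theta>))) \<le> M * \<bar>\<theta>\<bar> * E k"
      proof -
        have "cmod (of_real v0 * (cis (a * \<theta>) - cis (b * \<theta>))) = v0 * cmod (cis (a * \<theta>) - cis (b * \<theta>))" using uE by (simp add: norm_mult)
        also have "\<dots> \<le> E k * (M * \<bar>\<theta>\<bar>)"
        proof (intro mult_mono uE)
          have "cmod (cis (a * \<theta>) - cis (b * \<theta>)) \<le> \<bar>a * \<theta> - b * \<theta>\<bar>" by (rule cmod_cis_diff_le)
          also have "\<dots> = \<bar>a - b\<bar> * \<bar>\<theta>\<bar>" by (simp add: abs_mult[symmetric] left_diff_distrib)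
          also have "\<dots> \<le> M * \<bar>\<theta>\<bar>" using abM by (intro mult_right_mono) auto
          finally show "cmod (cis (a * \<theta>) - cis (b * \<theta>)) \<le> M * \<bar>\<theta>\<bar>" .
        qed (use E0[of k] in auto)
        finally show ?thesis by (simp add: mult_ac)
      qed
      \<comment> \<open>Splits the numerator into a difference of moduli, O(t e^(-tk)), and a
        difference of phases, O(|\<theta>| e^(-tk)) with |\<theta>| \<le> t/4.\<close>
      have de: "d = d0 * cis (a * \<theta>) + of_real v0 * (cis (a * \<theta>) - cis (b * \<theta>))" by (simp add: d_def d0_def algebra_simps)
      have cd: "cmod d \<le> 2 * ?t * M * E k"
      proof -
        have "cmod d \<le> cmod d0 + M * \<bar>\<theta>\<bar> * E k" unfolding de using cc by (intro norm_triangle_le) (simp add: norm_mult)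
        also have "M * \<bar>\<theta>\<bar> * E k \<le> M * ?t * E k" using th t M1 E0[of k] by (intro mult_right_mono mult_left_mono) auto
        finally show ?thesis using cd0 by (simp add: algebra_simps)
      qed
      have cdd: "cmod (d - d0) \<le> ?t * M * E k * ((M + N * real k) * \<bar>\<theta>\<bar>) + M * \<bar>\<theta>\<bar> * E k"
      proof -
        have "d - d0 = d0 * (cis (a * \<theta>) - cis 0) + of_real v0 * (cis (a * \<theta>) - cis (b * \<theta>))" unfolding de by (simp add: algebra_simps)
        also have "cmod \<dots> \<le> cmod d0 * cmod (cis (a * \<theta>) - cis 0) + M * \<bar>\<theta>\<bar> * E k"
          using cc by (intro norm_triangle_le) (simp add: norm_mult)
        also have "cmod d0 * cmod (cis (a * \<theta>) - cis 0) \<le> (?t * M * E k) * ((M + N * real k) * \<bar>\<theta>\<bar>)"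
        proof (intro mult_mono cd0)
          show "cmod (cis (a * \<theta>) - cis 0) \<le> (M + N * real k) * \<bar>\<theta>\<bar>" using cmod_cis_diff_le[of "a * \<theta>" 0] th2[OF ab(5,3)] by simp
        qed (use t M1 E0[of k] in auto)
        finally show ?thesis by simp
      qed
      have "cmod (d * g1 * g2) \<le> (2 * ?t * M * E k) * 2 * 2"
        unfolding norm_mult using cd G t M1 E0[of k] by (intro mult_mono) auto
      then have 1: "cmod (ratio_term n \<theta> \<omega> k) \<le> 8 * ?t * M * E k" unfolding rt by simp
      have "d * g1 * g2 - d0 * h1 * h2 = (d - d0) * g1 * g2 + (d0 * (g1 - h1) * g2 + d0 * h1 * (g2 - h2))" by (simp add: algebra_simps)
      also have "cmod \<dots> \<le> cmod (d - d0) * 2 * 2 + ((?t * M * E k) * (2 * q k) * 2 + (?t * M * E k) * 2 * (2 * q k))"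
      proof (intro order_trans[OF norm_triangle_ineq] add_mono)
        show "cmod ((d - d0) * g1 * g2) \<le> cmod (d - d0) * 2 * 2"
          unfolding norm_mult using G by (intro mult_mono) auto
        show "cmod (d0 * (g1 - h1) * g2) \<le> (?t * M * E k) * (2 * q k) * 2"
          unfolding norm_mult using G dg1 cd0 t M1 E0[of k] q0[of k] by (intro mult_mono) auto
        show "cmod (d0 * h1 * (g2 - h2)) \<le> (?t * M * E k) * 2 * (2 * q k)"
          unfolding norm_mult using H dg2 cd0 t M1 E0[of k] q0[of k] by (intro mult_mono) auto
      qed
      also have "\<dots> \<le> 4 * (?t * M * E k * ((M + N * real k) * \<bar>\<theta>\<bar>) + M * \<bar>\<theta>\<bar> * E k) + 16 * (?t * M * E k) * q k"
      proof -
        have "0 \<le> (?t * M * E k) * q k" using t M1 E0[of k] q0[of k] by simp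
        moreover have "x * 2 * 2 + (p * (2 * z) * 2 + p * 2 * (2 * z)) \<le> 4 * y + 16 * p * z" if "x \<le> y" "0 \<le> p * z" for x y p z :: real
          using that by (simp add: algebra_simps)
        ultimately show ?thesis using cdd by blast
      qed
      finally show ?thesis using 1 unfolding rt x0e by blast
    qed
    have SE: "(\<Sum>k<n. E k) \<le> 2 / ?t" unfolding E_def using t by (intro sum_exp_le) auto
    have SkE: "(\<Sum>k<n. real k * E k) \<le> 8 / ?t\<^sup>2"
      using sum_power_exp_le[OF t finite_lessThan, of 1 n] by (simp add: E_def numeral_2_eq_2)
    have S1: "(\<Sum>k<n. cmod (ratio_term n \<theta> \<omega> k)) \<le> C"
    proof -
      have "(\<Sum>k<n. cmod (ratio_term n \<theta> \<omega> k)) \<le> (\<Sum>k<n. 8 * ?t * M * E k)" using main by (intro sum_mono) blast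
      also have "\<dots> \<le> 8 * ?t * M * (2 / ?t)" unfolding sum_distrib_left[symmetric] using t M1 by (intro mult_left_mono SE) auto
      also have "\<dots> \<le> C" using t M1 by (simp add: C_def)
      finally show ?thesis .
    qed
    have SM: "(\<Sum>k<n. E k * (M + N * real k)) \<le> (2 * M + 8 * N) / ?t\<^sup>2"
    proof -
      have "(\<Sum>k<n. E k * (M + N * real k)) = M * (\<Sum>k<n. E k) + N * (\<Sum>k<n. real k * E k)"
        by (simp add: sum_distrib_left sum.distrib algebra_simps)
      also have "\<dots> \<le> M * (2 / ?t) + N * (8 / ?t\<^sup>2)" using SE SkE M1 by (intro add_mono mult_left_mono) auto
      also have "M * (2 / ?t) \<le> M * (2 / ?t\<^sup>2)" using t M1 by (intro mult_left_mono divide_left_mono) (auto simp: power2_eq_square mult_left_le)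
      finally show ?thesis by (simp add: add_divide_distrib mult.commute)
    qed
    have "cmod ((\<Sum>k<n. ratio_term n \<theta> \<omega> k) - of_real (mean_diff n)) = cmod (\<Sum>k<n. ratio_term n \<theta> \<omega> k - of_real (x0 k))"
      unfolding mean_diff_eq x0_def[symmetric] by (simp add: sum_subtractf)
    also have "\<dots> \<le> (\<Sum>k<n. 4 * (?t * M * E k * ((M + N * real k) * \<bar>\<theta>\<bar>) + M * \<bar>\<theta>\<bar> * E k) + 16 * (?t * M * E k) * q k)"
      using main by (intro order_trans[OF norm_sum] sum_mono) blast
    also have "\<dots> = (\<Sum>k<n. 20 * ?t * M * \<bar>\<theta>\<bar> * (E k * (M + N * real k)) + (4 * M * \<bar>\<theta>\<bar> + 16 * ?t * M * \<bar>\<omega>\<bar>) * E k)"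
      by (intro sum.cong refl) (simp add: q_def algebra_simps)
    also have "\<dots> = 20 * ?t * M * \<bar>\<theta>\<bar> * (\<Sum>k<n. E k * (M + N * real k)) + (4 * M * \<bar>\<theta>\<bar> + 16 * ?t * M * \<bar>\<omega>\<bar>) * (\<Sum>k<n. E k)"
      by (simp only: sum.distrib sum_distrib_left)
    also have "\<dots> \<le> 20 * ?t * M * \<bar>\<theta>\<bar> * ((2 * M + 8 * N) / ?t\<^sup>2) + (4 * M * \<bar>\<theta>\<bar> + 16 * ?t * M * \<bar>\<omega>\<bar>) * (2 / ?t)"
      using t M1 by (intro add_mono mult_left_mono SE SM) auto
    also have "\<dots> = (20 * M * (2 * M + 8 * N) + 8 * M) * (\<bar>\<theta>\<bar> / ?t) + 32 * M * \<bar>\<omega>\<bar>"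
      using t by (simp add: power2_eq_square field_simps)
    also have "\<dots> \<le> C * (\<bar>\<theta>\<bar> / ?t) + C * \<bar>\<omega>\<bar>"
      using t M1 by (intro add_mono mult_right_mono) (auto simp: C_def)
    finally show ?thesis using S1 by (simp add: distrib_left)
  qed
  then show ?thesis using C0 by blast
qed

text \<open>After division by sin (\<omega>/2) the trigonometric factor is fejer \<omega> (1 + cos
  \<omega>), which tends to 2, and the sum of the ratio terms tends to shift / (2N); the product is
  the constant shift / N.\<close>

lemma sgn_gf_major:
  "\<exists>C>0. \<forall>n\<ge>1. \<forall>\<theta> \<omega>. \<bar>\<theta>\<bar> \<le> saddle n / 4 \<longrightarrow> \<omega> \<noteq> 0 \<longrightarrow> \<bar>\<omega>\<bar> \<le> 1 / 4 \<longrightarrow>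
    cmod (sgn_gf n \<theta> \<omega> - of_real (shift / N) * Phi n \<theta> (- \<omega>))
      \<le> C * (\<bar>\<theta>\<bar> / saddle n + \<bar>\<omega>\<bar> + saddle n) * cmod (Phi n \<theta> (- \<omega>))"
proof -
  obtain C where C: "0 < C" and R: "\<And>n \<theta> \<omega>. 1 \<le> n \<Longrightarrow> \<bar>\<theta>\<bar> \<le> saddle n / 4 \<Longrightarrow> \<bar>\<omega>\<bar> \<le> 1 / 4 \<Longrightarrow>
      (\<Sum>k<n. cmod (ratio_term n \<theta> \<omega> k)) \<le> C \<and>
      cmod ((\<Sum>k<n. ratio_term n \<theta> \<omega> k) - of_real (mean_diff n)) \<le> C * (\<bar>\<theta>\<bar> / saddle n + \<bar>\<omega>\<bar>)"
    using ratio_term_approx by blast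
  obtain D0 where D0: "\<And>n. n \<ge> 1 \<Longrightarrow> \<bar>mean_diff n - shift / (2 * real N)\<bar> \<le> D0 * saddle n" using mean_diff_bound by blast
  define D where "D = max D0 0"
  have D: "\<bar>mean_diff n - shift / (2 * real N)\<bar> \<le> D * saddle n" if "n \<ge> 1" for n
  proof -
    have "D0 * saddle n \<le> D * saddle n" using saddle_pos[OF that] by (intro mult_right_mono) (auto simp: D_def)
    then show ?thesis using D0[OF that] by linarith
  qed
  have D1: "0 \<le> D" by (simp add: D_def)
  \<comment> \<open>14 = 7 \<cdot> 4 / 2: the 7 from |sin (\<omega>/2)| \<ge> |\<omega>|/7, the 4
    from the square of 2 |\<omega>| C, the 2 from the denominator 2i.\<close>
  define C1 where "C1 = 14 * C\<^sup>2 * exp (2 * C)"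
  define C2 where "C2 = C1 + (2 * N + 1) * C + 2 * C + 2 * D"
  have C1: "0 \<le> C1" by (simp add: C1_def)
  have C2: "0 < C2" unfolding C2_def using C C1 D1 by (intro add_pos_nonneg add_nonneg_pos) auto
  have "cmod (sgn_gf n \<theta> \<omega> - of_real (shift / N) * Phi n \<theta> (- \<omega>)) \<le> C2 * (\<bar>\<theta>\<bar> / saddle n + \<bar>\<omega>\<bar> + saddle n) * cmod (Phi n \<theta> (- \<omega>))"
    if n: "n \<ge> 1" and th: "\<bar>\<theta>\<bar> \<le> saddle n / 4" and om: "\<omega> \<noteq> 0" "\<bar>\<omega>\<bar> \<le> 1 / 4" for n \<theta> \<omega>
  proof -
    let ?t = "saddle n" let ?W = "sgn_gf n \<theta> \<omega>" let ?P = "Phi n \<theta> (- \<omega>)"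
    have t: "0 < ?t" using saddle_pos[OF n] .
    define S where "S = (\<Sum>k<n. ratio_term n \<theta> \<omega> k)"
    define y where "y = (\<lambda>k. 2 * \<i> * of_real (sin \<omega>) * ratio_term n \<theta> \<omega> k)"
    define Y where "Y = (\<Sum>k<n. cmod (y k))"
    define T where "T = (\<Prod>k<n. 1 + y k) - 1 - (\<Sum>k<n. y k)"
    define F where "F = fejer \<omega> * (1 + cos \<omega>)"
    have Y0: "0 \<le> Y" by (simp add: Y_def sum_nonneg)
    have "Y = 2 * \<bar>sin \<omega>\<bar> * (\<Sum>k<n. cmod (ratio_term n \<theta> \<omega> k))" by (simp add: Y_def y_def norm_mult sum_distrib_left)
    also have "\<dots> \<le> 2 * \<bar>\<omega>\<bar> * C"
      using R[OF n th om(2)] abs_sin_x_le_abs_x by (intro mult_mono mult_left_mono) (auto intro: sum_nonneg)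
    finally have Y1: "Y \<le> 2 * \<bar>\<omega>\<bar> * C" .
    have "2 * \<bar>\<omega>\<bar> * C \<le> 2 * C" using om C by simp
    then have Y2: "Y \<le> 2 * C" using Y1 by linarith
    have "cmod T \<le> Y\<^sup>2 * exp Y" unfolding T_def Y_def by (rule prod_one_plus_approx)
    also have "\<dots> \<le> (2 * \<bar>\<omega>\<bar> * C)\<^sup>2 * exp (2 * C)" using Y0 Y1 Y2 by (intro mult_mono power_mono) auto
    finally have T: "cmod T \<le> 4 * \<omega>\<^sup>2 * C\<^sup>2 * exp (2 * C)" by (simp add: power_mult_distrib)
    have sy: "(\<Sum>k<n. y k) = 2 * \<i> * of_real (sin \<omega>) * S" by (simp only: y_def S_def sum_distrib_left)
    have "Phi n \<theta> \<omega> - ?P = ?P * ((\<Prod>k<n. 1 + y k) - 1)" unfolding y_def by (rule Phi_ratio[OF n])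
    also have "(\<Prod>k<n. 1 + y k) - 1 = 2 * \<i> * of_real (sin \<omega>) * S + T"
    proof -
      have "p - 1 = q + (p - 1 - q)" for p q :: complex by simp
      then show ?thesis unfolding T_def sy[symmetric] .
    qed
    finally have d: "Phi n \<theta> \<omega> - ?P = ?P * (2 * \<i> * of_real (sin \<omega>) * S + T)" .
    have "p * (2 * \<i> * w * S + T) / (2 * \<i>) = p * (w * S) + p * T / (2 * \<i>)" for p w :: complex
      by (simp add: distrib_left add_divide_distrib)
    then have pd: "(Phi n \<theta> \<omega> - ?P) / (2 * \<i>) = ?P * (of_real (sin \<omega>) * S) + ?P * T / (2 * \<i>)"
      unfolding d .
    have tr: "cos (\<omega> / 2) * sin \<omega> = sin (\<omega> / 2) * (1 + cos \<omega>)"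
      using sin_double[of "\<omega> / 2"] cos_double_cos[of "\<omega> / 2"] by (simp add: power2_eq_square)
    have "of_real (sin (\<omega> / 2)) * ?W = of_real (cos (\<omega> / 2) * sin \<omega> * fejer \<omega>) * (?P * S) + of_real (cos (\<omega> / 2) * fejer \<omega>) * (?P * T / (2 * \<i>))"
      unfolding sgn_gf_identity pd by (simp only: distrib_left of_real_mult mult_ac)
    also have "of_real (cos (\<omega> / 2) * sin \<omega> * fejer \<omega>) = of_real (sin (\<omega> / 2)) * (of_real F :: complex)"
      unfolding tr F_def by (simp only: of_real_mult mult_ac)
    finally have W1: "of_real (sin (\<omega> / 2)) * (?W - of_real F * (?P * S)) = of_real (cos (\<omega> / 2) * fejer \<omega>) * (?P * T / (2 * \<i>))"
      by (simp only: right_diff_distrib mult.assoc add_diff_cancel_left')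
    have "\<bar>\<omega>\<bar> / 7 * cmod (?W - of_real F * (?P * S)) \<le> \<bar>sin (\<omega> / 2)\<bar> * cmod (?W - of_real F * (?P * S))"
      using om pi_gt3 by (intro mult_right_mono abs_sin_half_ge) auto
    also have "\<dots> = cmod (of_real (cos (\<omega> / 2) * fejer \<omega>) * (?P * T / (2 * \<i>)))"
      unfolding W1[symmetric] by (simp only: norm_mult norm_of_real)
    also have "\<dots> = \<bar>cos (\<omega> / 2)\<bar> * \<bar>fejer \<omega>\<bar> * (cmod ?P * cmod T / 2)" by (simp add: norm_mult norm_divide abs_mult)
    also have "\<dots> \<le> 1 * 1 * (cmod ?P * cmod T / 2)"
      using abs_fejer_le_1 by (intro mult_right_mono mult_mono) auto
    also have "\<dots> \<le> 1 * 1 * (cmod ?P * (4 * \<omega>\<^sup>2 * C\<^sup>2 * exp (2 * C)) / 2)"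
      by (intro mult_left_mono divide_right_mono T) auto
    also have "\<dots> = \<bar>\<omega>\<bar> / 7 * (C1 * \<bar>\<omega>\<bar> * cmod ?P)"
    proof -
      have "\<omega>\<^sup>2 = \<bar>\<omega>\<bar> * \<bar>\<omega>\<bar>" by (simp add: power2_eq_square)
      then show ?thesis unfolding C1_def by simp
    qed
    finally have "\<bar>\<omega>\<bar> / 7 * cmod (?W - of_real F * (?P * S)) \<le> \<bar>\<omega>\<bar> / 7 * (C1 * \<bar>\<omega>\<bar> * cmod ?P)" .
    then have w1: "cmod (?W - of_real F * (?P * S)) \<le> C1 * \<bar>\<omega>\<bar> * cmod ?P"
      by (rule mult_left_le_imp_le) (use om in auto)
    have F2: "\<bar>F - 2\<bar> \<le> (2 * N + 1) * \<bar>\<omega>\<bar>"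
    proof -
      have "F - 2 = (fejer \<omega> - 1) * (1 + cos \<omega>) + (cos \<omega> - 1)" by (simp add: F_def algebra_simps)
      moreover have "\<bar>1 + cos \<omega>\<bar> \<le> 2" using cos_ge_minus_one[of \<omega>] cos_le_one[of \<omega>] by linarith
      then have "\<bar>(fejer \<omega> - 1) * (1 + cos \<omega>)\<bar> \<le> (N * \<bar>\<omega>\<bar>) * 2"
        unfolding abs_mult using fejer_diff_le[of 0 \<omega>] fejer_0 by (intro mult_mono) auto
      moreover have "\<bar>a + b\<bar> \<le> (2 * n + 1) * w" if "\<bar>a\<bar> \<le> n * w * 2" "\<bar>b\<bar> \<le> w" for a b n w :: real
        using that by (simp add: distrib_right)
      then have "\<bar>(fejer \<omega> - 1) * (1 + cos \<omega>) + (cos \<omega> - 1)\<bar> \<le> (2 * real N + 1) * \<bar>\<omega>\<bar>"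
        using abs_cos_minus_one_le[of \<omega>] \<open>\<bar>(fejer \<omega> - 1) * (1 + cos \<omega>)\<bar> \<le> (N * \<bar>\<omega>\<bar>) * 2\<close> by blast
      ultimately show ?thesis by (simp only: of_nat_add of_nat_mult of_nat_numeral of_nat_1)
    qed
    have S0: "cmod S \<le> C" using R[OF n th om(2)] norm_sum[of "ratio_term n \<theta> \<omega>" "{..<n}"] unfolding S_def by linarith
    have S1: "cmod (2 * S - of_real (shift / N)) \<le> 2 * (C * (\<bar>\<theta>\<bar> / ?t + \<bar>\<omega>\<bar>) + D * ?t)"
    proof -
      have "2 * S - of_real (shift / N) = 2 * ((S - of_real (mean_diff n)) + of_real (mean_diff n - shift / (2 * real N)))" by simp
      then have "cmod (2 * S - of_real (shift / N)) = 2 * cmod ((S - of_real (mean_diff n)) + of_real (mean_diff n - shift / (2 * real N)))"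
        by (simp only: norm_mult norm_numeral)
      also have "\<dots> \<le> 2 * (C * (\<bar>\<theta>\<bar> / ?t + \<bar>\<omega>\<bar>) + D * ?t)"
        using R[OF n th om(2)] D[OF n] unfolding S_def
        by (intro mult_left_mono norm_triangle_le add_mono) (auto simp only: norm_of_real)
      finally show ?thesis .
    qed
    have "cmod (of_real F * S - of_real (shift / N)) \<le> (2 * N + 1) * \<bar>\<omega>\<bar> * C + 2 * (C * (\<bar>\<theta>\<bar> / ?t + \<bar>\<omega>\<bar>) + D * ?t)"
    proof -
      have "of_real F * S - of_real (shift / N) = of_real (F - 2) * S + (2 * S - of_real (shift / N))" by (simp add: algebra_simps)
      also have "cmod \<dots> \<le> (2 * N + 1) * \<bar>\<omega>\<bar> * C + 2 * (C * (\<bar>\<theta>\<bar> / ?t + \<bar>\<omega>\<bar>) + D * ?t)"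
      proof (intro norm_triangle_le add_mono S1)
        show "cmod (of_real (F - 2) * S) \<le> (2 * N + 1) * \<bar>\<omega>\<bar> * C"
          unfolding norm_mult norm_of_real using F2 S0 by (intro mult_mono) auto
      qed
      finally show ?thesis .
    qed
    also have "\<dots> = ((2 * N + 1) * C) * \<bar>\<omega>\<bar> + 2 * C * (\<bar>\<theta>\<bar> / ?t) + 2 * C * \<bar>\<omega>\<bar> + 2 * D * ?t"
      by (simp only: distrib_left mult_ac add_ac)
    finally have w2: "cmod (of_real F * S - of_real (shift / N)) \<le> ((2 * N + 1) * C) * \<bar>\<omega>\<bar> + 2 * C * (\<bar>\<theta>\<bar> / ?t) + 2 * C * \<bar>\<omega>\<bar> + 2 * D * ?t" .
    have "?W - of_real (shift / N) * ?P = (?W - of_real F * (?P * S)) + (of_real F * S - of_real (shift / N)) * ?P" by (simp add: algebra_simps)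
    also have "cmod \<dots> \<le> C1 * \<bar>\<omega>\<bar> * cmod ?P + (((2 * N + 1) * C) * \<bar>\<omega>\<bar> + 2 * C * (\<bar>\<theta>\<bar> / ?t) + 2 * C * \<bar>\<omega>\<bar> + 2 * D * ?t) * cmod ?P"
      using w1 mult_right_mono[OF w2 norm_ge_zero, of ?P] by (intro norm_triangle_le add_mono) (simp_all only: norm_mult)
    also have "\<dots> = (C1 * \<bar>\<omega>\<bar> + ((2 * N + 1) * C) * \<bar>\<omega>\<bar> + 2 * C * (\<bar>\<theta>\<bar> / ?t) + 2 * C * \<bar>\<omega>\<bar> + 2 * D * ?t) * cmod ?P"
      by (simp only: distrib_right add_ac)
    also have "\<dots> \<le> (C2 * (\<bar>\<theta>\<bar> / ?t + \<bar>\<omega>\<bar> + ?t)) * cmod ?P"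
    proof (intro mult_right_mono norm_ge_zero)
      have "c1 * w + c3 * w + 2 * C * x + 2 * C * w + 2 * D * t \<le> (c1 + c3 + 2 * C + 2 * D) * (x + w + t)"
        if "0 \<le> c1" "0 \<le> c3" "0 \<le> w" "0 \<le> x" "0 \<le> t" for c1 c3 w x t :: real
      proof -
        have "0 \<le> (c1 + c3 + 2 * D) * x + 2 * D * w + (c1 + c3 + 2 * C) * t" using that C D1 by auto
        then show ?thesis by (simp add: algebra_simps)
      qed
      note gen = this
      show "C1 * \<bar>\<omega>\<bar> + ((2 * N + 1) * C) * \<bar>\<omega>\<bar> + 2 * C * (\<bar>\<theta>\<bar> / ?t) + 2 * C * \<bar>\<omega>\<bar> + 2 * D * ?t \<le> C2 * (\<bar>\<theta>\<bar> / ?t + \<bar>\<omega>\<bar> + ?t)"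
        unfolding C2_def using C C1 t by (intro gen) auto
    qed
    finally show ?thesis .
  qed
  then show ?thesis using C2 by blast
qed

text \<open>On the Gaussian scale |\<theta>|/t + |\<omega>| is s times the two absolute values on
  the left. Halving \<open>c\<close> absorbs these linear factors, and the gain s remains.\<close>

lemma gauss_err_absorb:
  assumes c: "0 < c"
  shows "(1 + \<bar>\<theta> / s ^ 3\<bar> + \<bar>\<omega> / s\<bar>) * gauss_err c s \<theta> \<omega> \<le> (3 + 2 / c) * gauss_err (c / 2) s \<theta> \<omega>"
proof -
  define S where "S = (\<theta> / s ^ 3)\<^sup>2 + (\<omega> / s)\<^sup>2"
  have S0: "0 \<le> S" by (simp add: S_def)
  have a: "\<bar>x\<bar> \<le> 1 + x\<^sup>2" for x :: real
  proof -
    have "0 \<le> (1 - \<bar>x\<bar>)\<^sup>2" by simp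
    then have "2 * \<bar>x\<bar> \<le> 1 + x\<^sup>2" by (simp add: power2_diff)
    then show ?thesis using abs_ge_zero[of x] by linarith
  qed
  have 1: "1 + \<bar>\<theta> / s ^ 3\<bar> + \<bar>\<omega> / s\<bar> \<le> 3 + S" using a[of "\<theta> / s ^ 3"] a[of "\<omega> / s"] unfolding S_def by linarith
  have e1: "exp (- (c / 2 * S)) \<le> 1" using c S0 by simp
  have "c / 2 * S \<le> exp (c / 2 * S)" using exp_ge_add_one_self[of "c / 2 * S"] by linarith
  then have "(c / 2 * S) * exp (- (c / 2 * S)) \<le> 1" by (simp add: exp_minus divide_simps)
  then have e2: "S * exp (- (c / 2 * S)) \<le> 2 / c" using c by (simp add: field_simps)
  have "(1 + \<bar>\<theta> / s ^ 3\<bar> + \<bar>\<omega> / s\<bar>) * gauss_err c s \<theta> \<omega> \<le> (3 + S) * gauss_err c s \<theta> \<omega>"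
    using gauss_err_pos[of c s \<theta> \<omega>] by (intro mult_right_mono 1) auto
  also have "(3 + S) * gauss_err c s \<theta> \<omega> = (3 + S) * (exp (- (c / 2 * S)) * gauss_err (c / 2) s \<theta> \<omega>)"
    unfolding gauss_err_def S_def[symmetric] exp_add[symmetric] by simp
  also have "(3 + S) * (exp (- (c / 2 * S)) * gauss_err (c / 2) s \<theta> \<omega>) = (3 * exp (- (c / 2 * S)) + S * exp (- (c / 2 * S))) * gauss_err (c / 2) s \<theta> \<omega>"
    by (simp only: distrib_right mult.assoc)
  also have "\<dots> \<le> (3 + 2 / c) * gauss_err (c / 2) s \<theta> \<omega>"
    using e1 e2 gauss_err_pos[of "c / 2" s \<theta> \<omega>] by (intro mult_right_mono) linarith+
  finally show ?thesis .
qed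

lemma gauss_minus: "gauss s \<theta> (- \<omega>) = gauss s \<theta> \<omega>" "gauss_err c s \<theta> (- \<omega>) = gauss_err c s \<theta> \<omega>"
  by (simp_all add: gauss_def gauss_err_def gauss_exponent_def)

lemma resonant_fst: "resonant a 0 \<longleftrightarrow> int N dvd a"
  using N_ge_2 by (auto simp: resonant_def dest: bspec[of _ _ 1])

text \<open>For b \<noteq> 0 the Fejer factor is O(|\<omega>|) and the sine in the denominator is
  bounded below, so even resonant peaks fall into the error. For b = 0 resonance forces a = 0, and
  only the peak at the origin needs the cancellation.\<close>

lemma sgn_gf_approx:
  "\<exists>A>0. \<exists>c>0. c \<le> 1 / (8 * N) \<and> (\<forall>\<^sub>F n in sequentially. \<forall>a<N. \<forall>b<N. \<forall>\<theta>\<in>arc. \<forall>\<omega>\<in>arc. \<omega> \<noteq> 0 \<longrightarrow>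
    cmod (sgn_gf n (\<theta> + step a) (\<omega> + step b) * cis (- (real n * \<theta>)) - (if a = 0 \<and> b = 0 then of_real (shift / N) else 0) * of_real (gauss (scale n) \<theta> \<omega>))
      \<le> A * (scale n * gauss_err c (scale n) \<theta> \<omega> + scale n ^ 6))"
proof -
  obtain C0 c where C0: "0 < C0" and c: "0 < c" "c \<le> 1 / (8 * N)" and
    ev: "\<forall>\<^sub>F n in sequentially. \<forall>a b. \<forall>\<theta>\<in>arc. \<forall>\<omega>\<in>arc.
    cmod (Phi n (\<theta> + 2 * pi * of_int a / N) (\<omega> + 2 * pi * of_int b / N) * cis (- (real n * \<theta>)) - (if resonant a b then of_real (gauss (scale n) \<theta> \<omega>) else 0))
      \<le> C0 * (scale n * gauss_err c (scale n) \<theta> \<omega> + scale n ^ 6) \<and>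
    \<bar>Re (Phi n (\<theta> + 2 * pi * of_int a / N) (\<omega> + 2 * pi * of_int b / N) * cis (- (real n * \<theta>))) - (if resonant a b then gauss (scale n) \<theta> \<omega> else 0)\<bar>
      \<le> C0 * ((scale n)\<^sup>2 * gauss_err c (scale n) \<theta> \<omega> + scale n ^ 6)"
    using Phi_approx by blast
  have ev1: "\<forall>\<^sub>F n in sequentially. \<forall>a b. \<forall>\<theta>\<in>arc. \<forall>\<omega>\<in>arc.
    cmod (Phi n (\<theta> + 2 * pi * of_int a / N) (\<omega> + 2 * pi * of_int b / N) * cis (- (real n * \<theta>)) - (if resonant a b then of_real (gauss (scale n) \<theta> \<omega>) else 0))
      \<le> C0 * (scale n * gauss_err c (scale n) \<theta> \<omega> + scale n ^ 6)"
    using ev by (rule eventually_mono) blast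
  obtain C1 where C1: "0 < C1" and maj: "\<And>n \<theta> \<omega>. n \<ge> 1 \<Longrightarrow> \<bar>\<theta>\<bar> \<le> saddle n / 4 \<Longrightarrow> \<omega> \<noteq> 0 \<Longrightarrow> \<bar>\<omega>\<bar> \<le> 1 / 4 \<Longrightarrow>
    cmod (sgn_gf n \<theta> \<omega> - of_real (shift / N) * Phi n \<theta> (- \<omega>)) \<le> C1 * (\<bar>\<theta>\<bar> / saddle n + \<bar>\<omega>\<bar> + saddle n) * cmod (Phi n \<theta> (- \<omega>))"
    using sgn_gf_major by blast
  obtain c1 where c1: "0 < c1" and ev2: "\<forall>\<^sub>F n in sequentially. \<forall>a b \<theta> \<omega>. \<bar>\<theta>\<bar> \<le> pi / N \<longrightarrow> \<bar>\<omega>\<bar> \<le> pi / N \<longrightarrow>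
    \<not> (resonant a b \<and> \<bar>\<theta>\<bar> \<le> 1 / 4 * saddle n \<and> \<bar>\<omega>\<bar> \<le> 1 / 4) \<longrightarrow>
    cmod (Phi n (\<theta> + 2 * pi * of_int a / N) (\<omega> + 2 * pi * of_int b / N)) \<le> exp (- (c1 / saddle n))"
    using minor_arc[of "1 / 4"] by auto
  have ev3: "\<forall>\<^sub>F n in sequentially. exp (- (c1 / saddle n)) \<le> scale n ^ 12" by (rule eventually_exp_saddle_le[OF c1])
  have N: "real N \<ge> 2" using N_ge_2 by simp
  \<comment> \<open>The square of sin (w/2) is (1 - cos w) / 2. For b \<noteq> 0 the shifted angle w
    stays at least \<pi>/N away from the multiples of 2\<pi>, so this is a lower bound for
    it.\<close>
  define \<sigma> where "\<sigma> = (1 - cos (pi / N)) / 2"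
  have "cos (pi / N) < cos 0" using N pi_gt_zero by (intro cos_monotone_0_pi) (auto simp: divide_simps)
  then have \<sigma>: "0 < \<sigma>" by (simp add: \<sigma>_def)
  define B where "B = 3 + 2 / c"
  have B: "3 \<le> B" using c by (simp add: B_def)
  define M where "M = \<bar>shift\<bar> / N"
  have M: "0 \<le> M" by (simp add: M_def)
  define R where "R = 7 + 112 * exp 32 + M * (1 / (c * (1 / 4)\<^sup>2))"
  have R: "0 < R" unfolding R_def using M c by (intro add_pos_nonneg) (auto intro: add_pos_pos)
  define A where "A = C1 * (1 + C0) * B + 2 * C1 * C0 + M * C0 + R + N * (1 + C0) * B / \<sigma> + pi * C0 / \<sigma>"
  have A0: "0 < A" unfolding A_def using C0 C1 M R B \<sigma> by (intro add_pos_nonneg add_nonneg_pos) auto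
  have key: "cmod (sgn_gf n (\<theta> + step a) (\<omega> + step b) * cis (- (real n * \<theta>)) - (if a = 0 \<and> b = 0 then of_real (shift / N) else 0) * of_real (gauss (scale n) \<theta> \<omega>))
      \<le> A * (scale n * gauss_err (c / 2) (scale n) \<theta> \<omega> + scale n ^ 6)"
    if n: "n \<ge> 1" and phi: "\<And>a b \<theta> \<omega>. \<theta> \<in> arc \<Longrightarrow> \<omega> \<in> arc \<Longrightarrow>
        cmod (Phi n (\<theta> + 2 * pi * of_int a / N) (\<omega> + 2 * pi * of_int b / N) * cis (- (real n * \<theta>)) - (if resonant a b then of_real (gauss (scale n) \<theta> \<omega>) else 0))
        \<le> C0 * (scale n * gauss_err c (scale n) \<theta> \<omega> + scale n ^ 6)"
      and minor: "\<And>a b \<theta> \<omega>. \<theta> \<in> arc \<Longrightarrow> \<omega> \<in> arc \<Longrightarrow> \<not> (resonant a b \<and> \<bar>\<theta>\<bar> \<le> 1 / 4 * saddle n \<and> \<bar>\<omega>\<bar> \<le> 1 / 4) \<Longrightarrow>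
        cmod (Phi n (\<theta> + 2 * pi * of_int a / N) (\<omega> + 2 * pi * of_int b / N)) \<le> scale n ^ 12"
      and ab: "a < N" "b < N" and th: "\<theta> \<in> arc" and om: "\<omega> \<in> arc" "\<omega> \<noteq> 0" for n a b \<theta> \<omega>
  proof -
    let ?s = "scale n" let ?t = "saddle n"
    let ?g = "gauss_err c ?s \<theta> \<omega>" let ?h = "gauss_err (c / 2) ?s \<theta> \<omega>" let ?G = "gauss ?s \<theta> \<omega>"
    have s: "0 < ?s" "?s \<le> 1" using scale_pos scale_le_1 n by auto
    have t: "?t = ?s\<^sup>2" using scale_sq[OF n] by simp
    have g: "0 < ?g" "0 < ?h" by (rule gauss_err_pos)+
    have gh: "?g \<le> ?h" using c by (intro gauss_err_antimono) auto
    have "c \<le> 1 / (2 * N)"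
    proof (rule order_trans[OF c(2)])
      show "1 / (8 * N) \<le> 1 / real (2 * N)" using N by (simp add: field_simps)
    qed
    then have Gg: "?G \<le> ?g" by (intro gauss_le_err) simp
    have G0: "0 < ?G" by (simp add: gauss_def)
    have s6: "0 \<le> ?s ^ 6" using s by simp
    have sg: "?s * ?g \<le> ?g" using s g by simp
    have Phi_le: "cmod (Phi n (\<theta> + 2 * pi * of_int a / N) (\<psi> + 2 * pi * of_int b / N)) \<le> (1 + C0) * ?g + C0 * ?s ^ 6" if "\<psi> = \<omega> \<or> \<psi> = - \<omega>" for a b \<psi>
    proof -
      have ps: "\<psi> \<in> arc" "gauss ?s \<theta> \<psi> = ?G" "gauss_err c ?s \<theta> \<psi> = ?g" using that om arc_minus by (auto simp: gauss_minus)
      let ?P = "Phi n (\<theta> + 2 * pi * of_int a / N) (\<psi> + 2 * pi * of_int b / N)"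
      have "cmod (if resonant a b then of_real ?G else 0 :: complex) \<le> ?g" using Gg g G0 by auto
      moreover have "cmod (?P * cis (- (real n * \<theta>)) - (if resonant a b then of_real ?G else 0)) \<le> C0 * (?s * ?g + ?s ^ 6)"
        using phi[OF th ps(1), of a b] unfolding ps by simp
      moreover have "C0 * (?s * ?g + ?s ^ 6) \<le> C0 * (?g + ?s ^ 6)" using C0 sg by (intro mult_left_mono add_right_mono) auto
      moreover have "cmod (?P * cis (- (real n * \<theta>))) = cmod ?P" by (simp add: norm_mult)
      moreover have "cmod p \<le> (1 + C0) * y + C0 * z" if "cmod q \<le> y" "cmod (p' - q) \<le> w" "w \<le> C0 * (y + z)" "cmod p' = cmod p" for p p' q :: complex and w y z
        using that norm_triangle_ineq2[of p' q] by (simp add: algebra_simps)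
      ultimately show ?thesis by blast
    qed
    have Cg: "(\<bar>\<theta>\<bar> / ?t + \<bar>\<omega>\<bar> + ?t) * ?g \<le> B * (?s * ?h)" "\<bar>\<omega>\<bar> * ?g \<le> B * (?s * ?h)"
    proof -
      have ab: "(1 + \<bar>\<theta> / ?s ^ 3\<bar> + \<bar>\<omega> / ?s\<bar>) * ?g \<le> B * ?h" unfolding B_def by (rule gauss_err_absorb[OF c(1)])
      have e: "\<bar>\<theta>\<bar> / ?t = ?s * \<bar>\<theta> / ?s ^ 3\<bar>" "\<bar>\<omega>\<bar> = ?s * \<bar>\<omega> / ?s\<bar>"
        using s unfolding t by (auto simp: abs_divide power2_eq_square power3_eq_cube)
      have "?t \<le> ?s * 1" using s unfolding t power2_eq_square by (intro mult_left_mono) auto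
      then have 1: "\<bar>\<theta>\<bar> / ?t + \<bar>\<omega>\<bar> + ?t \<le> ?s * (1 + \<bar>\<theta> / ?s ^ 3\<bar> + \<bar>\<omega> / ?s\<bar>)"
        unfolding distrib_left using e by linarith
      have "0 \<le> ?s * 1 + ?s * \<bar>\<theta> / ?s ^ 3\<bar>" using s by simp
      then have 2: "\<bar>\<omega>\<bar> \<le> ?s * (1 + \<bar>\<theta> / ?s ^ 3\<bar> + \<bar>\<omega> / ?s\<bar>)"
        unfolding distrib_left using e by linarith
      have 3: "x * ?g \<le> B * (?s * ?h)" if "x \<le> ?s * (1 + \<bar>\<theta> / ?s ^ 3\<bar> + \<bar>\<omega> / ?s\<bar>)" for x
      proof -
        have "x * ?g \<le> ?s * (1 + \<bar>\<theta> / ?s ^ 3\<bar> + \<bar>\<omega> / ?s\<bar>) * ?g" using that g by (intro mult_right_mono) auto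
        also have "\<dots> \<le> ?s * (B * ?h)" unfolding mult.assoc using s ab by (intro mult_left_mono) auto
        finally show ?thesis by (simp only: mult_ac)
      qed
      show "(\<bar>\<theta>\<bar> / ?t + \<bar>\<omega>\<bar> + ?t) * ?g \<le> B * (?s * ?h)" "\<bar>\<omega>\<bar> * ?g \<le> B * (?s * ?h)" using 3 1 2 by blast+
    qed
    have X: "0 \<le> ?s * ?h" using s g by simp
    have fin: "p * (?s * ?h) + q * ?s ^ 6 \<le> A * (?s * ?h + ?s ^ 6)" if "p \<le> A" "q \<le> A" for p q
      unfolding distrib_left using that X s6 by (intro add_mono mult_right_mono) auto
    have p0: "0 \<le> C1 * (1 + C0) * B" "0 \<le> 2 * C1 * C0" "0 \<le> M * C0" "0 \<le> N * (1 + C0) * B / \<sigma>" "0 \<le> pi * C0 / \<sigma>"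
      using C0 C1 M B \<sigma> by auto
    have st: "step k = 2 * pi * of_int (int k) / N" for k by (simp add: step_def)
    have alg: "x * l * ((1 + k) * y + k * z) = x * (1 + k) * (l * y) + x * (l * (k * z))" for x l k y z :: real
      by (simp add: algebra_simps)
    have omN: "\<bar>\<omega>\<bar> \<le> pi / N" using om by (simp add: arc_iff)
    have piN: "pi / N \<le> pi" using N pi_gt_zero by (simp add: divide_simps)
    \<comment> \<open>The threshold 1/4 is that of \<open>sgn_gf_major\<close>. In the second case
      either a \<noteq> 0 and (a, 0) is not resonant, or the point is off the central peak; in both
      situations \<Phi> is O(s^12).\<close>
    consider (major) "a = 0" "b = 0" "\<bar>\<theta>\<bar> \<le> 1 / 4 * ?t" "\<bar>\<omega>\<bar> \<le> 1 / 4"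
      | (minor) "b = 0" "\<not> (a = 0 \<and> \<bar>\<theta>\<bar> \<le> 1 / 4 * ?t \<and> \<bar>\<omega>\<bar> \<le> 1 / 4)" | (away) "b \<noteq> 0" by blast
    then show ?thesis
    proof cases
      case major
      let ?P = "Phi n \<theta> (- \<omega>)"
      let ?L = "\<bar>\<theta>\<bar> / ?t + \<bar>\<omega>\<bar> + ?t"
      have t0: "0 < ?t" "?t \<le> 1" using saddle_pos saddle_le_1 n by auto
      have "\<bar>\<theta>\<bar> / ?t \<le> 1 / 4" using major(3) t0 by (simp add: divide_simps)
      moreover have "0 \<le> \<bar>\<theta>\<bar> / ?t" using t0 by simp
      ultimately have L: "0 \<le> ?L" "?L \<le> 2" using major(4) t0 abs_ge_zero[of \<omega>] by linarith+
      have P: "cmod ?P \<le> (1 + C0) * ?g + C0 * ?s ^ 6" using Phi_le[of "- \<omega>" 0 0] by simp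
      have 1: "cmod (sgn_gf n \<theta> \<omega> - of_real (shift / N) * ?P) \<le> C1 * (1 + C0) * B * (?s * ?h) + 2 * C1 * C0 * ?s ^ 6"
      proof -
        have "cmod (sgn_gf n \<theta> \<omega> - of_real (shift / N) * ?P) \<le> C1 * ?L * cmod ?P"
          using major om n by (intro maj) auto
        also have "\<dots> \<le> C1 * ?L * ((1 + C0) * ?g + C0 * ?s ^ 6)" using C1 L by (intro mult_left_mono P) auto
        also have "\<dots> = C1 * (1 + C0) * (?L * ?g) + C1 * (?L * (C0 * ?s ^ 6))" by (rule alg)
        also have "\<dots> \<le> C1 * (1 + C0) * (B * (?s * ?h)) + C1 * (2 * (C0 * ?s ^ 6))"
          using C1 C0 L s6 by (intro add_mono mult_left_mono mult_right_mono Cg) auto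
        finally show ?thesis by (simp only: mult_ac)
      qed
      have "cmod (?P * cis (- (real n * \<theta>)) - of_real ?G) \<le> C0 * (?s * ?g + ?s ^ 6)"
        using phi[OF th arc_minus[OF om(1)], of 0 0] resonant_fst[of 0] by (simp add: gauss_minus)
      also have "\<dots> \<le> C0 * (?s * ?h + ?s ^ 6)" using C0 s gh by (intro mult_left_mono add_right_mono) auto
      finally have 2: "cmod (?P * cis (- (real n * \<theta>)) - of_real ?G) \<le> C0 * (?s * ?h + ?s ^ 6)" .
      have "sgn_gf n \<theta> \<omega> * cis (- (real n * \<theta>)) - of_real (shift / N) * of_real ?G
        = (sgn_gf n \<theta> \<omega> - of_real (shift / N) * ?P) * cis (- (real n * \<theta>)) + of_real (shift / N) * (?P * cis (- (real n * \<theta>)) - of_real ?G)"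
        by (simp add: algebra_simps)
      also have "cmod \<dots> \<le> (C1 * (1 + C0) * B * (?s * ?h) + 2 * C1 * C0 * ?s ^ 6) + M * (C0 * (?s * ?h + ?s ^ 6))"
      proof (intro norm_triangle_le add_mono)
        show "cmod ((sgn_gf n \<theta> \<omega> - of_real (shift / N) * ?P) * cis (- (real n * \<theta>))) \<le> C1 * (1 + C0) * B * (?s * ?h) + 2 * C1 * C0 * ?s ^ 6"
          using 1 unfolding norm_mult norm_cis by (simp only: mult_1_right)
        have "cmod (of_real (shift / N)) = M" unfolding norm_of_real M_def by simp
        then show "cmod (of_real (shift / N) * (?P * cis (- (real n * \<theta>)) - of_real ?G)) \<le> M * (C0 * (?s * ?h + ?s ^ 6))"
          unfolding norm_mult[of "of_real (shift / N)"] using 2 M by (simp only: mult_left_mono)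
      qed
      also have "\<dots> = (C1 * (1 + C0) * B + M * C0) * (?s * ?h) + (2 * C1 * C0 + M * C0) * ?s ^ 6"
        by (simp only: distrib_left distrib_right mult.assoc add_ac)
      also have "\<dots> \<le> A * (?s * ?h + ?s ^ 6)" using p0 R by (intro fin) (auto simp: A_def)
      finally show ?thesis using major by (simp add: step_def)
    next
      case minor
      have nr: "\<not> (resonant (int a) 0 \<and> \<bar>\<theta>\<bar> \<le> 1 / 4 * ?t \<and> \<bar>\<omega>\<bar> \<le> 1 / 4)"
      proof
        assume *: "resonant (int a) 0 \<and> \<bar>\<theta>\<bar> \<le> 1 / 4 * ?t \<and> \<bar>\<omega>\<bar> \<le> 1 / 4"
        then have "int N dvd int a" by (simp only: resonant_fst)
        then have "a = 0" using ab by (auto dest: nat_dvd_not_less)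
        then show False using minor * by blast
      qed
      then have nr': "\<not> (resonant (int a) 0 \<and> \<bar>\<theta>\<bar> \<le> 1 / 4 * ?t \<and> \<bar>- \<omega>\<bar> \<le> 1 / 4)" by simp
      have "cmod (Phi n (\<theta> + step a) \<omega>) \<le> ?s ^ 12" "cmod (Phi n (\<theta> + step a) (- \<omega>)) \<le> ?s ^ 12"
        using that(3)[OF th om(1) nr] that(3)[OF th arc_minus[OF om(1)] nr'] unfolding st by (simp_all only: of_int_0 mult_zero_right div_0 add_0_right)
      then have "cmod (sgn_gf n (\<theta> + step a) \<omega>) \<le> (7 + 112 * exp 32) * ?s ^ 12 / ?t ^ 3"
        using omN piN om by (intro sgn_gf_minor[OF n]) auto
      also have "?s ^ 12 / ?t ^ 3 = ?s ^ 6" unfolding t power_mult[symmetric] using s by (simp add: divide_simps power_add[symmetric])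
      then have "(7 + 112 * exp 32) * ?s ^ 12 / ?t ^ 3 = (7 + 112 * exp 32) * ?s ^ 6" by (simp only: times_divide_eq_right[symmetric])
      finally have 1: "cmod (sgn_gf n (\<theta> + step a) \<omega>) \<le> (7 + 112 * exp 32) * ?s ^ 6" .
      have 2: "cmod ((if a = 0 \<and> b = 0 then of_real (shift / N) else 0) * of_real ?G) \<le> M * (1 / (c * (1 / 4)\<^sup>2)) * (?s * ?h)"
      proof (cases "a = 0")
        case True
        then have out: "\<bar>\<theta>\<bar> > 1 / 4 * ?s\<^sup>2 \<or> \<bar>\<omega>\<bar> > 1 / 4" using minor unfolding t by auto
        have "2 * c \<le> 1 / (2 * N)"
        proof -
          have "2 * c \<le> 2 * (1 / (8 * N))" using c by simp
          also have "\<dots> \<le> 1 / (2 * N)" using N by (simp add: field_simps)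
          finally show ?thesis .
        qed
        then have "?G \<le> gauss_err (2 * c) ?s \<theta> \<omega>" by (intro gauss_le_err) simp
        also have "\<dots> = ?g * ?g" by (rule gauss_err_square)
        also have "\<dots> \<le> (1 / (c * (1 / 4)\<^sup>2) * ?s\<^sup>2) * ?h"
          using c s g gh by (intro mult_mono gauss_err_outside[OF c(1) s _ out]) auto
        also have "\<dots> = 1 / (c * (1 / 4)\<^sup>2) * (?s * (?s * ?h))" by (simp only: power2_eq_square mult_ac)
        also have "\<dots> \<le> 1 / (c * (1 / 4)\<^sup>2) * (?s * (1 * ?h))" using s c g by (intro mult_left_mono mult_right_mono) auto
        finally have G: "?G \<le> 1 / (c * (1 / 4)\<^sup>2) * (?s * ?h)" by simp
        have "cmod ((if a = 0 \<and> b = 0 then of_real (shift / N) else 0) * of_real ?G) = M * ?G"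
          using True minor G0 by (simp add: norm_mult norm_divide M_def)
        also have "\<dots> \<le> M * (1 / (c * (1 / 4)\<^sup>2) * (?s * ?h))" using M by (intro mult_left_mono G)
        finally show ?thesis by (simp only: mult.assoc)
      qed (use M c X in simp)
      have "cmod (sgn_gf n (\<theta> + step a) \<omega> * cis (- (real n * \<theta>)) - (if a = 0 \<and> b = 0 then of_real (shift / N) else 0) * of_real ?G)
        \<le> (7 + 112 * exp 32) * ?s ^ 6 + M * (1 / (c * (1 / 4)\<^sup>2)) * (?s * ?h)"
      proof (intro order_trans[OF norm_triangle_ineq4] add_mono 2)
        show "cmod (sgn_gf n (\<theta> + step a) \<omega> * cis (- (real n * \<theta>))) \<le> (7 + 112 * exp 32) * ?s ^ 6"
          using 1 unfolding norm_mult norm_cis by (simp only: mult_1_right)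
      qed
      also have "\<dots> = M * (1 / (c * (1 / 4)\<^sup>2)) * (?s * ?h) + (7 + 112 * exp 32) * ?s ^ 6" by (rule add.commute)
      also have "\<dots> \<le> A * (?s * ?h + ?s ^ 6)"
      proof (rule fin)
        have "0 \<le> M * (1 / (c * (1 / 4)\<^sup>2))" using M c by simp
        then show "M * (1 / (c * (1 / 4)\<^sup>2)) \<le> A" "7 + 112 * exp 32 \<le> A"
          using p0 by (auto simp: A_def R_def add_nonneg_nonneg)
      qed
      finally show ?thesis using minor by (simp add: step_def)
    next
      case away
      let ?w = "\<omega> + step b"
      have sb: "2 * pi / N \<le> step b" "step b \<le> 2 * pi - 2 * pi / N"
      proof -
        have "real b \<ge> 1" "real b \<le> real N - 1" using away ab by linarith+
        then have "2 * pi * 1 / N \<le> 2 * pi * real b / N" "2 * pi * real b / N \<le> 2 * pi * (real N - 1) / N"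
          using N pi_gt_zero by (intro divide_right_mono mult_left_mono; simp)+
        then show "2 * pi / N \<le> step b" "step b \<le> 2 * pi - 2 * pi / N"
          using N by (auto simp: step_def right_diff_distrib diff_divide_distrib)
      qed
      have "pi / N \<le> ?w" "?w \<le> 2 * pi - pi / N" using sb omN by (auto simp: abs_le_iff)
      then have "cos ?w \<le> cos (pi / N)" by (intro cos_le_away) auto
      moreover have "cos w = 1 - 2 * (sin (w / 2))\<^sup>2" for w :: real using cos_double_sin[of "w / 2"] by simp
      then have "cos ?w = 1 - 2 * (sin (?w / 2))\<^sup>2" .
      moreover have "(1 - x) / 2 \<le> z" if "y \<le> x" "y = 1 - 2 * z" for x y z :: real using that by simp
      ultimately have "\<sigma> \<le> (sin (?w / 2))\<^sup>2" unfolding \<sigma>_def by blast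
      also have "\<dots> \<le> \<bar>sin (?w / 2)\<bar>"
      proof -
        have "\<bar>sin (?w / 2)\<bar> * \<bar>sin (?w / 2)\<bar> \<le> \<bar>sin (?w / 2)\<bar> * 1" by (intro mult_left_mono) auto
        then show ?thesis by (simp add: power2_eq_square)
      qed
      finally have sn: "\<sigma> \<le> \<bar>sin (?w / 2)\<bar>" .
      have F: "\<bar>fejer ?w\<bar> \<le> N * \<bar>\<omega>\<bar>"
        using fejer_diff_le[of "step b" \<omega>] fejer_step[of b] away ab by (simp add: add.commute)
      have P1: "cmod (Phi n (\<theta> + step a) ?w) \<le> (1 + C0) * ?g + C0 * ?s ^ 6" unfolding st by (rule Phi_le) simp
      \<comment> \<open>Reflection carries the arc around the shift \<open>b\<close> to the arc
        around \<open>-b\<close>; \<open>Phi_le\<close> holds for all integer shifts.\<close>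
      have "- ?w = - \<omega> + 2 * pi * of_int (- int b) / N" by (simp add: step_def)
      then have P2: "cmod (Phi n (\<theta> + step a) (- ?w)) \<le> (1 + C0) * ?g + C0 * ?s ^ 6" using Phi_le[of "- \<omega>" "int a" "- int b"] by (simp only: st simp_thms)
      have "\<sigma> * cmod (sgn_gf n (\<theta> + step a) ?w) \<le> \<bar>sin (?w / 2)\<bar> * cmod (sgn_gf n (\<theta> + step a) ?w)" by (intro mult_right_mono sn) auto
      also have "\<dots> = cmod (of_real (sin (?w / 2)) * sgn_gf n (\<theta> + step a) ?w)" by (simp only: norm_mult norm_of_real)
      also have "\<dots> = \<bar>cos (?w / 2)\<bar> * \<bar>fejer ?w\<bar> * (cmod (Phi n (\<theta> + step a) ?w - Phi n (\<theta> + step a) (- ?w)) / 2)"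
        unfolding sgn_gf_identity by (simp only: norm_mult norm_divide norm_of_real abs_mult norm_numeral norm_ii mult_1_right)
      also have "\<dots> \<le> 1 * (N * \<bar>\<omega>\<bar>) * ((1 + C0) * ?g + C0 * ?s ^ 6)"
      proof (intro mult_mono F)
        show "cmod (Phi n (\<theta> + step a) ?w - Phi n (\<theta> + step a) (- ?w)) / 2 \<le> (1 + C0) * ?g + C0 * ?s ^ 6"
          using norm_triangle_ineq4[of "Phi n (\<theta> + step a) ?w" "Phi n (\<theta> + step a) (- ?w)"] P1 P2 by linarith
      qed auto
      also have "\<dots> = N * (1 + C0) * (\<bar>\<omega>\<bar> * ?g) + (N * \<bar>\<omega>\<bar>) * (C0 * ?s ^ 6)" unfolding mult_1_left by (subst alg) (simp only: mult.assoc)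
      also have "\<dots> \<le> N * (1 + C0) * (B * (?s * ?h)) + pi * (C0 * ?s ^ 6)"
      proof (intro add_mono mult_left_mono mult_right_mono Cg)
        show "N * \<bar>\<omega>\<bar> \<le> pi" using omN N by (simp add: field_simps)
      qed (use C0 s6 in auto)
      finally have "\<sigma> * cmod (sgn_gf n (\<theta> + step a) ?w) \<le> N * (1 + C0) * (B * (?s * ?h)) + pi * (C0 * ?s ^ 6)" .
      then have "cmod (sgn_gf n (\<theta> + step a) ?w) \<le> (N * (1 + C0) * (B * (?s * ?h)) + pi * (C0 * ?s ^ 6)) / \<sigma>"
        using \<sigma> by (simp add: pos_le_divide_eq mult.commute)
      also have "\<dots> = (N * (1 + C0) * B / \<sigma>) * (?s * ?h) + (pi * C0 / \<sigma>) * ?s ^ 6" by (simp add: add_divide_distrib)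
      also have "\<dots> \<le> A * (?s * ?h + ?s ^ 6)"
        using p0 R by (intro fin) (auto simp: A_def)
      finally show ?thesis using away by (simp add: norm_mult)
    qed
  qed
  have "\<forall>\<^sub>F n in sequentially. \<forall>a<N. \<forall>b<N. \<forall>\<theta>\<in>arc. \<forall>\<omega>\<in>arc. \<omega> \<noteq> 0 \<longrightarrow>
    cmod (sgn_gf n (\<theta> + step a) (\<omega> + step b) * cis (- (real n * \<theta>)) - (if a = 0 \<and> b = 0 then of_real (shift / N) else 0) * of_real (gauss (scale n) \<theta> \<omega>))
      \<le> A * (scale n * gauss_err (c / 2) (scale n) \<theta> \<omega> + scale n ^ 6)"
    using ev1 ev2 ev3 eventually_ge_at_top[of 1]
  proof eventually_elim
    case (elim n)
    have minor: "cmod (Phi n (\<theta> + 2 * pi * of_int a / N) (\<omega> + 2 * pi * of_int b / N)) \<le> scale n ^ 12"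
      if "\<theta> \<in> arc" "\<omega> \<in> arc" "\<not> (resonant a b \<and> \<bar>\<theta>\<bar> \<le> 1 / 4 * saddle n \<and> \<bar>\<omega>\<bar> \<le> 1 / 4)" for a b \<theta> \<omega>
      using elim(2,3) that unfolding arc_iff by (blast intro: order_trans)
    show ?case using elim(1) by (intro allI ballI impI key[OF elim(4) _ minor]) blast+
  qed
  then show ?thesis using A0 c by (intro exI[of _ A] exI[of _ "c / 2"] conjI) auto
qed

section \<open>Asymptotic counts\<close>

lemma continuous_on_Phi: "continuous_on UNIV (\<lambda>\<theta>. Phi n (\<theta> + u) v)"
  unfolding Phi_def by (intro continuous_intros)

text \<open>Normalises counts: 2\<pi> times a weighted count is an integral of \<Phi>, or of a
  kernel sum divided by \<open>gf\<close>, over the circle, and 4\<pi>^2 plays the same part for the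
  torus.\<close>

definition weight :: "nat \<Rightarrow> real" where
  "weight n = exp (- (saddle n * real n)) / gf n"

lemma finite_distinct_partitions [simp]: "finite (distinct_partitions_gt K n)"
  unfolding Pow_parts_eq[symmetric] by (rule finite_subset[of _ "Pow (parts n)"]) auto

text \<open>The count is real, so the integrand may be replaced by its real part, whose relative
  error is s^2. As (a, 0) is resonant for 0 \<le> a < N only if a = 0, a single peak
  remains.\<close>

lemma total_asymp:
  "\<exists>C. \<forall>\<^sub>F n in sequentially.
    \<bar>2 * pi * weight n * real (card (distinct_partitions_gt K n)) - scale n ^ 3 * sqrt (12 / pi)\<bar> \<le> C * scale n ^ 5"
proof -
  obtain C0 c where C0: "0 < C0" and c: "0 < c" "c \<le> 1 / (8 * N)" and
    ev1: "\<forall>\<^sub>F n in sequentially. \<forall>a b. \<forall>\<theta>\<in>arc. \<forall>\<omega>\<in>arc.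
    cmod (Phi n (\<theta> + 2 * pi * of_int a / N) (\<omega> + 2 * pi * of_int b / N) * cis (- (real n * \<theta>)) - (if resonant a b then of_real (gauss (scale n) \<theta> \<omega>) else 0))
      \<le> C0 * (scale n * gauss_err c (scale n) \<theta> \<omega> + scale n ^ 6) \<and>
    \<bar>Re (Phi n (\<theta> + 2 * pi * of_int a / N) (\<omega> + 2 * pi * of_int b / N) * cis (- (real n * \<theta>))) - (if resonant a b then gauss (scale n) \<theta> \<omega> else 0)\<bar>
      \<le> C0 * ((scale n)\<^sup>2 * gauss_err c (scale n) \<theta> \<omega> + scale n ^ 6)"
    using Phi_approx by blast
  obtain c1 where c1: "0 < c1" and ev2: "\<forall>\<^sub>F n in sequentially. \<forall>a b \<theta> \<omega>. \<bar>\<theta>\<bar> \<le> pi / N \<longrightarrow> \<bar>\<omega>\<bar> \<le> pi / N \<longrightarrow>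
    \<not> (resonant a b \<and> \<bar>\<theta>\<bar> \<le> 1 * saddle n \<and> \<bar>\<omega>\<bar> \<le> 1) \<longrightarrow>
    cmod (Phi n (\<theta> + 2 * pi * of_int a / N) (\<omega> + 2 * pi * of_int b / N)) \<le> exp (- (c1 / saddle n))"
    using minor_arc[of 1] by auto
  have ev3: "\<forall>\<^sub>F n in sequentially. exp (- (c1 / saddle n)) \<le> scale n ^ 12" by (rule eventually_exp_saddle_le[OF c1])
  define A where "A = C0 + 1"
  have A: "0 \<le> A" "C0 \<le> A" "1 \<le> A" using C0 by (auto simp: A_def)
  obtain C1 where arc_approx: "\<And>s f \<tau>. 0 < s \<Longrightarrow> s \<le> 1 \<Longrightarrow> f \<in> borel_measurable lborel \<Longrightarrow> \<bar>\<tau>\<bar> \<le> 1 \<Longrightarrow>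
    (\<forall>\<theta>\<in>arc. \<bar>f \<theta> - \<tau> * gauss s \<theta> 0\<bar> \<le> A * (s\<^sup>2 * gauss_err c s \<theta> 0 + s ^ 6)) \<Longrightarrow>
    \<bar>arc_integral f - \<tau> * (s ^ 3 * sqrt (12 / pi))\<bar> \<le> C1 * s ^ 5"
    using arc_integral_approx[OF c A(1) zero_le_one] by blast
  have N0: "(0::real) \<in> arc" by (simp add: arc_iff)
  have "\<forall>\<^sub>F n in sequentially.
    \<bar>2 * pi * weight n * real (card (distinct_partitions_gt K n)) - scale n ^ 3 * sqrt (12 / pi)\<bar> \<le> (N * C1) * scale n ^ 5"
    using ev1 ev2 ev3 eventually_ge_at_top[of 1]
  proof eventually_elim
    case (elim n)
    let ?s = "scale n"
    have s: "0 < ?s" "?s \<le> 1" using scale_pos scale_le_1 elim(4) by auto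
    define f where "f = (\<lambda>a \<theta>. Phi n (\<theta> + step a) 0 * cis (- (real n * (\<theta> + step a))))"
    have fc: "continuous_on UNIV (f a)" for a
      unfolding f_def by (intro continuous_intros continuous_on_Phi)
    have "\<bar>arc_integral (\<lambda>\<theta>. Re (f a \<theta>)) - (if a = 0 then 1 else 0) * (?s ^ 3 * sqrt (12 / pi))\<bar> \<le> C1 * ?s ^ 5" if a: "a < N" for a
    proof (rule arc_approx[OF s])
      show "(\<lambda>\<theta>. Re (f a \<theta>)) \<in> borel_measurable lborel"
        using borel_measurable_continuous_onI[OF continuous_on_Re[OF fc]] by simp
      show "\<bar>if a = 0 then 1 else 0 :: real\<bar> \<le> 1" by simp
      show "\<forall>\<theta>\<in>arc. \<bar>Re (f a \<theta>) - (if a = 0 then 1 else 0) * gauss ?s \<theta> 0\<bar> \<le> A * (?s\<^sup>2 * gauss_err c ?s \<theta> 0 + ?s ^ 6)"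
      proof
        fix \<theta> assume th: "\<theta> \<in> arc"
        have g: "0 \<le> ?s\<^sup>2 * gauss_err c ?s \<theta> 0" "0 \<le> ?s ^ 6" using s gauss_err_pos[of c ?s \<theta> 0] by auto
        show "\<bar>Re (f a \<theta>) - (if a = 0 then 1 else 0) * gauss ?s \<theta> 0\<bar> \<le> A * (?s\<^sup>2 * gauss_err c ?s \<theta> 0 + ?s ^ 6)"
        proof (cases "a = 0")
          case True
          have "\<bar>Re (Phi n \<theta> 0 * cis (- (real n * \<theta>))) - gauss ?s \<theta> 0\<bar> \<le> C0 * (?s\<^sup>2 * gauss_err c ?s \<theta> 0 + ?s ^ 6)"
            using elim(1)[rule_format, OF th N0, of 0 0] resonant_fst[of 0] by (simp del: times_complex.simps)
          also have "\<dots> \<le> A * (?s\<^sup>2 * gauss_err c ?s \<theta> 0 + ?s ^ 6)" using A g by (intro mult_right_mono) auto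
          finally show ?thesis using True by (simp add: f_def step_def del: times_complex.simps)
        next
          case False
          have "\<not> resonant (int a) 0" unfolding resonant_fst using False a by (auto dest: nat_dvd_not_less)
          then have "cmod (Phi n (\<theta> + step a) 0) \<le> ?s ^ 12"
            using elim(2)[rule_format, of \<theta> 0 "int a" 0] elim(3) th N0 by (simp add: arc_iff step_def)
          also have "\<dots> \<le> ?s ^ 6" using s by (intro power_decreasing) auto
          finally have "\<bar>Re (f a \<theta>)\<bar> \<le> ?s ^ 6"
            using abs_Re_le_cmod[of "f a \<theta>"] by (simp add: f_def norm_mult del: times_complex.simps)
          also have "\<dots> \<le> 1 * (?s\<^sup>2 * gauss_err c ?s \<theta> 0 + ?s ^ 6)" using g by simp
          also have "\<dots> \<le> A * (?s\<^sup>2 * gauss_err c ?s \<theta> 0 + ?s ^ 6)" using A g by (intro mult_right_mono) auto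
          finally show ?thesis using False by simp
        qed
      qed
    qed
    note each = this
    have "Re ((\<Sum>a<N. arc_integral (f a)) * of_real (gf n)) = Re (of_real (2 * pi * exp (- (saddle n * real n))) * of_nat (card (distinct_partitions_gt K n)))"
      unfolding f_def fourier_extraction_total Pow_parts_eq ..
    then have "(\<Sum>a<N. arc_integral (\<lambda>\<theta>. Re (f a \<theta>))) * gf n = 2 * pi * exp (- (saddle n * real n)) * real (card (distinct_partitions_gt K n))"
      unfolding arc_integral_Re[OF fc] by (simp add: Re_sum)
    then have e: "2 * pi * weight n * real (card (distinct_partitions_gt K n)) = (\<Sum>a<N. arc_integral (\<lambda>\<theta>. Re (f a \<theta>)))"
      using gf_pos[of n] by (simp add: weight_def field_simps)
    have "(\<Sum>a<N. (if a = 0 then 1 else 0) * (?s ^ 3 * sqrt (12 / pi))) = ?s ^ 3 * sqrt (12 / pi)"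
      using N_ge_2 by (simp add: sum.delta if_distrib[of "\<lambda>x. x * _"] cong: if_cong)
    then have "2 * pi * weight n * real (card (distinct_partitions_gt K n)) - ?s ^ 3 * sqrt (12 / pi)
      = (\<Sum>a<N. arc_integral (\<lambda>\<theta>. Re (f a \<theta>)) - (if a = 0 then 1 else 0) * (?s ^ 3 * sqrt (12 / pi)))"
      unfolding e sum_subtractf by simp
    also have "\<bar>\<dots>\<bar> \<le> (\<Sum>a<N. C1 * ?s ^ 5)"
      using each by (intro order_trans[OF sum_abs] sum_mono) auto
    finally show ?case by simp
  qed
  then show ?thesis by blast
qed

text \<open>Moving \<theta> by \<open>step a\<close> multiplies the integrand by cis (-n \<cdot>
  step a); through this phase the second order term can depend on n modulo N.\<close>

lemma extraction_asymp:
  assumes cont: "\<And>d. continuous_on UNIV (ker d)"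
    and w: "\<And>d. (\<Sum>b<N. arc_integral (\<lambda>\<omega>. ker d (\<omega> + step b))) = of_real (2 * pi) * w d"
    and c: "0 < c" "c \<le> 1 / (8 * N)" and A: "0 \<le> A" and T: "0 \<le> T" "\<And>a b. cmod (\<tau> a b) \<le> T"
    and ev: "\<forall>\<^sub>F n in sequentially. \<forall>a<N. \<forall>b<N. \<forall>\<theta>\<in>arc. \<forall>\<omega>\<in>arc. \<omega> \<noteq> 0 \<longrightarrow>
      cmod (kernel_gf ker n (\<theta> + step a) (\<omega> + step b) / of_real (gf n) * cis (- (real n * \<theta>)) - \<tau> a b * of_real (gauss (scale n) \<theta> \<omega>))
      \<le> A * (scale n * gauss_err c (scale n) \<theta> \<omega> + scale n ^ 6)"
  shows "\<exists>C. \<forall>\<^sub>F n in sequentially.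
    cmod (of_real (4 * pi\<^sup>2 * weight n) * (\<Sum>A\<in>distinct_partitions_gt K n. w (part_diff A))
      - of_real (scale n ^ 4 * sqrt (24 * N)) * (\<Sum>a<N. \<Sum>b<N. \<tau> a b * cis (- (real n * step a)))) \<le> C * scale n ^ 5"
proof -
  obtain C where C: "\<And>s f \<tau>. 0 < s \<Longrightarrow> s \<le> 1 \<Longrightarrow> (\<lambda>z. f (fst z) (snd z)) \<in> borel_measurable (lborel \<Otimes>\<^sub>M lborel) \<Longrightarrow> cmod \<tau> \<le> T \<Longrightarrow>
    (\<forall>\<theta>\<in>arc. \<forall>\<omega>\<in>arc. \<omega> \<noteq> 0 \<longrightarrow> cmod (f \<theta> \<omega> - \<tau> * of_real (gauss s \<theta> \<omega>)) \<le> A * (s * gauss_err c s \<theta> \<omega> + s ^ 6)) \<Longrightarrow>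
    cmod (box_integral f - \<tau> * of_real (s ^ 4 * sqrt (24 * N))) \<le> C * s ^ 5"
    using box_integral_approx[OF c A T(1)] by blast
  have "\<forall>\<^sub>F n in sequentially.
    cmod (of_real (4 * pi\<^sup>2 * weight n) * (\<Sum>A\<in>distinct_partitions_gt K n. w (part_diff A))
      - of_real (scale n ^ 4 * sqrt (24 * N)) * (\<Sum>a<N. \<Sum>b<N. \<tau> a b * cis (- (real n * step a)))) \<le> (N * (N * C)) * scale n ^ 5"
    using ev eventually_ge_at_top[of 1]
  proof eventually_elim
    case (elim n)
    let ?s = "scale n"
    have s: "0 < ?s" "?s \<le> 1" using scale_pos scale_le_1 elim(2) by auto
    let ?k = "\<lambda>a b \<theta> \<omega>. kernel_gf ker n (\<theta> + step a) (\<omega> + step b) * cis (- (real n * (\<theta> + step a)))"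
    define f where "f = (\<lambda>a b \<theta> \<omega>. ?k a b \<theta> \<omega> / of_real (gf n))"
    have each: "cmod (box_integral (f a b) - (\<tau> a b * cis (- (real n * step a))) * of_real (?s ^ 4 * sqrt (24 * N))) \<le> C * ?s ^ 5"
      if ab: "a < N" "b < N" for a b
    proof (rule C[OF s])
      have [measurable]: "(\<lambda>z. ?k a b (fst z) (snd z)) \<in> borel_measurable (lborel \<Otimes>\<^sub>M lborel)"
        by (rule kernel_gf_measurable[OF cont])
      show "(\<lambda>z. f a b (fst z) (snd z)) \<in> borel_measurable (lborel \<Otimes>\<^sub>M lborel)"
        unfolding f_def by measurable
      show "cmod (\<tau> a b * cis (- (real n * step a))) \<le> T" using T(2) by (simp add: norm_mult)
      show "\<forall>\<theta>\<in>arc. \<forall>\<omega>\<in>arc. \<omega> \<noteq> 0 \<longrightarrow> cmod (f a b \<theta> \<omega> - \<tau> a b * cis (- (real n * step a)) * of_real (gauss ?s \<theta> \<omega>)) \<le> A * (?s * gauss_err c ?s \<theta> \<omega> + ?s ^ 6)"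
      proof (intro ballI impI)
        fix \<theta> \<omega> assume *: "\<theta> \<in> arc" "\<omega> \<in> arc" "\<omega> \<noteq> 0"
        let ?u = "kernel_gf ker n (\<theta> + step a) (\<omega> + step b) / of_real (gf n)"
        have "cis (- (real n * (\<theta> + step a))) = cis (- (real n * \<theta>)) * cis (- (real n * step a))"
          unfolding cis_mult by (rule arg_cong[where f = cis]) (simp add: distrib_left)
        moreover have "k * (x * y) / g - v * y * G = (k / g * x - v * G) * y" for k x y g v G :: complex
          by (simp add: left_diff_distrib)
        ultimately have "f a b \<theta> \<omega> - \<tau> a b * cis (- (real n * step a)) * of_real (gauss ?s \<theta> \<omega>)
          = (?u * cis (- (real n * \<theta>)) - \<tau> a b * of_real (gauss ?s \<theta> \<omega>)) * cis (- (real n * step a))"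
          unfolding f_def by (simp only:)
        then have "cmod (f a b \<theta> \<omega> - \<tau> a b * cis (- (real n * step a)) * of_real (gauss ?s \<theta> \<omega>))
          = cmod (?u * cis (- (real n * \<theta>)) - \<tau> a b * of_real (gauss ?s \<theta> \<omega>))"
          by (simp only: norm_mult[of _ "cis _"] norm_cis mult_1_right)
        also have "\<dots> \<le> A * (?s * gauss_err c ?s \<theta> \<omega> + ?s ^ 6)" using elim(1) ab * by blast
        finally show "cmod (f a b \<theta> \<omega> - \<tau> a b * cis (- (real n * step a)) * of_real (gauss ?s \<theta> \<omega>)) \<le> A * (?s * gauss_err c ?s \<theta> \<omega> + ?s ^ 6)" .
      qed
    qed
    have bf: "box_integral (f a b) = box_integral (?k a b) / of_real (gf n)" for a b
      unfolding box_integral_def f_def by (simp only: scaleR_conv_of_real times_divide_eq_right integral_divide_zero)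
    have "(\<Sum>a<N. \<Sum>b<N. box_integral (f a b)) = (\<Sum>a<N. \<Sum>b<N. box_integral (?k a b)) / of_real (gf n)"
      unfolding bf by (simp only: sum_divide_distrib)
    also have "\<dots> = of_real (4 * pi\<^sup>2 * weight n) * (\<Sum>A\<in>distinct_partitions_gt K n. w (part_diff A))"
      unfolding fourier_extraction[OF cont w] Pow_parts_eq[of n, symmetric] weight_def by simp
    finally have e: "of_real (4 * pi\<^sup>2 * weight n) * (\<Sum>A\<in>distinct_partitions_gt K n. w (part_diff A)) = (\<Sum>a<N. \<Sum>b<N. box_integral (f a b))" ..
    have "of_real (4 * pi\<^sup>2 * weight n) * (\<Sum>A\<in>distinct_partitions_gt K n. w (part_diff A))
      - of_real (?s ^ 4 * sqrt (24 * N)) * (\<Sum>a<N. \<Sum>b<N. \<tau> a b * cis (- (real n * step a)))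
      = (\<Sum>a<N. \<Sum>b<N. box_integral (f a b) - (\<tau> a b * cis (- (real n * step a))) * of_real (?s ^ 4 * sqrt (24 * N)))"
      unfolding e sum_subtractf sum_distrib_right[symmetric] by (simp only: mult.commute)
    also have "cmod \<dots> \<le> (\<Sum>a<N. \<Sum>b<N. C * ?s ^ 5)"
      by (intro order_trans[OF norm_sum] sum_mono order_trans[OF norm_sum] each) auto
    finally show ?case by simp
  qed
  then show ?thesis by blast
qed

text \<open>The singular series of the problem: every resonant peak contributes the phases attached
  to n and to the condition D = k.\<close>

definition phase_sum :: "nat \<Rightarrow> int \<Rightarrow> complex" where
  "phase_sum n k = (\<Sum>a<N. \<Sum>b<N. (if resonant (int a) (int b) then cis (- (of_int k * step b)) else 0) * cis (- (real n * step a)))"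

text \<open>The kernel for D = k is cis ((D - k)\<omega>). Replacing the factor from
  \<open>k\<close> by its value at the peak costs |k\<omega>|, which is O(s) against the
  Gaussian.\<close>

lemma diff_count_asymp:
  "\<exists>C. \<forall>\<^sub>F n in sequentially.
    cmod (of_real (4 * pi\<^sup>2 * weight n * real (card {A \<in> distinct_partitions_gt K n. part_diff A = k}))
      - of_real (scale n ^ 4 * sqrt (24 * N)) * phase_sum n k) \<le> C * scale n ^ 5"
proof -
  obtain C0 c where C0: "0 < C0" and c: "0 < c" "c \<le> 1 / (8 * N)" and
    ev1: "\<forall>\<^sub>F n in sequentially. \<forall>a b. \<forall>\<theta>\<in>arc. \<forall>\<omega>\<in>arc.
    cmod (Phi n (\<theta> + 2 * pi * of_int a / N) (\<omega> + 2 * pi * of_int b / N) * cis (- (real n * \<theta>)) - (if resonant a b then of_real (gauss (scale n) \<theta> \<omega>) else 0))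
      \<le> C0 * (scale n * gauss_err c (scale n) \<theta> \<omega> + scale n ^ 6) \<and>
    \<bar>Re (Phi n (\<theta> + 2 * pi * of_int a / N) (\<omega> + 2 * pi * of_int b / N) * cis (- (real n * \<theta>))) - (if resonant a b then gauss (scale n) \<theta> \<omega> else 0)\<bar>
      \<le> C0 * ((scale n)\<^sup>2 * gauss_err c (scale n) \<theta> \<omega> + scale n ^ 6)"
    using Phi_approx by blast
  have N: "real N \<ge> 2" using N_ge_2 by simp
  define ker where "ker = (\<lambda>d \<omega>. cis (of_int (d - k) * \<omega>))"
  define \<tau> where "\<tau> = (\<lambda>a b. if resonant (int a) (int b) then cis (- (of_int k * step b)) else 0)"
  define B where "B = 3 + 2 / c"
  have B: "0 \<le> B" using c by (simp add: B_def)
  define D where "D = C0 + \<bar>of_int k\<bar> * B"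
  have D: "0 \<le> D" using C0 B by (simp add: D_def)
  have kg: "kernel_gf ker n \<theta> \<omega> / of_real (gf n) = Phi n \<theta> \<omega> * cis (- (of_int k * \<omega>))" for n \<theta> \<omega>
  proof -
    have "cis (of_int (d - k) * \<omega>) = cis (of_int d * \<omega>) * cis (- (of_int k * \<omega>))" for d
      unfolding cis_mult by (rule arg_cong[where f = cis]) (simp add: left_diff_distrib)
    then have "kernel_gf ker n \<theta> \<omega> = of_real (gf n) * Phi n \<theta> \<omega> * cis (- (of_int k * \<omega>))"
      unfolding gf_Phi_expansion kernel_gf_def ker_def sum_distrib_right by (simp only: mult.assoc)
    then show ?thesis using gf_pos[of n] by simp
  qed
  have "\<exists>C. \<forall>\<^sub>F n in sequentially.
    cmod (of_real (4 * pi\<^sup>2 * weight n) * (\<Sum>A\<in>distinct_partitions_gt K n. if part_diff A = k then 1 else 0)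
      - of_real (scale n ^ 4 * sqrt (24 * N)) * (\<Sum>a<N. \<Sum>b<N. \<tau> a b * cis (- (real n * step a)))) \<le> C * scale n ^ 5"
  proof (rule extraction_asymp)
    show "continuous_on UNIV (ker d)" for d unfolding ker_def by (intro continuous_intros)
    show "(\<Sum>b<N. arc_integral (\<lambda>\<omega>. ker d (\<omega> + step b))) = of_real (2 * pi) * (if d = k then 1 else 0)" for d
      unfolding ker_def arc_integral_cis by simp
    show "0 < c / 2" "c / 2 \<le> 1 / (8 * N)" using c by auto
    show "0 \<le> D" "0 \<le> (1::real)" using D by auto
    show "cmod (\<tau> a b) \<le> 1" for a b by (simp add: \<tau>_def)
    show "\<forall>\<^sub>F n in sequentially. \<forall>a<N. \<forall>b<N. \<forall>\<theta>\<in>arc. \<forall>\<omega>\<in>arc. \<omega> \<noteq> 0 \<longrightarrow>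
      cmod (kernel_gf ker n (\<theta> + step a) (\<omega> + step b) / of_real (gf n) * cis (- (real n * \<theta>)) - \<tau> a b * of_real (gauss (scale n) \<theta> \<omega>))
      \<le> D * (scale n * gauss_err (c / 2) (scale n) \<theta> \<omega> + scale n ^ 6)"
      using ev1 eventually_ge_at_top[of 1]
    proof eventually_elim
      case (elim n)
      let ?s = "scale n"
      have s: "0 < ?s" "?s \<le> 1" using scale_pos scale_le_1 elim(2) by auto
      show ?case
      proof (intro allI ballI impI)
        fix a b \<theta> \<omega> assume ab: "a < N" "b < N" and th: "\<theta> \<in> arc" and om: "\<omega> \<in> arc" "\<omega> \<noteq> 0"
        let ?P = "Phi n (\<theta> + step a) (\<omega> + step b)"
        let ?G = "gauss ?s \<theta> \<omega>" let ?g = "gauss_err c ?s \<theta> \<omega>" let ?h = "gauss_err (c / 2) ?s \<theta> \<omega>"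
        let ?r = "if resonant (int a) (int b) then 1 else 0 :: complex"
        have g: "0 < ?g" "0 < ?h" by (rule gauss_err_pos)+
        have G0: "0 < ?G" by (simp add: gauss_def)
        have gh: "?g \<le> ?h" using c by (intro gauss_err_antimono) auto
        have s6: "0 \<le> ?s ^ 6" using s by simp
        have "c \<le> 1 / (2 * N)"
        proof (rule order_trans[OF c(2)])
          show "1 / (8 * N) \<le> 1 / real (2 * N)" using N by (simp add: field_simps)
        qed
        then have Gg: "?G \<le> ?g" by (intro gauss_le_err) simp
        have 1: "cmod (?P * cis (- (real n * \<theta>)) - ?r * of_real ?G) \<le> C0 * (?s * ?h + ?s ^ 6)"
        proof -
          have "cmod (?P * cis (- (real n * \<theta>)) - ?r * of_real ?G) \<le> C0 * (?s * ?g + ?s ^ 6)"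
            using elim(1)[rule_format, OF th om(1), of "int a" "int b"] by (auto simp: step_def split: if_splits)
          also have "\<dots> \<le> C0 * (?s * ?h + ?s ^ 6)" using C0 s gh by (intro mult_left_mono add_right_mono) auto
          finally show ?thesis .
        qed
        have 2: "\<bar>\<omega>\<bar> * ?G \<le> B * (?s * ?h)"
        proof -
          have "\<bar>\<omega>\<bar> * ?G \<le> \<bar>\<omega>\<bar> * ?g" using Gg by (intro mult_left_mono) auto
          also have "\<bar>\<omega>\<bar> * ?g = ?s * (\<bar>\<omega> / ?s\<bar> * ?g)" using s by (simp add: abs_divide)
          also have "\<dots> \<le> ?s * ((1 + \<bar>\<theta> / ?s ^ 3\<bar> + \<bar>\<omega> / ?s\<bar>) * ?g)"
            using s g by (intro mult_left_mono mult_right_mono) auto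
          also have "\<dots> \<le> ?s * (B * ?h)" unfolding B_def using s by (intro mult_left_mono gauss_err_absorb c) auto
          finally show ?thesis by (simp only: mult_ac)
        qed
        have sp: "cis (- (of_int k * (\<omega> + step b))) = cis (- (of_int k * \<omega>)) * cis (- (of_int k * step b))"
          unfolding cis_mult by (rule arg_cong[where f = cis]) (simp add: distrib_left)
        have "kernel_gf ker n (\<theta> + step a) (\<omega> + step b) / of_real (gf n) * cis (- (real n * \<theta>)) - \<tau> a b * of_real ?G
          = (?P * cis (- (real n * \<theta>)) - ?r * of_real ?G) * cis (- (of_int k * (\<omega> + step b))) + (?r * of_real ?G * cis (- (of_int k * step b))) * (cis (- (of_int k * \<omega>)) - 1)"
          unfolding kg \<tau>_def sp by (simp add: algebra_simps)
        also have "cmod \<dots> \<le> C0 * (?s * ?h + ?s ^ 6) + \<bar>of_int k\<bar> * (B * (?s * ?h))"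
        proof (intro norm_triangle_le add_mono)
          show "cmod ((?P * cis (- (real n * \<theta>)) - ?r * of_real ?G) * cis (- (of_int k * (\<omega> + step b)))) \<le> C0 * (?s * ?h + ?s ^ 6)"
            using 1 by (simp only: norm_mult[of _ "cis (- (of_int k * (\<omega> + step b)))"] norm_cis mult_1_right)
          have "cmod ((?r * of_real ?G * cis (- (of_int k * step b))) * (cis (- (of_int k * \<omega>)) - 1)) \<le> ?G * cmod (cis (- (of_int k * \<omega>)) - cis 0)"
            using G0 by (simp add: norm_mult)
          also have "\<dots> \<le> ?G * \<bar>- (of_int k * \<omega>) - 0\<bar>" using G0 by (intro mult_left_mono cmod_cis_diff_le) auto
          also have "\<dots> = \<bar>of_int k\<bar> * (\<bar>\<omega>\<bar> * ?G)" by (simp add: abs_mult)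
          also have "\<dots> \<le> \<bar>of_int k\<bar> * (B * (?s * ?h))" by (intro mult_left_mono 2) auto
          finally show "cmod ((?r * of_real ?G * cis (- (of_int k * step b))) * (cis (- (of_int k * \<omega>)) - 1)) \<le> \<bar>of_int k\<bar> * (B * (?s * ?h))" .
        qed
        also have "\<dots> = C0 * (?s * ?h + ?s ^ 6) + (\<bar>of_int k\<bar> * B) * (?s * ?h + 0)" by simp
        also have "\<dots> \<le> C0 * (?s * ?h + ?s ^ 6) + (\<bar>of_int k\<bar> * B) * (?s * ?h + ?s ^ 6)"
          using B s6 by (intro add_left_mono mult_left_mono) auto
        also have "\<dots> = D * (?s * ?h + ?s ^ 6)" unfolding D_def by (rule distrib_right[symmetric])
        finally show "cmod (kernel_gf ker n (\<theta> + step a) (\<omega> + step b) / of_real (gf n) * cis (- (real n * \<theta>)) - \<tau> a b * of_real ?G) \<le> D * (?s * ?h + ?s ^ 6)" .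
      qed
    qed
  qed
  moreover have "(\<Sum>A\<in>distinct_partitions_gt K n. if part_diff A = k then 1 else 0) = (of_real (real (card {A \<in> distinct_partitions_gt K n. part_diff A = k})) :: complex)" for n
    by (simp add: sum.If_cases Int_def)
  ultimately show ?thesis unfolding phase_sum_def \<tau>_def by (simp only: of_real_mult)
qed

text \<open>Only the peak at the origin has a non-zero coefficient, so this contribution does not
  depend on n modulo N.\<close>

lemma smooth_asymp:
  "\<exists>C. \<forall>\<^sub>F n in sequentially.
    \<bar>4 * pi\<^sup>2 * weight n * (\<Sum>A\<in>distinct_partitions_gt K n. smooth_sgn (part_diff A)) - scale n ^ 4 * sqrt (24 * N) * (shift / N)\<bar> \<le> C * scale n ^ 5"
proof -
  obtain A c where A: "0 < A" and c: "0 < c" "c \<le> 1 / (8 * N)" and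
    ev: "\<forall>\<^sub>F n in sequentially. \<forall>a<N. \<forall>b<N. \<forall>\<theta>\<in>arc. \<forall>\<omega>\<in>arc. \<omega> \<noteq> 0 \<longrightarrow>
    cmod (sgn_gf n (\<theta> + step a) (\<omega> + step b) * cis (- (real n * \<theta>)) - (if a = 0 \<and> b = 0 then of_real (shift / N) else 0) * of_real (gauss (scale n) \<theta> \<omega>))
      \<le> A * (scale n * gauss_err c (scale n) \<theta> \<omega> + scale n ^ 6)"
    using sgn_gf_approx by blast
  have N: "0 < N" using N_ge_2 by simp
  have "\<exists>C. \<forall>\<^sub>F n in sequentially.
    cmod (of_real (4 * pi\<^sup>2 * weight n) * (\<Sum>A\<in>distinct_partitions_gt K n. of_real (smooth_sgn (part_diff A)))
      - of_real (scale n ^ 4 * sqrt (24 * N)) * (\<Sum>a<N. \<Sum>b<N. (if a = 0 \<and> b = 0 then of_real (shift / N) else 0) * cis (- (real n * step a)))) \<le> C * scale n ^ 5"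
  proof (rule extraction_asymp)
    show "continuous_on UNIV (\<lambda>\<omega>. of_real (smooth_kernel d \<omega>) :: complex)" for d
      by (intro continuous_on_of_real continuous_on_smooth_kernel)
    show "(\<Sum>b<N. arc_integral (\<lambda>\<omega>. of_real (smooth_kernel d (\<omega> + step b)) :: complex)) = of_real (2 * pi) * of_real (smooth_sgn d)" for d
      by (rule arc_integral_smooth_kernel)
    show "0 < c" "c \<le> 1 / (8 * N)" by (fact c)+
    show "0 \<le> A" "0 \<le> \<bar>shift / N\<bar>" using A by auto
    show "cmod (if a = 0 \<and> b = 0 then of_real (shift / N) else 0) \<le> \<bar>shift / N\<bar>" for a b :: nat
      by (simp del: of_real_divide)
    show "\<forall>\<^sub>F n in sequentially. \<forall>a<N. \<forall>b<N. \<forall>\<theta>\<in>arc. \<forall>\<omega>\<in>arc. \<omega> \<noteq> 0 \<longrightarrow>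
      cmod (kernel_gf (\<lambda>d \<omega>. of_real (smooth_kernel d \<omega>)) n (\<theta> + step a) (\<omega> + step b) / of_real (gf n) * cis (- (real n * \<theta>))
        - (if a = 0 \<and> b = 0 then of_real (shift / N) else 0) * of_real (gauss (scale n) \<theta> \<omega>))
      \<le> A * (scale n * gauss_err c (scale n) \<theta> \<omega> + scale n ^ 6)"
      using ev unfolding sgn_gf_def .
  qed
  moreover have "(\<Sum>a<N. \<Sum>b<N. (if a = 0 \<and> b = 0 then of_real (shift / N) else 0) * cis (- (real n * step a))) = of_real (shift / N)" for n
  proof -
    have "(\<Sum>a<N. \<Sum>b<N. (if a = 0 \<and> b = 0 then of_real (shift / N) else 0) * cis (- (real n * step a)))
      = (\<Sum>a<N. if a = 0 then \<Sum>b<N. if b = 0 then of_real (shift / N) else (0 :: complex) else 0)"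
      by (intro sum.cong refl) (auto simp: step_def intro!: sum.cong sum.neutral)
    then show ?thesis using N by (simp add: sum.delta)
  qed
  ultimately have ex: "\<exists>C. \<forall>\<^sub>F n in sequentially.
    cmod (of_real (4 * pi\<^sup>2 * weight n) * (\<Sum>A\<in>distinct_partitions_gt K n. of_real (smooth_sgn (part_diff A)))
      - of_real (scale n ^ 4 * sqrt (24 * N)) * of_real (shift / N)) \<le> C * scale n ^ 5" by (simp only:)
  have "cmod (of_real x * (\<Sum>A\<in>S. of_real (f A)) - of_real y * of_real z) = \<bar>x * (\<Sum>A\<in>S. f A) - y * z\<bar>" for x y z :: real and f :: "nat set \<Rightarrow> real" and S
    by (simp only: norm_of_real flip: of_real_sum of_real_mult of_real_diff)
  then show ?thesis using ex by (simp only:)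
qed

section \<open>Congruence conditions and character sums\<close>

lemma sum_step_cis: "(\<Sum>a<N. cis (of_int k * step a)) = (if int N dvd k then of_nat N else 0)"
proof -
  have "(\<Sum>a<N. cis (of_int k * step a)) = (\<Sum>a<N. cis (2 * pi * of_int k * real a / N))"
    by (intro sum.cong refl arg_cong[where f = cis]) (simp add: step_def)
  then show ?thesis using sum_roots_of_unity[of N k] N_ge_2 by simp
qed

lemma finite_residue_vectors: "finite (residue_vectors N)"
  unfolding residue_vectors_def by (intro finite_PiE) auto

lemma residue_vectors_character_sum:
  "(\<Sum>l\<in>residue_vectors N. cis (of_int (\<Sum>j=1..N. c j * l j) * step 1)) = (if \<forall>j\<in>{1..N}. int N dvd c j then of_nat N ^ N else 0)"
proof -
  have cs: "cis (\<Sum>j\<in>S. f j) = (\<Prod>j\<in>S. cis (f j))" if "finite S" for f :: "nat \<Rightarrow> real" and S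
    using that by (induction rule: finite_induct) (auto simp: cis_mult[symmetric])
  have "(\<Sum>l\<in>residue_vectors N. cis (of_int (\<Sum>j=1..N. c j * l j) * step 1)) = (\<Sum>l\<in>residue_vectors N. \<Prod>j=1..N. cis (of_int (c j * l j) * step 1))"
    by (intro sum.cong refl) (simp only: of_int_sum sum_distrib_right cs finite_atLeastAtMost)
  also have "\<dots> = (\<Prod>j=1..N. \<Sum>x\<in>{0..<int N}. cis (of_int (c j * x) * step 1))"
    unfolding residue_vectors_def by (rule prod_sum_PiE[symmetric]) auto
  also have "\<dots> = (\<Prod>j=1..N. if int N dvd c j then of_nat N else 0)"
  proof (intro prod.cong refl)
    fix j
    have "(\<Sum>x\<in>{0..<int N}. cis (of_int (c j * x) * step 1)) = (\<Sum>a<N. cis (of_int (c j * int a) * step 1))"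
      unfolding image_int_atLeastLessThan[of 0 N, simplified, symmetric] lessThan_atLeast0 by (subst sum.reindex) auto
    also have "\<dots> = (\<Sum>a<N. cis (of_int (c j) * step a))"
      by (intro sum.cong refl arg_cong[where f = cis]) (simp add: step_def)
    finally show "(\<Sum>x\<in>{0..<int N}. cis (of_int (c j * x) * step 1)) = (if int N dvd c j then of_nat N else 0)"
      unfolding sum_step_cis .
  qed
  also have "\<dots> = (if \<forall>j\<in>{1..N}. int N dvd c j then of_nat N ^ N else 0)"
  proof (cases "\<forall>j\<in>{1..N}. int N dvd c j")
    case True
    then have "(\<Prod>j=1..N. if int N dvd c j then of_nat N else (0 :: complex)) = (\<Prod>j=1..N. of_nat N)"
      by (intro prod.cong) auto
    then show ?thesis using True by simp
  next
    case False
    then show ?thesis by (auto intro!: prod_zero)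
  qed
  finally show ?thesis .
qed

text \<open>The condition N H(l) \<equiv> n in linear form; the equivalence is
  \<open>H_fun_cong_iff\<close>.\<close>

definition solutions :: "nat \<Rightarrow> (nat \<Rightarrow> int) set" where
  "solutions n = {l \<in> residue_vectors N. [(\<Sum>j=1..N. int j * l j) = int n] (mod int N)}"

lemma finite_solutions [simp]: "finite (solutions n)"
  unfolding solutions_def using finite_residue_vectors by simp

lemma step_mult: "cis (of_int x * step a) = cis (of_int (x * int a) * step 1)"
  by (rule arg_cong[where f = cis]) (simp add: step_def)

lemma solutions_indicator:
  assumes "l \<in> residue_vectors N"
  shows "(\<Sum>a<N. cis (of_int ((\<Sum>j=1..N. int j * l j) - int n) * step a)) = (if l \<in> solutions n then of_nat N else 0)"
proof -
  have "l \<in> solutions n \<longleftrightarrow> int N dvd (\<Sum>j=1..N. int j * l j) - int n"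
    using assms unfolding solutions_def cong_iff_dvd_diff by blast
  then show ?thesis unfolding sum_step_cis by (simp only:)
qed

text \<open>The congruence is detected by averaging over characters \<open>a\<close>; those with a
  \<noteq> 0 contribute nothing, since the coordinate j = 1 would require N to divide
  \<open>a\<close>. That the count is the same for all n explains why the leading term of the
  theorem is smooth in n.\<close>

lemma card_solutions: "card (solutions n) = N ^ (N - 1)"
proof -
  have N: "0 < N" using N_ge_2 by simp
  have "of_nat N * of_nat (card (solutions n)) = (\<Sum>l\<in>residue_vectors N. if l \<in> solutions n then of_nat N else (0 :: complex))"
  proof -
    have "solutions n \<subseteq> residue_vectors N" by (auto simp: solutions_def)
    then have "(\<Sum>l\<in>residue_vectors N. if l \<in> solutions n then of_nat N else (0 :: complex)) = (\<Sum>l\<in>solutions n. of_nat N)"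
      by (intro sum.mono_neutral_cong_right finite_residue_vectors) auto
    then show ?thesis by simp
  qed
  also have "\<dots> = (\<Sum>l\<in>residue_vectors N. \<Sum>a<N. cis (of_int ((\<Sum>j=1..N. int j * l j) - int n) * step a))"
    by (intro sum.cong refl) (simp only: solutions_indicator)
  also have "\<dots> = (\<Sum>a<N. \<Sum>l\<in>residue_vectors N. cis (of_int ((\<Sum>j=1..N. int j * l j) - int n) * step a))"
    by (rule sum.swap)
  also have "\<dots> = (\<Sum>a<N. if a = 0 then of_nat N ^ N else 0)"
  proof (intro sum.cong refl)
    fix a assume a: "a \<in> {..<N}"
    have "cis (of_int ((\<Sum>j=1..N. int j * l j) - int n) * step a) = cis (of_int (\<Sum>j=1..N. (int j * int a) * l j) * step 1) * cis (- (real n * step a))" for l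
    proof -
      have "cis (of_int ((\<Sum>j=1..N. int j * l j) - int n) * step a) = cis (of_int (\<Sum>j=1..N. int j * l j) * step a) * cis (- (real n * step a))"
        unfolding cis_mult by (rule arg_cong[where f = cis]) (simp add: left_diff_distrib)
      also have "cis (of_int (\<Sum>j=1..N. int j * l j) * step a) = cis (of_int (\<Sum>j=1..N. (int j * int a) * l j) * step 1)"
        unfolding step_mult[of _ a] sum_distrib_right by (simp only: mult_ac)
      finally show ?thesis .
    qed
    then have "(\<Sum>l\<in>residue_vectors N. cis (of_int ((\<Sum>j=1..N. int j * l j) - int n) * step a))
      = (if \<forall>j\<in>{1..N}. int N dvd int j * int a then of_nat N ^ N else 0) * cis (- (real n * step a))"
      by (simp only: sum_distrib_right[symmetric] residue_vectors_character_sum)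
    moreover have "(\<forall>j\<in>{1..N}. int N dvd int j * int a) \<longleftrightarrow> a = 0"
    proof
      assume "\<forall>j\<in>{1..N}. int N dvd int j * int a"
      then have "int N dvd int 1 * int a" using N by (intro bspec[where x = 1]) auto
      then have "N dvd a" by simp
      then show "a = 0" using a by (auto dest: nat_dvd_not_less)
    qed simp
    ultimately show "(\<Sum>l\<in>residue_vectors N. cis (of_int ((\<Sum>j=1..N. int j * l j) - int n) * step a)) = (if a = 0 then of_nat N ^ N else 0)"
      by (simp add: step_def)
  qed
  also have "\<dots> = of_nat N ^ N" using N by (simp add: sum.delta)
  finally have "N * card (solutions n) = N ^ N" by (simp flip: of_nat_mult of_nat_power)
  also have "N ^ N = N * N ^ (N - 1)" using N by (cases N) auto
  finally show ?thesis using N by simp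
qed

text \<open>Both congruences are detected by characters, \<open>a\<close> for the weighted sum and
  \<open>b\<close> for the difference. The sum over all residue vectors is non-zero exactly when N
  divides j a + chi j b for all j, that is, at the resonant pairs: analytic peaks and surviving
  characters coincide.\<close>

lemma phase_sum_eq:
  "phase_sum n k = of_real ((real N)\<^sup>2 * real (card {l \<in> solutions n. [l \<alpha> - l \<beta> = k] (mod int N)}) / real N ^ N)"
proof -
  have N: "0 < N" using N_ge_2 by simp
  have chi: "chi \<alpha> = 1" "chi \<beta> = -1" "\<And>j. j \<in> {1..N} \<Longrightarrow> j \<noteq> \<alpha> \<Longrightarrow> j \<noteq> \<beta> \<Longrightarrow> chi j = 0"
  proof -
    have "chi j = chi (first_part j + N * 0)" for j by (rule chi_cong[OF cong_sym[OF cong_first_part]])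
    then show "chi \<alpha> = 1" "chi \<beta> = -1" "\<And>j. j \<in> {1..N} \<Longrightarrow> j \<noteq> \<alpha> \<Longrightarrow> j \<noteq> \<beta> \<Longrightarrow> chi j = 0"
      using chi_first_part[of 0] chi_first_part(3)[of _ 0] by (metis, metis, metis)
  qed
  have dl: "l \<alpha> - l \<beta> = (\<Sum>j=1..N. chi j * l j)" for l :: "nat \<Rightarrow> int"
  proof -
    have "(\<Sum>j=1..N. chi j * l j) = (\<Sum>j\<in>{\<alpha>, \<beta>}. chi j * l j)"
      using alpha beta chi(3) by (intro sum.mono_neutral_right) auto
    then show ?thesis using alpha_neq_beta by (simp add: chi)
  qed
  let ?S = "{l \<in> solutions n. [l \<alpha> - l \<beta> = k] (mod int N)}"
  let ?u = "\<lambda>l. (\<Sum>j=1..N. int j * l j) - int n" let ?v = "\<lambda>l. l \<alpha> - l \<beta> - k"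
  have "of_nat N * (of_nat N * of_nat (card ?S)) = (\<Sum>l\<in>residue_vectors N. (if l \<in> ?S then of_nat N * of_nat N else 0 :: complex))"
    using finite_residue_vectors by (simp add: sum.If_cases Int_def solutions_def mult_ac conj_ac)
  also have "\<dots> = (\<Sum>l\<in>residue_vectors N. (\<Sum>a<N. cis (of_int (?u l) * step a)) * (\<Sum>b<N. cis (of_int (?v l) * step b)))"
    unfolding sum_step_cis by (intro sum.cong refl) (auto simp: solutions_def cong_iff_dvd_diff)
  also have "\<dots> = (\<Sum>l\<in>residue_vectors N. \<Sum>a<N. \<Sum>b<N. cis (of_int (?u l) * step a) * cis (of_int (?v l) * step b))"
    by (simp only: sum_product)
  also have "\<dots> = (\<Sum>a<N. \<Sum>l\<in>residue_vectors N. \<Sum>b<N. cis (of_int (?u l) * step a) * cis (of_int (?v l) * step b))"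
    by (rule sum.swap)
  also have "\<dots> = (\<Sum>a<N. \<Sum>b<N. \<Sum>l\<in>residue_vectors N. cis (of_int (?u l) * step a) * cis (of_int (?v l) * step b))"
    by (intro sum.cong refl sum.swap)
  also have "\<dots> = (\<Sum>a<N. \<Sum>b<N. of_nat N ^ N * ((if resonant (int a) (int b) then cis (- (of_int k * step b)) else 0) * cis (- (real n * step a))))"
  proof (intro sum.cong refl)
    fix a b
    let ?c = "\<lambda>j. int j * int a + chi j * int b"
    have "cis (of_int (?u l) * step a) * cis (of_int (?v l) * step b) = cis (of_int (\<Sum>j=1..N. ?c j * l j) * step 1) * (cis (- (of_int k * step b)) * cis (- (real n * step a)))" for l
    proof -
      have "(\<Sum>j=1..N. ?c j * l j) = (\<Sum>j=1..N. int j * l j) * int a + (l \<alpha> - l \<beta>) * int b"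
      proof -
        have "(\<Sum>j=1..N. ?c j * l j) = (\<Sum>j=1..N. (int j * l j) * int a + (chi j * l j) * int b)"
          by (intro sum.cong refl) (simp add: algebra_simps)
        then show ?thesis unfolding dl by (simp only: sum.distrib sum_distrib_right)
      qed
      then have "of_int (\<Sum>j=1..N. ?c j * l j) * step 1 = of_int (\<Sum>j=1..N. int j * l j) * step a + of_int (l \<alpha> - l \<beta>) * step b"
      proof -
        have "of_int (X * int a + D * int b) * step 1 = of_int X * step a + of_int D * step b" for X D
          by (simp add: step_def distrib_left add_divide_distrib algebra_simps)
        then show ?thesis unfolding \<open>(\<Sum>j=1..N. ?c j * l j) = _\<close> .
      qed
      then show ?thesis unfolding cis_mult by (intro arg_cong[where f = cis]) (simp add: left_diff_distrib del: of_int_sum)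
    qed
    then have "(\<Sum>l\<in>residue_vectors N. cis (of_int (?u l) * step a) * cis (of_int (?v l) * step b))
      = (if \<forall>j\<in>{1..N}. int N dvd ?c j then of_nat N ^ N else 0) * (cis (- (of_int k * step b)) * cis (- (real n * step a)))"
      by (simp only: sum_distrib_right[symmetric] residue_vectors_character_sum)
    then show "(\<Sum>l\<in>residue_vectors N. cis (of_int (?u l) * step a) * cis (of_int (?v l) * step b))
      = of_nat N ^ N * ((if resonant (int a) (int b) then cis (- (of_int k * step b)) else 0) * cis (- (real n * step a)))"
      by (simp add: resonant_def)
  qed
  also have "\<dots> = of_nat N ^ N * phase_sum n k" unfolding phase_sum_def by (simp only: sum_distrib_left)
  finally have "of_nat N * (of_nat N * of_nat (card ?S)) = of_nat N ^ N * phase_sum n k" .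
  moreover have "(of_nat N ^ N :: complex) \<noteq> 0" using N by simp
  ultimately have "phase_sum n k = of_nat N * (of_nat N * of_nat (card ?S)) / of_nat N ^ N" by (simp add: field_simps)
  then show ?thesis by (simp add: power2_eq_square mult.assoc)
qed

section \<open>Values of the averaged sign and the correction they cause\<close>

lemma smooth_sgn_minus: "smooth_sgn (- d) = - smooth_sgn d"
proof -
  have "(\<Sum>i<N. \<Sum>j<N. of_int (sgn (- d + int i - int j)) :: real) = (\<Sum>j<N. \<Sum>i<N. of_int (sgn (- d + int i - int j)))"
    by (rule sum.swap)
  also have "\<dots> = (\<Sum>i<N. \<Sum>j<N. - of_int (sgn (d + int i - int j)))"
  proof (intro sum.cong refl)
    fix i j :: nat
    have "sgn (- d + int i - int j) = - sgn (d + int j - int i)" by (auto simp: sgn_if)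
    then show "(of_int (sgn (- d + int i - int j)) :: real) = - of_int (sgn (d + int j - int i))" by simp
  qed
  finally show ?thesis by (simp add: smooth_sgn_def sum_negf)
qed

lemma smooth_sgn_large:
  assumes "int N \<le> \<bar>d\<bar>"
  shows "smooth_sgn d = of_int (sgn d)"
proof -
  have pos: "smooth_sgn d = 1" if "int N \<le> d" for d
  proof -
    have "(\<Sum>i<N. \<Sum>j<N. of_int (sgn (d + int i - int j)) :: real) = (\<Sum>i<N. \<Sum>j<N. 1)"
      using that by (intro sum.cong refl) (auto simp: sgn_if)
    then show ?thesis using N_ge_2 by (simp add: smooth_sgn_def power2_eq_square)
  qed
  show ?thesis
  proof (cases "0 \<le> d")
    case True
    then show ?thesis using pos[of d] assms N_ge_2 by simp
  next
    case False
    then show ?thesis using pos[of "- d"] smooth_sgn_minus[of d] assms N_ge_2 by simp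
  qed
qed

text \<open>A parabola between 0 and N: passing from d to d + 1 adds 2N - 2d - 1 to the double sum,
  by telescoping in i and counting signs in j.\<close>

lemma smooth_sgn_eq:
  assumes "d \<le> N"
  shows "smooth_sgn (int d) = (2 * real N * real d - (real d)\<^sup>2) / (real N)\<^sup>2"
proof -
  define f where "f = (\<lambda>d. \<Sum>i<N. \<Sum>j<N. sgn (d + int i - int j))"
  have fs: "smooth_sgn d = of_int (f d) / (real N)\<^sup>2" for d by (simp add: smooth_sgn_def f_def)
  have "smooth_sgn 0 = 0" using smooth_sgn_minus[of 0] by simp
  then have f0: "f 0 = 0" using N_ge_2 fs[of 0] by simp
  have "f (int d) = 2 * int N * int d - (int d)\<^sup>2"
    using assms
  proof (induction d)
    case (Suc d)
    have d: "d < N" using Suc.prems by simp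
    have "f (int (Suc d)) - f (int d) = (\<Sum>j<N. \<Sum>i<N. sgn (int d + int (Suc i) - int j) - sgn (int d + int i - int j))"
      unfolding f_def by (subst (1 2) sum.swap) (simp add: sum_subtractf algebra_simps)
    also have "\<dots> = (\<Sum>j<N. sgn (int d + int N - int j) - sgn (int d - int j))"
      by (intro sum.cong refl) (subst sum_lessThan_telescope, simp)
    also have "\<dots> = (\<Sum>j<N. 1 - ((if j < d then 1 else 0) - (if d < j then 1 else 0)))"
      by (intro sum.cong refl) (auto simp: sgn_if)
    also have "\<dots> = int N - (int (card {j. j < N \<and> j < d}) - int (card {j. j < N \<and> d < j}))"
      by (simp add: sum_subtractf sum.If_cases Int_def lessThan_def)
    also have "{j. j < N \<and> j < d} = {..<d}" using d by auto
    also have "{j. j < N \<and> d < j} = {d<..<N}" by auto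
    finally have "f (int (Suc d)) - f (int d) = int N - (int d - int (N - Suc d))" by simp
    moreover have "int (N - Suc d) = int N - int d - 1" using d by simp
    moreover have "f (int d) = 2 * int N * int d - (int d)\<^sup>2" using Suc d by simp
    ultimately show ?case by (simp add: power2_eq_square algebra_simps)
  qed (simp add: f0)
  then show ?thesis unfolding fs by simp
qed

lemma least_pos_residue_eq:
  "least_pos_residue N d = (if int N dvd d then N else nat (d mod int N))"
proof -
  have N: "0 < N" using N_ge_2 by simp
  show ?thesis
  proof (cases "int N dvd d")
    case True
    have "least_pos_residue N d = N"
      unfolding least_pos_residue_def
    proof (rule Least_equality)
      show "0 < N \<and> [int N = d] (mod int N)" using N True by (simp add: cong_def mod_eq_0_iff_dvd)
      fix m assume "0 < m \<and> [int m = d] (mod int N)"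
      moreover then have "int N dvd int m" using True cong_dvd_iff by blast
      ultimately show "N \<le> m" by (auto dest: zdvd_imp_le)
    qed
    then show ?thesis using True by simp
  next
    case False
    have r: "0 \<le> d mod int N" "d mod int N < int N" using N by auto
    have "d mod int N \<noteq> 0" using False by (simp add: mod_eq_0_iff_dvd)
    then have r0: "0 < d mod int N" using r by linarith
    have "least_pos_residue N d = nat (d mod int N)"
      unfolding least_pos_residue_def
    proof (rule Least_equality)
      show "0 < nat (d mod int N) \<and> [int (nat (d mod int N)) = d] (mod int N)" using r0 by (simp add: cong_def)
      fix m assume m: "0 < m \<and> [int m = d] (mod int N)"
      then have "d mod int N = int m mod int N" by (simp add: cong_def)
      also have "\<dots> \<le> int m" by (simp add: zmod_le_nonneg_dividend)
      finally show "nat (d mod int N) \<le> m" by simp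
    qed
    then show ?thesis using False by simp
  qed
qed

text \<open>A class r with 0 < r < N contains two integers of absolute value below N, namely r and r
  - N; their signs cancel and the averaged signs leave 1 - 2r/N. In the class of 0 the sum vanishes
  and the subtracted indicator leaves -1 = 1 - 2N/N. This is why the residue has to be taken in 1,
  ..., N.\<close>

lemma sgn_correction_sum:
  "(\<Sum>k\<in>{- (int N - 1)..int N - 1}. (of_int (sgn k) - smooth_sgn k) * (if [d = k] (mod int N) then 1 else 0)) - (if int N dvd d then 1 else 0)
    = 1 - 2 * real (least_pos_residue N d) / real N"
proof -
  have N: "0 < N" using N_ge_2 by simp
  let ?I = "{- (int N - 1)..int N - 1}"
  have cg: "[d = k] (mod int N) \<longleftrightarrow> int N dvd (d mod int N - k)" for k
    by (simp add: cong_iff_dvd_diff mod_diff_left_eq flip: mod_eq_0_iff_dvd)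
  have small: "x = 0" if "int N dvd x" "\<bar>x\<bar> < int N" for x using that dvd_imp_le_int[of x "int N"] by fastforce
  have s0: "smooth_sgn 0 = 0" using smooth_sgn_minus[of 0] by simp
  show ?thesis
  proof (cases "int N dvd d")
    case True
    then have d0: "d mod int N = 0" by simp
    have "[d = k] (mod int N) \<longleftrightarrow> k = 0" if k: "k \<in> ?I" for k
    proof
      assume "[d = k] (mod int N)"
      then have "int N dvd k" unfolding cg d0 by simp
      moreover have "\<bar>k\<bar> < int N" using k by auto
      ultimately show "k = 0" by (rule small)
    qed (simp add: cg d0)
    then have "(\<Sum>k\<in>?I. (of_int (sgn k) - smooth_sgn k) * (if [d = k] (mod int N) then 1 else 0)) = (\<Sum>k\<in>?I. 0)"
      by (intro sum.cong refl) (auto simp: s0)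
    then show ?thesis using True N by (simp add: least_pos_residue_eq)
  next
    case False
    define r where "r = nat (d mod int N)"
    have r: "d mod int N = int r" "r < N" using N by (auto simp: r_def nat_less_iff)
    have "d mod int N \<noteq> 0" using False by (simp add: mod_eq_0_iff_dvd)
    then have r0: "0 < r" using r by auto
    have iff: "[d = k] (mod int N) \<longleftrightarrow> k = int r \<or> k = int r - int N" if k: "k \<in> ?I" for k
    proof
      assume "[d = k] (mod int N)"
      then have dv: "int N dvd int r - k" unfolding cg r .
      show "k = int r \<or> k = int r - int N"
      proof (cases "0 \<le> k")
        case True
        then have "\<bar>int r - k\<bar> < int N" using k r(2) by auto
        then show ?thesis using small[OF dv] by simp
      next
        case False
        have "int N dvd int r - k - int N" using dv by simp
        moreover have "\<bar>int r - k - int N\<bar> < int N" using False k r(2) r0 by auto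
        ultimately show ?thesis using small[of "int r - k - int N"] by simp
      qed
    qed (auto simp: cg r)
    have "(\<Sum>k\<in>?I. (of_int (sgn k) - smooth_sgn k) * (if [d = k] (mod int N) then 1 else 0))
      = (\<Sum>k\<in>{int r, int r - int N}. (of_int (sgn k) - smooth_sgn k) * (if [d = k] (mod int N) then 1 else 0))"
      using r r0 iff by (intro sum.mono_neutral_right) auto
    also have "\<dots> = (\<Sum>k\<in>{int r, int r - int N}. of_int (sgn k) - smooth_sgn k)"
    proof (intro sum.cong refl)
      fix k assume k: "k \<in> {int r, int r - int N}"
      then have "k \<in> ?I" using r r0 by auto
      then show "(of_int (sgn k) - smooth_sgn k) * (if [d = k] (mod int N) then 1 else 0) = of_int (sgn k) - smooth_sgn k"
        using iff k by auto
    qed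
    also have "\<dots> = smooth_sgn (int (N - r)) - smooth_sgn (int r)"
    proof -
      have "int r - int N = - int (N - r)" using r by simp
      then have "smooth_sgn (int r - int N) = - smooth_sgn (int (N - r))" by (simp only: smooth_sgn_minus)
      then show ?thesis using r r0 N by simp
    qed
    also have "\<dots> = 1 - 2 * real r / real N"
    proof -
      have "real (N - r) = real N - real r" using r by simp
      then show ?thesis using N unfolding smooth_sgn_eq[OF diff_le_self] smooth_sgn_eq[OF less_imp_le[OF r(2)]]
        by (simp add: field_simps power2_eq_square)
    qed
    finally show ?thesis using False by (simp add: least_pos_residue_eq r_def)
  qed
qed

text \<open>With x = l_j and e = e_j, N (x^2/2 + (j/N - 1/2 + e) x) = j x + N (e x + x (x - 1) / 2),
  and x (x - 1) / 2 is an integer.\<close>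

lemma H_fun_cong_iff:
  "[real N * H_fun N K l = real n] (rmod real N) \<longleftrightarrow> [(\<Sum>j=1..N. int j * l j) = int n] (mod int N)"
proof -
  have N: "0 < N" using N_ge_2 by simp
  define z where "z = (\<Sum>j=1..N. int (e_vec N K j) * l j + (l j * (l j - 1)) div 2)"
  have h: "real_of_int ((x * (x - 1)) div 2) = (of_int x)\<^sup>2 / 2 - of_int x / 2" for x :: int
  proof -
    have "even (x * (x - 1))" by simp
    then have "real_of_int ((x * (x - 1)) div 2) = of_int (x * (x - 1)) / 2" by (simp add: real_of_int_div)
    then show ?thesis by (simp add: power2_eq_square algebra_simps diff_divide_distrib)
  qed
  have "real N * H_fun N K l = (\<Sum>j=1..N. real N * (1 / 2 * (of_int (l j))\<^sup>2) + real N * (b_vec N K j * of_int (l j)))"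
    unfolding H_fun_def by (simp add: sum.distrib sum_distrib_left distrib_left)
  also have "\<dots> = (\<Sum>j=1..N. of_int (int j * l j) + of_int (int N) * of_int (int (e_vec N K j) * l j + (l j * (l j - 1)) div 2))"
    unfolding of_int_add of_int_mult h b_vec_def using N by (intro sum.cong refl) (simp add: field_simps)
  also have "\<dots> = of_int ((\<Sum>j=1..N. int j * l j) + int N * z)"
    unfolding z_def by (simp only: sum.distrib sum_distrib_left of_int_sum of_int_add of_int_mult distrib_left mult.assoc)
  finally have e: "real N * H_fun N K l = of_int ((\<Sum>j=1..N. int j * l j) + int N * z)" .
  have "[real_of_int x = real_of_int y] (rmod real N) \<longleftrightarrow> [x = y] (mod int N)" for x y
  proof -
    have "[real_of_int x = real_of_int y] (rmod real N) \<longleftrightarrow> (\<exists>q. real_of_int y = real_of_int x + of_int q * real N)"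
      by (simp add: rcong_altdef)
    also have "\<dots> \<longleftrightarrow> (\<exists>q. y = x + q * int N)"
    proof -
      have "real_of_int x + of_int q * real N = of_int (x + q * int N)" for q by simp
      then show ?thesis by (simp only: of_int_eq_iff)
    qed
    also have "\<dots> \<longleftrightarrow> [x = y] (mod int N)"
      by (metis cong_iff_lin mult.commute)
    finally show ?thesis .
  qed
  from this[of "(\<Sum>j=1..N. int j * l j) + int N * z" "int n"] show ?thesis
    unfolding e by (simp add: cong_def)
qed

lemma H_fun_solutions: "{l \<in> residue_vectors N. [real N * H_fun N K l = real n] (rmod real N)} = solutions n"
  unfolding solutions_def H_fun_cong_iff ..

section \<open>The two-term expansion\<close>

text \<open>Twice the indicator of D > 0 is 1 - [D = 0] + sgn D. For |D| \<ge> N the averaged sign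
  equals the sign, so their difference is a finite combination of the events D = k with |k| <
  N.\<close>

lemma d_count_identity:
  "2 * real (d_count \<alpha> \<beta> N K n) = real (card (distinct_partitions_gt K n)) - real (card {A \<in> distinct_partitions_gt K n. part_diff A = 0})
    + (\<Sum>k\<in>{- (int N - 1)..int N - 1}. (of_int (sgn k) - smooth_sgn k) * real (card {A \<in> distinct_partitions_gt K n. part_diff A = k}))
    + (\<Sum>A\<in>distinct_partitions_gt K n. smooth_sgn (part_diff A))"
proof -
  let ?P = "distinct_partitions_gt K n" let ?I = "{- (int N - 1)..int N - 1}"
  have c: "real (card {A \<in> ?P. Q A}) = (\<Sum>A\<in>?P. if Q A then 1 else 0)" for Q by (simp add: sum.If_cases Int_def)
  have "{S \<in> ?P. parts_cong N \<beta> S < parts_cong N \<alpha> S} = {A \<in> ?P. 0 < part_diff A}"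
    by (auto simp: distinct_partitions_gt_def part_diff_eq)
  then have "2 * real (d_count \<alpha> \<beta> N K n) = (\<Sum>A\<in>?P. 2 * (if 0 < part_diff A then 1 else 0))"
    unfolding d_count_def by (simp only: c sum_distrib_left)
  also have "\<dots> = (\<Sum>A\<in>?P. 1 - (if part_diff A = 0 then 1 else 0)
      + (\<Sum>k\<in>?I. (of_int (sgn k) - smooth_sgn k) * (if part_diff A = k then 1 else 0)) + smooth_sgn (part_diff A))"
  proof (intro sum.cong refl)
    fix A
    let ?x = "part_diff A"
    have "(\<Sum>k\<in>?I. (of_int (sgn k) - smooth_sgn k) * (if ?x = k then 1 else 0)) = (if ?x \<in> ?I then of_int (sgn ?x) - smooth_sgn ?x else 0)"
      by (simp add: if_distrib[of "\<lambda>y. _ * y"] sum.delta' cong: if_cong)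
    also have "\<dots> = of_int (sgn ?x) - smooth_sgn ?x"
    proof (cases "?x \<in> ?I")
      case False
      then have "int N \<le> \<bar>?x\<bar>" by auto
      then show ?thesis using False by (simp add: smooth_sgn_large)
    qed simp
    finally show "2 * (if 0 < ?x then 1 else 0) = (1 :: real) - (if ?x = 0 then 1 else 0)
      + (\<Sum>k\<in>?I. (of_int (sgn k) - smooth_sgn k) * (if ?x = k then 1 else 0)) + smooth_sgn ?x"
      by (simp add: sgn_if)
  qed
  also have "\<dots> = real (card ?P) - real (card {A \<in> ?P. part_diff A = 0})
    + (\<Sum>A\<in>?P. \<Sum>k\<in>?I. (of_int (sgn k) - smooth_sgn k) * (if part_diff A = k then 1 else 0)) + (\<Sum>A\<in>?P. smooth_sgn (part_diff A))"
    unfolding c by (simp add: sum.distrib sum_subtractf)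
  also have "(\<Sum>A\<in>?P. \<Sum>k\<in>?I. (of_int (sgn k) - smooth_sgn k) * (if part_diff A = k then 1 else 0))
    = (\<Sum>k\<in>?I. \<Sum>A\<in>?P. (of_int (sgn k) - smooth_sgn k) * (if part_diff A = k then 1 else 0))"
    by (rule sum.swap)
  also have "\<dots> = (\<Sum>k\<in>?I. (of_int (sgn k) - smooth_sgn k) * real (card {A \<in> ?P. part_diff A = k}))"
    unfolding c by (simp only: sum_distrib_left)
  finally show ?thesis .
qed

definition correction :: "nat \<Rightarrow> real" where
  "correction n = (\<Sum>l\<in>solutions n. (real N)\<^sup>2 - 2 * real N * real (least_pos_residue N (l \<alpha> - l \<beta>)) + shift)"

text \<open>By \<open>phase_sum_eq\<close> this is the value of \<open>phase_sum n k\<close>, as a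
  real number.\<close>

definition class_count :: "nat \<Rightarrow> int \<Rightarrow> real" where
  "class_count n k = (real N)\<^sup>2 * real (card {l \<in> solutions n. [l \<alpha> - l \<beta> = k] (mod int N)}) / real N ^ N"

text \<open>Exchanging the sums over k and over solutions, \<open>sgn_correction_sum\<close> applies
  to each solution separately; the constant shift / N is spread evenly over the N^(N-1)
  solutions.\<close>

lemma class_count_sum:
  "(\<Sum>k\<in>{- (int N - 1)..int N - 1}. (of_int (sgn k) - smooth_sgn k) * class_count n k) - class_count n 0 + shift / N = correction n / real N ^ N"
proof -
  have N: "0 < N" using N_ge_2 by simp
  let ?I = "{- (int N - 1)..int N - 1}"
  let ?b = "\<lambda>l k. if [l \<alpha> - l \<beta> = k] (mod int N) then 1 else 0 :: real"
  let ?z = "\<lambda>k :: int. of_int (sgn k) - smooth_sgn k"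
  let ?p = "\<lambda>l. least_pos_residue N (l \<alpha> - l \<beta>)"
  define f where "f = (real N)\<^sup>2 / real N ^ N"
  have c: "class_count n k = (\<Sum>l\<in>solutions n. f * ?b l k)" for k
    by (simp add: class_count_def f_def sum.If_cases Int_def if_distrib[of "\<lambda>y. _ * y"] cong: if_cong)
  have "(\<Sum>k\<in>?I. ?z k * class_count n k) - class_count n 0 = (\<Sum>k\<in>?I. \<Sum>l\<in>solutions n. ?z k * (f * ?b l k)) - (\<Sum>l\<in>solutions n. f * ?b l 0)"
    unfolding c sum_distrib_left ..
  also have "(\<Sum>k\<in>?I. \<Sum>l\<in>solutions n. ?z k * (f * ?b l k)) = (\<Sum>l\<in>solutions n. \<Sum>k\<in>?I. ?z k * (f * ?b l k))" by (rule sum.swap)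
  also have "\<dots> = (\<Sum>l\<in>solutions n. f * (\<Sum>k\<in>?I. ?z k * ?b l k))" unfolding sum_distrib_left by (simp only: mult_ac)
  also have "\<dots> - (\<Sum>l\<in>solutions n. f * ?b l 0) = (\<Sum>l\<in>solutions n. f * ((\<Sum>k\<in>?I. ?z k * ?b l k) - (if int N dvd l \<alpha> - l \<beta> then 1 else 0)))"
    unfolding cong_0_iff right_diff_distrib sum_subtractf ..
  also have "\<dots> = (\<Sum>l\<in>solutions n. f * (1 - 2 * real (?p l) / real N))" unfolding sgn_correction_sum ..
  finally have 1: "(\<Sum>k\<in>?I. ?z k * class_count n k) - class_count n 0 = (\<Sum>l\<in>solutions n. f * (1 - 2 * real (?p l) / real N))" .
  have "real N ^ N = real N * real N ^ (N - 1)" using N by (cases N) auto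
  then have 2: "shift / N = (\<Sum>l\<in>solutions n. shift / real N ^ N)" using N by (simp add: card_solutions)
  have "f * (1 - 2 * real (?p l) / real N) + shift / real N ^ N = ((real N)\<^sup>2 - 2 * real N * real (?p l) + shift) / real N ^ N" for l
  proof -
    have "(real N)\<^sup>2 * (1 - 2 * real (?p l) / real N) = (real N)\<^sup>2 - 2 * real N * real (?p l)" using N by (simp add: power2_eq_square field_simps)
    then show ?thesis unfolding f_def by (simp add: add_divide_distrib)
  qed
  then show ?thesis unfolding 1 by (subst 2) (simp only: sum.distrib[symmetric] correction_def sum_divide_distrib)
qed

text \<open>Fourier inversion of the total brings one factor 2\<pi>, that of the other terms two;
  the total is therefore multiplied by 2\<pi> before everything is inserted into
  \<open>d_count_identity\<close>.\<close>

lemma d_count_asymp: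
  "\<exists>C. \<forall>\<^sub>F n in sequentially.
    \<bar>8 * pi\<^sup>2 * weight n * real (d_count \<alpha> \<beta> N K n) - (2 * pi * sqrt (12 / pi) * scale n ^ 3 + scale n ^ 4 * sqrt (24 * N) * (correction n / real N ^ N))\<bar> \<le> C * scale n ^ 5"
proof -
  let ?I = "{- (int N - 1)..int N - 1}"
  define G where "G = (\<lambda>n k. real (card {A \<in> distinct_partitions_gt K n. part_diff A = k}))"
  define z where "z = (\<lambda>k. of_int (sgn k) - smooth_sgn k)"
  obtain C1 where e1: "\<forall>\<^sub>F n in sequentially. \<bar>2 * pi * weight n * real (card (distinct_partitions_gt K n)) - scale n ^ 3 * sqrt (12 / pi)\<bar> \<le> C1 * scale n ^ 5"
    using total_asymp by blast
  obtain C2 where e2: "\<forall>\<^sub>F n in sequentially.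
    \<bar>4 * pi\<^sup>2 * weight n * (\<Sum>A\<in>distinct_partitions_gt K n. smooth_sgn (part_diff A)) - scale n ^ 4 * sqrt (24 * N) * (shift / N)\<bar> \<le> C2 * scale n ^ 5"
    using smooth_asymp by blast
  have "\<exists>C. \<forall>\<^sub>F n in sequentially. \<bar>4 * pi\<^sup>2 * weight n * G n k - scale n ^ 4 * sqrt (24 * N) * class_count n k\<bar> \<le> C * scale n ^ 5" for k
  proof -
    have "cmod (of_real (4 * pi\<^sup>2 * weight n * real (card {A \<in> distinct_partitions_gt K n. part_diff A = k}))
      - of_real (scale n ^ 4 * sqrt (24 * N)) * phase_sum n k) = \<bar>4 * pi\<^sup>2 * weight n * G n k - scale n ^ 4 * sqrt (24 * N) * class_count n k\<bar>" for n
      unfolding phase_sum_eq class_count_def[symmetric] G_def of_real_mult[symmetric] of_real_diff[symmetric] norm_of_real ..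
    then show ?thesis using diff_count_asymp[of k] by (simp only:)
  qed
  then obtain C3 where "\<And>k. \<forall>\<^sub>F n in sequentially. \<bar>4 * pi\<^sup>2 * weight n * G n k - scale n ^ 4 * sqrt (24 * N) * class_count n k\<bar> \<le> C3 k * scale n ^ 5"
    using choice[of "\<lambda>k C. \<forall>\<^sub>F n in sequentially. \<bar>4 * pi\<^sup>2 * weight n * G n k - scale n ^ 4 * sqrt (24 * N) * class_count n k\<bar> \<le> C * scale n ^ 5"]
    by blast
  \<comment> \<open>The constants depend on \<open>k\<close>, but only finitely many
    \<open>k\<close> occur.\<close>
  then have e3: "\<forall>\<^sub>F n in sequentially. \<forall>k\<in>insert 0 ?I. \<bar>4 * pi\<^sup>2 * weight n * G n k - scale n ^ 4 * sqrt (24 * N) * class_count n k\<bar> \<le> C3 k * scale n ^ 5"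
    by (intro eventually_ball_finite) auto
  define C where "C = 2 * pi * C1 + C3 0 + (\<Sum>k\<in>?I. \<bar>z k\<bar> * C3 k) + C2"
  have "\<forall>\<^sub>F n in sequentially.
    \<bar>8 * pi\<^sup>2 * weight n * real (d_count \<alpha> \<beta> N K n) - (2 * pi * sqrt (12 / pi) * scale n ^ 3 + scale n ^ 4 * sqrt (24 * N) * (correction n / real N ^ N))\<bar> \<le> C * scale n ^ 5"
    using e1 e2 e3
  proof eventually_elim
    case (elim n)
    let ?s = "scale n" let ?W = "4 * pi\<^sup>2 * weight n" let ?q = "?s ^ 4 * sqrt (24 * N)"
    let ?T = "real (card (distinct_partitions_gt K n))"
    let ?D = "\<Sum>A\<in>distinct_partitions_gt K n. smooth_sgn (part_diff A)"
    define x1 where "x1 = 2 * pi * (2 * pi * weight n * ?T - ?s ^ 3 * sqrt (12 / pi))"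
    define x2 where "x2 = ?W * G n 0 - ?q * class_count n 0"
    define x3 where "x3 = (\<Sum>k\<in>?I. z k * (?W * G n k - ?q * class_count n k))"
    define x4 where "x4 = ?W * ?D - ?q * (shift / N)"
    have a1: "\<bar>x1\<bar> \<le> 2 * pi * (C1 * ?s ^ 5)" unfolding x1_def using elim(1) by (simp add: abs_mult)
    have a2: "\<bar>x2\<bar> \<le> C3 0 * ?s ^ 5" unfolding x2_def using elim(3) by blast
    have a4: "\<bar>x4\<bar> \<le> C2 * ?s ^ 5" unfolding x4_def by (rule elim(2))
    have "\<bar>x3\<bar> \<le> (\<Sum>k\<in>?I. \<bar>z k\<bar> * (C3 k * ?s ^ 5))"
      unfolding x3_def by (rule order_trans[OF sum_abs]) (auto simp only: abs_mult intro!: sum_mono mult_left_mono elim(3)[rule_format])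
    also have "\<dots> = (\<Sum>k\<in>?I. \<bar>z k\<bar> * C3 k) * ?s ^ 5" by (simp only: sum_distrib_right mult.assoc)
    finally have a3: "\<bar>x3\<bar> \<le> (\<Sum>k\<in>?I. \<bar>z k\<bar> * C3 k) * ?s ^ 5" .
    have x3e: "x3 = ?W * (\<Sum>k\<in>?I. z k * G n k) - ?q * (\<Sum>k\<in>?I. z k * class_count n k)"
      unfolding x3_def right_diff_distrib sum_subtractf sum_distrib_left by (simp only: mult_ac)
    have "8 * pi\<^sup>2 * weight n * real (d_count \<alpha> \<beta> N K n) = ?W * (2 * real (d_count \<alpha> \<beta> N K n))" by simp
    also have "\<dots> = ?W * (?T - G n 0 + (\<Sum>k\<in>?I. z k * G n k) + ?D)" unfolding d_count_identity G_def z_def ..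
    finally have L: "8 * pi\<^sup>2 * weight n * real (d_count \<alpha> \<beta> N K n) = ?W * (?T - G n 0 + (\<Sum>k\<in>?I. z k * G n k) + ?D)" .
    have cs: "correction n / real N ^ N = (\<Sum>k\<in>?I. z k * class_count n k) - class_count n 0 + shift / N"
      unfolding z_def class_count_sum ..
    have gen: "4 * p\<^sup>2 * w * (t - g + S + D) - (2 * p * r * s3 + Q * (S' - g' + h))
      = 2 * p * (2 * p * w * t - s3 * r) - (4 * p\<^sup>2 * w * g - Q * g') + (4 * p\<^sup>2 * w * S - Q * S') + (4 * p\<^sup>2 * w * D - Q * h)"
      for p w t g S D r s3 Q S' g' h :: real by (simp add: algebra_simps power2_eq_square)
    have "8 * pi\<^sup>2 * weight n * real (d_count \<alpha> \<beta> N K n) - (2 * pi * sqrt (12 / pi) * ?s ^ 3 + ?q * (correction n / real N ^ N)) = x1 - x2 + x3 + x4"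
      unfolding L cs gen x1_def x2_def x3e x4_def ..
    also have "\<bar>\<dots>\<bar> \<le> 2 * pi * (C1 * ?s ^ 5) + C3 0 * ?s ^ 5 + (\<Sum>k\<in>?I. \<bar>z k\<bar> * C3 k) * ?s ^ 5 + C2 * ?s ^ 5"
      using a1 a2 a3 a4 by linarith
    also have "\<dots> = C * ?s ^ 5" unfolding C_def by (simp only: distrib_right mult.assoc)
    finally show ?case .
  qed
  then show ?thesis by blast
qed

text \<open>The factor in front of the sum over l. As that sum has N^(N-1) terms, the leading order
  of the count is main_term n \<cdot> N^(N-1).\<close>

definition main_term :: "nat \<Rightarrow> real" where
  "main_term n = exp (pi * sqrt (real n / 3)) / (2 ^ (K + 3) * 3 powr (1 / 4) * real N ^ (N - 1) * real n powr (3 / 4))"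

definition second_scale :: "nat \<Rightarrow> real" where
  "second_scale n = 2 * 3 powr (1 / 4) * sqrt (real N) * real n powr (1 / 4)"

text \<open>From s^4 = t^2 = \<pi>^2 / (12 n): converts powers of s into the powers of n^(1/4) of
  the theorem.\<close>

lemma scale_quartic: "n \<ge> 1 \<Longrightarrow> scale n * (3 powr (1 / 4) * real n powr (1 / 4)) = sqrt (pi / 2)"
proof -
  assume n: "n \<ge> 1"
  have h: "(x powr (1 / 4))\<^sup>2 = sqrt x" if "0 < x" for x :: real
    using that by (simp add: powr_half_sqrt[symmetric] powr_power)
  have "(scale n * (3 powr (1 / 4) * real n powr (1 / 4)))\<^sup>2 = saddle n * (sqrt 3 * sqrt (real n))"
    using n unfolding power_mult_distrib scale_sq[OF n] by (simp add: h)
  also have "\<dots> = pi / 2" using n by (simp add: saddle_def real_sqrt_mult)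
  finally show ?thesis using scale_pos[OF n] by (intro real_sqrt_unique[symmetric]) auto
qed

text \<open>In other words, the second order coefficient s^4 \<surd>(24N) divided by the first order
  term 2\<pi> \<surd>(12/\<pi>) s^3 is N / second_scale n.\<close>

lemma scale_second_scale:
  assumes "n \<ge> 1"
  shows "scale n * sqrt (24 * N) * second_scale n = 2 * pi * sqrt (12 / pi) * N"
proof -
  have "scale n * sqrt (24 * N) * second_scale n = 2 * (sqrt (24 * N) * sqrt N) * (scale n * (3 powr (1 / 4) * real n powr (1 / 4)))"
    by (simp add: second_scale_def)
  also have "\<dots> = 2 * (sqrt (24 * N) * sqrt N * sqrt (pi / 2))" unfolding scale_quartic[OF assms] by simp
  also have "sqrt (24 * N) * sqrt N * sqrt (pi / 2) = sqrt ((real N)\<^sup>2 * (pi\<^sup>2 * (12 / pi)))"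
    unfolding real_sqrt_mult[symmetric] by (simp add: power2_eq_square)
  also have "\<dots> = real N * (pi * sqrt (12 / pi))" by (rule real_sqrt_unique) (auto simp: power_mult_distrib)
  finally show ?thesis by simp
qed

text \<open>An exact identity, with the whole error confined to the last exponential, the defect of
  ln (gf n). The growth rate arises as t n + \<pi>^2 / (12 t) = \<pi> \<surd>(n/3), whose two
  summands are equal at t = \<open>saddle n\<close>.\<close>

lemma main_term_ratio:
  assumes n: "n \<ge> 1"
  shows "2 * pi * sqrt (12 / pi) * scale n ^ 3 = 8 * pi\<^sup>2 * weight n * (main_term n * real N ^ (N - 1))
    * exp (ln (gf n) - (pi\<^sup>2 / (12 * saddle n) - (real K + 1 / 2) * ln 2))"
proof -
  define q r where "q = (3::real) powr (1 / 4)" and "r = real n powr (1 / 4)"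
  have N: "0 < real N" using N_ge_2 by simp
  have q: "0 < q" "q\<^sup>2 = sqrt 3" by (auto simp: q_def powr_half_sqrt[symmetric] powr_power)
  have r: "0 < r" "real n powr (3 / 4) = r ^ 3" using n by (auto simp: r_def powr_power simp del: powr_half_sqrt)
  have sq: "scale n * (q * r) = sqrt (pi / 2)" unfolding q_def r_def by (rule scale_quartic[OF n])
  have ex: "saddle n * real n + pi\<^sup>2 / (12 * saddle n) = pi * sqrt (real n / 3)"
  proof -
    have t: "saddle n * sqrt (3 * real n) = pi / 2" using n by (simp add: saddle_def)
    have t0: "0 < saddle n" using saddle_pos[OF n] .
    have "saddle n * real n * 6 = pi * sqrt (3 * real n)"
    proof -
      have "saddle n * (sqrt (3 * real n) * sqrt (3 * real n)) * 2 = pi * sqrt (3 * real n)"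
        unfolding mult.assoc[symmetric] t by simp
      then show ?thesis by simp
    qed
    moreover have "pi\<^sup>2 / (12 * saddle n) * 6 = pi * sqrt (3 * real n)"
    proof -
      have "pi * sqrt (3 * real n) * (2 * saddle n) = pi\<^sup>2" using t by (simp add: power2_eq_square algebra_simps)
      then show ?thesis using t0 by (simp add: field_simps)
    qed
    moreover have "sqrt (3 * real n) = 3 * sqrt (real n / 3)"
      by (rule real_sqrt_unique) (auto simp: power_mult_distrib)
    moreover have "x + y = z" if "x * 6 = w" "y * 6 = w" "w = 3 * z" for x y z w :: real using that by simp
    ultimately show ?thesis by (metis (no_types) mult.left_commute)
  qed
  have pw: "exp ((real K + 1 / 2) * ln 2) = 2 ^ K * sqrt 2"
  proof -
    have "exp ((real K + 1 / 2) * ln 2) = 2 powr (real K + 1 / 2)" by (simp add: powr_def)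
    then show ?thesis by (simp add: powr_add powr_realpow powr_half_sqrt)
  qed
  have "exp (- (saddle n * real n)) * exp (pi * sqrt (real n / 3)) * exp (ln (gf n) - (pi\<^sup>2 / (12 * saddle n) - (real K + 1 / 2) * ln 2))
    = exp (ln (gf n)) * exp ((real K + 1 / 2) * ln 2)"
    unfolding exp_add[symmetric] ex[symmetric] by (simp add: algebra_simps)
  then have E: "weight n * exp (pi * sqrt (real n / 3)) * exp (ln (gf n) - (pi\<^sup>2 / (12 * saddle n) - (real K + 1 / 2) * ln 2)) = 2 ^ K * sqrt 2"
    unfolding pw exp_ln[OF gf_pos] weight_def using gf_pos[of n] by (simp add: field_simps)
  have "8 * pi\<^sup>2 * weight n * (main_term n * real N ^ (N - 1)) * exp (ln (gf n) - (pi\<^sup>2 / (12 * saddle n) - (real K + 1 / 2) * ln 2))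
    = 8 * pi\<^sup>2 * (weight n * exp (pi * sqrt (real n / 3)) * exp (ln (gf n) - (pi\<^sup>2 / (12 * saddle n) - (real K + 1 / 2) * ln 2))) / (2 ^ (K + 3) * q * r ^ 3)"
    using N unfolding main_term_def q_def[symmetric] r(2) by simp
  also have "\<dots> = pi\<^sup>2 * sqrt 2 / (q * r ^ 3)" unfolding E by (simp add: power_add)
  also have "\<dots> = 2 * pi * sqrt (12 / pi) * scale n ^ 3"
  proof -
    have "scale n ^ 3 * (q * r ^ 3) * q\<^sup>2 = (scale n * (q * r)) ^ 3" by (simp add: power_mult_distrib power2_eq_square power3_eq_cube)
    also have "\<dots> = pi / 2 * sqrt (pi / 2)" unfolding sq by (simp add: power3_eq_cube)
    finally have "2 * pi * sqrt (12 / pi) * (scale n ^ 3 * (q * r ^ 3) * q\<^sup>2) = pi\<^sup>2 * (sqrt (12 / pi) * sqrt (pi / 2))"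
      by (simp add: power2_eq_square)
    also have "sqrt (12 / pi) * sqrt (pi / 2) = sqrt (2 * 3)" unfolding real_sqrt_mult[symmetric] by simp
    also have "pi\<^sup>2 * sqrt (2 * 3) = (pi\<^sup>2 * sqrt 2) * q\<^sup>2" unfolding q(2) real_sqrt_mult by simp
    finally have "(2 * pi * sqrt (12 / pi) * scale n ^ 3 * (q * r ^ 3)) * q\<^sup>2 = (pi\<^sup>2 * sqrt 2) * q\<^sup>2" by (simp only: mult.assoc)
    then have "2 * pi * sqrt (12 / pi) * scale n ^ 3 * (q * r ^ 3) = pi\<^sup>2 * sqrt 2" using q by simp
    then show ?thesis using q r by (simp add: field_simps)
  qed
  finally show ?thesis ..
qed

lemma abs_correction_le: "\<bar>correction n\<bar> \<le> real N ^ (N - 1) * (3 * (real N)\<^sup>2 + \<bar>shift\<bar>)"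
proof -
  have N: "0 < N" using N_ge_2 by simp
  have "\<bar>correction n\<bar> \<le> (\<Sum>l\<in>solutions n. 3 * (real N)\<^sup>2 + \<bar>shift\<bar>)"
    unfolding correction_def
  proof (intro order_trans[OF sum_abs] sum_mono)
    fix l :: "nat \<Rightarrow> int"
    let ?p = "least_pos_residue N (l \<alpha> - l \<beta>)"
    have "(l \<alpha> - l \<beta>) mod int N \<le> int N" using N by (intro less_imp_le pos_mod_bound) simp
    then have "?p \<le> N" by (auto simp: least_pos_residue_eq nat_le_iff)
    then have "real N * real ?p \<le> real N * real N" by (intro mult_left_mono) auto
    moreover have "0 \<le> real N * real ?p" by simp
    moreover have "\<bar>m - 2 * x + d\<bar> \<le> 3 * m + \<bar>d\<bar>" if "0 \<le> x" "x \<le> m" for m x d :: real using that by linarith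
    ultimately show "\<bar>(real N)\<^sup>2 - 2 * real N * real ?p + shift\<bar> \<le> 3 * (real N)\<^sup>2 + \<bar>shift\<bar>"
      by (simp only: power2_eq_square mult.assoc)
  qed
  then show ?thesis by (simp add: card_solutions)
qed

lemma main_term_pos: "n \<ge> 1 \<Longrightarrow> 0 < main_term n"
  using N_ge_2 by (simp add: main_term_def)

lemma second_scale_ge_1: "n \<ge> 1 \<Longrightarrow> 1 \<le> second_scale n"
proof -
  assume n: "n \<ge> 1"
  have "1 \<le> (3 :: real) powr (1 / 4)" "1 \<le> real n powr (1 / 4)" using n by (auto intro: ge_one_powr_ge_zero)
  moreover have "1 \<le> sqrt (real N)" using N_ge_2 by simp
  ultimately have "1 * 1 * 1 * 1 \<le> 2 * 3 powr (1 / 4) * sqrt (real N) * real n powr (1 / 4)" by (intro mult_mono) auto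
  then show ?thesis by (simp add: second_scale_def)
qed

text \<open>Two relative errors of order t: s^5 / s^3 from the integrals, and the defect of ln (gf
  n). The latter also multiplies the second order term \<open>u\<close>, which is bounded.\<close>

lemma d_count_ratio:
  "\<exists>C. \<forall>\<^sub>F n in sequentially.
    \<bar>real (d_count \<alpha> \<beta> N K n) / (main_term n * real N ^ (N - 1)) - 1 - correction n / real N ^ (N - 1) / second_scale n\<bar> \<le> C * saddle n"
proof -
  obtain C where ev: "\<forall>\<^sub>F n in sequentially.
    \<bar>8 * pi\<^sup>2 * weight n * real (d_count \<alpha> \<beta> N K n) - (2 * pi * sqrt (12 / pi) * scale n ^ 3 + scale n ^ 4 * sqrt (24 * N) * (correction n / real N ^ N))\<bar> \<le> C * scale n ^ 5"
    using d_count_asymp by blast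
  define \<delta> where "\<delta> = (\<lambda>n. ln (gf n) - (pi\<^sup>2 / (12 * saddle n) - (real K + 1 / 2) * ln 2))"
  obtain G0 where G0: "\<And>n. n \<ge> 1 \<Longrightarrow> \<bar>\<delta> n\<bar> \<le> G0 * saddle n" using gf_bound unfolding \<delta>_def by blast
  define G where "G = max G0 0"
  have G: "0 \<le> G" by (simp add: G_def)
  define B where "B = 2 * pi * sqrt (12 / pi)"
  have B: "0 < B" by (simp add: B_def)
  define U where "U = 3 * (real N)\<^sup>2 + \<bar>shift\<bar>"
  have U: "0 \<le> U" by (simp add: U_def)
  have N: "0 < real N" using N_ge_2 by simp
  have "\<forall>\<^sub>F n in sequentially.
    \<bar>real (d_count \<alpha> \<beta> N K n) / (main_term n * real N ^ (N - 1)) - 1 - correction n / real N ^ (N - 1) / second_scale n\<bar> \<le> (\<bar>C\<bar> / B * exp G + G * exp G * (1 + U)) * saddle n"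
    using ev eventually_ge_at_top[of 1]
  proof eventually_elim
    case (elim n)
    let ?s = "scale n" let ?t = "saddle n" let ?d = "real (d_count \<alpha> \<beta> N K n)"
    define a where "a = main_term n * real N ^ (N - 1)"
    define u where "u = correction n / real N ^ (N - 1) / second_scale n"
    define w where "w = 8 * pi\<^sup>2 * weight n"
    have n: "n \<ge> 1" by (rule elim(2))
    have t: "0 < ?t" "?t \<le> 1" using saddle_pos saddle_le_1 n by auto
    have s: "0 < ?s" "?s\<^sup>2 = ?t" using scale_pos scale_sq n by auto
    have a: "0 < a" using main_term_pos[OF n] N by (simp add: a_def)
    have w: "0 < w" using gf_pos[of n] by (simp add: w_def weight_def)
    have D: "1 \<le> second_scale n" by (rule second_scale_ge_1[OF n])
    have "\<bar>\<delta> n\<bar> \<le> G0 * ?t" by (rule G0[OF n])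
    also have "\<dots> \<le> G * ?t" using t by (intro mult_right_mono) (auto simp: G_def)
    finally have dl: "\<bar>\<delta> n\<bar> \<le> G * ?t" .
    also have "\<dots> \<le> G" using G t by (simp add: mult_left_le)
    finally have dG: "\<bar>\<delta> n\<bar> \<le> G" .
    then have eG: "exp (\<delta> n) \<le> exp G" "exp \<bar>\<delta> n\<bar> \<le> exp G" by auto
    have uU: "\<bar>u\<bar> \<le> U"
    proof -
      have "\<bar>u\<bar> = \<bar>correction n\<bar> / real N ^ (N - 1) / second_scale n" using D by (simp add: u_def abs_divide)
      also have "\<dots> \<le> (real N ^ (N - 1) * U) / real N ^ (N - 1) / 1"
        using abs_correction_le[of n] D N U by (intro frac_le divide_right_mono) (auto simp: U_def)
      finally show ?thesis using N by simp
    qed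
    have bs: "B * ?s ^ 3 = w * a * exp (\<delta> n)"
      using main_term_ratio[OF n] unfolding B_def w_def a_def \<delta>_def by (simp only: mult.assoc)
    have u2: "?s ^ 4 * sqrt (24 * N) * (correction n / real N ^ N) = B * ?s ^ 3 * u"
    proof -
      have NN: "real N ^ N = real N * real N ^ (N - 1)" using N_ge_2 by (cases N) auto
      have "?s * sqrt (24 * N) = B * N / second_scale n" using scale_second_scale[OF n] D by (simp add: B_def field_simps)
      then have "?s ^ 3 * (?s * sqrt (24 * N)) * (correction n / real N ^ N) = ?s ^ 3 * (B * N / second_scale n) * (correction n / (real N * real N ^ (N - 1)))"
        unfolding NN by (simp only:)
      also have "\<dots> = B * ?s ^ 3 * u" using N by (simp add: u_def mult_ac)
      finally show ?thesis by (simp add: eval_nat_numeral mult_ac)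
    qed
    have "\<bar>w * ?d - w * a * exp (\<delta> n) * (1 + u)\<bar> \<le> C * ?s ^ 5"
    proof -
      have "w * a * exp (\<delta> n) * (1 + u) = B * ?s ^ 3 + B * ?s ^ 3 * u" unfolding bs by (simp only: distrib_left mult_1_right)
      then show ?thesis using elim(1) unfolding u2 B_def[symmetric] w_def[symmetric] by (simp only:)
    qed
    also have "\<dots> \<le> \<bar>C\<bar> * ?s ^ 5" using s by (intro mult_right_mono) auto
    also have "\<dots> = \<bar>C\<bar> / B * ?t * (B * ?s ^ 3)" using B unfolding s(2)[symmetric] by (simp add: eval_nat_numeral)
    also have "\<dots> = (w * a) * (\<bar>C\<bar> / B * ?t * exp (\<delta> n))" unfolding bs by (simp only: mult_ac)
    also have "\<dots> \<le> (w * a) * (\<bar>C\<bar> / B * ?t * exp G)" using w a B t eG by (intro mult_left_mono) auto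
    finally have 1: "\<bar>w * ?d - w * a * exp (\<delta> n) * (1 + u)\<bar> \<le> (w * a) * (\<bar>C\<bar> / B * ?t * exp G)" .
    have "w * ?d - w * a * exp (\<delta> n) * (1 + u) = (w * a) * (?d / a - exp (\<delta> n) * (1 + u))" using a by (simp add: right_diff_distrib)
    then have "(w * a) * \<bar>?d / a - exp (\<delta> n) * (1 + u)\<bar> \<le> (w * a) * (\<bar>C\<bar> / B * ?t * exp G)"
      using 1 w a by (simp only: abs_mult abs_of_pos)
    then have 2: "\<bar>?d / a - exp (\<delta> n) * (1 + u)\<bar> \<le> \<bar>C\<bar> / B * ?t * exp G"
      by (rule mult_left_le_imp_le) (use w a in simp)
    have 3: "\<bar>exp (\<delta> n) - 1\<bar> \<le> (G * ?t) * exp G"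
    proof -
      have "\<bar>\<delta> n\<bar> * exp \<bar>\<delta> n\<bar> \<le> (G * ?t) * exp G" using dl eG by (intro mult_mono) auto
      moreover have "exp (\<delta> n) - 1 \<le> \<bar>\<delta> n\<bar> * exp \<bar>\<delta> n\<bar>"
      proof -
        have "exp (\<delta> n) - 1 \<le> exp \<bar>\<delta> n\<bar> - 1" by simp
        also have "\<dots> \<le> \<bar>\<delta> n\<bar> * exp \<bar>\<delta> n\<bar>" by (rule exp_minus_one_le)
        finally show ?thesis .
      qed
      moreover have "1 - exp (\<delta> n) \<le> \<bar>\<delta> n\<bar> * exp \<bar>\<delta> n\<bar>"
      proof -
        have "1 - exp (\<delta> n) \<le> \<bar>\<delta> n\<bar> * 1" using exp_ge_add_one_self[of "\<delta> n"] by linarith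
        also have "\<dots> \<le> \<bar>\<delta> n\<bar> * exp \<bar>\<delta> n\<bar>" by (intro mult_left_mono) auto
        finally show ?thesis .
      qed
      ultimately show ?thesis unfolding abs_le_iff by linarith
    qed
    have "?d / a - 1 - u = (?d / a - exp (\<delta> n) * (1 + u)) + (exp (\<delta> n) - 1) * (1 + u)" by (simp add: algebra_simps)
    also have "\<bar>\<dots>\<bar> \<le> \<bar>C\<bar> / B * ?t * exp G + (G * ?t) * exp G * (1 + U)"
    proof (intro order_trans[OF abs_triangle_ineq] add_mono 2)
      show "\<bar>(exp (\<delta> n) - 1) * (1 + u)\<bar> \<le> (G * ?t) * exp G * (1 + U)"
        unfolding abs_mult using 3 uU G t by (intro mult_mono) auto
    qed
    also have "\<dots> = (\<bar>C\<bar> / B * exp G + G * exp G * (1 + U)) * ?t" by (simp only: distrib_right distrib_left mult_ac)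
    finally show ?case unfolding a_def u_def .
  qed
  then show ?thesis by blast
qed

text \<open>\<open>E\<close> is the exact relative remainder. Adding E n to each of the N^(N-1)
  summands is the same as adding it once to the sum divided by N^(N-1), so one function can serve
  all l.\<close>

lemma d_count_expansion:
  "\<exists>E :: nat \<Rightarrow> real. E \<in> O(\<lambda>n. 1 / sqrt (real n)) \<and>
    (\<forall>\<^sub>F n in sequentially. real (d_count \<alpha> \<beta> N K n) = main_term n *
      (\<Sum>l\<in>solutions n. 1 + ((real N)\<^sup>2 - 2 * real N * real (least_pos_residue N (l \<alpha> - l \<beta>)) + shift) / second_scale n + E n))"
proof -
  have N: "0 < real N" using N_ge_2 by simp
  define E where "E = (\<lambda>n. real (d_count \<alpha> \<beta> N K n) / (main_term n * real N ^ (N - 1)) - 1 - correction n / real N ^ (N - 1) / second_scale n)"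
  obtain C where "\<forall>\<^sub>F n in sequentially. \<bar>E n\<bar> \<le> C * saddle n" using d_count_ratio unfolding E_def by blast
  then have "E \<in> O(saddle)"
    by (intro bigoI[of _ "\<bar>C\<bar>"]) (auto elim!: eventually_mono simp flip: abs_mult)
  also have "saddle \<in> O(\<lambda>n. 1 / sqrt (real n))" unfolding saddle_def[abs_def] by real_asymp
  finally have O: "E \<in> O(\<lambda>n. 1 / sqrt (real n))" .
  have "\<forall>\<^sub>F n in sequentially. real (d_count \<alpha> \<beta> N K n) = main_term n *
      (\<Sum>l\<in>solutions n. 1 + ((real N)\<^sup>2 - 2 * real N * real (least_pos_residue N (l \<alpha> - l \<beta>)) + shift) / second_scale n + E n)"
    using eventually_ge_at_top[of 1]
  proof eventually_elim
    case (elim n)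
    have m: "main_term n \<noteq> 0" using main_term_pos[OF elim] by simp
    have gen: "(\<Sum>l\<in>solutions n. 1 + v l / y + e) = real N ^ (N - 1) + (\<Sum>l\<in>solutions n. v l) / y + real N ^ (N - 1) * e" for v y e
      by (simp add: sum.distrib sum_divide_distrib card_solutions)
    have "(\<Sum>l\<in>solutions n. 1 + ((real N)\<^sup>2 - 2 * real N * real (least_pos_residue N (l \<alpha> - l \<beta>)) + shift) / second_scale n + E n)
      = real N ^ (N - 1) + correction n / second_scale n + real N ^ (N - 1) * E n"
      unfolding gen correction_def ..
    also have "\<dots> = real (d_count \<alpha> \<beta> N K n) / main_term n"
      using N unfolding E_def by (simp add: right_diff_distrib)
    finally show ?case using m by simp
  qed
  then show ?thesis using O by blast
qed

end

theorem theorem1p1: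
  fixes N K \<alpha> \<beta> :: nat
  assumes "N \<ge> 2"
    and "\<alpha> \<in> {1..N}" and "\<beta> \<in> {1..N}" and "\<alpha> \<noteq> \<beta>"
  shows "\<exists>E :: (nat \<Rightarrow> int) \<Rightarrow> nat \<Rightarrow> real.
    (\<forall>l \<in> residue_vectors N. E l \<in> O(\<lambda>n. 1 / sqrt (real n))) \<and>
    (\<forall>\<^sub>F n in sequentially.
      real (d_count \<alpha> \<beta> N K n) =
        exp (pi * sqrt (real n / 3)) /
          (2 ^ (K + 3) * 3 powr (1 / 4) * real N ^ (N - 1) * real n powr (3 / 4)) *
        (\<Sum>l \<in> {l \<in> residue_vectors N. [real N * H_fun N K l = real n] (rmod real N)}.
          1 + ((real N)\<^sup>2 - 2 * real N * real (least_pos_residue N (l \<alpha> - l \<beta>))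
                 + real \<beta> - real \<alpha>
                 + real N * (real (e_vec N K \<beta>) - real (e_vec N K \<alpha>)))
              / (2 * 3 powr (1 / 4) * sqrt (real N) * real n powr (1 / 4))
            + E l n))"
proof -
  interpret residue_pair N K \<alpha> \<beta> by (rule residue_pair.intro) (fact assms)+
  obtain E where E: "E \<in> O(\<lambda>n. 1 / sqrt (real n))" and ev: "\<forall>\<^sub>F n in sequentially. real (d_count \<alpha> \<beta> N K n) = main_term n *
      (\<Sum>l\<in>solutions n. 1 + ((real N)\<^sup>2 - 2 * real N * real (least_pos_residue N (l \<alpha> - l \<beta>)) + shift) / second_scale n + E n)"
    using d_count_expansion by blast
  have "x + shift = x + real \<beta> - real \<alpha> + real N * (real (e_vec N K \<beta>) - real (e_vec N K \<alpha>))" for x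
    unfolding shift_eq by simp
  \<comment> \<open>The error functions of the theorem are taken equal for all residue
    vectors.\<close>
  then show ?thesis
    using E ev unfolding H_fun_solutions main_term_def second_scale_def by (intro exI[of _ "\<lambda>_. E"]) (simp only: simp_thms ball_triv)
qed

end
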